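(* Let $\mathcal D$ be a small category, $W$ a level-wise Segal space and $x:D[0]\to W$ an object. Then the map $\{id_x\}:D[0]\to W_{x/}$ is a $\mathcal D$-covariant equivalence over $W$.
   Context: $\mathbf\Delta$ is the simplex category, $\mathcal S$ the category of simplicial sets (``spaces''). A $\mathcal D$-simplicial space is a functor $X:\mathcal D^{op}\times\mathbf\Delta^{op}\to\mathcal S$, category $s\mathcal P(\mathcal D\times\mathbf\Delta)$ (which is Cartesian closed). $\mathrm{Und}_dX=X[d,-]$. $D[n]$ is the $\mathcal D$-simplicial space $(d,[k])\mapsto\mathrm{Hom}_{\mathbf\Delta}([k],[n])$ (discrete and constant in $d$); $D[0]$ is terminal. The injective model structure has objectwise Kan equivalences as weak equivalences and monomorphisms as cofibrations. A level-wise Segal space is an injectively fibrant $\mathcal D$-simplicial space $W$ such that every $\mathrm{Und}_dW$ is a Segal space, i.e. (it is Reedy fibrant and) $(\mathrm{Und}_dW)_n\to(\mathrm{Und}_dW)_1\times_{(\mathrm{Und}_dW)_0}\cdots\times_{(\mathrm{Und}_dW)_0}(\mathrm{Und}_dW)_1$ is a Kan equivalence for $n\ge2$. $W_{x/}=D[0]\times_WW^{D[1]}$ is the pullback of $x:D[0]\to W$ along the map $W^{D[1]}\to W$ given by evaluation at $0$; it maps to $W$ by evaluation at $1$. $\{id_x\}:D[0]\to W_{x/}$ is induced by the composite $D[1]\to D[0]\xrightarrow{x}W$; it lies over $x:D[0]\to W$. A Reedy fibration of simplicial spaces $L\to X$ is a left fibration if for all $n$ the map $L_n\to L_0\times_{X_0}X_n$,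 induced by $[0]\to[n]$, $0\mapsto0$, is a Kan equivalence. An injective fibration of $\mathcal D$-simplicial spaces is a $\mathcal D$-left fibration if each $\mathrm{Und}_d$ of it is a left fibration. The $\mathcal D$-covariant model structure on $s\mathcal P(\mathcal D\times\mathbf\Delta)_{/W}$ has cofibrations the monomorphisms and fibrant objects the $\mathcal D$-left fibrations over $W$; its weak equivalences are the $\mathcal D$-covariant equivalences over $W$. *)

theory Defs
  imports Main "HOL-Library.FuncSet"
begin

section \<open>Categories and model structures\<close>

text \<open>\<open>cmp g f\<close> is the composite "first \<open>f\<close>, then \<open>g\<close>".\<close>

record ('o, 'm) cat =
  Ob :: "'o set"
  Ar :: "'m set"
  src :: "'m \<Rightarrow> 'o"
  tgt :: "'m \<Rightarrow> 'o"
  idn :: "'o \<Rightarrow> 'm"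
  cmp :: "'m \<Rightarrow> 'm \<Rightarrow> 'm"

definition category :: "('o, 'm) cat \<Rightarrow> bool" where
  "category C \<longleftrightarrow>
     (\<forall>f\<in>Ar C. src C f \<in> Ob C \<and> tgt C f \<in> Ob C) \<and>
     (\<forall>c\<in>Ob C. idn C c \<in> Ar C \<and> src C (idn C c) = c \<and> tgt C (idn C c) = c) \<and>
     (\<forall>f\<in>Ar C. \<forall>g\<in>Ar C. src C g = tgt C f \<longrightarrow>
        cmp C g f \<in> Ar C \<and> src C (cmp C g f) = src C f \<and> tgt C (cmp C g f) = tgt C g) \<and>
     (\<forall>f\<in>Ar C. cmp C f (idn C (src C f)) = f \<and> cmp C (idn C (tgt C f)) f = f) \<and>
     (\<forall>f\<in>Ar C. \<forall>g\<in>Ar C. \<forall>h\<in>Ar C. src C g = tgt C f \<longrightarrow> src C h = tgt C g \<longrightarrow>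
        cmp C h (cmp C g f) = cmp C (cmp C h g) f)"

definition prod_cat :: "('o, 'm) cat \<Rightarrow> ('p, 'n) cat \<Rightarrow> ('o \<times> 'p, 'm \<times> 'n) cat"
    (infixr "\<times>\<^sub>c" 80) where
  "C \<times>\<^sub>c D = \<lparr>
     Ob = Ob C \<times> Ob D,
     Ar = Ar C \<times> Ar D,
     src = (\<lambda>(f, g). (src C f, src D g)),
     tgt = (\<lambda>(f, g). (tgt C f, tgt D g)),
     idn = (\<lambda>(c, d). (idn C c, idn D d)),
     cmp = (\<lambda>(g, g') (f, f'). (cmp C g f, cmp D g' f'))\<rparr>"

definition terminal_object :: "('o, 'm) cat \<Rightarrow> 'o \<Rightarrow> bool" where
  "terminal_object C t \<longleftrightarrow>
     t \<in> Ob C \<and> (\<forall>c\<in>Ob C. \<exists>!f. f \<in> Ar C \<and> src C f = c \<and> tgt C f = t)"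

definition has_lifting :: "('o, 'm) cat \<Rightarrow> 'm \<Rightarrow> 'm \<Rightarrow> bool" where
  "has_lifting C i p \<longleftrightarrow>
     (\<forall>u\<in>Ar C. \<forall>v\<in>Ar C.
        src C u = src C i \<longrightarrow> tgt C u = src C p \<longrightarrow>
        src C v = tgt C i \<longrightarrow> tgt C v = tgt C p \<longrightarrow>
        cmp C p u = cmp C v i \<longrightarrow>
        (\<exists>h\<in>Ar C. src C h = tgt C i \<and> tgt C h = src C p \<and> cmp C h i = u \<and> cmp C p h = v))"

definition retract_of :: "('o, 'm) cat \<Rightarrow> 'm \<Rightarrow> 'm \<Rightarrow> bool" where
  "retract_of C f g \<longleftrightarrow>
     (\<exists>i\<in>Ar C. \<exists>r\<in>Ar C. \<exists>j\<in>Ar C. \<exists>s\<in>Ar C.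
        src C i = src C f \<and> tgt C i = src C g \<and> src C r = src C g \<and> tgt C r = src C f \<and>
        src C j = tgt C f \<and> tgt C j = tgt C g \<and> src C s = tgt C g \<and> tgt C s = tgt C f \<and>
        cmp C r i = idn C (src C f) \<and> cmp C s j = idn C (tgt C f) \<and>
        cmp C g i = cmp C j f \<and> cmp C f r = cmp C s g)"

text \<open>A model structure with cofibrations \<open>cof\<close>, weak equivalences \<open>weq\<close> and fibrations
  \<open>fib\<close>; factorizations are not required to be functorial.\<close>

definition model_structure :: "('o, 'm) cat \<Rightarrow> 'm set \<Rightarrow> 'm set \<Rightarrow> 'm set \<Rightarrow> bool" where
  "model_structure C cof weq fib \<longleftrightarrow>
     cof \<subseteq> Ar C \<and> weq \<subseteq> Ar C \<and> fib \<subseteq> Ar C \<and>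
     (\<forall>f\<in>Ar C. \<forall>g\<in>Ar C. src C g = tgt C f \<longrightarrow>
        (f \<in> weq \<and> g \<in> weq \<longrightarrow> cmp C g f \<in> weq) \<and>
        (f \<in> weq \<and> cmp C g f \<in> weq \<longrightarrow> g \<in> weq) \<and>
        (g \<in> weq \<and> cmp C g f \<in> weq \<longrightarrow> f \<in> weq)) \<and>
     (\<forall>f\<in>Ar C. \<forall>g\<in>Ar C. retract_of C f g \<longrightarrow>
        (g \<in> cof \<longrightarrow> f \<in> cof) \<and> (g \<in> weq \<longrightarrow> f \<in> weq) \<and> (g \<in> fib \<longrightarrow> f \<in> fib)) \<and>
     (\<forall>i\<in>cof \<inter> weq. \<forall>p\<in>fib. has_lifting C i p) \<and>
     (\<forall>i\<in>cof. \<forall>p\<in>fib \<inter> weq. has_lifting C i p) \<and>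
     (\<forall>f\<in>Ar C.
        (\<exists>i\<in>cof \<inter> weq. \<exists>p\<in>fib. src C p = tgt C i \<and> cmp C p i = f) \<and>
        (\<exists>i\<in>cof. \<exists>p\<in>fib \<inter> weq. src C p = tgt C i \<and> cmp C p i = f))"

definition fibrant_objects :: "('o, 'm) cat \<Rightarrow> 'm set \<Rightarrow> 'o set" where
  "fibrant_objects C fib =
     {c \<in> Ob C. \<exists>f\<in>fib. src C f = c \<and> terminal_object C (tgt C f)}"

definition slice_cat :: "('o, 'm) cat \<Rightarrow> 'o \<Rightarrow> ('m, 'm \<times> 'm \<times> 'm) cat" where
  "slice_cat C w = \<lparr>
     Ob = {a \<in> Ar C. tgt C a = w},
     Ar = {(a, b, f). a \<in> Ar C \<and> tgt C a = w \<and> b \<in> Ar C \<and> tgt C b = w \<and>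
             f \<in> Ar C \<and> src C f = src C a \<and> tgt C f = src C b \<and> cmp C b f = a},
     src = (\<lambda>(a, b, f). a),
     tgt = (\<lambda>(a, b, f). b),
     idn = (\<lambda>a. (a, a, idn C (src C a))),
     cmp = (\<lambda>(b, c, g) (a, b', f). (a, c, cmp C g f))\<rparr>"


section \<open>Presheaves of sets\<close>

text \<open>A presheaf on \<open>C\<close> whose elements are taken from the type \<open>'a\<close>. Natural transformations
  are extensional (\<open>undefined\<close> off the objects of \<open>C\<close> and off the elements of the source), so
  that equality of transformations is equality of functions. Source and target may use
  different element types.\<close>

record ('o, 'm, 'a) psh =
  val :: "'o \<Rightarrow> 'a set"
  act :: "'m \<Rightarrow> 'a \<Rightarrow> 'a"

definition presheaf :: "('o, 'm) cat \<Rightarrow> ('o, 'm, 'a) psh \<Rightarrow> bool" where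
  "presheaf C X \<longleftrightarrow>
     (\<forall>f\<in>Ar C. act X f \<in> val X (tgt C f) \<rightarrow> val X (src C f)) \<and>
     (\<forall>c\<in>Ob C. \<forall>x\<in>val X c. act X (idn C c) x = x) \<and>
     (\<forall>f\<in>Ar C. \<forall>g\<in>Ar C. src C g = tgt C f \<longrightarrow>
        (\<forall>x\<in>val X (tgt C g). act X (cmp C g f) x = act X f (act X g x)))"

definition hom ::
  "('o, 'm) cat \<Rightarrow> ('o, 'm, 'a) psh \<Rightarrow> ('o, 'm, 'b) psh \<Rightarrow> ('o \<Rightarrow> 'a \<Rightarrow> 'b) set" where
  "hom C X Y = {t \<in> (\<Pi>\<^sub>E c\<in>Ob C. val X c \<rightarrow>\<^sub>E val Y c).
     \<forall>f\<in>Ar C. \<forall>x\<in>val X (tgt C f). t (src C f) (act X f x) = act Y f (t (tgt C f) x)}"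

definition transf ::
  "('o, 'm) cat \<Rightarrow> ('o, 'm, 'a) psh \<Rightarrow> ('o \<Rightarrow> 'a \<Rightarrow> 'b) \<Rightarrow> 'o \<Rightarrow> 'a \<Rightarrow> 'b" where
  "transf C X t = (\<lambda>c\<in>Ob C. \<lambda>x\<in>val X c. t c x)"

definition id_transf :: "('o, 'm) cat \<Rightarrow> ('o, 'm, 'a) psh \<Rightarrow> 'o \<Rightarrow> 'a \<Rightarrow> 'a" where
  "id_transf C X = transf C X (\<lambda>c x. x)"

definition comp_transf ::
  "('o, 'm) cat \<Rightarrow> ('o, 'm, 'a) psh \<Rightarrow> ('o \<Rightarrow> 'b \<Rightarrow> 'c) \<Rightarrow> ('o \<Rightarrow> 'a \<Rightarrow> 'b) \<Rightarrow> 'o \<Rightarrow> 'a \<Rightarrow> 'c" where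
  "comp_transf C X g f = transf C X (\<lambda>c x. g c (f c x))"

definition psh_cat ::
  "('o, 'm) cat \<Rightarrow>
   (('o, 'm, 'a) psh, ('o, 'm, 'a) psh \<times> ('o, 'm, 'a) psh \<times> ('o \<Rightarrow> 'a \<Rightarrow> 'a)) cat" where
  "psh_cat C = \<lparr>
     Ob = {X. presheaf C X},
     Ar = {(X, Y, f). presheaf C X \<and> presheaf C Y \<and> f \<in> hom C X Y},
     src = (\<lambda>(X, Y, f). X),
     tgt = (\<lambda>(X, Y, f). Y),
     idn = (\<lambda>X. (X, X, id_transf C X)),
     cmp = (\<lambda>(Y, Z, g) (X, Y', f). (X, Z, comp_transf C X g f))\<rparr>"

text \<open>Monomorphisms of presheaves are the objectwise injections.\<close>

definition mono_transf :: "('o, 'm) cat \<Rightarrow> ('o, 'm, 'a) psh \<Rightarrow> ('o \<Rightarrow> 'a \<Rightarrow> 'b) \<Rightarrow> bool" where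
  "mono_transf C X t \<longleftrightarrow> (\<forall>c\<in>Ob C. inj_on (t c) (val X c))"

definition iso_transf ::
  "('o, 'm) cat \<Rightarrow> ('o, 'm, 'a) psh \<Rightarrow> ('o, 'm, 'b) psh \<Rightarrow> ('o \<Rightarrow> 'a \<Rightarrow> 'b) \<Rightarrow> bool" where
  "iso_transf C X Y t \<longleftrightarrow> t \<in> hom C X Y \<and> (\<forall>c\<in>Ob C. bij_betw (t c) (val X c) (val Y c))"

definition lifts ::
  "('o, 'm) cat \<Rightarrow> ('o, 'm, 'a) psh \<Rightarrow> ('o, 'm, 'b) psh \<Rightarrow> ('o \<Rightarrow> 'a \<Rightarrow> 'b) \<Rightarrow>
   ('o, 'm, 'c) psh \<Rightarrow> ('o, 'm, 'd) psh \<Rightarrow> ('o \<Rightarrow> 'c \<Rightarrow> 'd) \<Rightarrow> bool" where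
  "lifts C A B i X Y p \<longleftrightarrow>
     (\<forall>u\<in>hom C A X. \<forall>v\<in>hom C B Y. comp_transf C A p u = comp_transf C A v i \<longrightarrow>
        (\<exists>h\<in>hom C B X. comp_transf C A h i = u \<and> comp_transf C B p h = v))"

definition terminal_psh :: "('o, 'm, unit) psh" where
  "terminal_psh = \<lparr>val = (\<lambda>_. {()}), act = (\<lambda>_ x. x)\<rparr>"

definition to_terminal :: "('o, 'm) cat \<Rightarrow> ('o, 'm, 'a) psh \<Rightarrow> 'o \<Rightarrow> 'a \<Rightarrow> unit" where
  "to_terminal C X = transf C X (\<lambda>_ _. ())"

definition representable :: "('o, 'm) cat \<Rightarrow> 'o \<Rightarrow> ('o, 'm, 'm) psh" where
  "representable C c =
     \<lparr>val = (\<lambda>b. {f \<in> Ar C. src C f = b \<and> tgt C f = c}), act = (\<lambda>g f. cmp C f g)\<rparr>"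

definition prod_psh ::
  "('o, 'm, 'a) psh \<Rightarrow> ('o, 'm, 'b) psh \<Rightarrow> ('o, 'm, 'a \<times> 'b) psh" (infixr "\<times>\<^sub>p" 80) where
  "X \<times>\<^sub>p Y = \<lparr>val = (\<lambda>c. val X c \<times> val Y c), act = (\<lambda>f (x, y). (act X f x, act Y f y))\<rparr>"

definition pullback_psh ::
  "('o, 'm, 'a) psh \<Rightarrow> ('o, 'm, 'b) psh \<Rightarrow> ('o \<Rightarrow> 'a \<Rightarrow> 's) \<Rightarrow> ('o \<Rightarrow> 'b \<Rightarrow> 's) \<Rightarrow>
   ('o, 'm, 'a \<times> 'b) psh" where
  "pullback_psh X Y u v =
     \<lparr>val = (\<lambda>c. {(x, y). x \<in> val X c \<and> y \<in> val Y c \<and> u c x = v c y}),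
      act = (\<lambda>f (x, y). (act X f x, act Y f y))\<rparr>"

text \<open>The internal hom \<open>Y\<^sup>Z\<close>, with \<open>(Y\<^sup>Z)(c) = Hom(\<y>c \<times> Z, Y)\<close>.\<close>

definition exp_psh ::
  "('o, 'm) cat \<Rightarrow> ('o, 'm, 'z) psh \<Rightarrow> ('o, 'm, 'a) psh \<Rightarrow> ('o, 'm, 'o \<Rightarrow> 'm \<times> 'z \<Rightarrow> 'a) psh" where
  "exp_psh C Z Y =
     \<lparr>val = (\<lambda>c. hom C (representable C c \<times>\<^sub>p Z) Y),
      act = (\<lambda>f \<theta>. transf C (representable C (src C f) \<times>\<^sub>p Z) (\<lambda>b (g, z). \<theta> b (cmp C f g, z)))\<rparr>"


section \<open>Simplicial sets\<close>

text \<open>A morphism \<open>\<alpha> : [m] \<rightarrow> [n]\<close> of the simplex category is the pair of the list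
  \<open>[\<alpha> 0, \<dots>, \<alpha> m]\<close> and \<open>n\<close>.\<close>

type_synonym smor = "nat list \<times> nat"

definition simplex :: "(nat, smor) cat" where
  "simplex = \<lparr>
     Ob = UNIV,
     Ar = {(xs, n). xs \<noteq> [] \<and> sorted xs \<and> set xs \<subseteq> {..n}},
     src = (\<lambda>(xs, n). length xs - 1),
     tgt = (\<lambda>(xs, n). n),
     idn = (\<lambda>n. ([0..<Suc n], n)),
     cmp = (\<lambda>(ys, k) (xs, n). (map (\<lambda>i. ys ! i) xs, k))\<rparr>"

definition const_mor :: "nat \<Rightarrow> nat \<Rightarrow> nat \<Rightarrow> smor" where
  "const_mor m n i = (replicate (Suc m) i, n)"

type_synonym 'a sset = "(nat, smor, 'a) psh"

abbreviation std_simplex :: "nat \<Rightarrow> smor sset" where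
  "std_simplex n \<equiv> representable simplex n"

definition boundary :: "nat \<Rightarrow> smor sset" where
  "boundary n = \<lparr>val = (\<lambda>m. {\<alpha> \<in> val (std_simplex n) m. \<not> {..n} \<subseteq> set (fst \<alpha>)}),
                 act = act (std_simplex n)\<rparr>"

definition horn :: "nat \<Rightarrow> nat \<Rightarrow> smor sset" where
  "horn n k = \<lparr>val = (\<lambda>m. {\<alpha> \<in> val (std_simplex n) m. \<not> {..n} \<subseteq> insert k (set (fst \<alpha>))}),
               act = act (std_simplex n)\<rparr>"

definition kan_fibration :: "'a sset \<Rightarrow> 'b sset \<Rightarrow> (nat \<Rightarrow> 'a \<Rightarrow> 'b) \<Rightarrow> bool" where
  "kan_fibration X Y p \<longleftrightarrow> p \<in> hom simplex X Y \<and>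
     (\<forall>n\<ge>1. \<forall>k\<le>n.
        lifts simplex (horn n k) (std_simplex n) (id_transf simplex (horn n k)) X Y p)"

definition kan_complex :: "'a sset \<Rightarrow> bool" where
  "kan_complex K \<longleftrightarrow>
     presheaf simplex K \<and> kan_fibration K terminal_psh (to_terminal simplex K)"

definition homotopic ::
  "'a sset \<Rightarrow> 'b sset \<Rightarrow> (nat \<Rightarrow> 'a \<Rightarrow> 'b) \<Rightarrow> (nat \<Rightarrow> 'a \<Rightarrow> 'b) \<Rightarrow> bool" where
  "homotopic X K u v \<longleftrightarrow>
     (\<exists>H\<in>hom simplex (X \<times>\<^sub>p std_simplex 1) K. \<forall>m. \<forall>x\<in>val X m.
        H m (x, const_mor m 1 0) = u m x \<and> H m (x, const_mor m 1 1) = v m x)"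

text \<open>Kan equivalences (weak homotopy equivalences of simplicial sets): \<open>f : X \<rightarrow> Y\<close> induces a
  bijection \<open>\<pi>\<^sub>0 Map(Y, K) \<rightarrow> \<pi>\<^sub>0 Map(X, K)\<close> for every Kan complex \<open>K\<close>. For such \<open>K\<close> the relation
  \<open>homotopic X K\<close> is an equivalence relation, with quotient \<open>\<pi>\<^sub>0 Map(X, K)\<close>. It is enough to let
  \<open>K\<close> range over Kan complexes with elements in \<open>'a + 'b + nat\<close>: the only ones needed are Kan
  replacements of \<open>X\<close> and \<open>Y\<close>, and these can be chosen with at most
  max(\<open>|X|\<close>, \<open>|Y|\<close>, \<open>\<aleph>\<^sub>0\<close>) elements.\<close>

definition kan_equivalence :: "'a sset \<Rightarrow> 'b sset \<Rightarrow> (nat \<Rightarrow> 'a \<Rightarrow> 'b) \<Rightarrow> bool" where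
  "kan_equivalence X Y f \<longleftrightarrow> f \<in> hom simplex X Y \<and>
     (\<forall>K :: ('a + 'b + nat) sset. kan_complex K \<longrightarrow>
        (\<forall>u\<in>hom simplex X K. \<exists>v\<in>hom simplex Y K.
           homotopic X K (comp_transf simplex X v f) u) \<and>
        (\<forall>v\<in>hom simplex Y K. \<forall>v'\<in>hom simplex Y K.
           homotopic X K (comp_transf simplex X v f) (comp_transf simplex X v' f) \<longrightarrow>
           homotopic Y K v v'))"


section \<open>Simplicial spaces\<close>

text \<open>Functors into simplicial sets are uncurried: a simplicial space is a presheaf of sets on
  \<open>simplex \<times>\<^sub>c simplex\<close>, the first coordinate being the simplicial direction and the second one
  the space direction.\<close>

type_synonym 'a sspace = "(nat \<times> nat, smor \<times> smor, 'a) psh"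

abbreviation simplex2 :: "(nat \<times> nat, smor \<times> smor) cat" where
  "simplex2 \<equiv> simplex \<times>\<^sub>c simplex"

definition level :: "'a sspace \<Rightarrow> nat \<Rightarrow> 'a sset" where
  "level X n = \<lparr>val = (\<lambda>l. val X (n, l)), act = (\<lambda>\<beta>. act X (idn simplex n, \<beta>))\<rparr>"

definition level_map :: "nat \<Rightarrow> (nat \<times> nat \<Rightarrow> 'a \<Rightarrow> 'b) \<Rightarrow> nat \<Rightarrow> 'a \<Rightarrow> 'b" where
  "level_map n t = (\<lambda>l. t (n, l))"

text \<open>For \<open>\<alpha> : [m] \<rightarrow> [n]\<close>, the induced map \<open>X\<^sub>n \<rightarrow> X\<^sub>m\<close>.\<close>

definition level_act :: "'a sspace \<Rightarrow> smor \<Rightarrow> nat \<Rightarrow> 'a \<Rightarrow> 'a" where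
  "level_act X \<alpha> = transf simplex (level X (tgt simplex \<alpha>)) (\<lambda>l. act X (\<alpha>, idn simplex l))"

definition row :: "'a sspace \<Rightarrow> nat \<Rightarrow> 'a sset" where
  "row X l = \<lparr>val = (\<lambda>k. val X (k, l)), act = (\<lambda>\<alpha>. act X (\<alpha>, idn simplex l))\<rparr>"

text \<open>The matching space \<open>M\<^sub>n X\<close>, the limit of the \<open>X\<^sub>k\<close> over the simplices \<open>[k] \<rightarrow> [n]\<close> of
  the boundary of the standard \<open>n\<close>-simplex.\<close>

definition matching :: "'a sspace \<Rightarrow> nat \<Rightarrow> (nat \<Rightarrow> smor \<Rightarrow> 'a) sset" where
  "matching X n =
     \<lparr>val = (\<lambda>l. hom simplex (boundary n) (row X l)),
      act = (\<lambda>\<beta> \<theta>. transf simplex (boundary n) (\<lambda>k \<alpha>. act X (idn simplex k, \<beta>) (\<theta> k \<alpha>)))\<rparr>"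

definition matching_map :: "'a sspace \<Rightarrow> nat \<Rightarrow> nat \<Rightarrow> 'a \<Rightarrow> nat \<Rightarrow> smor \<Rightarrow> 'a" where
  "matching_map X n = transf simplex (level X n)
     (\<lambda>l x. transf simplex (boundary n) (\<lambda>k \<alpha>. act X (\<alpha>, idn simplex l) x))"

definition matching_of ::
  "'a sspace \<Rightarrow> nat \<Rightarrow> (nat \<times> nat \<Rightarrow> 'a \<Rightarrow> 'b) \<Rightarrow> nat \<Rightarrow> (nat \<Rightarrow> smor \<Rightarrow> 'a) \<Rightarrow> nat \<Rightarrow> smor \<Rightarrow> 'b" where
  "matching_of X n p = transf simplex (matching X n)
     (\<lambda>l \<theta>. transf simplex (boundary n) (\<lambda>k \<alpha>. p (k, l) (\<theta> k \<alpha>)))"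

text \<open>All relative matching maps \<open>X\<^sub>n \<rightarrow> Y\<^sub>n \<times>\<^bsub>M\<^sub>n Y\<^esub> M\<^sub>n X\<close> are Kan fibrations.\<close>

definition reedy_fibration ::
  "'a sspace \<Rightarrow> 'b sspace \<Rightarrow> (nat \<times> nat \<Rightarrow> 'a \<Rightarrow> 'b) \<Rightarrow> bool" where
  "reedy_fibration X Y p \<longleftrightarrow> p \<in> hom simplex2 X Y \<and>
     (\<forall>n. kan_fibration (level X n)
        (pullback_psh (level Y n) (matching X n) (matching_map Y n) (matching_of X n p))
        (transf simplex (level X n) (\<lambda>l x. (p (n, l) x, matching_map X n l x))))"

definition left_fibration ::
  "'a sspace \<Rightarrow> 'b sspace \<Rightarrow> (nat \<times> nat \<Rightarrow> 'a \<Rightarrow> 'b) \<Rightarrow> bool" where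
  "left_fibration L X p \<longleftrightarrow> reedy_fibration L X p \<and>
     (\<forall>n. kan_equivalence (level L n)
        (pullback_psh (level L 0) (level X n) (level_map 0 p) (level_act X (const_mor 0 n 0)))
        (transf simplex (level L n)
           (\<lambda>l x. (level_act L (const_mor 0 n 0) l x, p (n, l) x))))"

text \<open>The iterated fibre product \<open>X\<^sub>1 \<times>\<^bsub>X\<^sub>0\<^esub> \<dots> \<times>\<^bsub>X\<^sub>0\<^esub> X\<^sub>1\<close> with \<open>n\<close> factors.\<close>

definition spine :: "'a sspace \<Rightarrow> nat \<Rightarrow> (nat \<Rightarrow> 'a) sset" where
  "spine X n =
     \<lparr>val = (\<lambda>l. {w \<in> {..<n} \<rightarrow>\<^sub>E val X (1, l). \<forall>i. Suc i < n \<longrightarrow>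
        level_act X (const_mor 0 1 1) l (w i) = level_act X (const_mor 0 1 0) l (w (Suc i))}),
      act = (\<lambda>\<beta> w. \<lambda>i\<in>{..<n}. act X (idn simplex 1, \<beta>) (w i))\<rparr>"

definition segal_map :: "'a sspace \<Rightarrow> nat \<Rightarrow> nat \<Rightarrow> 'a \<Rightarrow> nat \<Rightarrow> 'a" where
  "segal_map X n = transf simplex (level X n) (\<lambda>l x. \<lambda>i\<in>{..<n}. level_act X ([i, Suc i], n) l x)"

definition segal_space :: "'a sspace \<Rightarrow> bool" where
  "segal_space X \<longleftrightarrow> presheaf simplex2 X \<and>
     reedy_fibration X terminal_psh (to_terminal simplex2 X) \<and>
     (\<forall>n\<ge>2. kan_equivalence (level X n) (spine X n) (segal_map X n))"


section \<open>\<open>D\<close>-simplicial spaces\<close>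

type_synonym 'o dob = "'o \<times> nat \<times> nat"
type_synonym 'm dmor = "'m \<times> smor \<times> smor"
type_synonym ('o, 'm, 'a) dspace = "('o dob, 'm dmor, 'a) psh"

definition dsimp_cat :: "('o, 'm) cat \<Rightarrow> ('o dob, 'm dmor) cat" where
  "dsimp_cat D = D \<times>\<^sub>c simplex2"

definition und :: "('o, 'm) cat \<Rightarrow> 'o \<Rightarrow> ('o, 'm, 'a) dspace \<Rightarrow> 'a sspace" where
  "und D d X = \<lparr>val = (\<lambda>c. val X (d, c)), act = (\<lambda>\<phi>. act X (idn D d, \<phi>))\<rparr>"

definition und_map :: "'o \<Rightarrow> ('o dob \<Rightarrow> 'a \<Rightarrow> 'b) \<Rightarrow> nat \<times> nat \<Rightarrow> 'a \<Rightarrow> 'b" where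
  "und_map d t = (\<lambda>c. t (d, c))"

definition objectwise_kan_equivalence ::
  "('o, 'm) cat \<Rightarrow> ('o, 'm, 'a) dspace \<Rightarrow> ('o, 'm, 'b) dspace \<Rightarrow> ('o dob \<Rightarrow> 'a \<Rightarrow> 'b) \<Rightarrow> bool" where
  "objectwise_kan_equivalence D A B j \<longleftrightarrow>
     (\<forall>d\<in>Ob D. \<forall>n. kan_equivalence (level (und D d A) n) (level (und D d B) n)
                                    (level_map n (und_map d j)))"

text \<open>Fibrations of the injective model structure: the right lifting property against the
  monomorphisms that are objectwise Kan equivalences.\<close>

definition injective_fibration ::
  "('o, 'm) cat \<Rightarrow> ('o, 'm, 'a) dspace \<Rightarrow> ('o, 'm, 'b) dspace \<Rightarrow> ('o dob \<Rightarrow> 'a \<Rightarrow> 'b) \<Rightarrow> bool" where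
  "injective_fibration D X Y p \<longleftrightarrow> p \<in> hom (dsimp_cat D) X Y \<and>
     (\<forall>(A :: ('o, 'm, 'a) dspace) (B :: ('o, 'm, 'a) dspace) j.
        presheaf (dsimp_cat D) A \<longrightarrow> presheaf (dsimp_cat D) B \<longrightarrow> j \<in> hom (dsimp_cat D) A B \<longrightarrow>
        mono_transf (dsimp_cat D) A j \<longrightarrow> objectwise_kan_equivalence D A B j \<longrightarrow>
        lifts (dsimp_cat D) A B j X Y p)"

definition levelwise_segal_space :: "('o, 'm) cat \<Rightarrow> ('o, 'm, 'a) dspace \<Rightarrow> bool" where
  "levelwise_segal_space D W \<longleftrightarrow> presheaf (dsimp_cat D) W \<and>
     injective_fibration D W terminal_psh (to_terminal (dsimp_cat D) W) \<and>
     (\<forall>d\<in>Ob D. segal_space (und D d W))"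

definition D_left_fibration ::
  "('o, 'm) cat \<Rightarrow> ('o, 'm, 'a) dspace \<Rightarrow> ('o, 'm, 'b) dspace \<Rightarrow> ('o dob \<Rightarrow> 'a \<Rightarrow> 'b) \<Rightarrow> bool" where
  "D_left_fibration D L W p \<longleftrightarrow> injective_fibration D L W p \<and>
     (\<forall>d\<in>Ob D. left_fibration (und D d L) (und D d W) (und_map d p))"

definition dsimp :: "nat \<Rightarrow> ('o, 'm, smor) dspace" where
  "dsimp n =
     \<lparr>val = (\<lambda>(d, k, l). {\<alpha> \<in> Ar simplex. src simplex \<alpha> = k \<and> tgt simplex \<alpha> = n}),
      act = (\<lambda>(f, \<alpha>, \<beta>) \<gamma>. cmp simplex \<gamma> \<alpha>)\<rparr>"

definition dsimp_map :: "('o, 'm) cat \<Rightarrow> smor \<Rightarrow> 'o dob \<Rightarrow> smor \<Rightarrow> smor" where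
  "dsimp_map D \<alpha> =
     transf (dsimp_cat D) (dsimp (src simplex \<alpha>) :: ('o, 'm, smor) dspace) (\<lambda>_ \<gamma>. cmp simplex \<alpha> \<gamma>)"


section \<open>Under-objects\<close>

text \<open>\<open>W\<^bsup>D[1]\<^esup>\<close> and its evaluations at the vertices \<open>i\<close> of \<open>D[1]\<close>.\<close>

abbreviation arrow_space ::
  "('o, 'm) cat \<Rightarrow> ('o, 'm, 'a) dspace \<Rightarrow> ('o, 'm, 'o dob \<Rightarrow> 'm dmor \<times> smor \<Rightarrow> 'a) dspace" where
  "arrow_space D W \<equiv> exp_psh (dsimp_cat D) (dsimp 1) W"

definition eval_at ::
  "('o, 'm) cat \<Rightarrow> ('o, 'm, 'a) dspace \<Rightarrow> nat \<Rightarrow> 'o dob \<Rightarrow> ('o dob \<Rightarrow> 'm dmor \<times> smor \<Rightarrow> 'a) \<Rightarrow> 'a" where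
  "eval_at D W i = transf (dsimp_cat D) (arrow_space D W)
     (\<lambda>(d, k, l) \<theta>. \<theta> (d, k, l) (idn (dsimp_cat D) (d, k, l), const_mor k 1 i))"

definition under_obj ::
  "('o, 'm) cat \<Rightarrow> ('o, 'm, 'a) dspace \<Rightarrow> ('o dob \<Rightarrow> smor \<Rightarrow> 'a) \<Rightarrow>
   ('o, 'm, smor \<times> ('o dob \<Rightarrow> 'm dmor \<times> smor \<Rightarrow> 'a)) dspace" where
  "under_obj D W x = pullback_psh (dsimp 0) (arrow_space D W) x (eval_at D W 0)"

definition under_proj ::
  "('o, 'm) cat \<Rightarrow> ('o, 'm, 'a) dspace \<Rightarrow> ('o dob \<Rightarrow> smor \<Rightarrow> 'a) \<Rightarrow>
   'o dob \<Rightarrow> smor \<times> ('o dob \<Rightarrow> 'm dmor \<times> smor \<Rightarrow> 'a) \<Rightarrow> 'a" where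
  "under_proj D W x = transf (dsimp_cat D) (under_obj D W x) (\<lambda>c (s, \<theta>). eval_at D W 1 c \<theta>)"

text \<open>\<open>\<lambda>b (g, z). \<dots>\<close> is the adjunct of \<open>D[0] \<times> D[1] \<rightarrow> D[1] \<rightarrow> D[0] \<rightarrow> W\<close>; the middle map is
  induced by the unique morphism \<open>[1] \<rightarrow> [0]\<close>.\<close>

definition id_point ::
  "('o, 'm) cat \<Rightarrow> ('o, 'm, 'a) dspace \<Rightarrow> ('o dob \<Rightarrow> smor \<Rightarrow> 'a) \<Rightarrow>
   'o dob \<Rightarrow> smor \<Rightarrow> smor \<times> ('o dob \<Rightarrow> 'm dmor \<times> smor \<Rightarrow> 'a)" where
  "id_point D W x = transf (dsimp_cat D) (dsimp 0 :: ('o, 'm, smor) dspace)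
     (\<lambda>c s. (s, transf (dsimp_cat D) (representable (dsimp_cat D) c \<times>\<^sub>p dsimp 1)
                  (\<lambda>b (g, z). x b (dsimp_map D (const_mor 1 0 0) b z))))"


section \<open>The \<open>D\<close>-covariant model structure\<close>

text \<open>The elements of the type \<open>'u\<close> play the role of the universe of sets in which simplicial
  sets take their values. Smallness of \<open>D\<close> relative to this universe: with \<open>\<kappa> = |Ar D| + \<aleph>\<^sub>0\<close> and
  \<open>\<lambda> = |'u|\<close>, one has \<open>\<lambda> \<ge> 2\<close> and \<open>\<lambda>\<close> to the power \<open>2\<^sup>\<kappa>\<close> equals \<open>\<lambda>\<close> (for nonempty \<open>D\<close>). Any
  \<open>D\<close> is small in this sense relative to large enough universes, for example \<open>('m \<times> nat) set \<Rightarrow> 'b\<close>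
  where \<open>'b\<close> is any type with at least two elements. The exponent is large enough for the small
  object argument producing the model structure below to stay inside \<open>'u\<close>.\<close>

definition small_in :: "'u itself \<Rightarrow> ('o, 'm) cat \<Rightarrow> bool" where
  "small_in U D \<longleftrightarrow> category D \<and> (\<exists>a b :: 'u. a \<noteq> b) \<and>
     (\<exists>e :: (('m \<times> nat) set \<Rightarrow> 'u) \<Rightarrow> 'u.
        inj_on e (Pow (Ar D \<times> UNIV) \<rightarrow>\<^sub>E UNIV))"

type_synonym ('o, 'm, 'u) dspace_mor =
  "('o, 'm, 'u) dspace \<times> ('o, 'm, 'u) dspace \<times> ('o dob \<Rightarrow> 'u \<Rightarrow> 'u)"

definition dspaces_over ::
  "('o, 'm) cat \<Rightarrow> ('o, 'm, 'u) dspace \<Rightarrow>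
   (('o, 'm, 'u) dspace_mor,
    ('o, 'm, 'u) dspace_mor \<times> ('o, 'm, 'u) dspace_mor \<times> ('o, 'm, 'u) dspace_mor) cat" where
  "dspaces_over D W = slice_cat (psh_cat (dsimp_cat D)) W"

text \<open>A model structure is determined by its cofibrations and its fibrant objects, so at most
  one triple satisfies this predicate.\<close>

definition D_covariant_model_structure ::
  "('o, 'm) cat \<Rightarrow> ('o, 'm, 'u) dspace \<Rightarrow>
   (('o, 'm, 'u) dspace_mor \<times> ('o, 'm, 'u) dspace_mor \<times> ('o, 'm, 'u) dspace_mor) set \<Rightarrow>
   (('o, 'm, 'u) dspace_mor \<times> ('o, 'm, 'u) dspace_mor \<times> ('o, 'm, 'u) dspace_mor) set \<Rightarrow>
   (('o, 'm, 'u) dspace_mor \<times> ('o, 'm, 'u) dspace_mor \<times> ('o, 'm, 'u) dspace_mor) set \<Rightarrow> bool" where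
  "D_covariant_model_structure D W cof weq fib \<longleftrightarrow>
     model_structure (dspaces_over D W) cof weq fib \<and>
     cof = {((A, W\<^sub>1, a), (B, W\<^sub>2, b), (A', B', f)) \<in> Ar (dspaces_over D W).
              mono_transf (dsimp_cat D) A' f} \<and>
     fibrant_objects (dspaces_over D W) fib =
       {(L, W', p) \<in> Ob (dspaces_over D W). D_left_fibration D L W' p}"

text \<open>For objects \<open>a : A \<rightarrow> W\<close>, \<open>b : B \<rightarrow> W\<close> over \<open>W\<close> whose elements come from other types than
  \<open>'u\<close>, and a map \<open>f : A \<rightarrow> B\<close> over \<open>W\<close>: some isomorphic copy of \<open>f\<close> over \<open>W\<close> with elements in
  \<open>'u\<close> is a weak equivalence. As \<open>weq\<close> is closed under isomorphism, the choice of the copy does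
  not matter.\<close>

definition D_covariant_equivalence ::
  "('o, 'm) cat \<Rightarrow> ('o, 'm, 'u) dspace \<Rightarrow>
   (('o, 'm, 'u) dspace_mor \<times> ('o, 'm, 'u) dspace_mor \<times> ('o, 'm, 'u) dspace_mor) set \<Rightarrow>
   ('o, 'm, 'a) dspace \<Rightarrow> ('o dob \<Rightarrow> 'a \<Rightarrow> 'u) \<Rightarrow>
   ('o, 'm, 'b) dspace \<Rightarrow> ('o dob \<Rightarrow> 'b \<Rightarrow> 'u) \<Rightarrow> ('o dob \<Rightarrow> 'a \<Rightarrow> 'b) \<Rightarrow> bool" where
  "D_covariant_equivalence D W weq A a B b f \<longleftrightarrow>
     (\<exists>A' a' B' b' f' \<phi> \<psi>.
        iso_transf (dsimp_cat D) A A' \<phi> \<and> iso_transf (dsimp_cat D) B B' \<psi> \<and>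
        comp_transf (dsimp_cat D) A a' \<phi> = a \<and> comp_transf (dsimp_cat D) B b' \<psi> = b \<and>
        comp_transf (dsimp_cat D) A f' \<phi> = comp_transf (dsimp_cat D) A \<psi> f \<and>
        ((A', W, a'), (B', W, b'), (A', B', f')) \<in> weq)"

end

theory Submission
  imports Defs "HOL-Library.Equipollence" "HOL-Library.Countable"
begin

text \<open>The point \<open>id\<^sub>x\<close> is a \<open>D[1]\<close>-deformation retract of \<open>W\<^bsub>x/\<^esub>\<close>: precomposition with
  \<open>min : D[1] \<times> D[1] \<rightarrow> D[1]\<close> contracts all paths starting at \<open>x\<close> to the constant one. It remains to
  see that such an inclusion \<open>A \<subseteq> B\<close> over \<open>W\<close> is a weak equivalence. A \<open>D\<close>-left fibration
  \<open>L \<rightarrow> W\<close> lifts against all inclusions \<open>X \<times> {0} \<union> A \<times> D[1] \<subseteq> X \<times> D[1]\<close>: objectwise in the space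
  direction the map \<open>L\<^bsup>D[1]\<^esup> \<rightarrow> L \<times>\<^bsub>W\<^esub> W\<^bsup>D[1]\<^esup>\<close> has the right lifting property against all
  monomorphisms, by right cancellation starting from the vertices \<open>{0} \<subseteq> \<Delta>[n]\<close>, and the
  resulting objectwise lifts are assembled to a natural one by embedding the presheaf of local
  lifts, as an objectwise deformation retract, into the product of \<open>X\<close> with a cofree presheaf and
  extending the tautological lift along this embedding, as \<open>L \<rightarrow> W\<close> is an injective fibration.
  Hence \<open>L \<rightarrow> W\<close> lifts against \<open>A \<subseteq> B\<close>, and for a cylinder object \<open>B \<times> J\<close> also against
  \<open>A \<times> J \<union> B \<times> {0, 1} \<subseteq> B \<times> J\<close>, so \<open>A \<subseteq> B\<close> induces bijections on homotopy classes of maps over \<open>W\<close> into fibrant objects.\<close>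

section \<open>Presheaves and lifting problems for subpresheaves\<close>

text \<open>The deformation of the under-object moves the end point of a path, so it is not a
  homotopy over \<open>W\<close> and by itself says nothing about weak equivalences over
  \<open>W\<close>. It becomes useful because a lifting problem can be pulled back along it to a
  cylinder with \<open>D[1]\<close>, where a path in the base has to be lifted from its end 0. This
  is what left fibrations do, and it fixes the direction of all contractions along
  \<open>D[1]\<close>. The category \<open>D\<close> has no skeletal filtration, so lifts cannot be
  built cell by cell over it; this forces the detour through local lifts and cofree presheaves. Kan
  equivalences are awkward to verify, being tested on homotopy classes of maps into Kan complexes.
  The only ones established here are inclusions that admit a simplicial deformation
  (\<open>contracts\<close>), and every acyclic cofibration fed to an injective fibration is
  objectwise of this kind. As fibrations and the model structure only see presheaves with elements
  in the universe type, auxiliary presheaves have to be shown small and are then replaced by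
  copies.\<close>

lemma category_Ob:
  assumes "category C" "f \<in> Ar C" shows "src C f \<in> Ob C" "tgt C f \<in> Ob C"
  using assms unfolding category_def by auto

lemma category_idn:
  assumes "category C" "c \<in> Ob C"
  shows "idn C c \<in> Ar C" "src C (idn C c) = c" "tgt C (idn C c) = c"
  using assms unfolding category_def by auto

lemma category_cmp:
  assumes "category C" "f \<in> Ar C" "g \<in> Ar C" "src C g = tgt C f"
  shows "cmp C g f \<in> Ar C" "src C (cmp C g f) = src C f" "tgt C (cmp C g f) = tgt C g"
  using assms unfolding category_def by auto

lemma category_unit:
  assumes "category C" "f \<in> Ar C"
  shows "src C f = c \<Longrightarrow> cmp C f (idn C c) = f" "tgt C f = c \<Longrightarrow> cmp C (idn C c) f = f"
  using assms unfolding category_def by auto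

lemma category_assoc:
  assumes "category C" "f \<in> Ar C" "g \<in> Ar C" "h \<in> Ar C" "src C g = tgt C f" "src C h = tgt C g"
  shows "cmp C h (cmp C g f) = cmp C (cmp C h g) f"
  using assms unfolding category_def by blast

lemma prod_cat_simps [simp]:
  "(c, d) \<in> Ob (C \<times>\<^sub>c D) \<longleftrightarrow> c \<in> Ob C \<and> d \<in> Ob D"
  "(f, g) \<in> Ar (C \<times>\<^sub>c D) \<longleftrightarrow> f \<in> Ar C \<and> g \<in> Ar D"
  "src (C \<times>\<^sub>c D) (f, g) = (src C f, src D g)" "tgt (C \<times>\<^sub>c D) (f, g) = (tgt C f, tgt D g)"
  "idn (C \<times>\<^sub>c D) (c, d) = (idn C c, idn D d)"
  "cmp (C \<times>\<^sub>c D) (f, g) (f', g') = (cmp C f f', cmp D g g')"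
  by (simp_all add: prod_cat_def)

lemma prod_cat_sets: "Ob (C \<times>\<^sub>c D) = Ob C \<times> Ob D" "Ar (C \<times>\<^sub>c D) = Ar C \<times> Ar D"
  by (simp_all add: prod_cat_def)

lemma category_prod:
  assumes "category C" "category D" shows "category (C \<times>\<^sub>c D)"
  unfolding category_def prod_cat_sets
  using assms by (auto simp: category_Ob category_idn category_cmp category_unit category_assoc)

lemma presheaf_act:
  assumes "presheaf C X" "f \<in> Ar C" "tgt C f = c" "src C f = b" "x \<in> val X c"
  shows "act X f x \<in> val X b"
  using assms unfolding presheaf_def by blast

lemma presheaf_idn:
  assumes "presheaf C X" "c \<in> Ob C" "x \<in> val X c"
  shows "act X (idn C c) x = x"
  using assms unfolding presheaf_def by blast

lemma presheaf_cmp: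
  assumes "presheaf C X" "f \<in> Ar C" "g \<in> Ar C" "src C g = tgt C f" "tgt C g = c" "x \<in> val X c"
  shows "act X (cmp C g f) x = act X f (act X g x)"
  using assms unfolding presheaf_def by blast

lemma presheafI:
  assumes "\<And>f x. f \<in> Ar C \<Longrightarrow> x \<in> val X (tgt C f) \<Longrightarrow> act X f x \<in> val X (src C f)"
    "\<And>c x. c \<in> Ob C \<Longrightarrow> x \<in> val X c \<Longrightarrow> act X (idn C c) x = x"
    "\<And>f g x. f \<in> Ar C \<Longrightarrow> g \<in> Ar C \<Longrightarrow> src C g = tgt C f \<Longrightarrow> x \<in> val X (tgt C g) \<Longrightarrow>
      act X (cmp C g f) x = act X f (act X g x)"
  shows "presheaf C X"
  using assms unfolding presheaf_def by blast

text \<open>Subobjects are families of subsets rather than monomorphisms, so that unions, preimages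
  and filtrations are plain set operations.\<close>

definition sub :: "('o, 'm) cat \<Rightarrow> ('o, 'm, 'a) psh \<Rightarrow> ('o \<Rightarrow> 'a set) \<Rightarrow> bool" where
  "sub C X A \<longleftrightarrow> (\<forall>c\<in>Ob C. A c \<subseteq> val X c) \<and>
     (\<forall>f\<in>Ar C. \<forall>x\<in>A (tgt C f). act X f x \<in> A (src C f))"

definition restr :: "('o, 'm, 'a) psh \<Rightarrow> ('o \<Rightarrow> 'a set) \<Rightarrow> ('o, 'm, 'a) psh" where
  "restr X A = \<lparr>val = A, act = act X\<rparr>"

lemma restr_simps [simp]:
  "val (restr X A) = A" "act (restr X A) = act X" "restr (restr X A) B = restr X B"
  by (simp_all add: restr_def)

lemma restr_val [simp]: "restr X (val X) = X"
  by (simp add: restr_def)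

lemma subD: "sub C X A \<Longrightarrow> c \<in> Ob C \<Longrightarrow> x \<in> A c \<Longrightarrow> x \<in> val X c"
  unfolding sub_def by blast

lemma sub_act: "sub C X A \<Longrightarrow> f \<in> Ar C \<Longrightarrow> tgt C f = c \<Longrightarrow> src C f = b \<Longrightarrow> x \<in> A c \<Longrightarrow> act X f x \<in> A b"
  unfolding sub_def by blast

lemma presheaf_restr: "category C \<Longrightarrow> presheaf C X \<Longrightarrow> sub C X A \<Longrightarrow> presheaf C (restr X A)"
  by (rule presheafI)
    (auto intro: sub_act presheaf_idn presheaf_cmp dest: subD category_Ob)

lemma sub_val: "presheaf C X \<Longrightarrow> sub C X (val X)"
  unfolding presheaf_def sub_def by auto

text \<open>Natural maps \<open>A \<rightarrow> Y\<close> for a subpresheaf \<open>A\<close> of \<open>X\<close>; unlike in \<open>hom\<close>, the values off \<open>A\<close>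
  are arbitrary.\<close>

definition nat_on ::
  "('o, 'm) cat \<Rightarrow> ('o, 'm, 'a) psh \<Rightarrow> ('o \<Rightarrow> 'a set) \<Rightarrow> ('o, 'm, 'b) psh \<Rightarrow> ('o \<Rightarrow> 'a \<Rightarrow> 'b) \<Rightarrow> bool"
  where
  "nat_on C X A Y t \<longleftrightarrow> (\<forall>c\<in>Ob C. \<forall>x\<in>A c. t c x \<in> val Y c) \<and>
     (\<forall>f\<in>Ar C. \<forall>x\<in>A (tgt C f). t (src C f) (act X f x) = act Y f (t (tgt C f) x))"

lemma nat_on_val: "nat_on C X A Y t \<Longrightarrow> c \<in> Ob C \<Longrightarrow> x \<in> A c \<Longrightarrow> t c x \<in> val Y c"
  unfolding nat_on_def by blast

lemma nat_on_act:
  "nat_on C X A Y t \<Longrightarrow> f \<in> Ar C \<Longrightarrow> tgt C f = c \<Longrightarrow> src C f = b \<Longrightarrow> x \<in> A c \<Longrightarrow>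
    t b (act X f x) = act Y f (t c x)"
  unfolding nat_on_def by blast

lemma nat_onI:
  assumes "\<And>c x. c \<in> Ob C \<Longrightarrow> x \<in> A c \<Longrightarrow> t c x \<in> val Y c"
    "\<And>f x. f \<in> Ar C \<Longrightarrow> x \<in> A (tgt C f) \<Longrightarrow> t (src C f) (act X f x) = act Y f (t (tgt C f) x)"
  shows "nat_on C X A Y t"
  using assms unfolding nat_on_def by blast

lemma nat_on_mono:
  assumes "category C" "nat_on C X A Y t" "\<And>c. c \<in> Ob C \<Longrightarrow> B c \<subseteq> A c" shows "nat_on C X B Y t"
  using assms category_Ob(2)[OF assms(1)] unfolding nat_on_def by blast

lemma nat_on_comp:
  assumes "category C" "nat_on C X A Y s" "nat_on C Y B Z t" "\<And>c x. c \<in> Ob C \<Longrightarrow> x \<in> A c \<Longrightarrow> s c x \<in> B c"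
  shows "nat_on C X A Z (\<lambda>c x. t c (s c x))"
proof (rule nat_onI)
  fix c x assume "c \<in> Ob C" "x \<in> A c"
  then show "t c (s c x) \<in> val Z c" using assms(4)[of c x] nat_on_val[OF assms(3)] by blast
next
  fix f x assume f: "f \<in> Ar C" "x \<in> A (tgt C f)"
  show "t (src C f) (s (src C f) (act X f x)) = act Z f (t (tgt C f) (s (tgt C f) x))"
    using nat_on_act[OF assms(2) f(1) refl refl f(2)]
      nat_on_act[OF assms(3) f(1) refl refl assms(4)[OF category_Ob(2)[OF assms(1) f(1)] f(2)]] by simp
qed

text \<open>Right lifting against the inclusion of \<open>A\<close> into \<open>X\<close>. All
  equations are asked only on elements of the objects involved, so maps can be glued, restricted and
  composed without being normalized to extensional ones; \<open>RLP_of_lifts\<close> and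
  \<open>lifts_of_RLP\<close> translate to \<open>lifts\<close>.\<close>

definition RLP ::
  "('o, 'm) cat \<Rightarrow> ('o, 'm, 'x) psh \<Rightarrow> ('o \<Rightarrow> 'x set) \<Rightarrow>
   ('o, 'm, 'a) psh \<Rightarrow> ('o, 'm, 'b) psh \<Rightarrow> ('o \<Rightarrow> 'a \<Rightarrow> 'b) \<Rightarrow> bool" where
  "RLP C X A E B p \<longleftrightarrow>
     (\<forall>u v. nat_on C X A E u \<longrightarrow> nat_on C X (val X) B v \<longrightarrow>
        (\<forall>c\<in>Ob C. \<forall>x\<in>A c. p c (u c x) = v c x) \<longrightarrow>
        (\<exists>h. nat_on C X (val X) E h \<and> (\<forall>c\<in>Ob C. \<forall>x\<in>A c. h c x = u c x) \<and>
             (\<forall>c\<in>Ob C. \<forall>x\<in>val X c. p c (h c x) = v c x)))"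

lemma RLPI:
  assumes "\<And>u v. nat_on C X A E u \<Longrightarrow> nat_on C X (val X) B v \<Longrightarrow>
      (\<And>c x. c \<in> Ob C \<Longrightarrow> x \<in> A c \<Longrightarrow> p c (u c x) = v c x) \<Longrightarrow>
      \<exists>h. nat_on C X (val X) E h \<and> (\<forall>c\<in>Ob C. \<forall>x\<in>A c. h c x = u c x) \<and>
             (\<forall>c\<in>Ob C. \<forall>x\<in>val X c. p c (h c x) = v c x)"
  shows "RLP C X A E B p"
  using assms unfolding RLP_def by blast

lemma RLPE:
  assumes "RLP C X A E B p" "nat_on C X A E u" "nat_on C X (val X) B v"
    "\<And>c x. c \<in> Ob C \<Longrightarrow> x \<in> A c \<Longrightarrow> p c (u c x) = v c x"
  obtains h where "nat_on C X (val X) E h" "\<And>c x. c \<in> Ob C \<Longrightarrow> x \<in> A c \<Longrightarrow> h c x = u c x"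
    "\<And>c x. c \<in> Ob C \<Longrightarrow> x \<in> val X c \<Longrightarrow> p c (h c x) = v c x"
  using assms unfolding RLP_def by blast

lemma RLP_cong_sub:
  assumes "category C" "RLP C X A E B p" "\<And>c. c \<in> Ob C \<Longrightarrow> A c = A' c"
  shows "RLP C X A' E B p"
proof (rule RLPI)
  fix u v assume *: "nat_on C X A' E u" "nat_on C X (val X) B v"
      "\<And>c x. c \<in> Ob C \<Longrightarrow> x \<in> A' c \<Longrightarrow> p c (u c x) = v c x"
  have "nat_on C X A E u" using nat_on_mono[OF assms(1) *(1)] assms(3) by blast
  from RLPE[OF assms(2) this *(2)] *(3) assms(3) show "\<exists>h. nat_on C X (val X) E h \<and>
      (\<forall>c\<in>Ob C. \<forall>x\<in>A' c. h c x = u c x) \<and> (\<forall>c\<in>Ob C. \<forall>x\<in>val X c. p c (h c x) = v c x)"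
    by metis
qed

text \<open>For a retract of pairs, a problem on \<open>(T, S)\<close> is composed with
  \<open>r\<close>, solved on \<open>(T', S')\<close>, and the solution is restricted along
  \<open>i\<close>; \<open>ri\<close> recovers the original data.\<close>

lemma RLP_retract:
  assumes "category C" "RLP C T' S' E B p" "sub C T S" "sub C T' S'"
    and i: "nat_on C T (val T) T' i" and r: "nat_on C T' (val T') T r"
    and ri: "\<And>c x. c \<in> Ob C \<Longrightarrow> x \<in> val T c \<Longrightarrow> r c (i c x) = x"
    and iS: "\<And>c x. c \<in> Ob C \<Longrightarrow> x \<in> S c \<Longrightarrow> i c x \<in> S' c"
    and rS: "\<And>c x. c \<in> Ob C \<Longrightarrow> x \<in> S' c \<Longrightarrow> r c x \<in> S c"
  shows "RLP C T S E B p"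
proof (rule RLPI)
  fix u v assume *: "nat_on C T S E u" "nat_on C T (val T) B v"
      "\<And>c x. c \<in> Ob C \<Longrightarrow> x \<in> S c \<Longrightarrow> p c (u c x) = v c x"
  note r' = nat_on_mono[OF assms(1) r subsetI[OF subD[OF assms(4)]]]
  have 1: "nat_on C T' S' E (\<lambda>c x. u c (r c x))" by (rule nat_on_comp[OF assms(1) r' *(1) rS])
  have 2: "nat_on C T' (val T') B (\<lambda>c x. v c (r c x))"
    by (rule nat_on_comp[OF assms(1) r *(2) nat_on_val[OF r]])
  obtain h where h: "nat_on C T' (val T') E h" "\<And>c x. c \<in> Ob C \<Longrightarrow> x \<in> S' c \<Longrightarrow> h c x = u c (r c x)"
    "\<And>c x. c \<in> Ob C \<Longrightarrow> x \<in> val T' c \<Longrightarrow> p c (h c x) = v c (r c x)"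
    by (rule RLPE[OF assms(2) 1 2]) (use *(3) rS in blast)+
  show "\<exists>h. nat_on C T (val T) E h \<and>
      (\<forall>c\<in>Ob C. \<forall>x\<in>S c. h c x = u c x) \<and> (\<forall>c\<in>Ob C. \<forall>x\<in>val T c. p c (h c x) = v c x)"
  proof (intro exI conjI ballI)
    show "nat_on C T (val T) E (\<lambda>c x. h c (i c x))"
      by (rule nat_on_comp[OF assms(1) i h(1) nat_on_val[OF i]])
    fix c x assume c: "c \<in> Ob C"
    show "h c (i c x) = u c x" if "x \<in> S c"
      using h(2)[OF c iS[OF c that]] ri[OF c subD[OF assms(3) c that]] by simp
    show "p c (h c (i c x)) = v c x" if "x \<in> val T c"
      using h(3)[OF c nat_on_val[OF i c that]] ri[OF c that] by simp
  qed
qed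

lemma RLP_trans:
  assumes "category C" "RLP C (restr Z A1) A0 E B p" "RLP C Z A1 E B p"
    "\<And>c. c \<in> Ob C \<Longrightarrow> A0 c \<subseteq> A1 c" "\<And>c. c \<in> Ob C \<Longrightarrow> A1 c \<subseteq> val Z c"
  shows "RLP C Z A0 E B p"
proof (rule RLPI)
  fix u v assume *: "nat_on C Z A0 E u" "nat_on C Z (val Z) B v"
      "\<And>c x. c \<in> Ob C \<Longrightarrow> x \<in> A0 c \<Longrightarrow> p c (u c x) = v c x"
  have u: "nat_on C (restr Z A1) A0 E u" using *(1) unfolding nat_on_def by simp
  have v: "nat_on C (restr Z A1) (val (restr Z A1)) B v"
    using nat_on_mono[OF assms(1) *(2) assms(5)] unfolding nat_on_def by simp
  obtain h1 where h1: "nat_on C (restr Z A1) A1 E h1"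
    "\<And>c x. c \<in> Ob C \<Longrightarrow> x \<in> A0 c \<Longrightarrow> h1 c x = u c x"
    "\<And>c x. c \<in> Ob C \<Longrightarrow> x \<in> A1 c \<Longrightarrow> p c (h1 c x) = v c x"
    using RLPE[OF assms(2) u v] *(3) by (metis restr_simps(1))
  have "nat_on C Z A1 E h1" using h1(1) unfolding nat_on_def by simp
  then obtain h where h: "nat_on C Z (val Z) E h"
    "\<And>c x. c \<in> Ob C \<Longrightarrow> x \<in> A1 c \<Longrightarrow> h c x = h1 c x"
    "\<And>c x. c \<in> Ob C \<Longrightarrow> x \<in> val Z c \<Longrightarrow> p c (h c x) = v c x"
    using RLPE[OF assms(3) _ *(2)] h1(3) by metis
  have "h c x = u c x" if "c \<in> Ob C" "x \<in> A0 c" for c x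
    using h(2)[OF that(1) subsetD[OF assms(4)[OF that(1)] that(2)]] h1(2)[OF that] by simp
  then show "\<exists>h. nat_on C Z (val Z) E h \<and> (\<forall>c\<in>Ob C. \<forall>x\<in>A0 c. h c x = u c x) \<and>
      (\<forall>c\<in>Ob C. \<forall>x\<in>val Z c. p c (h c x) = v c x)"
    using h(1,3) by blast
qed

lemma RLP_refl: "RLP C (restr Z A) A E B p"
  by (rule RLPI) auto

text \<open>Cobase change: \<open>A1\<close> is the pushout of \<open>A0\<close> and \<open>Y\<close> along the preimage of \<open>A0\<close> in \<open>Y\<close>.\<close>

lemma RLP_pushout:
  assumes "category C" "sub C Z A0" "presheaf C Y" "sub C Z A1"
    and \<sigma>: "nat_on C Y (val Y) Z \<sigma>"
    and A1: "\<And>c. c \<in> Ob C \<Longrightarrow> A1 c = A0 c \<union> \<sigma> c ` val Y c"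
    and inj: "\<And>c y y'. c \<in> Ob C \<Longrightarrow> y \<in> val Y c \<Longrightarrow> y' \<in> val Y c \<Longrightarrow> \<sigma> c y = \<sigma> c y' \<Longrightarrow>
        \<sigma> c y \<notin> A0 c \<Longrightarrow> y = y'"
    and rlp: "RLP C Y (\<lambda>c. {y \<in> val Y c. \<sigma> c y \<in> A0 c}) E B p"
  shows "RLP C (restr Z A1) A0 E B p"
proof (rule RLPI, unfold restr_simps)
  fix u v assume u: "nat_on C (restr Z A1) A0 E u" and v: "nat_on C (restr Z A1) A1 B v"
    and uv: "\<And>c x. c \<in> Ob C \<Longrightarrow> x \<in> A0 c \<Longrightarrow> p c (u c x) = v c x"
  have u': "nat_on C Z A0 E u" and v': "nat_on C Z A1 B v" using u v unfolding nat_on_def by simp_all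
  have 1: "nat_on C Y (\<lambda>c. {y \<in> val Y c. \<sigma> c y \<in> A0 c}) E (\<lambda>c y. u c (\<sigma> c y))"
    by (rule nat_on_comp[OF assms(1) nat_on_mono[OF assms(1) \<sigma>] u']) auto
  have 2: "nat_on C Y (val Y) B (\<lambda>c y. v c (\<sigma> c y))"
    by (rule nat_on_comp[OF assms(1) \<sigma> v']) (auto simp: A1)
  obtain h where h: "nat_on C Y (val Y) E h"
    "\<And>c x. c \<in> Ob C \<Longrightarrow> x \<in> val Y c \<Longrightarrow> \<sigma> c x \<in> A0 c \<Longrightarrow> h c x = u c (\<sigma> c x)"
    "\<And>c x. c \<in> Ob C \<Longrightarrow> x \<in> val Y c \<Longrightarrow> p c (h c x) = v c (\<sigma> c x)"
    by (rule RLPE[OF rlp 1 2]) (use uv in auto)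
  \<comment> \<open>Off \<open>A0\<close> a point has only one preimage under
    \<open>\<sigma>\<close> by \<open>inj\<close>, and on \<open>A0\<close> the lift
    \<open>h\<close> already agrees with \<open>u\<close>, so the choice of preimage is
    harmless.\<close>
  define k where "k = (\<lambda>c z. if z \<in> A0 c then u c z else h c (SOME y. y \<in> val Y c \<and> \<sigma> c y = z))"
  have k0: "k c z = u c z" if "z \<in> A0 c" for c z using that by (simp add: k_def)
  have k1: "k c (\<sigma> c y) = h c y" if "c \<in> Ob C" "y \<in> val Y c" for c y
  proof (cases "\<sigma> c y \<in> A0 c")
    case True then show ?thesis using h(2) that k0 by simp
  next
    case False
    have "(SOME y'. y' \<in> val Y c \<and> \<sigma> c y' = \<sigma> c y) = y"
      using inj[OF that(1) that(2)] False that(2) by (intro some_equality) metis+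
    then show ?thesis using False by (simp add: k_def)
  qed
  have "nat_on C (restr Z A1) A1 E k"
  proof (rule nat_onI)
    fix c x assume c: "c \<in> Ob C" "x \<in> A1 c"
    then consider "x \<in> A0 c" | y where "y \<in> val Y c" "x = \<sigma> c y" using A1 by blast
    then show "k c x \<in> val E c"
      by cases (use k0 k1 nat_on_val[OF u' c(1)] nat_on_val[OF h(1) c(1)] c in auto)
  next
    fix f x assume f: "f \<in> Ar C" "x \<in> A1 (tgt C f)"
    note o = category_Ob[OF assms(1) f(1)]
    consider "x \<in> A0 (tgt C f)" | y where "y \<in> val Y (tgt C f)" "x = \<sigma> (tgt C f) y"
      using A1[OF o(2)] f(2) by blast
    then show "k (src C f) (act (restr Z A1) f x) = act E f (k (tgt C f) x)"
    proof cases
      case 1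
      then show ?thesis
        using k0 nat_on_act[OF u' f(1) refl refl 1] sub_act[OF assms(2) f(1) refl refl 1] by simp
    next
      case 2
      have "act Y f y \<in> val Y (src C f)" using presheaf_act[OF assms(3) f(1) refl refl 2(1)] .
      then show ?thesis
        using k1 o 2 nat_on_act[OF \<sigma> f(1) refl refl 2(1)] nat_on_act[OF h(1) f(1) refl refl 2(1)]
        by (metis restr_simps(2))
    qed
  qed
  moreover have "p c (k c x) = v c x" if "c \<in> Ob C" "x \<in> A1 c" for c x
    using that A1[OF that(1)] uv k0 k1 h(3) by auto
  ultimately show "\<exists>h. nat_on C (restr Z A1) A1 E h \<and> (\<forall>c\<in>Ob C. \<forall>x\<in>A0 c. h c x = u c x) \<and>
      (\<forall>c\<in>Ob C. \<forall>x\<in>A1 c. p c (h c x) = v c x)"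
    using k0 by blast
qed

text \<open>Lifts along the stages are chosen compatibly by dependent choice. The stages exhaust
  \<open>Z\<close> with a bound \<open>N c\<close> that depends only on the object, so the limit
  lift at \<open>c\<close> can be read off at stage \<open>N c\<close>.\<close>

lemma RLP_sequence:
  assumes "category C" "\<And>n. RLP C (restr Z (B (Suc n))) (B n) E F p"
    and mono: "\<And>n c. c \<in> Ob C \<Longrightarrow> B n c \<subseteq> B (Suc n) c" and le: "\<And>n c. c \<in> Ob C \<Longrightarrow> B n c \<subseteq> val Z c"
    and ex: "\<And>c. c \<in> Ob C \<Longrightarrow> val Z c \<subseteq> B (N c) c" and "presheaf C Z"
  shows "RLP C Z (B 0) E F p"
proof (rule RLPI)
  fix u v assume u: "nat_on C Z (B 0) E u" and v: "nat_on C Z (val Z) F v"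
    and uv: "\<And>c x. c \<in> Ob C \<Longrightarrow> x \<in> B 0 c \<Longrightarrow> p c (u c x) = v c x"
  let ?P = "\<lambda>n h. nat_on C Z (B n) E h \<and> (\<forall>c\<in>Ob C. \<forall>x\<in>B n c. p c (h c x) = v c x) \<and>
    (n = 0 \<longrightarrow> h = u)"
  let ?Q = "\<lambda>n h k. \<forall>c\<in>Ob C. \<forall>x\<in>B n c. k c x = h c x"
  have "\<exists>f. \<forall>n. ?P n (f n) \<and> ?Q n (f n) (f (Suc n))"
  proof (rule dependent_nat_choice)
    show "\<exists>h. ?P 0 h" using u uv by blast
    fix h n assume h: "?P n h"
    have 1: "nat_on C (restr Z (B (Suc n))) (B n) E h"
      using h unfolding nat_on_def by simp
    have 2: "nat_on C (restr Z (B (Suc n))) (B (Suc n)) F v"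
      using nat_on_mono[OF assms(1) v, of "B (Suc n)"] le unfolding nat_on_def by simp
    have 3: "p c (h c x) = v c x" if "c \<in> Ob C" "x \<in> B n c" for c x using h that by blast
    obtain k where k: "nat_on C (restr Z (B (Suc n))) (B (Suc n)) E k"
      "\<And>c x. c \<in> Ob C \<Longrightarrow> x \<in> B n c \<Longrightarrow> k c x = h c x"
      "\<And>c x. c \<in> Ob C \<Longrightarrow> x \<in> B (Suc n) c \<Longrightarrow> p c (k c x) = v c x"
      using RLPE[OF assms(2) 1, of v] 2 3 by (metis restr_simps(1))
    have "nat_on C Z (B (Suc n)) E k" using k(1) unfolding nat_on_def by simp
    then show "\<exists>k. ?P (Suc n) k \<and> ?Q n h k"
      using k(2,3) by (intro exI[of _ k]) auto
  qed
  then obtain f where f: "\<And>n. ?P n (f n)" "\<And>n. ?Q n (f n) (f (Suc n))" by blast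
  have monoB: "B m c \<subseteq> B n c" if "m \<le> n" "c \<in> Ob C" for m n c
    by (rule lift_Suc_mono_le[of "\<lambda>n. B n c", OF mono[OF that(2)] that(1)])
  have eq: "f n c x = f m c x" if "m \<le> n" "c \<in> Ob C" "x \<in> B m c" for m n c x
    using that(1)
  proof (induction rule: dec_induct)
    case (step i) then show ?case using f(2) that monoB[OF step(1) that(2)] by auto
  qed simp
  have eqN: "f (N c) c x = f n c x" if "N c \<le> n" "c \<in> Ob C" "x \<in> val Z c" for c n x
    using eq[OF that(1,2), of x] ex[OF that(2)] that(3) by auto
  show "\<exists>h. nat_on C Z (val Z) E h \<and> (\<forall>c\<in>Ob C. \<forall>x\<in>B 0 c. h c x = u c x) \<and>
      (\<forall>c\<in>Ob C. \<forall>x\<in>val Z c. p c (h c x) = v c x)"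
  proof (intro exI conjI ballI)
    show "nat_on C Z (val Z) E (\<lambda>c. f (N c) c)"
    proof (rule nat_onI)
      fix c x assume "c \<in> Ob C" "x \<in> val Z c"
      then show "f (N c) c x \<in> val E c"
        using f(1)[of "N c"] ex unfolding nat_on_def by blast
    next
      fix g x assume g: "g \<in> Ar C" "x \<in> val Z (tgt C g)"
      note o = category_Ob[OF assms(1) g(1)]
      have y: "act Z g x \<in> val Z (src C g)" by (rule presheaf_act[OF assms(6) g(1) refl refl g(2)])
      \<comment> \<open>Naturality along \<open>g\<close> compares two objects with different
        bounds; it is checked at a stage that covers both.\<close>
      define n where "n = max (N (src C g)) (N (tgt C g))"
      have "x \<in> B n (tgt C g)" using ex[OF o(2)] g(2) monoB[OF _ o(2), of "N (tgt C g)" n] n_def by auto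
      then have "f n (src C g) (act Z g x) = act E g (f n (tgt C g) x)"
        using f(1)[of n] g(1) unfolding nat_on_def by blast
      then show "f (N (src C g)) (src C g) (act Z g x) = act E g (f (N (tgt C g)) (tgt C g) x)"
        using eqN[OF _ o(1) y, of n] eqN[OF _ o(2) g(2), of n] by (simp add: n_def)
    qed
    fix c x assume c: "c \<in> Ob C"
    show "f (N c) c x = u c x" if "x \<in> B 0 c" using eq[OF _ c that, of "N c"] f(1)[of 0] by simp
    show "p c (f (N c) c x) = v c x" if "x \<in> val Z c" using f(1)[of "N c"] c that ex[OF c] by blast
  qed
qed

section \<open>Coproducts, pushout products and deformations\<close>

definition copower :: "'i set \<Rightarrow> ('o, 'm, 'a) psh \<Rightarrow> ('o, 'm, 'i \<times> 'a) psh" where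
  "copower I Y = \<lparr>val = (\<lambda>c. I \<times> val Y c), act = (\<lambda>f (i, y). (i, act Y f y))\<rparr>"

lemma copower_simps [simp]:
  "val (copower I Y) c = I \<times> val Y c" "act (copower I Y) f (i, y) = (i, act Y f y)"
  by (simp_all add: copower_def)

lemma presheaf_copower: "presheaf C Y \<Longrightarrow> presheaf C (copower I Y)"
  by (rule presheafI) (auto simp: presheaf_act presheaf_idn presheaf_cmp)

lemma RLP_copower:
  assumes "category C" "RLP C Y S E B p"
  shows "RLP C (copower I Y) (\<lambda>c. I \<times> S c) E B p"
proof (rule RLPI)
  fix u v assume u: "nat_on C (copower I Y) (\<lambda>c. I \<times> S c) E u"
    and v: "nat_on C (copower I Y) (val (copower I Y)) B v"
    and uv: "\<And>c x. c \<in> Ob C \<Longrightarrow> x \<in> I \<times> S c \<Longrightarrow> p c (u c x) = v c x"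
  have "\<exists>h. nat_on C Y (val Y) E h \<and> (\<forall>c\<in>Ob C. \<forall>x\<in>S c. h c x = u c (i, x)) \<and>
      (\<forall>c\<in>Ob C. \<forall>x\<in>val Y c. p c (h c x) = v c (i, x))" if i: "i \<in> I" for i
  proof -
    have "nat_on C Y S E (\<lambda>c x. u c (i, x))" "nat_on C Y (val Y) B (\<lambda>c x. v c (i, x))"
      using u v i unfolding nat_on_def by auto
    from RLPE[OF assms(2) this] uv i show ?thesis by (metis SigmaI)
  qed
  then obtain h where h: "\<And>i. i \<in> I \<Longrightarrow> nat_on C Y (val Y) E (h i)"
    "\<And>i c x. i \<in> I \<Longrightarrow> c \<in> Ob C \<Longrightarrow> x \<in> S c \<Longrightarrow> h i c x = u c (i, x)"
    "\<And>i c x. i \<in> I \<Longrightarrow> c \<in> Ob C \<Longrightarrow> x \<in> val Y c \<Longrightarrow> p c (h i c x) = v c (i, x)" by metis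
  have "nat_on C (copower I Y) (val (copower I Y)) E (\<lambda>c (i, x). h i c x)"
    using h(1) unfolding nat_on_def by auto
  then show "\<exists>h. nat_on C (copower I Y) (val (copower I Y)) E h \<and>
      (\<forall>c\<in>Ob C. \<forall>x\<in>I \<times> S c. h c x = u c x) \<and> (\<forall>c\<in>Ob C. \<forall>x\<in>val (copower I Y) c. p c (h c x) = v c x)"
    using h(2,3) by (intro exI[of _ "\<lambda>c (i, x). h i c x"]) auto
qed

lemma prod_psh_simps [simp]:
  "val (X \<times>\<^sub>p Y) c = val X c \<times> val Y c" "act (X \<times>\<^sub>p Y) f (x, y) = (act X f x, act Y f y)"
  by (simp_all add: prod_psh_def)

lemma presheaf_prod: "presheaf C X \<Longrightarrow> presheaf C Y \<Longrightarrow> presheaf C (X \<times>\<^sub>p Y)"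
  by (rule presheafI) (auto simp: presheaf_act presheaf_idn presheaf_cmp)

text \<open>The domain of the pushout product of \<open>A\<close> in \<open>X\<close> with
  \<open>S\<close> in \<open>Y\<close>.\<close>

definition corner ::
  "('o, 'm, 'a) psh \<Rightarrow> ('o \<Rightarrow> 'a set) \<Rightarrow> ('o, 'm, 'b) psh \<Rightarrow> ('o \<Rightarrow> 'b set) \<Rightarrow> 'o \<Rightarrow> ('a \<times> 'b) set" where
  "corner X A Y S = (\<lambda>c. {(x, y). x \<in> val X c \<and> y \<in> val Y c \<and> (x \<in> A c \<or> y \<in> S c)})"

lemma corner_iff [simp]:
  "(x, y) \<in> corner X A Y S c \<longleftrightarrow> x \<in> val X c \<and> y \<in> val Y c \<and> (x \<in> A c \<or> y \<in> S c)"
  by (simp add: corner_def)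

lemma sub_corner:
  assumes "presheaf C X" "presheaf C Y" "sub C X A" "sub C Y S"
  shows "sub C (X \<times>\<^sub>p Y) (corner X A Y S)"
  unfolding sub_def using sub_act[OF assms(3)] sub_act[OF assms(4)] assms(1,2)
  by (auto simp: corner_def presheaf_act)

definition point :: "('o, 'm) cat \<Rightarrow> ('o, 'm, 'i) psh \<Rightarrow> ('o \<Rightarrow> 'i) \<Rightarrow> bool" where
  "point C I e \<longleftrightarrow> (\<forall>c\<in>Ob C. e c \<in> val I c) \<and> (\<forall>f\<in>Ar C. act I f (e (tgt C f)) = e (src C f))"

lemma sub_point: "point C I e \<Longrightarrow> sub C I (\<lambda>c. {e c})"
  unfolding point_def sub_def by auto

abbreviation cyl where "cyl X A I e \<equiv> corner X A I (\<lambda>c. {e c})"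

text \<open>A deformation of \<open>X\<close> into \<open>A\<close>, starting from the identity at
  \<open>e1\<close> and ending in \<open>A\<close> at \<open>e0\<close>. Points of \<open>A\<close>
  may move, but only inside \<open>A\<close>; this weak form survives products with arbitrary
  pairs.\<close>

definition contracts ::
  "('o, 'm) cat \<Rightarrow> ('o, 'm, 'i) psh \<Rightarrow> ('o \<Rightarrow> 'i) \<Rightarrow> ('o \<Rightarrow> 'i) \<Rightarrow> ('o, 'm, 'a) psh \<Rightarrow> ('o \<Rightarrow> 'a set) \<Rightarrow> bool"
  where
  "contracts C I e0 e1 X A \<longleftrightarrow> (\<exists>H. nat_on C (X \<times>\<^sub>p I) (val (X \<times>\<^sub>p I)) X H \<and>
     (\<forall>c\<in>Ob C. \<forall>x\<in>val X c. H c (x, e1 c) = x \<and> H c (x, e0 c) \<in> A c) \<and>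
     (\<forall>c\<in>Ob C. \<forall>x\<in>A c. \<forall>t\<in>val I c. H c (x, t) \<in> A c))"

text \<open>\<open>(X, A)\<close> is a retract of the cylinder pair: include \<open>X\<close> at the
  end \<open>e1\<close> and retract by the deformation, which sends both the cylinder over
  \<open>A\<close> and the end \<open>e0\<close> into \<open>A\<close>.\<close>

lemma contracts_RLP:
  assumes "category C" "contracts C I e0 e1 X A" "presheaf C X" "presheaf C I" "sub C X A"
    and e: "point C I e0" "point C I e1" and rlp: "RLP C (X \<times>\<^sub>p I) (cyl X A I e0) E B p"
  shows "RLP C X A E B p"
proof -
  obtain H where H: "nat_on C (X \<times>\<^sub>p I) (val (X \<times>\<^sub>p I)) X H"
     "\<And>c x. c \<in> Ob C \<Longrightarrow> x \<in> val X c \<Longrightarrow> H c (x, e1 c) = x \<and> H c (x, e0 c) \<in> A c"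
     "\<And>c x t. c \<in> Ob C \<Longrightarrow> x \<in> A c \<Longrightarrow> t \<in> val I c \<Longrightarrow> H c (x, t) \<in> A c"
    using assms(2) unfolding contracts_def by blast
  show ?thesis
  proof (rule RLP_retract[OF assms(1) rlp assms(5) sub_corner[OF assms(3,4,5) sub_point[OF e(1)]] _ H(1)])
    show "nat_on C X (val X) (X \<times>\<^sub>p I) (\<lambda>c x. (x, e1 c))"
      using e(2) unfolding nat_on_def point_def by auto
  qed (use H(2,3) e(2) subD[OF assms(5)] in \<open>auto simp: corner_def point_def\<close>)
qed

text \<open>The deformation moves only the first coordinate, so the condition
  \<open>y \<in> S\<close> persists and the part lying over \<open>A\<close> stays over
  \<open>A\<close>.\<close>

lemma contracts_corner:
  fixes X :: "('o, 'm, 'a) psh" and Y :: "('o, 'm, 'c) psh"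
  assumes "category C" "contracts C I e0 e1 X A" "sub C X A"
  shows "contracts C I e0 e1 (X \<times>\<^sub>p Y) (corner X A Y S)"
proof -
  obtain H where H: "nat_on C (X \<times>\<^sub>p I) (val (X \<times>\<^sub>p I)) X H"
     "\<And>c x. c \<in> Ob C \<Longrightarrow> x \<in> val X c \<Longrightarrow> H c (x, e1 c) = x \<and> H c (x, e0 c) \<in> A c"
     "\<And>c x t. c \<in> Ob C \<Longrightarrow> x \<in> A c \<Longrightarrow> t \<in> val I c \<Longrightarrow> H c (x, t) \<in> A c"
    using assms(2) unfolding contracts_def by blast
  have Hv: "H c (x, t) \<in> val X c" if "c \<in> Ob C" "x \<in> val X c" "t \<in> val I c" for c x t
    using nat_on_val[OF H(1), of c "(x, t)"] that by simp
  have Ha: "H (src C f) (act X f x, act I f t) = act X f (H (tgt C f) (x, t))"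
    if "f \<in> Ar C" "x \<in> val X (tgt C f)" "t \<in> val I (tgt C f)" for f x t
    using nat_on_act[OF H(1) that(1) refl refl, of "(x, t)"] that by simp
  define K where "K = (\<lambda>c ((x, y), t). (H c (x, t), y :: 'c))"
  have K [simp]: "K c ((x, y), t) = (H c (x, t), y)" for c x y t by (simp add: K_def)
  have 1: "nat_on C ((X \<times>\<^sub>p Y) \<times>\<^sub>p I) (val ((X \<times>\<^sub>p Y) \<times>\<^sub>p I)) (X \<times>\<^sub>p Y) K"
    using Hv Ha by (intro nat_onI) auto
  have 2: "K c (z, e1 c) = z \<and> K c (z, e0 c) \<in> corner X A Y S c"
    if "c \<in> Ob C" "z \<in> val (X \<times>\<^sub>p Y) c" for c z
    using H(2)[OF that(1)] subD[OF assms(3) that(1)] that by auto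
  have 3: "K c (z, t) \<in> corner X A Y S c"
    if "c \<in> Ob C" "z \<in> corner X A Y S c" "t \<in> val I c" for c z t
    using H(3)[OF that(1)] Hv[OF that(1)] that by (cases z) auto
  show ?thesis unfolding contracts_def using 1 2 3 by blast
qed


section \<open>The simplex category\<close>

abbreviation smap :: "nat \<Rightarrow> nat \<Rightarrow> smor set" where
  "smap k n \<equiv> {\<alpha> \<in> Ar simplex. src simplex \<alpha> = k \<and> tgt simplex \<alpha> = n}"

definition ev :: "smor \<Rightarrow> nat \<Rightarrow> nat" where
  "ev \<alpha> i = fst \<alpha> ! i"

definition mk :: "nat \<Rightarrow> nat \<Rightarrow> (nat \<Rightarrow> nat) \<Rightarrow> smor" where
  "mk k n f = (map f [0..<Suc k], n)"

lemma simplex_Ob [simp]: "k \<in> Ob simplex"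
  by (simp add: simplex_def)

text \<open>Turns lists into monotone functions; from here on arguments run through the values
  \<open>ev\<close>, the extensionality rule \<open>smap_ext\<close> and the constructor
  \<open>mk\<close>.\<close>

lemma smap_iff:
  "\<alpha> \<in> smap k n \<longleftrightarrow> length (fst \<alpha>) = Suc k \<and> snd \<alpha> = n \<and> (\<forall>i\<le>k. ev \<alpha> i \<le> n) \<and>
     (\<forall>i j. i \<le> j \<longrightarrow> j \<le> k \<longrightarrow> ev \<alpha> i \<le> ev \<alpha> j)"
proof (cases \<alpha>)
  case (Pair xs m)
  have *: "xs \<noteq> [] \<and> length xs - 1 = k \<longleftrightarrow> length xs = Suc k" by (cases xs) auto
  have "\<alpha> \<in> smap k n \<longleftrightarrow> length xs = Suc k \<and> m = n \<and> sorted xs \<and> set xs \<subseteq> {..n}"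
    unfolding Pair simplex_def using * by auto
  show ?thesis
  proof (cases "length xs = Suc k")
    case True
    have "set xs \<subseteq> {..n} \<longleftrightarrow> (\<forall>i\<le>k. xs ! i \<le> n)"
      using True by (auto simp: set_conv_nth less_Suc_eq_le)
    moreover have "sorted xs \<longleftrightarrow> (\<forall>i j. i \<le> j \<longrightarrow> j \<le> k \<longrightarrow> xs ! i \<le> xs ! j)"
      unfolding sorted_iff_nth_mono True less_Suc_eq_le by (rule refl)
    ultimately show ?thesis unfolding \<open>\<alpha> \<in> smap k n \<longleftrightarrow> _\<close> by (simp add: Pair ev_def conj_commute)
  next
    case False
    then show ?thesis unfolding \<open>\<alpha> \<in> smap k n \<longleftrightarrow> _\<close> by (simp add: Pair)
  qed
qed

lemma smap_le: "\<alpha> \<in> smap k n \<Longrightarrow> i \<le> k \<Longrightarrow> ev \<alpha> i \<le> n"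
  by (simp only: smap_iff)

lemma smap_mono: "\<alpha> \<in> smap k n \<Longrightarrow> i \<le> j \<Longrightarrow> j \<le> k \<Longrightarrow> ev \<alpha> i \<le> ev \<alpha> j"
  by (simp only: smap_iff)

lemma smap_ext:
  assumes "\<alpha> \<in> smap k n" "\<beta> \<in> smap k n" "\<And>i. i \<le> k \<Longrightarrow> ev \<alpha> i = ev \<beta> i"
  shows "\<alpha> = \<beta>"
proof -
  have "fst \<alpha> = fst \<beta>"
    using assms by (intro nth_equalityI) (auto simp only: smap_iff ev_def less_Suc_eq_le)
  then show ?thesis using assms(1,2) by (simp only: smap_iff) (metis prod.expand)
qed

lemma ev_mk [simp]: "i \<le> k \<Longrightarrow> ev (mk k n f) i = f i"
  unfolding ev_def mk_def fst_conv by (subst nth_map) (simp_all del: upt_Suc)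

lemma mk_smap:
  assumes "\<And>i. i \<le> k \<Longrightarrow> f i \<le> n" "\<And>i j. i \<le> j \<Longrightarrow> j \<le> k \<Longrightarrow> f i \<le> f j"
  shows "mk k n f \<in> smap k n"
  using assms by (simp add: smap_iff del: mem_Collect_eq) (simp add: mk_def)

lemma smap_set: "\<alpha> \<in> smap k n \<Longrightarrow> set (fst \<alpha>) = ev \<alpha> ` {..k}"
  unfolding smap_iff ev_def by (auto simp: set_conv_nth less_Suc_eq_le image_iff)

lemma smap_Ar: "\<alpha> \<in> Ar simplex \<Longrightarrow> \<alpha> \<in> smap (src simplex \<alpha>) (tgt simplex \<alpha>)"
  by simp

lemma const_mor_mk: "const_mor k n i = mk k n (\<lambda>_. i)"
  unfolding const_mor_def mk_def by (simp add: map_replicate_const del: upt_Suc)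

lemma const_mor_smap: "i \<le> n \<Longrightarrow> const_mor k n i \<in> smap k n"
  unfolding const_mor_mk by (rule mk_smap) auto

lemma ev_const_mor [simp]: "j \<le> k \<Longrightarrow> ev (const_mor k n i) j = i"
  unfolding const_mor_mk by simp

lemma idn_mk: "idn simplex n = mk n n (\<lambda>i. i)"
  unfolding simplex_def mk_def by simp

lemma idn_smap: "idn simplex n \<in> smap n n"
  unfolding idn_mk by (rule mk_smap) auto

lemma ev_idn [simp]: "i \<le> n \<Longrightarrow> ev (idn simplex n) i = i"
  unfolding idn_mk by simp

lemma cmp_smap:
  assumes "\<alpha> \<in> smap k m" "\<gamma> \<in> smap m n"
  shows "cmp simplex \<gamma> \<alpha> \<in> smap k n" "i \<le> k \<Longrightarrow> ev (cmp simplex \<gamma> \<alpha>) i = ev \<gamma> (ev \<alpha> i)"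
proof -
  have eq: "cmp simplex \<gamma> \<alpha> = (map (ev \<gamma>) (fst \<alpha>), snd \<gamma>)"
    unfolding simplex_def by (auto simp: ev_def split: prod.splits)
  show *: "ev (cmp simplex \<gamma> \<alpha>) i = ev \<gamma> (ev \<alpha> i)" if "i \<le> k" for i
    using assms that unfolding eq by (simp add: smap_iff ev_def del: mem_Collect_eq)
  have "ev (cmp simplex \<gamma> \<alpha>) i \<le> n" if "i \<le> k" for i
    unfolding *[OF that] by (rule smap_le[OF assms(2) smap_le[OF assms(1) that]])
  moreover have "ev (cmp simplex \<gamma> \<alpha>) i \<le> ev (cmp simplex \<gamma> \<alpha>) j" if "i \<le> j" "j \<le> k" for i j
    unfolding *[OF that(2)] *[OF order_trans[OF that]]
    by (rule smap_mono[OF assms(2) smap_mono[OF assms(1) that] smap_le[OF assms(1) that(2)]])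
  ultimately show "cmp simplex \<gamma> \<alpha> \<in> smap k n"
    unfolding smap_iff[of "cmp simplex \<gamma> \<alpha>"] using assms
    by (simp add: smap_iff eq del: mem_Collect_eq)
qed

lemma category_simplex: "category simplex"
proof -
  have id: "idn simplex c \<in> Ar simplex \<and> src simplex (idn simplex c) = c \<and> tgt simplex (idn simplex c) = c"
    for c using idn_smap[of c] by simp
  have cmp: "cmp simplex g f \<in> Ar simplex \<and> src simplex (cmp simplex g f) = src simplex f \<and>
      tgt simplex (cmp simplex g f) = tgt simplex g"
    if "f \<in> Ar simplex" "g \<in> Ar simplex" "src simplex g = tgt simplex f" for f g
    using cmp_smap(1)[of f "src simplex f" "tgt simplex f" g "tgt simplex g"] that by simp
  have unit: "cmp simplex f (idn simplex (src simplex f)) = f \<and> cmp simplex (idn simplex (tgt simplex f)) f = f"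
    if "f \<in> Ar simplex" for f
  proof
    note f = smap_Ar[OF that]
    show "cmp simplex f (idn simplex (src simplex f)) = f"
      by (rule smap_ext[OF cmp_smap(1)[OF idn_smap f] f]) (simp add: cmp_smap(2)[OF idn_smap f])
    show "cmp simplex (idn simplex (tgt simplex f)) f = f"
      by (rule smap_ext[OF cmp_smap(1)[OF f idn_smap] f])
        (simp add: cmp_smap(2)[OF f idn_smap] smap_le[OF f])
  qed
  have assoc: "cmp simplex h (cmp simplex g f) = cmp simplex (cmp simplex h g) f"
    if "f \<in> Ar simplex" "g \<in> Ar simplex" "h \<in> Ar simplex"
      "src simplex g = tgt simplex f" "src simplex h = tgt simplex g" for f g h
  proof -
    have f: "f \<in> smap (src simplex f) (src simplex g)" and g: "g \<in> smap (src simplex g) (src simplex h)"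
      and h: "h \<in> smap (src simplex h) (tgt simplex h)" using that by simp_all
    show ?thesis
      by (rule smap_ext[OF cmp_smap(1)[OF cmp_smap(1)[OF f g] h] cmp_smap(1)[OF f cmp_smap(1)[OF g h]]])
       (simp add: cmp_smap(2)[OF cmp_smap(1)[OF f g] h] cmp_smap(2)[OF f cmp_smap(1)[OF g h]]
          cmp_smap(2)[OF f g] cmp_smap(2)[OF g h] smap_le[OF f])
  qed
  show ?thesis unfolding category_def using id cmp unit assoc by simp
qed

lemma representable_simps [simp]:
  "val (representable C c) b = {f \<in> Ar C. src C f = b \<and> tgt C f = c}"
  "act (representable C c) g f = cmp C f g"
  by (simp_all add: representable_def)

lemma presheaf_representable: "category C \<Longrightarrow> presheaf C (representable C c)"
  by (rule presheafI) (auto simp: category_cmp category_unit category_assoc)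

lemmas presheaf_simplex = presheaf_representable[OF category_simplex]

text \<open>\<open>\<gamma>\<close> is the coface that skips the missed vertex \<open>q\<close>, and
  \<open>\<beta>\<close> lowers the values above \<open>q\<close> by one.\<close>

lemma smap_not_onto:
  assumes "\<alpha> \<in> smap k n" "q \<le> n" "\<And>i. i \<le> k \<Longrightarrow> ev \<alpha> i \<noteq> q"
  obtains m \<beta> \<gamma> where "m < n" "\<beta> \<in> smap k m" "\<gamma> \<in> smap m n" "\<alpha> = cmp simplex \<gamma> \<beta>"
proof -
  have n: "n \<noteq> 0" using assms(2) assms(3)[of 0] smap_le[OF assms(1), of 0] by auto
  define \<beta> where "\<beta> = mk k (n - 1) (\<lambda>i. if ev \<alpha> i < q then ev \<alpha> i else ev \<alpha> i - 1)"
  define \<gamma> where "\<gamma> = mk (n - 1) n (\<lambda>i. if i < q then i else Suc i)"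
  have \<beta>: "\<beta> \<in> smap k (n - 1)" unfolding \<beta>_def
  proof (rule mk_smap)
    fix i assume "i \<le> k" then show "(if ev \<alpha> i < q then ev \<alpha> i else ev \<alpha> i - 1) \<le> n - 1"
      using smap_le[OF assms(1), of i] assms(2) by auto
  next
    fix i j assume "i \<le> j" "j \<le> k"
    then show "(if ev \<alpha> i < q then ev \<alpha> i else ev \<alpha> i - 1) \<le> (if ev \<alpha> j < q then ev \<alpha> j else ev \<alpha> j - 1)"
      using smap_mono[OF assms(1), of i j] by auto
  qed
  have \<gamma>: "\<gamma> \<in> smap (n - 1) n" unfolding \<gamma>_def using n by (intro mk_smap) auto
  have "\<alpha> = cmp simplex \<gamma> \<beta>"
  proof (rule smap_ext[OF assms(1) cmp_smap(1)[OF \<beta> \<gamma>]])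
    fix i assume i: "i \<le> k"
    show "ev \<alpha> i = ev (cmp simplex \<gamma> \<beta>) i"
      unfolding cmp_smap(2)[OF \<beta> \<gamma> i] using smap_le[OF \<beta> i] i assms(3)[OF i]
      by (auto simp: \<gamma>_def \<beta>_def)
  qed
  then show ?thesis using that[OF _ \<beta> \<gamma>] n by simp
qed

text \<open>Any choice of preimages is automatically monotone because \<open>\<alpha>\<close> is.
  The section can be made to pass through a prescribed vertex \<open>i0\<close>, which lets sections
  tell surjections apart in the Eilenberg-Zilber argument.\<close>

lemma smap_section:
  assumes "\<alpha> \<in> smap k n" "{..n} \<subseteq> ev \<alpha> ` {..k}" "i0 \<le> k"
  obtains \<delta> where "\<delta> \<in> smap n k" "cmp simplex \<alpha> \<delta> = idn simplex n" "ev \<delta> (ev \<alpha> i0) = i0"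
proof -
  define d where "d = (\<lambda>j. if j = ev \<alpha> i0 then i0 else SOME i. i \<le> k \<and> ev \<alpha> i = j)"
  have d: "d j \<le> k \<and> ev \<alpha> (d j) = j" if "j \<le> n" for j
  proof (cases "j = ev \<alpha> i0")
    case False
    have "\<exists>i. i \<le> k \<and> ev \<alpha> i = j" using assms(2) that by auto
    from someI_ex[OF this] show ?thesis using False by (simp add: d_def)
  qed (use assms(3) in \<open>simp add: d_def\<close>)
  define \<delta> where "\<delta> = mk n k d"
  have \<delta>: "\<delta> \<in> smap n k" unfolding \<delta>_def
  proof (rule mk_smap)
    fix i j assume ij: "i \<le> j" "j \<le> n"
    show "d i \<le> d j"
    proof (cases "i = j")
      case False
      show ?thesis
      proof (rule ccontr)
        assume "\<not> d i \<le> d j"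
        then have "ev \<alpha> (d j) \<le> ev \<alpha> (d i)" using smap_mono[OF assms(1), of "d j" "d i"] d[of i] ij by simp
        then show False using d[of i] d[of j] ij False by simp
      qed
    qed simp
  qed (use d in auto)
  have "cmp simplex \<alpha> \<delta> = idn simplex n"
    by (rule smap_ext[OF cmp_smap(1)[OF \<delta> assms(1)] idn_smap])
      (use d in \<open>simp add: cmp_smap(2)[OF \<delta> assms(1)], simp add: \<delta>_def\<close>)
  moreover have "ev \<delta> (ev \<alpha> i0) = i0" using smap_le[OF assms(1,3)] by (simp add: \<delta>_def d_def)
  ultimately show ?thesis using that \<delta> by blast
qed

text \<open>A monotone bijection is strictly increasing, so it lies above the identity by induction
  from 0 and below it by induction downwards from \<open>n\<close>.\<close>

lemma smap_onto_idn:
  assumes "\<alpha> \<in> smap n n" "{..n} \<subseteq> ev \<alpha> ` {..n}"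
  shows "\<alpha> = idn simplex n"
proof (rule smap_ext[OF assms(1) idn_smap])
  have inj: "inj_on (ev \<alpha>) {..n}"
  proof (rule eq_card_imp_inj_on)
    have "ev \<alpha> ` {..n} = {..n}" using assms(2) smap_le[OF assms(1)] by auto
    then show "card (ev \<alpha> ` {..n}) = card {..n}" by simp
  qed simp
  have strict: "ev \<alpha> i < ev \<alpha> j" if "i < j" "j \<le> n" for i j
    using smap_mono[OF assms(1), of i j] inj_onD[OF inj, of i j] that by fastforce
  have 1: "i \<le> ev \<alpha> i" if "i \<le> n" for i using that
  proof (induction i)
    case (Suc i) then show ?case using strict[of i "Suc i"] by simp
  qed simp
  have 2: "ev \<alpha> (n - i) \<le> n - i" if "i \<le> n" for i using that
  proof (induction i)
    case 0 then show ?case using smap_le[OF assms(1), of n] by simp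
  next
    case (Suc i)
    then have "n - Suc i < n - i" by simp
    then show ?case using strict[of "n - Suc i" "n - i"] Suc by linarith
  qed
  fix i assume i: "i \<le> n"
  show "ev \<alpha> i = ev (idn simplex n) i" using 1[OF i] 2[of "n - i"] i by simp
qed

section \<open>Anodyne extensions of simplicial sets\<close>

lemma boundary_val:
  "val (boundary n) m = {\<alpha> \<in> smap m n. \<not> {..n} \<subseteq> ev \<alpha> ` {..m}}"
  unfolding boundary_def using smap_set[of _ m n] by auto

lemma horn_val:
  "val (horn n k) m = {\<alpha> \<in> smap m n. \<not> {..n} \<subseteq> insert k (ev \<alpha> ` {..m})}"
  unfolding horn_def using smap_set[of _ m n] by auto

lemma cmp_image:
  assumes "\<alpha> \<in> smap k m" "\<gamma> \<in> smap m n"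
  shows "ev (cmp simplex \<gamma> \<alpha>) ` {..k} = ev \<gamma> ` ev \<alpha> ` {..k}"
  using cmp_smap(2)[OF assms] by (auto simp: image_iff)

lemma cmp_image_subset:
  assumes "\<alpha> \<in> smap k m" "\<gamma> \<in> smap m n"
  shows "ev (cmp simplex \<gamma> \<alpha>) ` {..k} \<subseteq> ev \<gamma> ` {..m}"
  unfolding cmp_image[OF assms] using smap_le[OF assms(1)] by auto

lemma sub_boundary: "sub simplex (std_simplex n) (val (boundary n))"
  unfolding sub_def
proof (intro conjI ballI subsetI)
  fix f x assume f: "f \<in> Ar simplex" "x \<in> val (boundary n) (tgt simplex f)"
  then have x: "x \<in> smap (tgt simplex f) n" "\<not> {..n} \<subseteq> ev x ` {..tgt simplex f}"
    unfolding boundary_val by auto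
  have "cmp simplex x f \<in> smap (src simplex f) n" by (rule cmp_smap(1)[OF smap_Ar[OF f(1)] x(1)])
  moreover have "\<not> {..n} \<subseteq> ev (cmp simplex x f) ` {..src simplex f}"
    using cmp_image_subset[OF smap_Ar[OF f(1)] x(1)] x(2) by blast
  ultimately show "act (std_simplex n) f x \<in> val (boundary n) (src simplex f)"
    unfolding boundary_val by simp
qed (simp add: boundary_val)

lemma sub_horn: "sub simplex (std_simplex n) (val (horn n k))"
  unfolding sub_def
proof (intro conjI ballI subsetI)
  fix f x assume f: "f \<in> Ar simplex" "x \<in> val (horn n k) (tgt simplex f)"
  then have x: "x \<in> smap (tgt simplex f) n" "\<not> {..n} \<subseteq> insert k (ev x ` {..tgt simplex f})"
    unfolding horn_val by auto
  have "cmp simplex x f \<in> smap (src simplex f) n" by (rule cmp_smap(1)[OF smap_Ar[OF f(1)] x(1)])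
  moreover have "\<not> {..n} \<subseteq> insert k (ev (cmp simplex x f) ` {..src simplex f})"
    using cmp_image_subset[OF smap_Ar[OF f(1)] x(1)] x(2) by blast
  ultimately show "act (std_simplex n) f x \<in> val (horn n k) (src simplex f)"
    unfolding horn_val by simp
qed (simp add: horn_val)

lemma horn_restr: "horn n k = restr (std_simplex n) (val (horn n k))"
  by (simp add: horn_def restr_def)

text \<open>Cell attachment along the skeletal filtration: \<open>X\<close> is obtained from \<open>A\<close> by attaching its
  nondegenerate simplices outside \<open>A\<close>, which satisfy the Eilenberg-Zilber uniqueness property.\<close>

lemma RLP_skeletal:
  fixes X :: "'x sset" and T :: "'t sset"
  assumes X: "presheaf simplex X" and A: "sub simplex X A"
    and T: "presheaf simplex T" and S: "sub simplex T S"
    and cells: "\<And>n. RLP simplex (std_simplex n \<times>\<^sub>p T)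
        (corner (std_simplex n) (val (boundary n)) T S) E B p"
  shows "RLP simplex (X \<times>\<^sub>p T) (corner X A T S) E B p"
proof -
  note cat = category_simplex
  \<comment> \<open>The relative skeleta: stage \<open>n\<close> is \<open>A\<close> together with
    the \<open>(n-1)\<close>-skeleton of \<open>X\<close>.\<close>
  define F where "F = (\<lambda>n k. A k \<union> {act X \<alpha> y |\<alpha> y. \<exists>m<n. \<alpha> \<in> smap k m \<and> y \<in> val X m})"
  have subF: "sub simplex X (F n)" for n unfolding sub_def
  proof (intro conjI ballI subsetI)
    fix c x assume "x \<in> F n c" then show "x \<in> val X c"
      unfolding F_def using subD[OF A, of c x] presheaf_act[OF X] by auto
  next
    fix f x assume f: "f \<in> Ar simplex" "x \<in> F n (tgt simplex f)"
    then consider "x \<in> A (tgt simplex f)"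
      | \<alpha> y m where "x = act X \<alpha> y" "m < n" "\<alpha> \<in> smap (tgt simplex f) m" "y \<in> val X m"
      unfolding F_def by blast
    then show "act X f x \<in> F n (src simplex f)"
    proof cases
      case 1 then show ?thesis using sub_act[OF A f(1)] by (auto simp: F_def)
    next
      case 2
      then have "act X f x = act X (cmp simplex \<alpha> f) y"
        using presheaf_cmp[OF X f(1), of \<alpha>] by simp
      moreover have "cmp simplex \<alpha> f \<in> smap (src simplex f) m"
        by (rule cmp_smap(1)[OF smap_Ar[OF f(1)] 2(3)])
      ultimately show ?thesis using 2(2,4) unfolding F_def by blast
    qed
  qed
  define G where "G = (\<lambda>n. corner X (F n) T S)"
  have subG: "sub simplex (X \<times>\<^sub>p T) (G n)" for n
    unfolding G_def by (rule sub_corner[OF X T subF S])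
  have step: "RLP simplex (restr (X \<times>\<^sub>p T) (G (Suc n))) (G n) E B p" for n
  proof -
    \<comment> \<open>The simplices to be attached at this stage: the nondegenerate ones outside
      \<open>A\<close>.\<close>
    define N where "N = val X n - F n n"
    let ?D = "std_simplex n"
    let ?Y = "copower N (?D \<times>\<^sub>p T)"
    define \<sigma> where "\<sigma> = (\<lambda>k :: nat. \<lambda>(x, \<alpha>, t :: 't). (act X \<alpha> x, t))"
    \<comment> \<open>A nonsurjective \<open>\<alpha>\<close> factors through a lower dimension; a
      surjective one has a section, which would bring \<open>x\<close> itself into
      \<open>F n n\<close>.\<close>
    have onto: "act X \<alpha> x \<notin> F n k \<longleftrightarrow> {..n} \<subseteq> ev \<alpha> ` {..k}" if xN: "x \<in> N" and xs: "\<alpha> \<in> smap k n" for x \<alpha> k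
    proof
      note that = xN xs
      assume notF: "act X \<alpha> x \<notin> F n k"
      show "{..n} \<subseteq> ev \<alpha> ` {..k}"
      proof (rule ccontr)
        assume "\<not> ?thesis"
        then obtain q where "q \<le> n" "\<And>i. i \<le> k \<Longrightarrow> ev \<alpha> i \<noteq> q" by auto
        then obtain m \<beta> \<gamma> where m: "m < n" "\<beta> \<in> smap k m" "\<gamma> \<in> smap m n" "\<alpha> = cmp simplex \<gamma> \<beta>"
          by (rule smap_not_onto[OF xs])
        have "act X \<alpha> x = act X \<beta> (act X \<gamma> x)" "act X \<gamma> x \<in> val X m"
          using that(1) m by (auto simp: N_def presheaf_cmp[OF X] presheaf_act[OF X])
        then show False using notF m unfolding F_def by blast
      qed
    next
      assume "{..n} \<subseteq> ev \<alpha> ` {..k}"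
      then obtain \<delta> where \<delta>: "\<delta> \<in> smap n k" "cmp simplex \<alpha> \<delta> = idn simplex n"
        by (rule smap_section[OF xs _ le0])
      have "act X \<delta> (act X \<alpha> x) = x"
        using presheaf_cmp[OF X, of \<delta> \<alpha> n x] presheaf_idn[OF X, of n x] \<delta> that by (simp add: N_def)
      then show "act X \<alpha> x \<notin> F n k"
        using sub_act[OF subF, of \<delta> k n "act X \<alpha> x" n] \<delta>(1) that(1) by (auto simp: N_def)
    qed
    \<comment> \<open>Eilenberg-Zilber uniqueness: every section of \<open>\<alpha>\<close> is also
      a section of \<open>\<alpha>'\<close>, and sections through each vertex force the two
      surjections to agree.\<close>
    have inj: "x = x' \<and> \<alpha> = \<alpha>'" if x: "x \<in> N" "x' \<in> N" and \<alpha>: "\<alpha> \<in> smap k n" "\<alpha>' \<in> smap k n"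
      and eq: "act X \<alpha> x = act X \<alpha>' x'" and notF: "act X \<alpha> x \<notin> F n k" for x x' \<alpha> \<alpha>' k
    proof -
      have on: "{..n} \<subseteq> ev \<alpha> ` {..k}" using onto[OF x(1) \<alpha>(1)] notF by blast
      have key: "x = x' \<and> cmp simplex \<alpha>' \<delta> = idn simplex n"
        if \<delta>: "\<delta> \<in> smap n k" "cmp simplex \<alpha> \<delta> = idn simplex n" for \<delta>
      proof -
        have "x = act X \<delta> (act X \<alpha> x)"
          using presheaf_cmp[OF X, of \<delta> \<alpha> n x] presheaf_idn[OF X, of n x] \<delta> x \<alpha> by (simp add: N_def)
        also have "\<dots> = act X (cmp simplex \<alpha>' \<delta>) x'"
          unfolding eq using presheaf_cmp[OF X, of \<delta> \<alpha>' n x'] \<delta> x \<alpha> by (simp add: N_def)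
        finally have xx: "x = act X (cmp simplex \<alpha>' \<delta>) x'" .
        have c: "cmp simplex \<alpha>' \<delta> \<in> smap n n" by (rule cmp_smap(1)[OF \<delta>(1) \<alpha>(2)])
        have "{..n} \<subseteq> ev (cmp simplex \<alpha>' \<delta>) ` {..n}"
          using onto[OF x(2) c] x(1) xx by (simp add: N_def)
        then have "cmp simplex \<alpha>' \<delta> = idn simplex n" by (rule smap_onto_idn[OF c])
        then show ?thesis using xx x(2) presheaf_idn[OF X, of n x'] by (simp add: N_def)
      qed
      have "ev \<alpha> i = ev \<alpha>' i" if i: "i \<le> k" for i
      proof -
        obtain \<delta> where \<delta>: "\<delta> \<in> smap n k" "cmp simplex \<alpha> \<delta> = idn simplex n" "ev \<delta> (ev \<alpha> i) = i"
          by (rule smap_section[OF \<alpha>(1) on i])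
        have "ev (cmp simplex \<alpha>' \<delta>) (ev \<alpha> i) = ev \<alpha> i"
          using key[OF \<delta>(1,2)] smap_le[OF \<alpha>(1) i] by simp
        then show ?thesis using cmp_smap(2)[OF \<delta>(1) \<alpha>(2), of "ev \<alpha> i"] smap_le[OF \<alpha>(1) i] \<delta>(3) by simp
      qed
      then have "\<alpha> = \<alpha>'" by (rule smap_ext[OF \<alpha>])
      moreover obtain \<delta> where "\<delta> \<in> smap n k" "cmp simplex \<alpha> \<delta> = idn simplex n"
        by (rule smap_section[OF \<alpha>(1) on le0])
      ultimately show ?thesis using key by blast
    qed
    have nat: "nat_on simplex ?Y (val ?Y) (X \<times>\<^sub>p T) \<sigma>"
    proof (rule nat_onI)
      fix c y assume "y \<in> val ?Y c" then show "\<sigma> c y \<in> val (X \<times>\<^sub>p T) c"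
        using presheaf_act[OF X] by (auto simp: \<sigma>_def N_def)
    next
      fix f y assume "f \<in> Ar simplex" "y \<in> val ?Y (tgt simplex f)"
      then show "\<sigma> (src simplex f) (act ?Y f y) = act (X \<times>\<^sub>p T) f (\<sigma> (tgt simplex f) y)"
        by (auto simp: \<sigma>_def N_def presheaf_cmp[OF X])
    qed
    show ?thesis
    proof (rule RLP_pushout[OF cat subG _ subG nat])
      show "presheaf simplex ?Y" by (intro presheaf_copower presheaf_prod presheaf_simplex T)
      fix c
      show "G (Suc n) c = G n c \<union> \<sigma> c ` val ?Y c"
      proof (intro equalityI subsetI)
        fix z assume z: "z \<in> G (Suc n) c"
        obtain x t where xt: "z = (x, t)" by (cases z)
        have v: "x \<in> val X c" "t \<in> val T c" using z by (auto simp: G_def xt)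
        show "z \<in> G n c \<union> \<sigma> c ` val ?Y c"
        proof (cases "z \<in> G n c")
          case False
          then have "x \<notin> F n c" "x \<in> F (Suc n) c" using z v by (auto simp: G_def xt)
          then obtain \<alpha> y m where y: "x = act X \<alpha> y" "\<alpha> \<in> smap c m" "y \<in> val X m" "m < Suc n"
             "\<not> (m < n)" unfolding F_def by blast
          then have m: "m = n" by simp
          have "y \<notin> F n n"
            using y(1,2) \<open>x \<notin> F n c\<close> sub_act[OF subF, of \<alpha> n c y n] m by auto
          then have "(y, \<alpha>, t) \<in> val ?Y c" "z = \<sigma> c (y, \<alpha>, t)"
            using y(1-3) v m by (auto simp: N_def \<sigma>_def xt)
          then show ?thesis by blast
        qed simp
      next
        fix z assume "z \<in> G n c \<union> \<sigma> c ` val ?Y c"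
        then consider "z \<in> G n c" | x \<alpha> t where "z = (act X \<alpha> x, t)" "x \<in> N" "\<alpha> \<in> smap c n" "t \<in> val T c"
          by (auto simp: \<sigma>_def)
        then show "z \<in> G (Suc n) c"
        proof cases
          case 1
          have "F n c \<subseteq> F (Suc n) c" unfolding F_def using less_SucI by blast
          then show ?thesis using 1 by (cases z) (auto simp: G_def)
        next
          case 2
          then have "act X \<alpha> x \<in> F (Suc n) c" "act X \<alpha> x \<in> val X c"
            using presheaf_act[OF X] unfolding F_def N_def by blast+
          then show ?thesis using 2 by (auto simp: G_def)
        qed
      qed
      fix y y' assume *: "y \<in> val ?Y c" "y' \<in> val ?Y c" "\<sigma> c y = \<sigma> c y'" "\<sigma> c y \<notin> G n c"
      obtain x \<alpha> t x' \<alpha>' t' where "y = (x, \<alpha>, t)" "y' = (x', \<alpha>', t')" by (metis prod_cases3)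
      with * show "y = y'"
        using inj[of x x' \<alpha> c \<alpha>'] presheaf_act[OF X, of \<alpha> n c x]
        by (auto simp: \<sigma>_def G_def N_def)
    next
      show "RLP simplex ?Y (\<lambda>c. {y \<in> val ?Y c. \<sigma> c y \<in> G n c}) E B p"
      proof (rule RLP_cong_sub[OF cat RLP_copower[OF cat cells[of n], of N]])
        fix c
        have eq: "(x, \<alpha>, t) \<in> N \<times> corner ?D (val (boundary n)) T S c \<longleftrightarrow>
            (x, \<alpha>, t) \<in> {y \<in> val ?Y c. \<sigma> c y \<in> G n c}" for x \<alpha> t
          using onto[of x \<alpha> c] presheaf_act[OF X, of \<alpha> n c x]
          by (auto simp: \<sigma>_def G_def boundary_val N_def simp del: not_le)
        have "z \<in> N \<times> corner ?D (val (boundary n)) T S c \<longleftrightarrow> z \<in> {y \<in> val ?Y c. \<sigma> c y \<in> G n c}" for z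
          by (cases z rule: prod_cases3) (simp only: eq)
        then show "N \<times> corner ?D (val (boundary n)) T S c = {y \<in> val ?Y c. \<sigma> c y \<in> G n c}"
          by (rule set_eqI)
      qed
    qed
  qed
  have "RLP simplex (X \<times>\<^sub>p T) (G 0) E B p"
  \<comment> \<open>A \<open>c\<close>-simplex factors through its own identity, so it is present
    from stage \<open>Suc c\<close> on.\<close>
  proof (rule RLP_sequence[where B = G and N = Suc, OF cat step])
    fix n c
    have "F n c \<subseteq> F (Suc n) c" unfolding F_def using less_SucI by blast
    then show "G n c \<subseteq> G (Suc n) c" by (auto simp: G_def corner_def)
    show "G n c \<subseteq> val (X \<times>\<^sub>p T) c" by (auto simp: G_def corner_def)
    have "val X c \<subseteq> F (Suc c) c"
    proof
      fix x assume "x \<in> val X c"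
      then have "x = act X (idn simplex c) x" using presheaf_idn[OF X] by simp
      then show "x \<in> F (Suc c) c" unfolding F_def using idn_smap \<open>x \<in> val X c\<close> by blast
    qed
    then show "val (X \<times>\<^sub>p T) c \<subseteq> G (Suc c) c" by (auto simp: G_def)
  qed (intro presheaf_prod X T)
  moreover have "G 0 = corner X A T S" by (simp add: G_def F_def)
  ultimately show ?thesis by simp
qed

text \<open>The prism \<open>\<Delta>[n] \<times> \<Delta>[1]\<close> is the union of the \<open>(n+1)\<close>-simplices
  \<open>(0,0), \<dots>, (j,0), (j,1), \<dots>, (n,1)\<close>, given by the maps \<open>(prism_fst n j, prism_snd n j)\<close>.\<close>

definition prism_fst :: "nat \<Rightarrow> nat \<Rightarrow> smor" where
  "prism_fst n j = mk (Suc n) n (\<lambda>p. if p \<le> j then p else p - 1)"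

definition prism_snd :: "nat \<Rightarrow> nat \<Rightarrow> smor" where
  "prism_snd n j = mk (Suc n) 1 (\<lambda>p. if p \<le> j then 0 else 1)"

definition prism :: "nat \<Rightarrow> nat \<Rightarrow> smor \<Rightarrow> smor \<times> smor" where
  "prism n j \<beta> = (cmp simplex (prism_fst n j) \<beta>, cmp simplex (prism_snd n j) \<beta>)"

text \<open>The \<open>j\<close>-th simplex of the prism described by inequalities: at height 0 only
  vertices up to \<open>j\<close> occur, at height 1 only those from \<open>j\<close> on. Membership
  can then be tested without producing a factorization.\<close>

definition prism_range :: "nat \<Rightarrow> nat \<Rightarrow> nat \<Rightarrow> (smor \<times> smor) set" where
  "prism_range n j k = {(\<alpha>, t). \<alpha> \<in> smap k n \<and> t \<in> smap k 1 \<and>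
     (\<forall>p\<le>k. (ev t p = 0 \<longrightarrow> ev \<alpha> p \<le> j) \<and> (ev t p = 1 \<longrightarrow> j \<le> ev \<alpha> p))}"

lemma prism_fst_smap: "j \<le> n \<Longrightarrow> prism_fst n j \<in> smap (Suc n) n"
  unfolding prism_fst_def by (rule mk_smap) auto

lemma prism_snd_smap: "prism_snd n j \<in> smap (Suc n) 1"
  unfolding prism_snd_def by (rule mk_smap) auto

lemma prism_smap:
  assumes "j \<le> n" "\<beta> \<in> smap k (Suc n)"
  shows "fst (prism n j \<beta>) \<in> smap k n" "snd (prism n j \<beta>) \<in> smap k 1"
    "i \<le> k \<Longrightarrow> ev (fst (prism n j \<beta>)) i = (if ev \<beta> i \<le> j then ev \<beta> i else ev \<beta> i - 1)"
    "i \<le> k \<Longrightarrow> ev (snd (prism n j \<beta>)) i = (if ev \<beta> i \<le> j then 0 else 1)"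
proof -
  show "fst (prism n j \<beta>) \<in> smap k n" "snd (prism n j \<beta>) \<in> smap k 1"
    unfolding prism_def fst_conv snd_conv
    by (rule cmp_smap(1)[OF assms(2) prism_fst_smap[OF assms(1)]],
        rule cmp_smap(1)[OF assms(2) prism_snd_smap])
  assume "i \<le> k"
  note * = this smap_le[OF assms(2) this]
  show "ev (fst (prism n j \<beta>)) i = (if ev \<beta> i \<le> j then ev \<beta> i else ev \<beta> i - 1)"
    unfolding prism_def fst_conv cmp_smap(2)[OF assms(2) prism_fst_smap[OF assms(1)] *(1)]
    using *(2) by (simp add: prism_fst_def)
  show "ev (snd (prism n j \<beta>)) i = (if ev \<beta> i \<le> j then 0 else 1)"
    unfolding prism_def snd_conv cmp_smap(2)[OF assms(2) prism_snd_smap *(1)]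
    using *(2) by (simp add: prism_snd_def)
qed

lemma prism_act:
  assumes "j \<le> n" "\<beta> \<in> smap k (Suc n)" "f \<in> smap m k"
  shows "prism n j (cmp simplex \<beta> f) =
    (cmp simplex (fst (prism n j \<beta>)) f, cmp simplex (snd (prism n j \<beta>)) f)"
  using assms prism_fst_smap[OF assms(1)] prism_snd_smap[of n j]
  by (simp add: prism_def category_assoc[OF category_simplex])

lemma prism_in_range: "j \<le> n \<Longrightarrow> \<beta> \<in> smap k (Suc n) \<Longrightarrow> prism n j \<beta> \<in> prism_range n j k"
  unfolding prism_range_def using prism_smap[of j n \<beta> k]
  by (auto simp: split_beta)

lemma prism_inj:
  assumes "j \<le> n" "\<beta> \<in> smap k (Suc n)" "\<beta>' \<in> smap k (Suc n)" "prism n j \<beta> = prism n j \<beta>'"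
  shows "\<beta> = \<beta>'"
proof (rule smap_ext[OF assms(2,3)])
  fix i assume i: "i \<le> k"
  have "ev (fst (prism n j \<beta>)) i = ev (fst (prism n j \<beta>')) i"
    "ev (snd (prism n j \<beta>)) i = ev (snd (prism n j \<beta>')) i" using assms(4) by simp_all
  then show "ev \<beta> i = ev \<beta>' i"
    unfolding prism_smap(3)[OF assms(1,2) i] prism_smap(3)[OF assms(1,3) i]
      prism_smap(4)[OF assms(1,2) i] prism_smap(4)[OF assms(1,3) i]
    by (cases "ev \<beta> i \<le> j"; cases "ev \<beta>' i \<le> j"; simp)
qed

lemma smap1_cases: "t \<in> smap k 1 \<Longrightarrow> p \<le> k \<Longrightarrow> ev t p = 0 \<or> ev t p = 1"
  using smap_le[of t k 1 p] by linarith

lemma prism_range_eq: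
  assumes "j \<le> n" shows "prism_range n j k = prism n j ` smap k (Suc n)"
proof (intro equalityI subsetI)
  fix z assume "z \<in> prism_range n j k"
  then obtain \<alpha> t where z: "z = (\<alpha>, t)" and \<alpha>: "\<alpha> \<in> smap k n" and t: "t \<in> smap k 1"
    and r: "\<And>p. p \<le> k \<Longrightarrow> ev t p = 0 \<Longrightarrow> ev \<alpha> p \<le> j" "\<And>p. p \<le> k \<Longrightarrow> ev t p = 1 \<Longrightarrow> j \<le> ev \<alpha> p"
    unfolding prism_range_def by blast
  \<comment> \<open>The inverse adds the coordinates: \<open>(i, 0)\<close> is vertex
    \<open>i\<close> and \<open>(i, 1)\<close> is vertex \<open>i + 1\<close> of the
    \<open>j\<close>-th simplex.\<close>
  define \<beta> where "\<beta> = mk k (Suc n) (\<lambda>p. ev \<alpha> p + ev t p)"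
  have \<beta>: "\<beta> \<in> smap k (Suc n)" unfolding \<beta>_def
  proof (rule mk_smap)
    fix p assume "p \<le> k" then show "ev \<alpha> p + ev t p \<le> Suc n"
      using smap_le[OF \<alpha>, of p] smap_le[OF t, of p] by linarith
  next
    fix p q assume "p \<le> q" "q \<le> k" then show "ev \<alpha> p + ev t p \<le> ev \<alpha> q + ev t q"
      using smap_mono[OF \<alpha>, of p q] smap_mono[OF t, of p q] by linarith
  qed
  have e: "ev \<beta> p = ev \<alpha> p + ev t p" if "p \<le> k" for p using that by (simp add: \<beta>_def)
  have "fst (prism n j \<beta>) = \<alpha>"
  proof (rule smap_ext[OF prism_smap(1)[OF assms \<beta>] \<alpha>])
    fix p assume p: "p \<le> k"
    show "ev (fst (prism n j \<beta>)) p = ev \<alpha> p"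
      unfolding prism_smap(3)[OF assms \<beta> p] e[OF p] using smap1_cases[OF t p] r[OF p] by auto
  qed
  moreover have "snd (prism n j \<beta>) = t"
  proof (rule smap_ext[OF prism_smap(2)[OF assms \<beta>] t])
    fix p assume p: "p \<le> k"
    show "ev (snd (prism n j \<beta>)) p = ev t p"
      unfolding prism_smap(4)[OF assms \<beta> p] e[OF p] using smap1_cases[OF t p] r[OF p] by auto
  qed
  ultimately have "z = prism n j \<beta>" unfolding z by (simp only: prod_eq_iff fst_conv snd_conv)
  then show "z \<in> prism n j ` smap k (Suc n)" using \<beta> by (rule image_eqI)
qed (use prism_in_range[OF assms] in blast)

lemma prism_cover:
  assumes \<alpha>: "\<alpha> \<in> smap k n" and t: "t \<in> smap k 1"
  obtains j where "j \<le> n" "(\<alpha>, t) \<in> prism_range n j k"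
proof (cases "\<exists>p\<le>k. ev t p = 1")
  case False
  then have "(\<alpha>, t) \<in> prism_range n n k"
    unfolding prism_range_def using \<alpha> t smap_le[OF \<alpha>] by auto
  then show ?thesis using that by blast
next
  case True
  \<comment> \<open>The simplex is indexed by the value of \<open>\<alpha>\<close> at the place
    where the height first becomes 1.\<close>
  define q where "q = (LEAST p. p \<le> k \<and> ev t p = 1)"
  have q: "q \<le> k" "ev t q = 1" using LeastI_ex[OF True] by (auto simp: q_def)
  have least: "q \<le> p" if "p \<le> k" "ev t p = 1" for p
    unfolding q_def by (rule Least_le) (use that in simp)
  have "(\<alpha>, t) \<in> prism_range n (ev \<alpha> q) k"
    unfolding prism_range_def
  proof (intro CollectI case_prodI conjI allI impI)
    fix p assume p: "p \<le> k"
    show "ev \<alpha> q \<le> ev \<alpha> p" if "ev t p = 1" using smap_mono[OF \<alpha> least[OF p that] p] .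
    show "ev \<alpha> p \<le> ev \<alpha> q" if "ev t p = 0"
    proof (rule smap_mono[OF \<alpha> _ q(1)], rule ccontr)
      assume "\<not> p \<le> q"
      then show False using smap_mono[OF t, of q p] p q(2) that by simp
    qed
  qed (use \<alpha> t in auto)
  then show ?thesis using that smap_le[OF \<alpha> q(1)] by blast
qed

text \<open>Filtration of the prism relative to its end 0: starting from the cylinder base
  (\<open>j = Suc n\<close>), the simplices are added from index \<open>n\<close> down to 0.
  \<open>F\<close> is the boundary of the simplex in \<open>RLP_cyl\<close> and empty in
  \<open>box_prism\<close>.\<close>

definition prism_upper :: "nat \<Rightarrow> (nat \<Rightarrow> smor set) \<Rightarrow> nat \<Rightarrow> nat \<Rightarrow> (smor \<times> smor) set" where
  "prism_upper n F j k = {(\<alpha>, t). \<alpha> \<in> smap k n \<and> t \<in> smap k 1 \<and>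
     (t = const_mor k 1 0 \<or> \<alpha> \<in> F k \<or> (\<exists>i\<ge>j. i \<le> n \<and> (\<alpha>, t) \<in> prism_range n i k))}"

text \<open>The mirror filtration for the end 1. Here the simplices are added from index 0 upwards,
  since the simplex with index 0 is the one that contains the end 1 as a face.\<close>

definition prism_lower :: "nat \<Rightarrow> (nat \<Rightarrow> smor set) \<Rightarrow> nat \<Rightarrow> nat \<Rightarrow> (smor \<times> smor) set" where
  "prism_lower n F j k = {(\<alpha>, t). \<alpha> \<in> smap k n \<and> t \<in> smap k 1 \<and>
     (t = const_mor k 1 1 \<or> \<alpha> \<in> F k \<or> (\<exists>i<j. (\<alpha>, t) \<in> prism_range n i k))}"

lemma prism_upper_iff:
  "(\<alpha>, t) \<in> prism_upper n F j k \<longleftrightarrow> \<alpha> \<in> smap k n \<and> t \<in> smap k 1 \<and>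
     (t = const_mor k 1 0 \<or> \<alpha> \<in> F k \<or> (\<exists>i\<ge>j. i \<le> n \<and> (\<alpha>, t) \<in> prism_range n i k))"
  by (simp add: prism_upper_def)

lemma prism_lower_iff:
  "(\<alpha>, t) \<in> prism_lower n F j k \<longleftrightarrow> \<alpha> \<in> smap k n \<and> t \<in> smap k 1 \<and>
     (t = const_mor k 1 1 \<or> \<alpha> \<in> F k \<or> (\<exists>i<j. (\<alpha>, t) \<in> prism_range n i k))"
  by (simp add: prism_lower_def)

lemma smap_const:
  assumes "t \<in> smap k n" "\<And>p. p \<le> k \<Longrightarrow> ev t p = i" "i \<le> n" shows "t = const_mor k n i"
  by (rule smap_ext[OF assms(1) const_mor_smap[OF assms(3)]]) (use assms(2) in simp)

text \<open>What is already present of the \<open>j\<close>-th simplex: the part over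
  \<open>F\<close>, and the face opposite to vertex \<open>Suc j\<close>. This face is shared with
  the next simplex, or lies in the end 0 when \<open>j = n\<close>.\<close>

lemma prism_upper_preimage:
  assumes "j \<le> n" "\<beta> \<in> smap k (Suc n)"
  shows "prism n j \<beta> \<in> prism_upper n F (Suc j) k \<longleftrightarrow>
    fst (prism n j \<beta>) \<in> F k \<or> (\<forall>p\<le>k. ev \<beta> p \<noteq> Suc j)"
proof -
  note P = prism_smap[OF assms]
  have "fst (prism n j \<beta>) \<in> F k \<or> (\<forall>p\<le>k. ev \<beta> p \<noteq> Suc j)" if *: "prism n j \<beta> \<in> prism_upper n F (Suc j) k"
  proof -
    consider "snd (prism n j \<beta>) = const_mor k 1 0" | "fst (prism n j \<beta>) \<in> F k"
      | i where "Suc j \<le> i" "prism n j \<beta> \<in> prism_range n i k"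
      using * unfolding prism_upper_def by fastforce
    then show ?thesis
    proof cases
      case 1
      have "ev \<beta> p \<noteq> Suc j" if "p \<le> k" for p
      proof -
        have "(if ev \<beta> p \<le> j then 0 else 1 :: nat) = 0"
          unfolding P(4)[OF that, symmetric] 1 by (rule ev_const_mor[OF that])
        then show ?thesis by (cases "ev \<beta> p \<le> j") auto
      qed
      then show ?thesis by blast
    next
      case 3
      have "ev \<beta> p \<noteq> Suc j" if p: "p \<le> k" for p
      proof
        assume "ev \<beta> p = Suc j"
        then have "ev (snd (prism n j \<beta>)) p = 1" "ev (fst (prism n j \<beta>)) p = j" using P(3,4)[OF p] by auto
        then show False using 3 p unfolding prism_range_def by (auto simp: split_beta)
      qed
      then show ?thesis by blast
    qed blast
  qed
  moreover have "prism n j \<beta> \<in> prism_upper n F (Suc j) k"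
    if *: "\<And>p. p \<le> k \<Longrightarrow> ev \<beta> p \<noteq> Suc j"
  proof (cases "j = n")
    case True
    have "ev (snd (prism n j \<beta>)) p = 0" if "p \<le> k" for p
      using P(4)[OF that] *[OF that] smap_le[OF assms(2) that] True by auto
    then have "snd (prism n j \<beta>) = const_mor k 1 0" by (intro smap_const[OF P(2)]) auto
    then show ?thesis unfolding prism_upper_def using P(1,2) by (auto simp: split_beta)
  next
    case False
    have "prism n j \<beta> \<in> prism_range n (Suc j) k"
      unfolding prism_range_def
    proof (rule CollectI, unfold split_beta, intro conjI allI impI)
      fix p assume p: "p \<le> k"
      show "ev (fst (prism n j \<beta>)) p \<le> Suc j" if "ev (snd (prism n j \<beta>)) p = 0"
        using that unfolding P(3,4)[OF p] by (auto split: if_splits)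
      show "Suc j \<le> ev (fst (prism n j \<beta>)) p" if "ev (snd (prism n j \<beta>)) p = 1"
        using that *[OF p] unfolding P(3,4)[OF p] by (auto split: if_splits)
    qed (use P(1,2) in auto)
    then show ?thesis unfolding prism_upper_def using P(1,2) False assms(1)
      by (auto simp: split_beta intro!: exI[of _ "Suc j"])
  qed
  moreover have "prism n j \<beta> \<in> prism_upper n F (Suc j) k" if "fst (prism n j \<beta>) \<in> F k"
    unfolding prism_upper_def using P(1,2) that by (auto simp: split_beta)
  ultimately show ?thesis by blast
qed

text \<open>Mirror image: the shared face is opposite to vertex \<open>j\<close> and comes from the
  previous simplex, or from the end 1 when \<open>j = 0\<close>.\<close>

lemma prism_lower_preimage:
  assumes "j \<le> n" "\<beta> \<in> smap k (Suc n)"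
  shows "prism n j \<beta> \<in> prism_lower n F j k \<longleftrightarrow>
    fst (prism n j \<beta>) \<in> F k \<or> (\<forall>p\<le>k. ev \<beta> p \<noteq> j)"
proof -
  note P = prism_smap[OF assms]
  have "fst (prism n j \<beta>) \<in> F k \<or> (\<forall>p\<le>k. ev \<beta> p \<noteq> j)" if *: "prism n j \<beta> \<in> prism_lower n F j k"
  proof -
    consider "snd (prism n j \<beta>) = const_mor k 1 1" | "fst (prism n j \<beta>) \<in> F k"
      | i where "i < j" "prism n j \<beta> \<in> prism_range n i k"
      using * unfolding prism_lower_def by fastforce
    then show ?thesis
    proof cases
      case 1
      have "ev \<beta> p \<noteq> j" if "p \<le> k" for p
      proof -
        have "(if ev \<beta> p \<le> j then 0 else 1 :: nat) = 1"
          unfolding P(4)[OF that, symmetric] 1 by (rule ev_const_mor[OF that])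
        then show ?thesis by (cases "ev \<beta> p \<le> j") auto
      qed
      then show ?thesis by blast
    next
      case 3
      have "ev \<beta> p \<noteq> j" if p: "p \<le> k" for p
      proof
        assume "ev \<beta> p = j"
        then have "ev (snd (prism n j \<beta>)) p = 0" "ev (fst (prism n j \<beta>)) p = j" using P(3,4)[OF p] by auto
        then show False using 3 p unfolding prism_range_def by (auto simp: split_beta)
      qed
      then show ?thesis by blast
    qed blast
  qed
  moreover have "prism n j \<beta> \<in> prism_lower n F j k"
    if *: "\<And>p. p \<le> k \<Longrightarrow> ev \<beta> p \<noteq> j"
  proof (cases "j = 0")
    case True
    have "ev (snd (prism n j \<beta>)) p = 1" if "p \<le> k" for p
      using P(4)[OF that] *[OF that] True by auto
    then have "snd (prism n j \<beta>) = const_mor k 1 1" by (intro smap_const[OF P(2)]) auto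
    then show ?thesis unfolding prism_lower_def using P(1,2) by (auto simp: split_beta)
  next
    case False
    have "prism n j \<beta> \<in> prism_range n (j - 1) k"
      unfolding prism_range_def
    proof (rule CollectI, unfold split_beta, intro conjI allI impI)
      fix p assume p: "p \<le> k"
      show "ev (fst (prism n j \<beta>)) p \<le> j - 1" if "ev (snd (prism n j \<beta>)) p = 0"
        using that *[OF p] unfolding P(3,4)[OF p] by (auto split: if_splits)
      show "j - 1 \<le> ev (fst (prism n j \<beta>)) p" if "ev (snd (prism n j \<beta>)) p = 1"
        using that unfolding P(3,4)[OF p] by (auto split: if_splits)
    qed (use P(1,2) in auto)
    then show ?thesis unfolding prism_lower_def using P(1,2) False
      by (auto simp: split_beta intro!: exI[of _ "j - 1"])
  qed
  moreover have "prism n j \<beta> \<in> prism_lower n F j k" if "fst (prism n j \<beta>) \<in> F k"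
    unfolding prism_lower_def using P(1,2) that by (auto simp: split_beta)
  ultimately show ?thesis by blast
qed

lemma prism_range_act:
  assumes "(\<alpha>, t) \<in> prism_range n j k" "f \<in> smap m k"
  shows "(cmp simplex \<alpha> f, cmp simplex t f) \<in> prism_range n j m"
proof -
  have a: "\<alpha> \<in> smap k n" "t \<in> smap k 1" using assms(1) unfolding prism_range_def by auto
  show ?thesis
    unfolding prism_range_def using assms cmp_smap(1)[OF assms(2) a(1)] cmp_smap(1)[OF assms(2) a(2)]
      cmp_smap(2)[OF assms(2) a(1)] cmp_smap(2)[OF assms(2) a(2)] smap_le[OF assms(2)]
    by (auto simp: prism_range_def)
qed

lemma const_mor_act:
  assumes "f \<in> smap m k" "i \<le> n" shows "cmp simplex (const_mor k n i) f = const_mor m n i"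
  by (rule smap_const[OF cmp_smap(1)[OF assms(1) const_mor_smap[OF assms(2)]] _ assms(2)])
    (simp add: cmp_smap(2)[OF assms(1) const_mor_smap[OF assms(2)]] smap_le[OF assms(1)])

lemma prism_upper_act:
  assumes "sub simplex (std_simplex n) F" "(\<alpha>, t) \<in> prism_upper n F j k" "f \<in> smap m k"
  shows "(cmp simplex \<alpha> f, cmp simplex t f) \<in> prism_upper n F j m"
proof -
  have a: "\<alpha> \<in> smap k n" "t \<in> smap k 1" using assms(2) unfolding prism_upper_def by blast+
  have F: "cmp simplex \<alpha> f \<in> F m" if "\<alpha> \<in> F k"
    using sub_act[OF assms(1), of f k m \<alpha>] that assms(3) by simp
  note c = cmp_smap(1)[OF assms(3) a(1)] cmp_smap(1)[OF assms(3) a(2)]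
  consider "t = const_mor k 1 0" | "\<alpha> \<in> F k" | i where "j \<le> i" "i \<le> n" "(\<alpha>, t) \<in> prism_range n i k"
    using assms(2) unfolding prism_upper_iff by blast
  then show ?thesis
  proof cases
    case 1
    have "cmp simplex t f = const_mor m 1 0" unfolding 1 by (rule const_mor_act[OF assms(3)]) simp
    then show ?thesis unfolding prism_upper_iff using c by blast
  next
    case 2 then show ?thesis unfolding prism_upper_iff using c F by blast
  next
    case 3
    note p = prism_range_act[OF \<open>(\<alpha>, t) \<in> prism_range n i k\<close> assms(3)]
    show ?thesis unfolding prism_upper_iff using c 3 p by blast
  qed
qed

lemma prism_lower_act:
  assumes "sub simplex (std_simplex n) F" "(\<alpha>, t) \<in> prism_lower n F j k" "f \<in> smap m k"
  shows "(cmp simplex \<alpha> f, cmp simplex t f) \<in> prism_lower n F j m"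
proof -
  have a: "\<alpha> \<in> smap k n" "t \<in> smap k 1" using assms(2) unfolding prism_lower_def by blast+
  have F: "cmp simplex \<alpha> f \<in> F m" if "\<alpha> \<in> F k"
    using sub_act[OF assms(1), of f k m \<alpha>] that assms(3) by simp
  note c = cmp_smap(1)[OF assms(3) a(1)] cmp_smap(1)[OF assms(3) a(2)]
  consider "t = const_mor k 1 1" | "\<alpha> \<in> F k" | i where "i < j" "(\<alpha>, t) \<in> prism_range n i k"
    using assms(2) unfolding prism_lower_iff by blast
  then show ?thesis
  proof cases
    case 1
    have "cmp simplex t f = const_mor m 1 1" unfolding 1 by (rule const_mor_act[OF assms(3)]) simp
    then show ?thesis unfolding prism_lower_iff using c by blast
  next
    case 2 then show ?thesis unfolding prism_lower_iff using c F by blast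
  next
    case 3
    note p = prism_range_act[OF \<open>(\<alpha>, t) \<in> prism_range n i k\<close> assms(3)]
    show ?thesis unfolding prism_lower_iff using c 3 p by blast
  qed
qed

lemma prism_upper_step:
  assumes "j \<le> n" shows "prism_upper n F j k = prism_upper n F (Suc j) k \<union> prism n j ` smap k (Suc n)"
proof (rule set_eqI, clarify)
  fix \<alpha> t
  have "(\<exists>i\<ge>j. i \<le> n \<and> (\<alpha>, t) \<in> prism_range n i k) \<longleftrightarrow>
    (\<exists>i\<ge>Suc j. i \<le> n \<and> (\<alpha>, t) \<in> prism_range n i k) \<or> (\<alpha>, t) \<in> prism_range n j k"
    using assms by (metis Suc_leD Suc_leI le_eq_less_or_eq)
  moreover have "(\<alpha>, t) \<in> prism_range n j k \<Longrightarrow> \<alpha> \<in> smap k n \<and> t \<in> smap k 1"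
    by (simp add: prism_range_def)
  ultimately show "(\<alpha>, t) \<in> prism_upper n F j k \<longleftrightarrow>
      (\<alpha>, t) \<in> prism_upper n F (Suc j) k \<union> prism n j ` smap k (Suc n)"
    unfolding prism_range_eq[OF assms, symmetric] Un_iff prism_upper_iff by blast
qed

lemma prism_lower_step:
  assumes "j \<le> n" shows "prism_lower n F (Suc j) k = prism_lower n F j k \<union> prism n j ` smap k (Suc n)"
  unfolding prism_range_eq[OF assms, symmetric] prism_lower_def less_Suc_eq
  by (auto simp: prism_range_def)

lemma prism_upper_0: "prism_upper n F 0 k = smap k n \<times> smap k 1"
proof (intro equalityI subsetI)
  fix z assume "z \<in> smap k n \<times> smap k 1"
  then obtain \<alpha> t where z: "z = (\<alpha>, t)" "\<alpha> \<in> smap k n" "t \<in> smap k 1" by blast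
  obtain j where "j \<le> n" "(\<alpha>, t) \<in> prism_range n j k" by (rule prism_cover[OF z(2,3)])
  with le0 show "z \<in> prism_upper n F 0 k" unfolding z(1) prism_upper_iff using z(2,3) by blast
qed (unfold prism_upper_def, blast)

lemma prism_lower_Suc: "prism_lower n F (Suc n) k = smap k n \<times> smap k 1"
proof (intro equalityI subsetI)
  fix z assume "z \<in> smap k n \<times> smap k 1"
  then obtain \<alpha> t where z: "z = (\<alpha>, t)" "\<alpha> \<in> smap k n" "t \<in> smap k 1" by blast
  obtain j where j: "j \<le> n" "(\<alpha>, t) \<in> prism_range n j k" by (rule prism_cover[OF z(2,3)])
  have "j < Suc n" using j(1) by simp
  with j(2) show "z \<in> prism_lower n F (Suc n) k" unfolding z(1) prism_lower_iff using z(2,3) by blast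
qed (unfold prism_lower_def, blast)

lemma prism_upper_Suc: "prism_upper n F (Suc n) k = cyl (std_simplex n) F (std_simplex 1) (\<lambda>k. const_mor k 1 0) k"
  unfolding prism_upper_def by auto

lemma prism_lower_0: "prism_lower n F 0 k = cyl (std_simplex n) F (std_simplex 1) (\<lambda>k. const_mor k 1 1) k"
  unfolding prism_lower_def by auto

lemma nat_prism:
  assumes "j \<le> n"
  shows "nat_on simplex (std_simplex (Suc n)) (val (std_simplex (Suc n)))
    (std_simplex n \<times>\<^sub>p std_simplex 1) (\<lambda>k. prism n j)"
proof (rule nat_onI)
  fix c x assume "x \<in> val (std_simplex (Suc n)) c"
  then show "prism n j x \<in> val (std_simplex n \<times>\<^sub>p std_simplex 1) c"
    using prism_smap(1,2)[OF assms, of x c] by (cases "prism n j x") simp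
next
  fix f x assume f: "f \<in> Ar simplex" "x \<in> val (std_simplex (Suc n)) (tgt simplex f)"
  then have "x \<in> smap (tgt simplex f) (Suc n)" by simp
  from prism_act[OF assms this smap_Ar[OF f(1)]]
  show "prism n j (act (std_simplex (Suc n)) f x) = act (std_simplex n \<times>\<^sub>p std_simplex 1) f (prism n j x)"
    by (cases "prism n j x") simp
qed

lemma sub_prism_upper:
  assumes F: "sub simplex (std_simplex n) F"
  shows "sub simplex (std_simplex n \<times>\<^sub>p std_simplex 1) (prism_upper n F j)"
  unfolding sub_def
proof (intro conjI ballI subsetI)
  fix c z assume "z \<in> prism_upper n F j c" then show "z \<in> val (std_simplex n \<times>\<^sub>p std_simplex 1) c"
    unfolding prism_upper_def by auto
next
  fix f z assume f: "f \<in> Ar simplex" "z \<in> prism_upper n F j (tgt simplex f)"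
  obtain \<alpha> t where z: "z = (\<alpha>, t)" by (cases z)
  show "act (std_simplex n \<times>\<^sub>p std_simplex 1) f z \<in> prism_upper n F j (src simplex f)"
    using prism_upper_act[OF F f(2)[unfolded z] smap_Ar[OF f(1)]] by (simp add: z)
qed

lemma RLP_prism_upper:
  assumes F: "sub simplex (std_simplex n) F"
    and rlp: "\<And>j. j \<le> n \<Longrightarrow> RLP simplex (std_simplex (Suc n))
      (\<lambda>k. {\<beta> \<in> smap k (Suc n). fst (prism n j \<beta>) \<in> F k \<or> (\<forall>p\<le>k. ev \<beta> p \<noteq> Suc j)}) E B p"
  shows "RLP simplex (std_simplex n \<times>\<^sub>p std_simplex 1)
    (cyl (std_simplex n) F (std_simplex 1) (\<lambda>k. const_mor k 1 0)) E B p"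
proof -
  let ?Z = "std_simplex n \<times>\<^sub>p std_simplex 1"
  note sub = sub_prism_upper[OF F]
  have step: "RLP simplex (restr ?Z (prism_upper n F j)) (prism_upper n F (Suc j)) E B p" if j: "j \<le> n" for j
  proof (rule RLP_pushout[OF category_simplex sub presheaf_simplex sub nat_prism[OF j]])
    fix c
    show "prism_upper n F j c = prism_upper n F (Suc j) c \<union> prism n j ` val (std_simplex (Suc n)) c"
      using prism_upper_step[OF j] by simp
    fix y y' assume "y \<in> val (std_simplex (Suc n)) c" "y' \<in> val (std_simplex (Suc n)) c"
       "prism n j y = prism n j y'"
    then show "y = y'" using prism_inj[OF j, of y c y'] by simp
  next
    show "RLP simplex (std_simplex (Suc n))
        (\<lambda>c. {y \<in> val (std_simplex (Suc n)) c. prism n j y \<in> prism_upper n F (Suc j) c}) E B p"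
      by (rule RLP_cong_sub[OF category_simplex rlp[OF j]]) (use prism_upper_preimage[OF j] in auto)
  qed
  have "RLP simplex ?Z (prism_upper n F j) E B p" if "j \<le> Suc n" for j
    using that
  proof (induction j)
    case 0
    have "prism_upper n F 0 = val ?Z" using prism_upper_0[of n F] by auto
    then show ?case using RLP_refl[of simplex ?Z "val ?Z" E B p] by (simp only: restr_val)
  next
    case (Suc j)
    then have j: "j \<le> n" by simp
    have "prism_upper n F (Suc j) c \<subseteq> prism_upper n F j c" for c
      unfolding prism_upper_step[OF j] by blast
    moreover have "prism_upper n F j c \<subseteq> val ?Z c" for c using sub[of j] unfolding sub_def by simp
    moreover have "RLP simplex ?Z (prism_upper n F j) E B p" using Suc by simp
    ultimately show ?case by (intro RLP_trans[OF category_simplex step[OF j]])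
  qed
  from this[of "Suc n"] show ?thesis by (rule RLP_cong_sub[OF category_simplex]) (simp_all only: prism_upper_Suc)
qed

lemma sub_prism_lower:
  assumes F: "sub simplex (std_simplex n) F"
  shows "sub simplex (std_simplex n \<times>\<^sub>p std_simplex 1) (prism_lower n F j)"
  unfolding sub_def
proof (intro conjI ballI subsetI)
  fix c z assume "z \<in> prism_lower n F j c" then show "z \<in> val (std_simplex n \<times>\<^sub>p std_simplex 1) c"
    unfolding prism_lower_def by auto
next
  fix f z assume f: "f \<in> Ar simplex" "z \<in> prism_lower n F j (tgt simplex f)"
  obtain \<alpha> t where z: "z = (\<alpha>, t)" by (cases z)
  show "act (std_simplex n \<times>\<^sub>p std_simplex 1) f z \<in> prism_lower n F j (src simplex f)"
    using prism_lower_act[OF F f(2)[unfolded z] smap_Ar[OF f(1)]] by (simp add: z)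
qed

lemma RLP_prism_lower:
  assumes F: "sub simplex (std_simplex n) F"
    and rlp: "\<And>j. j \<le> n \<Longrightarrow> RLP simplex (std_simplex (Suc n))
      (\<lambda>k. {\<beta> \<in> smap k (Suc n). fst (prism n j \<beta>) \<in> F k \<or> (\<forall>p\<le>k. ev \<beta> p \<noteq> j)}) E B p"
  shows "RLP simplex (std_simplex n \<times>\<^sub>p std_simplex 1)
    (cyl (std_simplex n) F (std_simplex 1) (\<lambda>k. const_mor k 1 1)) E B p"
proof -
  let ?Z = "std_simplex n \<times>\<^sub>p std_simplex 1"
  note sub = sub_prism_lower[OF F]
  have attach: "RLP simplex (restr ?Z (prism_lower n F (Suc j))) (prism_lower n F j) E B p" if j: "j \<le> n" for j
  proof (rule RLP_pushout[OF category_simplex sub presheaf_simplex sub nat_prism[OF j]])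
    fix c
    show "prism_lower n F (Suc j) c = prism_lower n F j c \<union> prism n j ` val (std_simplex (Suc n)) c"
      using prism_lower_step[OF j] by simp
    fix y y' assume "y \<in> val (std_simplex (Suc n)) c" "y' \<in> val (std_simplex (Suc n)) c"
       "prism n j y = prism n j y'"
    then show "y = y'" using prism_inj[OF j, of y c y'] by simp
  next
    show "RLP simplex (std_simplex (Suc n))
        (\<lambda>c. {y \<in> val (std_simplex (Suc n)) c. prism n j y \<in> prism_lower n F j c}) E B p"
      by (rule RLP_cong_sub[OF category_simplex rlp[OF j]]) (use prism_lower_preimage[OF j] in auto)
  qed
  have "RLP simplex ?Z (prism_lower n F j) E B p" if "j \<le> Suc n" for j
    using that
  proof (induction rule: inc_induct)
    case base
    have "prism_lower n F (Suc n) = val ?Z" using prism_lower_Suc[of n F] by auto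
    then show ?case using RLP_refl[of simplex ?Z "val ?Z" E B p] by (simp only: restr_val)
  next
    case (step j)
    then have j: "j \<le> n" by simp
    have "prism_lower n F j c \<subseteq> prism_lower n F (Suc j) c" for c
      unfolding prism_lower_step[OF j] by blast
    moreover have "prism_lower n F (Suc j) c \<subseteq> val ?Z c" for c
      using sub[of "Suc j"] unfolding sub_def by simp
    ultimately show ?case using step.IH by (intro RLP_trans[OF category_simplex attach[OF j]])
  qed
  from this[OF le0] show ?thesis by (rule RLP_cong_sub[OF category_simplex]) (simp only: prism_lower_0)
qed

text \<open>For \<open>F\<close> the boundary the attachments are horn inclusions. The projection
  identifies the vertices \<open>j\<close> and \<open>Suc j\<close>, so it misses \<open>j\<close>
  only if \<open>\<beta>\<close> misses both, and it misses another vertex exactly when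
  \<open>\<beta>\<close> misses the corresponding one.\<close>

lemma horn_prism:
  assumes "j \<le> n" "\<beta> \<in> smap k (Suc n)"
  shows "\<beta> \<in> val (horn (Suc n) j) k \<longleftrightarrow> fst (prism n j \<beta>) \<in> val (boundary n) k \<or> (\<forall>p\<le>k. ev \<beta> p \<noteq> Suc j)"
    and "\<beta> \<in> val (horn (Suc n) (Suc j)) k \<longleftrightarrow> fst (prism n j \<beta>) \<in> val (boundary n) k \<or> (\<forall>p\<le>k. ev \<beta> p \<noteq> j)"
proof -
  note P = prism_smap[OF assms]
  have b: "fst (prism n j \<beta>) \<in> val (boundary n) k \<longleftrightarrow> (\<exists>q\<le>n. \<forall>p\<le>k. ev \<beta> p \<noteq> (if q \<le> j then q else Suc q) \<and>
      (q = j \<longrightarrow> ev \<beta> p \<noteq> Suc j))" (is "_ \<longleftrightarrow> ?R")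
  proof -
    have "fst (prism n j \<beta>) \<in> val (boundary n) k \<longleftrightarrow> (\<exists>q\<le>n. \<forall>p\<le>k. ev (fst (prism n j \<beta>)) p \<noteq> q)"
      unfolding boundary_val using P(1) by auto
    also have "\<dots> \<longleftrightarrow> ?R"
    proof (intro ex_cong1 conj_cong refl all_cong1 imp_cong)
      fix q p assume "p \<le> k"
      show "ev (fst (prism n j \<beta>)) p \<noteq> q \<longleftrightarrow> ev \<beta> p \<noteq> (if q \<le> j then q else Suc q) \<and> (q = j \<longrightarrow> ev \<beta> p \<noteq> Suc j)"
        unfolding P(3)[OF \<open>p \<le> k\<close>] by auto
    qed
    finally show ?thesis .
  qed
  have h: "\<beta> \<in> val (horn (Suc n) i) k \<longleftrightarrow> (\<exists>q\<le>Suc n. q \<noteq> i \<and> (\<forall>p\<le>k. ev \<beta> p \<noteq> q))" for i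
    unfolding horn_val using assms(2) by auto
  have 1: "\<exists>q\<le>n. \<forall>p\<le>k. ev \<beta> p \<noteq> (if q \<le> j then q else Suc q) \<and> (q = j \<longrightarrow> ev \<beta> p \<noteq> Suc j)"
    if q: "q \<le> Suc n" "q \<noteq> j" "q \<noteq> Suc j" "\<And>p. p \<le> k \<Longrightarrow> ev \<beta> p \<noteq> q" for q
  proof (cases "q < j")
    case True then show ?thesis using q assms(1) by (intro exI[of _ q]) auto
  next
    case False then show ?thesis using q by (intro exI[of _ "q - 1"]) auto
  qed
  have 2: "\<exists>q'\<le>Suc n. q' \<noteq> j \<and> (\<forall>p\<le>k. ev \<beta> p \<noteq> q')" "\<exists>q'\<le>Suc n. q' \<noteq> Suc j \<and> (\<forall>p\<le>k. ev \<beta> p \<noteq> q')"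
    if q: "q \<le> n" "\<And>p. p \<le> k \<Longrightarrow> ev \<beta> p \<noteq> (if q \<le> j then q else Suc q) \<and> (q = j \<longrightarrow> ev \<beta> p \<noteq> Suc j)" for q
  proof -
    consider "q < j" | "q = j" | "j < q" by linarith
    then show "\<exists>q'\<le>Suc n. q' \<noteq> j \<and> (\<forall>p\<le>k. ev \<beta> p \<noteq> q')"
    proof cases
      case 1 then show ?thesis using q by (intro exI[of _ q]) auto
    next
      case 2 then show ?thesis using q by (intro exI[of _ "Suc j"]) auto
    next
      case 3 then show ?thesis using q by (intro exI[of _ "Suc q"]) auto
    qed
    consider "q \<le> j" | "j < q" by linarith
    then show "\<exists>q'\<le>Suc n. q' \<noteq> Suc j \<and> (\<forall>p\<le>k. ev \<beta> p \<noteq> q')"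
    proof cases
      case 1 then show ?thesis using q by (intro exI[of _ q]) auto
    next
      case 2 then show ?thesis using q by (intro exI[of _ "Suc q"]) auto
    qed
  qed
  show "\<beta> \<in> val (horn (Suc n) j) k \<longleftrightarrow> fst (prism n j \<beta>) \<in> val (boundary n) k \<or> (\<forall>p\<le>k. ev \<beta> p \<noteq> Suc j)"
  proof
    assume "\<beta> \<in> val (horn (Suc n) j) k"
    then obtain q where "q \<le> Suc n" "q \<noteq> j" "\<And>p. p \<le> k \<Longrightarrow> ev \<beta> p \<noteq> q" unfolding h by blast
    then show "fst (prism n j \<beta>) \<in> val (boundary n) k \<or> (\<forall>p\<le>k. ev \<beta> p \<noteq> Suc j)"
      unfolding b using 1[of q] by (cases "q = Suc j") simp_all
  next
    assume "fst (prism n j \<beta>) \<in> val (boundary n) k \<or> (\<forall>p\<le>k. ev \<beta> p \<noteq> Suc j)"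
    then show "\<beta> \<in> val (horn (Suc n) j) k"
    proof
      assume "fst (prism n j \<beta>) \<in> val (boundary n) k"
      then show ?thesis unfolding b h using 2(1) by blast
    next
      assume "\<forall>p\<le>k. ev \<beta> p \<noteq> Suc j"
      then show ?thesis unfolding h using assms(1) by (intro exI[of _ "Suc j"]) simp
    qed
  qed
  show "\<beta> \<in> val (horn (Suc n) (Suc j)) k \<longleftrightarrow> fst (prism n j \<beta>) \<in> val (boundary n) k \<or> (\<forall>p\<le>k. ev \<beta> p \<noteq> j)"
  proof
    assume "\<beta> \<in> val (horn (Suc n) (Suc j)) k"
    then obtain q where "q \<le> Suc n" "q \<noteq> Suc j" "\<And>p. p \<le> k \<Longrightarrow> ev \<beta> p \<noteq> q" unfolding h by blast
    then show "fst (prism n j \<beta>) \<in> val (boundary n) k \<or> (\<forall>p\<le>k. ev \<beta> p \<noteq> j)"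
      unfolding b using 1[of q] by (cases "q = j") simp_all
  next
    assume "fst (prism n j \<beta>) \<in> val (boundary n) k \<or> (\<forall>p\<le>k. ev \<beta> p \<noteq> j)"
    then show "\<beta> \<in> val (horn (Suc n) (Suc j)) k"
    proof
      assume "fst (prism n j \<beta>) \<in> val (boundary n) k"
      then show ?thesis unfolding b h using 2(2) by blast
    next
      assume "\<forall>p\<le>k. ev \<beta> p \<noteq> j"
      then show ?thesis unfolding h using assms(1) by (intro exI[of _ "j"]) simp
    qed
  qed
qed

text \<open>Cylinder inclusions are anodyne: skeletal induction reduces to a simplex and its
  boundary, where the prism filtration attaches simplices along horns. Both ends are covered, since
  horns of every index may be filled.\<close>

theorem RLP_cyl:
  assumes X: "presheaf simplex X" and A: "sub simplex X A" and \<epsilon>: "\<epsilon> = 0 \<or> \<epsilon> = 1"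
    and horns: "\<And>n k. 1 \<le> n \<Longrightarrow> k \<le> n \<Longrightarrow> RLP simplex (std_simplex n) (val (horn n k)) E B p"
  shows "RLP simplex (X \<times>\<^sub>p std_simplex 1) (cyl X A (std_simplex 1) (\<lambda>k. const_mor k 1 \<epsilon>)) E B p"
proof -
  have pt: "sub simplex (std_simplex 1) (\<lambda>k. {const_mor k 1 \<epsilon>})"
    unfolding sub_def using \<epsilon> const_mor_smap[of \<epsilon> 1] const_mor_act[OF smap_Ar, of _ \<epsilon> 1] by auto
  show ?thesis
  proof (rule RLP_skeletal[OF X A presheaf_simplex pt])
    fix n
    have 0: "RLP simplex (std_simplex (Suc n))
      (\<lambda>k. {\<beta> \<in> smap k (Suc n). fst (prism n j \<beta>) \<in> val (boundary n) k \<or> (\<forall>p\<le>k. ev \<beta> p \<noteq> Suc j)}) E B p"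
      if "j \<le> n" for j
    proof (rule RLP_cong_sub[OF category_simplex horns[of "Suc n" "j"]])
      fix c
      have "val (horn (Suc n) j) c \<subseteq> smap c (Suc n)" unfolding horn_val by blast
      then show "val (horn (Suc n) j) c = {\<beta> \<in> smap c (Suc n).
          fst (prism n j \<beta>) \<in> val (boundary n) c \<or> (\<forall>p\<le>c. ev \<beta> p \<noteq> Suc j)}"
        using horn_prism(1)[OF that, of _ c] by blast
    qed (use that in simp_all)
    have 1: "RLP simplex (std_simplex (Suc n))
      (\<lambda>k. {\<beta> \<in> smap k (Suc n). fst (prism n j \<beta>) \<in> val (boundary n) k \<or> (\<forall>p\<le>k. ev \<beta> p \<noteq> j)}) E B p"
      if "j \<le> n" for j
    proof (rule RLP_cong_sub[OF category_simplex horns[of "Suc n" "Suc j"]])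
      fix c
      have "val (horn (Suc n) (Suc j)) c \<subseteq> smap c (Suc n)" unfolding horn_val by blast
      then show "val (horn (Suc n) (Suc j)) c = {\<beta> \<in> smap c (Suc n).
          fst (prism n j \<beta>) \<in> val (boundary n) c \<or> (\<forall>p\<le>c. ev \<beta> p \<noteq> j)}"
        using horn_prism(2)[OF that, of _ c] by blast
    qed (use that in simp_all)
    show "RLP simplex (std_simplex n \<times>\<^sub>p std_simplex 1)
       (cyl (std_simplex n) (val (boundary n)) (std_simplex 1) (\<lambda>k. const_mor k 1 \<epsilon>)) E B p"
      using \<epsilon> RLP_prism_upper[OF sub_boundary 0] RLP_prism_lower[OF sub_boundary 1] by blast
  qed
qed


section \<open>Kan equivalences and trivial fibrations\<close>

declare One_nat_def [simp del]

section \<open>Extensional transformations and elementwise lifting problems\<close>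

lemma transf_apply [simp]: "c \<in> Ob C \<Longrightarrow> x \<in> val X c \<Longrightarrow> transf C X t c x = t c x"
  by (simp add: transf_def)

lemma homD: "t \<in> hom C X Y \<Longrightarrow> nat_on C X (val X) Y t"
  unfolding hom_def nat_on_def by (auto simp: PiE_iff)

lemma transf_hom:
  assumes "category C" "presheaf C X" "nat_on C X (val X) Y t" shows "transf C X t \<in> hom C X Y"
proof -
  have "transf C X t (src C f) (act X f x) = act Y f (transf C X t (tgt C f) x)"
    if "f \<in> Ar C" "x \<in> val X (tgt C f)" for f x
    using nat_on_act[OF assms(3) that(1) refl refl that(2)] category_Ob[OF assms(1) that(1)] that
      presheaf_act[OF assms(2) that(1) refl refl that(2)] by simp
  then show ?thesis
    using assms(3) unfolding hom_def nat_on_def by (auto simp: transf_def)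
qed

lemma hom_ext:
  assumes "s \<in> hom C X Y" "t \<in> hom C X Y" "\<And>c x. c \<in> Ob C \<Longrightarrow> x \<in> val X c \<Longrightarrow> s c x = t c x"
  shows "s = t"
proof
  fix c
  show "s c = t c"
  proof (cases "c \<in> Ob C")
    case True
    show ?thesis
    proof
      fix x show "s c x = t c x"
        using assms True by (cases "x \<in> val X c") (auto simp: hom_def PiE_iff extensional_def)
    qed
  next
    case False
    then show ?thesis using assms(1,2) by (auto simp: hom_def PiE_iff extensional_def)
  qed
qed

lemma hom_comp:
  assumes "category C" "presheaf C X" "s \<in> hom C X Y" "t \<in> hom C Y Z"
  shows "comp_transf C X t s \<in> hom C X Z"
  unfolding comp_transf_def
  by (rule transf_hom[OF assms(1,2) nat_on_comp[OF assms(1) homD[OF assms(3)] homD[OF assms(4)]]])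
    (rule nat_on_val[OF homD[OF assms(3)]])

lemma comp_transf_apply [simp]:
  "c \<in> Ob C \<Longrightarrow> x \<in> val X c \<Longrightarrow> comp_transf C X t s c x = t c (s c x)"
  by (simp add: comp_transf_def)

lemma nat_on_id: "sub C X A \<Longrightarrow> nat_on C X A X (\<lambda>c x. x)"
  unfolding sub_def nat_on_def by auto

lemma nat_on_restr [simp]: "nat_on C (restr X S) A Y t \<longleftrightarrow> nat_on C X A Y t"
  unfolding nat_on_def by simp

lemma incl_hom:
  assumes "category C" "presheaf C X" "sub C X A"
  shows "id_transf C (restr X A) \<in> hom C (restr X A) X"
  unfolding id_transf_def using nat_on_id[OF assms(3)]
  by (intro transf_hom presheaf_restr assms) simp

text \<open>Values off the domains are normalized by \<open>transf\<close>; equality of composites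
  then unfolds into the elementwise equations of \<open>RLP\<close>.\<close>

lemma RLP_of_lifts:
  assumes C: "category C" and X: "presheaf C X" and A: "sub C X A"
    and l: "lifts C (restr X A) X (id_transf C (restr X A)) E B p"
  shows "RLP C X A E B p"
proof (rule RLPI)
  fix u v assume u: "nat_on C X A E u" and v: "nat_on C X (val X) B v"
    and uv: "\<And>c x. c \<in> Ob C \<Longrightarrow> x \<in> A c \<Longrightarrow> p c (u c x) = v c x"
  let ?A = "restr X A"
  have 1: "transf C ?A u \<in> hom C ?A E" by (rule transf_hom[OF C presheaf_restr[OF C X A]]) (use u in simp)
  have 2: "transf C X v \<in> hom C X B" by (rule transf_hom[OF C X v])
  have "comp_transf C ?A p (transf C ?A u) = comp_transf C ?A (transf C X v) (id_transf C ?A)"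
    unfolding comp_transf_def id_transf_def transf_def[of C ?A]
    using uv subD[OF A] by (auto intro!: restrict_ext)
  then obtain h where h: "h \<in> hom C X E" "comp_transf C ?A h (id_transf C ?A) = transf C ?A u"
    "comp_transf C X p h = transf C X v"
    using l 1 2 unfolding lifts_def by blast
  have "h c x = u c x" if "c \<in> Ob C" "x \<in> A c" for c x
    using fun_cong[OF fun_cong[OF h(2), of c], of x] that by (simp add: id_transf_def)
  moreover have "p c (h c x) = v c x" if "c \<in> Ob C" "x \<in> val X c" for c x
    using fun_cong[OF fun_cong[OF h(3), of c], of x] that by simp
  ultimately show "\<exists>h. nat_on C X (val X) E h \<and> (\<forall>c\<in>Ob C. \<forall>x\<in>A c. h c x = u c x) \<and>
             (\<forall>c\<in>Ob C. \<forall>x\<in>val X c. p c (h c x) = v c x)"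
    using homD[OF h(1)] by blast
qed

lemma lifts_of_RLP:
  assumes C: "category C" and X: "presheaf C X" and A: "sub C X A" and rlp: "RLP C X A E B p"
    and p: "nat_on C E (val E) B p"
  shows "lifts C (restr X A) X (id_transf C (restr X A)) E B p"
  unfolding lifts_def
proof (intro ballI impI)
  let ?A = "restr X A"
  fix u v assume u: "u \<in> hom C ?A E" and v: "v \<in> hom C X B"
    and uv: "comp_transf C ?A p u = comp_transf C ?A v (id_transf C ?A)"
  have 1: "nat_on C X A E u" using homD[OF u] by simp
  have 2: "p c (u c x) = v c x" if "c \<in> Ob C" "x \<in> A c" for c x
    using fun_cong[OF fun_cong[OF uv, of c], of x] that by (simp add: id_transf_def)
  obtain h where h: "nat_on C X (val X) E h" "\<And>c x. c \<in> Ob C \<Longrightarrow> x \<in> A c \<Longrightarrow> h c x = u c x"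
    "\<And>c x. c \<in> Ob C \<Longrightarrow> x \<in> val X c \<Longrightarrow> p c (h c x) = v c x"
    using RLPE[OF rlp 1 homD[OF v] 2] by blast
  have h': "transf C X h \<in> hom C X E" by (rule transf_hom[OF C X h(1)])
  have "comp_transf C ?A (transf C X h) (id_transf C ?A) = u"
    by (rule hom_ext[OF hom_comp[OF C presheaf_restr[OF C X A] incl_hom[OF C X A] h'] u])
      (use h(2) subD[OF A] in \<open>simp add: id_transf_def\<close>)
  moreover have "comp_transf C X p (transf C X h) = v"
  proof (rule hom_ext[OF _ v])
    show "comp_transf C X p (transf C X h) \<in> hom C X B" unfolding comp_transf_def
      by (rule transf_hom[OF C X nat_on_comp[OF C homD[OF h'] p]]) (rule nat_on_val[OF homD[OF h']])
  qed (use h(3) in simp)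
  ultimately show "\<exists>h\<in>hom C X E. comp_transf C ?A h (id_transf C ?A) = u \<and> comp_transf C X p h = v"
    using h' by blast
qed

lemma terminal_simps [simp]: "val terminal_psh c = {()}" "act terminal_psh f x = x"
  by (simp_all add: terminal_psh_def)

lemma nat_on_terminal: "nat_on C X A terminal_psh t"
  unfolding nat_on_def by auto

abbreviation \<Delta>1 :: "smor sset" where "\<Delta>1 \<equiv> std_simplex 1"
abbreviation vx :: "nat \<Rightarrow> nat \<Rightarrow> smor" where "vx i k \<equiv> const_mor k 1 i"

abbreviation ends :: "nat \<Rightarrow> smor set" where "ends k \<equiv> {vx 0 k, vx 1 k}"

text \<open>\<open>\<epsilon>\<close> names the end at which the deformation has reached the
  subobject; at the other end it is the identity.\<close>

abbreviation scontracts :: "nat \<Rightarrow> 'a sset \<Rightarrow> (nat \<Rightarrow> 'a set) \<Rightarrow> bool" where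
  "scontracts \<epsilon> \<equiv> contracts simplex \<Delta>1 (vx \<epsilon>) (vx (1 - \<epsilon>))"

lemma vx_neq [simp]: "vx 0 k \<noteq> vx 1 k" "vx 1 k \<noteq> vx 0 k"
  by (simp_all add: const_mor_def)

lemma vx_val: "i \<le> 1 \<Longrightarrow> vx i k \<in> smap k 1"
  by (rule const_mor_smap)

lemma vx_act: "i \<le> 1 \<Longrightarrow> f \<in> Ar simplex \<Longrightarrow> cmp simplex (vx i (tgt simplex f)) f = vx i (src simplex f)"
  by (rule const_mor_act[OF smap_Ar])

lemma point_vx: "i \<le> 1 \<Longrightarrow> point simplex \<Delta>1 (vx i)"
  unfolding point_def using vx_val vx_act by simp

lemma sub_ends: "sub simplex \<Delta>1 ends"
  unfolding sub_def using vx_val[of 0] vx_val[of 1] vx_act[of 0] vx_act[of 1] by auto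

lemma contractsI:
  assumes "nat_on C (X \<times>\<^sub>p I) (val (X \<times>\<^sub>p I)) X H"
    "\<And>c x. c \<in> Ob C \<Longrightarrow> x \<in> val X c \<Longrightarrow> H c (x, e1 c) = x"
    "\<And>c x. c \<in> Ob C \<Longrightarrow> x \<in> val X c \<Longrightarrow> H c (x, e0 c) \<in> A c"
    "\<And>c x t. c \<in> Ob C \<Longrightarrow> x \<in> A c \<Longrightarrow> t \<in> val I c \<Longrightarrow> H c (x, t) \<in> A c"
  shows "contracts C I e0 e1 X A"
  unfolding contracts_def using assms by blast

section \<open>Deformations parametrized by the standard 1-simplex\<close>

definition smin :: "nat \<Rightarrow> smor \<Rightarrow> smor \<Rightarrow> smor" where
  "smin k s t = mk k 1 (\<lambda>i. min (ev s i) (ev t i))"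

definition smax :: "nat \<Rightarrow> smor \<Rightarrow> smor \<Rightarrow> smor" where
  "smax k s t = mk k 1 (\<lambda>i. max (ev s i) (ev t i))"

lemma smin_smap:
  assumes "s \<in> smap k 1" "t \<in> smap k 1" shows "smin k s t \<in> smap k 1"
  unfolding smin_def
proof (rule mk_smap)
  fix i assume "i \<le> k"
  then show "min (ev s i) (ev t i) \<le> 1" using smap_le[OF assms(1)] smap_le[OF assms(2)] by fastforce
next
  fix i j assume "i \<le> j" "j \<le> k"
  then show "min (ev s i) (ev t i) \<le> min (ev s j) (ev t j)"
    by (intro min.mono smap_mono[OF assms(1)] smap_mono[OF assms(2)])
qed

lemma smax_smap:
  assumes "s \<in> smap k 1" "t \<in> smap k 1" shows "smax k s t \<in> smap k 1"
  unfolding smax_def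
proof (rule mk_smap)
  fix i assume "i \<le> k"
  then show "max (ev s i) (ev t i) \<le> 1" using smap_le[OF assms(1)] smap_le[OF assms(2)] by fastforce
next
  fix i j assume "i \<le> j" "j \<le> k"
  then show "max (ev s i) (ev t i) \<le> max (ev s j) (ev t j)"
    by (intro max.mono smap_mono[OF assms(1)] smap_mono[OF assms(2)])
qed

lemma smin_act:
  assumes "s \<in> smap k 1" "t \<in> smap k 1" "f \<in> smap m k"
  shows "cmp simplex (smin k s t) f = smin m (cmp simplex s f) (cmp simplex t f)"
proof (rule smap_ext[OF cmp_smap(1)[OF assms(3) smin_smap[OF assms(1,2)]]
      smin_smap[OF cmp_smap(1)[OF assms(3,1)] cmp_smap(1)[OF assms(3,2)]]])
  fix i assume i: "i \<le> m"
  show "ev (cmp simplex (smin k s t) f) i = ev (smin m (cmp simplex s f) (cmp simplex t f)) i"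
    unfolding cmp_smap(2)[OF assms(3) smin_smap[OF assms(1,2)] i]
    using smap_le[OF assms(3) i] i cmp_smap(2)[OF assms(3,1) i] cmp_smap(2)[OF assms(3,2) i]
    by (simp add: smin_def)
qed

lemma smax_act:
  assumes "s \<in> smap k 1" "t \<in> smap k 1" "f \<in> smap m k"
  shows "cmp simplex (smax k s t) f = smax m (cmp simplex s f) (cmp simplex t f)"
proof (rule smap_ext[OF cmp_smap(1)[OF assms(3) smax_smap[OF assms(1,2)]]
      smax_smap[OF cmp_smap(1)[OF assms(3,1)] cmp_smap(1)[OF assms(3,2)]]])
  fix i assume i: "i \<le> m"
  show "ev (cmp simplex (smax k s t) f) i = ev (smax m (cmp simplex s f) (cmp simplex t f)) i"
    unfolding cmp_smap(2)[OF assms(3) smax_smap[OF assms(1,2)] i]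
    using smap_le[OF assms(3) i] i cmp_smap(2)[OF assms(3,1) i] cmp_smap(2)[OF assms(3,2) i]
    by (simp add: smax_def)
qed

lemma smin_vx:
  assumes "t \<in> smap k 1"
  shows "smin k t (vx 1 k) = t" "smin k t (vx 0 k) = vx 0 k" "smin k (vx 0 k) t = vx 0 k" "smin k (vx 1 k) t = t"
proof -
  have v0: "vx 0 k \<in> smap k 1" and v1: "vx 1 k \<in> smap k 1" by (rule vx_val; simp)+
  note le = smap_le[OF assms]
  show "smin k t (vx 1 k) = t"
    by (rule smap_ext[OF smin_smap[OF assms v1] assms]) (use le in \<open>simp add: smin_def min_def\<close>)
  show "smin k t (vx 0 k) = vx 0 k"
    by (rule smap_ext[OF smin_smap[OF assms v0] v0]) (simp add: smin_def)
  show "smin k (vx 0 k) t = vx 0 k"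
    by (rule smap_ext[OF smin_smap[OF v0 assms] v0]) (simp add: smin_def)
  show "smin k (vx 1 k) t = t"
    by (rule smap_ext[OF smin_smap[OF v1 assms] assms]) (use le in \<open>simp add: smin_def min_def le_antisym\<close>)
qed

lemma smax_vx:
  assumes "t \<in> smap k 1"
  shows "smax k t (vx 0 k) = t" "smax k t (vx 1 k) = vx 1 k" "smax k (vx 0 k) t = t" "smax k (vx 1 k) t = vx 1 k"
proof -
  have v0: "vx 0 k \<in> smap k 1" and v1: "vx 1 k \<in> smap k 1" by (rule vx_val; simp)+
  note le = smap_le[OF assms]
  show "smax k t (vx 0 k) = t"
    by (rule smap_ext[OF smax_smap[OF assms v0] assms]) (simp add: smax_def)
  show "smax k t (vx 1 k) = vx 1 k"
    by (rule smap_ext[OF smax_smap[OF assms v1] v1]) (use le in \<open>simp add: smax_def max_def le_antisym\<close>)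
  show "smax k (vx 0 k) t = t"
    by (rule smap_ext[OF smax_smap[OF v0 assms] assms]) (simp add: smax_def)
  show "smax k (vx 1 k) t = vx 1 k"
    by (rule smap_ext[OF smax_smap[OF v1 assms] v1]) (use le in \<open>simp add: smax_def max_def le_antisym\<close>)
qed

text \<open>The minimum contracts the interval to 0, the maximum contracts it to 1.\<close>

lemma simplex1_contracts:
  assumes "\<epsilon> = 0 \<or> \<epsilon> = 1" shows "scontracts \<epsilon> \<Delta>1 (\<lambda>k. {vx \<epsilon> k})"
  using assms
proof
  assume e: "\<epsilon> = 0"
  have "nat_on simplex (\<Delta>1 \<times>\<^sub>p \<Delta>1) (val (\<Delta>1 \<times>\<^sub>p \<Delta>1)) \<Delta>1 (\<lambda>k (s, t). smin k s t)"
  proof (rule nat_onI)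
    fix c z assume "z \<in> val (\<Delta>1 \<times>\<^sub>p \<Delta>1) c"
    then show "(case z of (s, t) \<Rightarrow> smin c s t) \<in> val \<Delta>1 c"
      using smin_smap[of _ c] by (cases z) simp
  next
    fix f z assume "f \<in> Ar simplex" "z \<in> val (\<Delta>1 \<times>\<^sub>p \<Delta>1) (tgt simplex f)"
    then show "(case act (\<Delta>1 \<times>\<^sub>p \<Delta>1) f z of (s, t) \<Rightarrow> smin (src simplex f) s t) =
       act \<Delta>1 f (case z of (s, t) \<Rightarrow> smin (tgt simplex f) s t)"
      using smin_act[OF _ _ smap_Ar, of _ f] by (cases z) simp
  qed
  then show ?thesis unfolding e
    by (rule contractsI) (use smin_vx in simp_all)
next
  assume e: "\<epsilon> = 1"
  have "nat_on simplex (\<Delta>1 \<times>\<^sub>p \<Delta>1) (val (\<Delta>1 \<times>\<^sub>p \<Delta>1)) \<Delta>1 (\<lambda>k (s, t). smax k s t)"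
  proof (rule nat_onI)
    fix c z assume "z \<in> val (\<Delta>1 \<times>\<^sub>p \<Delta>1) c"
    then show "(case z of (s, t) \<Rightarrow> smax c s t) \<in> val \<Delta>1 c"
      using smax_smap[of _ c] by (cases z) simp
  next
    fix f z assume "f \<in> Ar simplex" "z \<in> val (\<Delta>1 \<times>\<^sub>p \<Delta>1) (tgt simplex f)"
    then show "(case act (\<Delta>1 \<times>\<^sub>p \<Delta>1) f z of (s, t) \<Rightarrow> smax (src simplex f) s t) =
       act \<Delta>1 f (case z of (s, t) \<Rightarrow> smax (tgt simplex f) s t)"
      using smax_act[OF _ _ smap_Ar, of _ f] by (cases z) simp
  qed
  then show ?thesis unfolding e
    by (rule contractsI) (use smax_vx in simp_all)
qed

lemma contracts_corner_right:
  fixes X :: "('o, 'm, 'a) psh" and Y :: "('o, 'm, 'c) psh"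
  assumes "category C" "contracts C I e0 e1 Y S" "sub C Y S"
  shows "contracts C I e0 e1 (X \<times>\<^sub>p Y) (corner X A Y S)"
proof -
  obtain H where H: "nat_on C (Y \<times>\<^sub>p I) (val (Y \<times>\<^sub>p I)) Y H"
     "\<And>c x. c \<in> Ob C \<Longrightarrow> x \<in> val Y c \<Longrightarrow> H c (x, e1 c) = x \<and> H c (x, e0 c) \<in> S c"
     "\<And>c x t. c \<in> Ob C \<Longrightarrow> x \<in> S c \<Longrightarrow> t \<in> val I c \<Longrightarrow> H c (x, t) \<in> S c"
    using assms(2) unfolding contracts_def by blast
  have Hv: "H c (x, t) \<in> val Y c" if "c \<in> Ob C" "x \<in> val Y c" "t \<in> val I c" for c x t
    using nat_on_val[OF H(1), of c "(x, t)"] that by simp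
  have Ha: "H (src C f) (act Y f x, act I f t) = act Y f (H (tgt C f) (x, t))"
    if "f \<in> Ar C" "x \<in> val Y (tgt C f)" "t \<in> val I (tgt C f)" for f x t
    using nat_on_act[OF H(1) that(1) refl refl, of "(x, t)"] that by simp
  define K where "K = (\<lambda>c ((x :: 'a, y), t). (x, H c (y, t)))"
  have K [simp]: "K c ((x, y), t) = (x, H c (y, t))" for c x y t by (simp add: K_def)
  have 1: "nat_on C ((X \<times>\<^sub>p Y) \<times>\<^sub>p I) (val ((X \<times>\<^sub>p Y) \<times>\<^sub>p I)) (X \<times>\<^sub>p Y) K"
    using Hv Ha by (intro nat_onI) auto
  have 2: "K c (z, e1 c) = z \<and> K c (z, e0 c) \<in> corner X A Y S c"
    if "c \<in> Ob C" "z \<in> val (X \<times>\<^sub>p Y) c" for c z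
    using H(2)[OF that(1)] subD[OF assms(3) that(1)] that by auto
  have 3: "K c (z, t) \<in> corner X A Y S c"
    if "c \<in> Ob C" "z \<in> corner X A Y S c" "t \<in> val I c" for c z t
    using H(3)[OF that(1)] Hv[OF that(1)] that by (cases z) auto
  show ?thesis unfolding contracts_def using 1 2 3 by blast
qed

text \<open>The interval coordinate is squeezed onto its end and \<open>X\<close> is left alone; so
  cylinder inclusions are themselves admissible as acyclic cofibrations.\<close>

lemma cyl_contracts:
  assumes "\<epsilon> = 0 \<or> \<epsilon> = 1" shows "scontracts \<epsilon> (X \<times>\<^sub>p \<Delta>1) (cyl X A \<Delta>1 (vx \<epsilon>))"
proof (rule contracts_corner_right[OF category_simplex simplex1_contracts[OF assms]])
  show "sub simplex \<Delta>1 (\<lambda>k. {vx \<epsilon> k})" by (rule sub_point[OF point_vx]) (use assms in auto)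
qed

text \<open>Values are only ever changed to \<open>k\<close>, so simplices of the horn stay in it.
  For \<open>k < n\<close> one truncates at \<open>k\<close>, and the result misses
  \<open>n\<close>; for \<open>k = n\<close> one collapses everything to \<open>n\<close>, and the
  result misses 0. Monotonicity decides the end \<open>\<epsilon>\<close>: lowered values must come
  first, raised values last.\<close>

lemma horn_contracts:
  assumes "1 \<le> n" "k \<le> n"
  obtains \<epsilon> where "\<epsilon> = 0 \<or> \<epsilon> = 1" "scontracts \<epsilon> (std_simplex n) (val (horn n k))"
proof -
  define \<epsilon> :: nat where "\<epsilon> = (if k < n then 0 else 1)"
  define r where "r = (\<lambda>x. if k < n then min x k else n)"
  define H where "H = (\<lambda>m (x, t). mk m n (\<lambda>i. if ev t i = \<epsilon> then r (ev x i) else ev x i))"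
  have \<epsilon>: "\<epsilon> = 0 \<or> \<epsilon> = 1" by (auto simp: \<epsilon>_def)
  have Hm: "H m (x, t) \<in> smap m n" if x: "x \<in> smap m n" and t: "t \<in> smap m 1" for m x t
    unfolding H_def prod.case
  proof (rule mk_smap)
    fix i assume "i \<le> m" then show "(if ev t i = \<epsilon> then r (ev x i) else ev x i) \<le> n"
      using smap_le[OF x, of i] assms by (auto simp: r_def)
  next
    fix i j assume "i \<le> j" "j \<le> m"
    then show "(if ev t i = \<epsilon> then r (ev x i) else ev x i) \<le> (if ev t j = \<epsilon> then r (ev x j) else ev x j)"
      using smap_mono[OF x, of i j] smap_mono[OF t, of i j] smap_le[OF x, of i] smap_le[OF t, of j]
      by (cases "k < n") (simp_all add: r_def \<epsilon>_def min_def)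
  qed
  have Hev: "ev (H m (x, t)) i = (if ev t i = \<epsilon> then r (ev x i) else ev x i)" if "i \<le> m" for m x t i
    using that by (simp add: H_def)
  have nat: "nat_on simplex (std_simplex n \<times>\<^sub>p \<Delta>1) (val (std_simplex n \<times>\<^sub>p \<Delta>1)) (std_simplex n) H"
  proof (rule nat_onI)
    fix c z assume "z \<in> val (std_simplex n \<times>\<^sub>p \<Delta>1) c"
    then show "H c z \<in> val (std_simplex n) c" using Hm[of _ c] by (cases z) simp
  next
    fix f z assume f: "f \<in> Ar simplex" and "z \<in> val (std_simplex n \<times>\<^sub>p \<Delta>1) (tgt simplex f)"
    then obtain x t where z: "z = (x, t)" and x: "x \<in> smap (tgt simplex f) n" and t: "t \<in> smap (tgt simplex f) 1"
      by (cases z) auto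
    note f' = smap_Ar[OF f]
    have "H (src simplex f) (cmp simplex x f, cmp simplex t f) = cmp simplex (H (tgt simplex f) (x, t)) f"
    proof (rule smap_ext[OF Hm[OF cmp_smap(1)[OF f' x] cmp_smap(1)[OF f' t]] cmp_smap(1)[OF f' Hm[OF x t]]])
      fix i assume i: "i \<le> src simplex f"
      show "ev (H (src simplex f) (cmp simplex x f, cmp simplex t f)) i = ev (cmp simplex (H (tgt simplex f) (x, t)) f) i"
        unfolding cmp_smap(2)[OF f' Hm[OF x t] i] Hev[OF i] Hev[OF smap_le[OF f' i]]
          cmp_smap(2)[OF f' x i] cmp_smap(2)[OF f' t i] by simp
    qed
    then show "H (src simplex f) (act (std_simplex n \<times>\<^sub>p \<Delta>1) f z) = act (std_simplex n) f (H (tgt simplex f) z)"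
      by (simp add: z)
  qed
  have 1: "H m (x, vx (1 - \<epsilon>) m) = x" if x: "x \<in> smap m n" for m x
  proof (rule smap_ext[OF Hm[OF x vx_val] x])
    fix i assume i: "i \<le> m"
    show "ev (H m (x, vx (1 - \<epsilon>) m)) i = ev x i" unfolding Hev[OF i] using i \<epsilon> by auto
  qed simp
  have e1: "\<epsilon> \<le> 1" using \<epsilon> by auto
  have 2: "H m (x, vx \<epsilon> m) \<in> val (horn n k) m" if x: "x \<in> smap m n" for m x
  proof -
    have "ev (H m (x, vx \<epsilon> m)) i = r (ev x i)" if "i \<le> m" for i
      unfolding Hev[OF that] using that by simp
    then have "ev (H m (x, vx \<epsilon> m)) ` {..m} \<subseteq> range r" by auto
    moreover have "\<not> {..n} \<subseteq> insert k (range r)"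
    proof (cases "k < n")
      case True
      then have "n \<notin> insert k (range r)" by (auto simp: r_def min_def)
      then show ?thesis by blast
    next
      case False
      then have "0 \<notin> insert k (range r)" using assms by (auto simp: r_def)
      then show ?thesis by blast
    qed
    ultimately show ?thesis unfolding horn_val using Hm[OF x vx_val[OF e1, of m]] by blast
  qed
  have 3: "H m (x, t) \<in> val (horn n k) m" if x: "x \<in> val (horn n k) m" and t: "t \<in> smap m 1" for m x t
  proof -
    have x': "x \<in> smap m n" "\<not> {..n} \<subseteq> insert k (ev x ` {..m})" using x unfolding horn_val by blast+
    have "ev (H m (x, t)) i = ev x i \<or> ev (H m (x, t)) i = k" if "i \<le> m" for i
      unfolding Hev[OF that] using assms(2) by (auto simp: r_def min_def)
    then have "insert k (ev (H m (x, t)) ` {..m}) \<subseteq> insert k (ev x ` {..m})" by auto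
    then show ?thesis unfolding horn_val using Hm[OF x'(1) t] x'(2) by blast
  qed
  have "scontracts \<epsilon> (std_simplex n) (val (horn n k))"
    by (rule contractsI[OF nat]) (use 1 2 3 in simp_all)
  then show ?thesis using that \<epsilon> by blast
qed

text \<open>The contraction makes the pair a retract of a cylinder pair, and cylinders are reduced
  to horns by \<open>RLP_cyl\<close>.\<close>

lemma kan_complex_RLP:
  assumes K: "kan_complex K" and X: "presheaf simplex X" and A: "sub simplex X A"
    and e: "\<epsilon> = 0 \<or> \<epsilon> = 1" "scontracts \<epsilon> X A"
  shows "RLP simplex X A K terminal_psh (to_terminal simplex K)"
proof (rule contracts_RLP[OF category_simplex e(2) X presheaf_simplex A point_vx point_vx])
  show "RLP simplex (X \<times>\<^sub>p \<Delta>1) (cyl X A \<Delta>1 (vx \<epsilon>)) K terminal_psh (to_terminal simplex K)"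
  proof (rule RLP_cyl[OF X A e(1)])
    fix n k :: nat assume "1 \<le> n" "k \<le> n"
    then have "lifts simplex (horn n k) (std_simplex n) (id_transf simplex (horn n k)) K terminal_psh
        (to_terminal simplex K)"
      using K unfolding kan_complex_def kan_fibration_def by blast
    then show "RLP simplex (std_simplex n) (val (horn n k)) K terminal_psh (to_terminal simplex K)"
      by (intro RLP_of_lifts[OF category_simplex presheaf_simplex sub_horn]) (simp only: horn_restr[symmetric])
  qed
qed (use e in auto)

lemma kan_complex_extend:
  assumes "kan_complex K" "presheaf simplex X" "sub simplex X A" "\<epsilon> = 0 \<or> \<epsilon> = 1" "scontracts \<epsilon> X A"
    and u: "nat_on simplex X A K u"
  obtains h where "nat_on simplex X (val X) K h" "\<And>c x. x \<in> A c \<Longrightarrow> h c x = u c x"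
proof -
  have pt: "to_terminal simplex K c (u c x) = ()" if "c \<in> Ob simplex" "x \<in> A c" for c x by simp
  show ?thesis
    by (rule RLPE[OF kan_complex_RLP[OF assms(1-5)] u nat_on_terminal[of _ _ _ "\<lambda>_ _. ()"] pt])
      (use that in simp_all)
qed

text \<open>Maps into a Kan complex extend along a contracting inclusion, which gives surjectivity
  on homotopy classes. A homotopy on \<open>S\<close> with given ends on \<open>T\<close> is an
  extension problem of the same kind, because corners inherit the contraction; this gives
  injectivity. Apart from those contained in the hypothesis on left fibrations, all Kan equivalences
  of the proof come from here.\<close>

theorem kan_equivalence_contracts:
  fixes T :: "'a sset"
  assumes T: "presheaf simplex T" and S: "sub simplex T S" and e: "\<epsilon> = 0 \<or> \<epsilon> = 1" "scontracts \<epsilon> T S"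
  shows "kan_equivalence (restr T S) T (id_transf simplex (restr T S))"
  unfolding kan_equivalence_def
proof (intro conjI allI impI ballI)
  note C = category_simplex
  let ?S = "restr T S"
  have S': "presheaf simplex ?S" by (rule presheaf_restr[OF C T S])
  show "id_transf simplex ?S \<in> hom simplex ?S T" by (rule incl_hom[OF C T S])
  fix K :: "('a + 'a + nat) sset" assume K: "kan_complex K"
  fix u assume u: "u \<in> hom simplex ?S K"
  have u': "nat_on simplex T S K u" using homD[OF u] by simp
  obtain h where h: "nat_on simplex T (val T) K h" "\<And>c x. x \<in> S c \<Longrightarrow> h c x = u c x"
    using kan_complex_extend[OF K T S e u'] by blast
  have "homotopic ?S K (comp_transf simplex ?S (transf simplex T h) (id_transf simplex ?S)) u"
    unfolding homotopic_def
  proof (intro bexI allI ballI)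
    have "nat_on simplex (?S \<times>\<^sub>p \<Delta>1) (val (?S \<times>\<^sub>p \<Delta>1)) K (\<lambda>c (x, t). u c x)"
      using homD[OF u] unfolding nat_on_def by auto
    then show "transf simplex (?S \<times>\<^sub>p \<Delta>1) (\<lambda>c (x, t). u c x) \<in> hom simplex (?S \<times>\<^sub>p \<Delta>1) K"
      by (intro transf_hom C presheaf_prod S' presheaf_simplex)
    fix m x assume x: "x \<in> val ?S m"
    then have "x \<in> val T m" using subD[OF S, of m x] by simp
    then show "transf simplex (?S \<times>\<^sub>p \<Delta>1) (\<lambda>c (x, t). u c x) m (x, vx 0 m) =
          comp_transf simplex ?S (transf simplex T h) (id_transf simplex ?S) m x \<and>
        transf simplex (?S \<times>\<^sub>p \<Delta>1) (\<lambda>c (x, t). u c x) m (x, vx 1 m) = u m x"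
      using x h(2) vx_val[of 0 m] vx_val[of 1 m] by (simp add: id_transf_def)
  qed
  then show "\<exists>v\<in>hom simplex T K. homotopic ?S K (comp_transf simplex ?S v (id_transf simplex ?S)) u"
    using transf_hom[OF C T h(1)] by blast
next
  note C = category_simplex
  let ?S = "restr T S" and ?i = "id_transf simplex (restr T S)"
  fix K :: "('a + 'a + nat) sset" and v v'
  assume K: "kan_complex K" and v: "v \<in> hom simplex T K" and v': "v' \<in> hom simplex T K"
    and "homotopic ?S K (comp_transf simplex ?S v ?i) (comp_transf simplex ?S v' ?i)"
  then obtain H where H: "H \<in> hom simplex (?S \<times>\<^sub>p \<Delta>1) K"
    "\<And>m x. x \<in> S m \<Longrightarrow> H m (x, vx 0 m) = v m x \<and> H m (x, vx 1 m) = v' m x"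
    unfolding homotopic_def by (auto simp: id_transf_def)
  \<comment> \<open>Data for a homotopy on \<open>T\<close>: the given one over \<open>S\<close>,
    and \<open>v\<close>, \<open>v'\<close> at the two ends.\<close>
  define w where "w = (\<lambda>m (x, t). if t = vx 0 m then v m x else if t = vx 1 m then v' m x else H m (x, t))"
  have wS: "w m (x, t) = H m (x, t)" if "x \<in> S m" for m x t using H(2)[OF that] by (simp add: w_def)
  have w0: "w m (x, vx 0 m) = v m x" "w m (x, vx 1 m) = v' m x" for m x by (simp_all add: w_def)
  note Hn = homD[OF H(1)] and vn = homD[OF v] and vn' = homD[OF v']
  let ?A = "corner T S \<Delta>1 ends"
  have w: "nat_on simplex (T \<times>\<^sub>p \<Delta>1) ?A K w"
  proof (rule nat_onI)
    fix c z assume "z \<in> ?A c"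
    then obtain x t where z: "z = (x, t)" "x \<in> val T c" "t \<in> smap c 1" "x \<in> S c \<or> t = vx 0 c \<or> t = vx 1 c"
      by (cases z) auto
    then show "w c z \<in> val K c"
      using wS[of x c t] w0[of c x] nat_on_val[OF Hn, of c "(x, t)"] nat_on_val[OF vn, of c x]
        nat_on_val[OF vn', of c x] by auto
  next
    fix f z assume f: "f \<in> Ar simplex" "z \<in> ?A (tgt simplex f)"
    then obtain x t where z: "z = (x, t)" "x \<in> val T (tgt simplex f)" "t \<in> smap (tgt simplex f) 1"
        "x \<in> S (tgt simplex f) \<or> t = vx 0 (tgt simplex f) \<or> t = vx 1 (tgt simplex f)"
      by (cases z) auto
    from z(4) show "w (src simplex f) (act (T \<times>\<^sub>p \<Delta>1) f z) = act K f (w (tgt simplex f) z)"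
    proof (elim disjE)
      assume x: "x \<in> S (tgt simplex f)"
      show ?thesis using wS[OF x] wS[OF sub_act[OF S f(1) refl refl x]]
          nat_on_act[OF Hn f(1) refl refl, of "(x, t)"] z x by simp
    qed (use w0 nat_on_act[OF vn f(1) refl refl z(2)] nat_on_act[OF vn' f(1) refl refl z(2)]
        vx_act[OF _ f(1), of 0] vx_act[OF _ f(1), of 1] z(1) in simp_all)
  qed
  have sc: "scontracts \<epsilon> (T \<times>\<^sub>p \<Delta>1) ?A" by (rule contracts_corner[OF C e(2) S])
  obtain h where h: "nat_on simplex (T \<times>\<^sub>p \<Delta>1) (val (T \<times>\<^sub>p \<Delta>1)) K h" "\<And>c x. x \<in> ?A c \<Longrightarrow> h c x = w c x"
    using kan_complex_extend[OF K presheaf_prod[OF T presheaf_simplex]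
          sub_corner[OF T presheaf_simplex S sub_ends] e(1) sc w] by blast
  show "homotopic T K v v'" unfolding homotopic_def
  proof (intro bexI allI ballI)
    show "transf simplex (T \<times>\<^sub>p \<Delta>1) h \<in> hom simplex (T \<times>\<^sub>p \<Delta>1) K"
      by (rule transf_hom[OF C presheaf_prod[OF T presheaf_simplex] h(1)])
    fix m x assume "x \<in> val T m"
    then show "transf simplex (T \<times>\<^sub>p \<Delta>1) h m (x, vx 0 m) = v m x \<and>
       transf simplex (T \<times>\<^sub>p \<Delta>1) h m (x, vx 1 m) = v' m x"
      using h(2)[of "(x, vx 0 m)" m] h(2)[of "(x, vx 1 m)" m] w0[of m x] vx_val[of 0 m] vx_val[of 1 m] by simp
  qed
qed

text \<open>The isomorphic presheaf with elements renamed by \<open>\<iota>\<close>. Kan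
  equivalences, injective fibrations and the model structure quantify over fixed element types, so
  auxiliary presheaves have to be moved there.\<close>

definition copy :: "('o, 'm) cat \<Rightarrow> ('o \<Rightarrow> 'a \<Rightarrow> 'b) \<Rightarrow> ('o, 'm, 'a) psh \<Rightarrow> ('o, 'm, 'b) psh" where
  "copy C \<iota> X = \<lparr>val = (\<lambda>c. \<iota> c ` val X c),
     act = (\<lambda>f y. \<iota> (src C f) (act X f (inv_into (val X (tgt C f)) (\<iota> (tgt C f)) y)))\<rparr>"

abbreviation uncopy :: "('o \<Rightarrow> 'a \<Rightarrow> 'b) \<Rightarrow> ('o, 'm, 'a) psh \<Rightarrow> 'o \<Rightarrow> 'b \<Rightarrow> 'a" where
  "uncopy \<iota> X c \<equiv> inv_into (val X c) (\<iota> c)"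

lemma copy_val [simp]: "val (copy C \<iota> X) c = \<iota> c ` val X c"
  by (simp add: copy_def)

lemma copy_act:
  assumes "inj_on (\<iota> (tgt C f)) (val X (tgt C f))" "x \<in> val X (tgt C f)"
  shows "act (copy C \<iota> X) f (\<iota> (tgt C f) x) = \<iota> (src C f) (act X f x)"
  using assms by (simp add: copy_def)

lemma copy_facts:
  assumes C: "category C" and X: "presheaf C X" and inj: "\<And>c. c \<in> Ob C \<Longrightarrow> inj_on (\<iota> c) (val X c)"
  shows "presheaf C (copy C \<iota> X)"
    and "nat_on C X (val X) (copy C \<iota> X) \<iota>"
    and "nat_on C (copy C \<iota> X) (val (copy C \<iota> X)) X (uncopy \<iota> X)"
proof -
  have act: "act (copy C \<iota> X) f (\<iota> (tgt C f) x) = \<iota> (src C f) (act X f x)"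
    if "f \<in> Ar C" "x \<in> val X (tgt C f)" for f x
    by (rule copy_act) (use inj category_Ob(2)[OF C that(1)] that(2) in auto)
  show "presheaf C (copy C \<iota> X)"
  proof (rule presheafI)
    fix f x assume f: "f \<in> Ar C" "x \<in> val (copy C \<iota> X) (tgt C f)"
    then obtain y where y: "y \<in> val X (tgt C f)" "x = \<iota> (tgt C f) y" by auto
    show "act (copy C \<iota> X) f x \<in> val (copy C \<iota> X) (src C f)"
      using act[OF f(1) y(1)] y(2) presheaf_act[OF X f(1) refl refl y(1)] by simp
  next
    fix c x assume c: "c \<in> Ob C" "x \<in> val (copy C \<iota> X) c"
    then obtain y where y: "y \<in> val X c" "x = \<iota> c y" by auto
    show "act (copy C \<iota> X) (idn C c) x = x"
      using act[of "idn C c" y] category_idn[OF C c(1)] y presheaf_idn[OF X c(1) y(1)] by simp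
  next
    fix f g x assume f: "f \<in> Ar C" "g \<in> Ar C" "src C g = tgt C f" and "x \<in> val (copy C \<iota> X) (tgt C g)"
    then obtain y where y: "y \<in> val X (tgt C g)" "x = \<iota> (tgt C g) y" by auto
    show "act (copy C \<iota> X) (cmp C g f) x = act (copy C \<iota> X) f (act (copy C \<iota> X) g x)"
      using act[OF f(2) y(1)] act[OF f(1), of "act X g y"] act[of "cmp C g f" y] category_cmp[OF C f]
        presheaf_act[OF X f(2) refl f(3) y(1)] presheaf_cmp[OF X f refl y(1)] y f(3) by simp
  qed
  show "nat_on C X (val X) (copy C \<iota> X) \<iota>"
    using act by (intro nat_onI) auto
  show "nat_on C (copy C \<iota> X) (val (copy C \<iota> X)) X (uncopy \<iota> X)"
  proof (rule nat_onI)
    fix f x assume f: "f \<in> Ar C" "x \<in> val (copy C \<iota> X) (tgt C f)"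
    then obtain y where y: "y \<in> val X (tgt C f)" "x = \<iota> (tgt C f) y" by auto
    note o = category_Ob[OF C f(1)]
    show "uncopy \<iota> X (src C f) (act (copy C \<iota> X) f x) = act X f (uncopy \<iota> X (tgt C f) x)"
      using act[OF f(1) y(1)] y(2) presheaf_act[OF X f(1) refl refl y(1)] inj[OF o(1)] inj[OF o(2)] y(1)
      by simp
  qed (use inj in auto)
qed

text \<open>Horn problems are carried back along \<open>uncopy\<close>, solved there, and the
  fillers are renamed by \<open>\<iota>\<close>.\<close>

lemma kan_complex_copy:
  assumes X: "presheaf simplex X" and inj: "\<And>c. inj_on (\<iota> c) (val X c)"
    and rlp: "\<And>n k q. 1 \<le> n \<Longrightarrow> k \<le> n \<Longrightarrow> RLP simplex (std_simplex n) (val (horn n k)) X terminal_psh q"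
  shows "kan_complex (copy simplex \<iota> X)"
proof -
  let ?Y = "copy simplex \<iota> X"
  note C = category_simplex and F = copy_facts[OF category_simplex X, of \<iota>, OF inj]
  have rl: "RLP simplex (std_simplex n) (val (horn n k)) ?Y terminal_psh q" if nk: "1 \<le> n" "k \<le> n" for n k q
  proof (rule RLPI)
    fix u v assume u: "nat_on simplex (std_simplex n) (val (horn n k)) ?Y u"
    have 1: "nat_on simplex (std_simplex n) (val (horn n k)) X (\<lambda>c x. uncopy \<iota> X c (u c x))"
      by (rule nat_on_comp[OF C u F(3) nat_on_val[OF u]])
    obtain h where h: "nat_on simplex (std_simplex n) (val (std_simplex n)) X h"
      "\<And>c x. c \<in> Ob simplex \<Longrightarrow> x \<in> val (horn n k) c \<Longrightarrow> h c x = uncopy \<iota> X c (u c x)"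
      using RLPE[OF rlp[OF nk] 1 nat_on_terminal[of _ _ _ "\<lambda>_ _. ()"], of "\<lambda>_ _. ()"] by auto
    have "\<iota> c (h c x) = u c x" if "x \<in> val (horn n k) c" for c x
      using h(2)[OF simplex_Ob that] nat_on_val[OF u simplex_Ob that] inj[of c] by auto
    then show "\<exists>h. nat_on simplex (std_simplex n) (val (std_simplex n)) ?Y h \<and>
        (\<forall>c\<in>Ob simplex. \<forall>x\<in>val (horn n k) c. h c x = u c x) \<and>
        (\<forall>c\<in>Ob simplex. \<forall>x\<in>val (std_simplex n) c. q c (h c x) = v c x)"
      using nat_on_comp[OF C h(1) F(2) nat_on_val[OF h(1)]] by (intro exI[of _ "\<lambda>c x. \<iota> c (h c x)"]) simp
  qed
  have "lifts simplex (horn n k) (std_simplex n) (id_transf simplex (horn n k)) ?Y terminal_psh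
      (to_terminal simplex ?Y)" if "1 \<le> n" "k \<le> n" for n k
    by (rule lifts_of_RLP[OF C presheaf_simplex sub_horn _ nat_on_terminal, of n k, folded horn_restr, OF rl[OF that]])
  moreover have "to_terminal simplex ?Y \<in> hom simplex ?Y terminal_psh"
    unfolding to_terminal_def by (rule transf_hom[OF C F(1) nat_on_terminal])
  ultimately show ?thesis unfolding kan_complex_def kan_fibration_def using F(1) by blast
qed

text \<open>The Kan complexes tested by \<open>kan_equivalence\<close> include copies of \<open>E\<close> and \<open>B\<close>.\<close>

lemma kan_equivalence_inverse:
  fixes E :: "'a sset" and B :: "'b sset"
  assumes E: "presheaf simplex E" and B: "presheaf simplex B" and eq: "kan_equivalence E B f"
    and kE: "\<And>n k q. 1 \<le> n \<Longrightarrow> k \<le> n \<Longrightarrow> RLP simplex (std_simplex n) (val (horn n k)) E terminal_psh q"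
    and kB: "\<And>n k q. 1 \<le> n \<Longrightarrow> k \<le> n \<Longrightarrow> RLP simplex (std_simplex n) (val (horn n k)) B terminal_psh q"
  obtains g G K where "nat_on simplex B (val B) E g"
    "nat_on simplex (E \<times>\<^sub>p \<Delta>1) (val (E \<times>\<^sub>p \<Delta>1)) E G"
    "\<And>c x. x \<in> val E c \<Longrightarrow> G c (x, vx 0 c) = g c (f c x)" "\<And>c x. x \<in> val E c \<Longrightarrow> G c (x, vx 1 c) = x"
    "nat_on simplex (B \<times>\<^sub>p \<Delta>1) (val (B \<times>\<^sub>p \<Delta>1)) B K"
    "\<And>c x. x \<in> val B c \<Longrightarrow> K c (x, vx 0 c) = f c (g c x)" "\<And>c x. x \<in> val B c \<Longrightarrow> K c (x, vx 1 c) = x"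
proof -
  note C = category_simplex
  have f: "nat_on simplex E (val E) B f" and f': "f \<in> hom simplex E B"
    using eq homD unfolding kan_equivalence_def by blast+
  define i where "i = (\<lambda>c :: nat. (Inl :: 'a \<Rightarrow> 'a + 'b + nat))"
  define j where "j = (\<lambda>c :: nat. \<lambda>x. (Inr (Inl x) :: 'a + 'b + nat))"
  have inji: "inj_on (i c) (val E c)" and injj: "inj_on (j c) (val B c)" for c
    by (auto simp: i_def j_def inj_on_def)
  let ?E = "copy simplex i E" and ?B = "copy simplex j B"
  note FE = copy_facts[OF C E, of i, OF inji] and FB = copy_facts[OF C B, of j, OF injj]
  have iv: "v0 \<in> val E c \<Longrightarrow> uncopy i E c (i c v0) = v0" for v0 c using inji by simp
  have jv: "v0 \<in> val B c \<Longrightarrow> uncopy j B c (j c v0) = v0" for v0 c using injj by simp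
  have KE: "kan_complex ?E" by (rule kan_complex_copy[OF E inji kE])
  have KB: "kan_complex ?B" by (rule kan_complex_copy[OF B injj kB])
  have "transf simplex E i \<in> hom simplex E ?E" by (rule transf_hom[OF C E FE(2)])
  \<comment> \<open>Surjectivity on classes of maps into the copy of \<open>E\<close>, applied to
    the renaming of the identity, yields the homotopy inverse.\<close>
  then obtain v where v: "v \<in> hom simplex B ?E"
      "homotopic E ?E (comp_transf simplex E v f) (transf simplex E i)"
    using eq KE unfolding kan_equivalence_def by blast
  obtain H where H: "H \<in> hom simplex (E \<times>\<^sub>p \<Delta>1) ?E"
    "\<And>m x. x \<in> val E m \<Longrightarrow> H m (x, vx 0 m) = v m (f m x) \<and> H m (x, vx 1 m) = i m x"
    using v(2) unfolding homotopic_def by auto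
  define g where "g = (\<lambda>c x. uncopy i E c (v c x))"
  define G where "G = (\<lambda>c x. uncopy i E c (H c x))"
  have g: "nat_on simplex B (val B) E g" unfolding g_def
    by (rule nat_on_comp[OF C homD[OF v(1)] FE(3) nat_on_val[OF homD[OF v(1)]]])
  have G: "nat_on simplex (E \<times>\<^sub>p \<Delta>1) (val (E \<times>\<^sub>p \<Delta>1)) E G" unfolding G_def
    by (rule nat_on_comp[OF C homD[OF H(1)] FE(3) nat_on_val[OF homD[OF H(1)]]])
  have G0: "G c (x, vx 0 c) = g c (f c x)" and G1: "G c (x, vx 1 c) = x" if "x \<in> val E c" for c x
    using H(2)[OF that] iv[OF that] by (simp_all add: G_def g_def)
  note fg = nat_on_comp[OF C g f nat_on_val[OF g]]
  define w where "w = transf simplex B (\<lambda>c x. j c (f c (g c x)))"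
  define w' where "w' = transf simplex B j"
  have w: "w \<in> hom simplex B ?B" unfolding w_def
    by (rule transf_hom[OF C B nat_on_comp[OF C fg FB(2) nat_on_val[OF fg]]])
  have w': "w' \<in> hom simplex B ?B" unfolding w'_def by (rule transf_hom[OF C B FB(2)])
  have P: "presheaf simplex (E \<times>\<^sub>p \<Delta>1)" by (rule presheaf_prod[OF E presheaf_simplex])
  note fG = nat_on_comp[OF C G f nat_on_val[OF G]]
  \<comment> \<open>The image of \<open>G\<close> under \<open>f\<close> runs from
    \<open>f g f\<close> to \<open>f\<close>; injectivity on classes of maps into the copy of
    \<open>B\<close> cancels the right-hand \<open>f\<close>.\<close>
  have "homotopic E ?B (comp_transf simplex E w f) (comp_transf simplex E w' f)"
    unfolding homotopic_def
  proof (intro bexI allI ballI)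
    show "transf simplex (E \<times>\<^sub>p \<Delta>1) (\<lambda>c x. j c (f c (G c x))) \<in> hom simplex (E \<times>\<^sub>p \<Delta>1) ?B"
      by (rule transf_hom[OF C P nat_on_comp[OF C fG FB(2) nat_on_val[OF fG]]])
    fix m x assume x: "x \<in> val E m"
    then show "transf simplex (E \<times>\<^sub>p \<Delta>1) (\<lambda>c x. j c (f c (G c x))) m (x, vx 0 m) = comp_transf simplex E w f m x \<and>
        transf simplex (E \<times>\<^sub>p \<Delta>1) (\<lambda>c x. j c (f c (G c x))) m (x, vx 1 m) = comp_transf simplex E w' f m x"
      using G0[OF x] G1[OF x] nat_on_val[OF f simplex_Ob x] vx_val[of 0 m] vx_val[of 1 m]
      by (simp add: w_def w'_def)
  qed
  then have "homotopic B ?B w w'" using eq KB w w' unfolding kan_equivalence_def by blast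
  then obtain H' where H': "H' \<in> hom simplex (B \<times>\<^sub>p \<Delta>1) ?B"
    "\<And>m x. x \<in> val B m \<Longrightarrow> H' m (x, vx 0 m) = j m (f m (g m x)) \<and> H' m (x, vx 1 m) = j m x"
    unfolding homotopic_def by (auto simp: w_def w'_def)
  define K where "K = (\<lambda>c x. uncopy j B c (H' c x))"
  have K: "nat_on simplex (B \<times>\<^sub>p \<Delta>1) (val (B \<times>\<^sub>p \<Delta>1)) B K" unfolding K_def
    by (rule nat_on_comp[OF C homD[OF H'(1)] FB(3) nat_on_val[OF homD[OF H'(1)]]])
  have "K c (x, vx 0 c) = f c (g c x)" "K c (x, vx 1 c) = x" if x: "x \<in> val B c" for c x
    using H'(2)[OF x] jv[OF x] jv[OF nat_on_val[OF fg simplex_Ob x]] by (simp_all add: K_def)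
  then show ?thesis using that[OF g G G0 G1 K] by blast
qed

lemma RLP_simplexE:
  assumes "RLP simplex X A E B p" "nat_on simplex X A E u" "nat_on simplex X (val X) B v"
    "\<And>c x. x \<in> A c \<Longrightarrow> p c (u c x) = v c x"
  obtains h where "nat_on simplex X (val X) E h" "\<And>c x. x \<in> A c \<Longrightarrow> h c x = u c x"
    "\<And>c x. x \<in> val X c \<Longrightarrow> p c (h c x) = v c x"
proof (rule RLPE[OF assms(1-3)])
  fix h assume "nat_on simplex X (val X) E h" "\<And>c x. c \<in> Ob simplex \<Longrightarrow> x \<in> A c \<Longrightarrow> h c x = u c x"
    "\<And>c x. c \<in> Ob simplex \<Longrightarrow> x \<in> val X c \<Longrightarrow> p c (h c x) = v c x"
  then show thesis by (intro that[of h]) simp_all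
qed (rule assms(4))

text \<open>Squares of maps on \<open>E\<close>: the first interval coordinate is the parameter of a
  homotopy, the second one deforms this homotopy. The open square lacks only the interior and the
  side where the second coordinate is 1.\<close>

abbreviation "square E \<equiv> (E \<times>\<^sub>p \<Delta>1) \<times>\<^sub>p \<Delta>1"
abbreviation "open_square E \<equiv> cyl (E \<times>\<^sub>p \<Delta>1) (corner E (\<lambda>_. {}) \<Delta>1 ends) \<Delta>1 (vx 0)"

lemma squareE:
  assumes "z \<in> val (square E) c"
  obtains e a b where "z = ((e, a), b)" "e \<in> val E c" "a \<in> smap c 1" "b \<in> smap c 1"
  using assms unfolding prod_psh_simps representable_simps by blast

text \<open>\<open>\<phi>\<close> is the bottom and \<open>\<psi>0\<close>, \<open>\<psi>1\<close>
  are the vertical sides over a given square \<open>v\<close> in the base; \<open>\<theta>\<close>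
  is the remaining side of a filler. Over a terminal base this composes homotopies; in general it
  also controls the projection of the composite.\<close>

lemma fill_square:
  assumes E: "presheaf simplex E" and rlp: "RLP simplex (square E) (open_square E) F B p"
    and \<phi>: "nat_on simplex (E \<times>\<^sub>p \<Delta>1) (val (E \<times>\<^sub>p \<Delta>1)) F \<phi>"
    and \<psi>0: "nat_on simplex (E \<times>\<^sub>p \<Delta>1) (val (E \<times>\<^sub>p \<Delta>1)) F \<psi>0"
    and \<psi>1: "nat_on simplex (E \<times>\<^sub>p \<Delta>1) (val (E \<times>\<^sub>p \<Delta>1)) F \<psi>1"
    and v: "nat_on simplex (square E) (val (square E)) B v"
    and c0: "\<And>c e. e \<in> val E c \<Longrightarrow> \<phi> c (e, vx 0 c) = \<psi>0 c (e, vx 0 c)"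
    and c1: "\<And>c e. e \<in> val E c \<Longrightarrow> \<phi> c (e, vx 1 c) = \<psi>1 c (e, vx 0 c)"
    and p\<phi>: "\<And>c e a. e \<in> val E c \<Longrightarrow> a \<in> smap c 1 \<Longrightarrow> p c (\<phi> c (e, a)) = v c ((e, a), vx 0 c)"
    and p\<psi>0: "\<And>c e b. e \<in> val E c \<Longrightarrow> b \<in> smap c 1 \<Longrightarrow> p c (\<psi>0 c (e, b)) = v c ((e, vx 0 c), b)"
    and p\<psi>1: "\<And>c e b. e \<in> val E c \<Longrightarrow> b \<in> smap c 1 \<Longrightarrow> p c (\<psi>1 c (e, b)) = v c ((e, vx 1 c), b)"
  obtains \<theta> where "nat_on simplex (E \<times>\<^sub>p \<Delta>1) (val (E \<times>\<^sub>p \<Delta>1)) F \<theta>"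
    "\<And>c e. e \<in> val E c \<Longrightarrow> \<theta> c (e, vx 0 c) = \<psi>0 c (e, vx 1 c)"
    "\<And>c e. e \<in> val E c \<Longrightarrow> \<theta> c (e, vx 1 c) = \<psi>1 c (e, vx 1 c)"
    "\<And>c e a. e \<in> val E c \<Longrightarrow> a \<in> smap c 1 \<Longrightarrow> p c (\<theta> c (e, a)) = v c ((e, a), vx 1 c)"
proof -
  note C = category_simplex
  define u where "u = (\<lambda>c ((e, a), b). if b = vx 0 c then \<phi> c (e, a) else if a = vx 0 c then \<psi>0 c (e, b) else \<psi>1 c (e, b))"
  have u: "u c ((e, a), vx 0 c) = \<phi> c (e, a)" for c e a by (simp add: u_def)
  have u0: "u c ((e, vx 0 c), b) = \<psi>0 c (e, b)" if "e \<in> val E c" for c e b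
    using c0[OF that] by (simp add: u_def)
  have u1: "u c ((e, vx 1 c), b) = \<psi>1 c (e, b)" if "e \<in> val E c" for c e b
    using c1[OF that] by (simp add: u_def)
  have cases: thesis if z: "z \<in> open_square E c"
    and "\<And>e a. z = ((e, a), vx 0 c) \<Longrightarrow> e \<in> val E c \<Longrightarrow> a \<in> smap c 1 \<Longrightarrow> thesis"
    and "\<And>e b. z = ((e, vx 0 c), b) \<Longrightarrow> e \<in> val E c \<Longrightarrow> b \<in> smap c 1 \<Longrightarrow> thesis"
    and "\<And>e b. z = ((e, vx 1 c), b) \<Longrightarrow> e \<in> val E c \<Longrightarrow> b \<in> smap c 1 \<Longrightarrow> thesis" for z c thesis
  proof -
    obtain e a b where z': "z = ((e, a), b)" by (metis prod.collapse)
    have "e \<in> val E c" "a \<in> smap c 1" "b \<in> smap c 1" "b = vx 0 c \<or> a = vx 0 c \<or> a = vx 1 c"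
      using z unfolding z' by auto
    then show thesis using that(2-4) z' by blast
  qed
  have un: "nat_on simplex (square E) (open_square E) F u"
  proof (rule nat_onI)
    fix c z assume "z \<in> open_square E c"
    then show "u c z \<in> val F c"
      by (rule cases)
        (use u u0 u1 nat_on_val[OF \<phi> simplex_Ob] nat_on_val[OF \<psi>0 simplex_Ob] nat_on_val[OF \<psi>1 simplex_Ob] in simp_all)
  next
    fix f z assume f: "f \<in> Ar simplex" and z: "z \<in> open_square E (tgt simplex f)"
    note V = vx_act[OF _ f, of 0] vx_act[OF _ f, of 1]
    note A = presheaf_act[OF E f refl refl] and N = nat_on_act[OF _ f refl refl]
    from z show "u (src simplex f) (act (square E) f z) = act F f (u (tgt simplex f) z)"
    proof (rule cases)
      fix e a assume "z = ((e, a), vx 0 (tgt simplex f))" "e \<in> val E (tgt simplex f)" "a \<in> smap (tgt simplex f) 1"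
      then show ?thesis using u V N[OF \<phi>, of "(e, a)"] by simp
    next
      fix e b assume "z = ((e, vx 0 (tgt simplex f)), b)" "e \<in> val E (tgt simplex f)" "b \<in> smap (tgt simplex f) 1"
      then show ?thesis using u0 V A N[OF \<psi>0, of "(e, b)"] by simp
    next
      fix e b assume "z = ((e, vx 1 (tgt simplex f)), b)" "e \<in> val E (tgt simplex f)" "b \<in> smap (tgt simplex f) 1"
      then show ?thesis using u1 V A N[OF \<psi>1, of "(e, b)"] by simp
    qed
  qed
  have pu: "p c (u c z) = v c z" if "z \<in> open_square E c" for c z
    using that by (rule cases) (simp_all add: u u0 u1 p\<phi> p\<psi>0 p\<psi>1 del: mem_Collect_eq)
  obtain h where h: "nat_on simplex (square E) (val (square E)) F h"
    "\<And>c z. z \<in> open_square E c \<Longrightarrow> h c z = u c z"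
    "\<And>c z. z \<in> val (square E) c \<Longrightarrow> p c (h c z) = v c z"
    using RLP_simplexE[OF rlp un v pu] by blast
  have v1: "vx 1 c \<in> smap c 1" "vx 0 c \<in> smap c 1" for c by (rule vx_val; simp)+
  show ?thesis
  proof (rule that[of "\<lambda>c z. h c (z, vx 1 c)"])
    have "nat_on simplex (E \<times>\<^sub>p \<Delta>1) (val (E \<times>\<^sub>p \<Delta>1)) (square E) (\<lambda>c z. (z, vx 1 c))"
      using v1 vx_act[of 1] by (intro nat_onI) auto
    from nat_on_comp[OF C this h(1)] v1
    show "nat_on simplex (E \<times>\<^sub>p \<Delta>1) (val (E \<times>\<^sub>p \<Delta>1)) F (\<lambda>c z. h c (z, vx 1 c))" by simp
  next
    fix c e assume e: "e \<in> val E c"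
    show "h c ((e, vx 0 c), vx 1 c) = \<psi>0 c (e, vx 1 c)"
      using h(2)[of "((e, vx 0 c), vx 1 c)" c] u0[OF e] e v1 by simp
    show "h c ((e, vx 1 c), vx 1 c) = \<psi>1 c (e, vx 1 c)"
      using h(2)[of "((e, vx 1 c), vx 1 c)" c] u1[OF e] e v1 by simp
    show "p c (h c ((e, a), vx 1 c)) = v c ((e, a), vx 1 c)" if "a \<in> smap c 1" for a
      using h(3)[of "((e, a), vx 1 c)" c] that e v1 by simp
  qed
qed

text \<open>A homotopy equivalence with the right lifting property against cylinder inclusions is a
  trivial fibration: the homotopy inverse is first deformed to a section \<open>s\<close>, then a homotopy from
  \<open>s p\<close> to the identity is deformed to a fibrewise one.\<close>

lemma trivial_fibration:
  assumes E: "presheaf simplex E" and B: "presheaf simplex B" and X: "presheaf simplex X" and A: "sub simplex X A"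
    and p: "nat_on simplex E (val E) B p"
    and r1: "RLP simplex (B \<times>\<^sub>p \<Delta>1) (cyl B (\<lambda>_. {}) \<Delta>1 (vx 0)) E B p"
    and r2: "RLP simplex (square E) (open_square E) E B p"
    and r3: "RLP simplex (square E) (open_square E) E terminal_psh (\<lambda>_ _. ())"
    and r4: "RLP simplex (X \<times>\<^sub>p \<Delta>1) (cyl X A \<Delta>1 (vx 0)) E B p"
    and g: "nat_on simplex B (val B) E g"
    and G: "nat_on simplex (E \<times>\<^sub>p \<Delta>1) (val (E \<times>\<^sub>p \<Delta>1)) E G"
    and G0: "\<And>c x. x \<in> val E c \<Longrightarrow> G c (x, vx 0 c) = g c (p c x)" and G1: "\<And>c x. x \<in> val E c \<Longrightarrow> G c (x, vx 1 c) = x"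
    and K: "nat_on simplex (B \<times>\<^sub>p \<Delta>1) (val (B \<times>\<^sub>p \<Delta>1)) B K"
    and K0: "\<And>c x. x \<in> val B c \<Longrightarrow> K c (x, vx 0 c) = p c (g c x)" and K1: "\<And>c x. x \<in> val B c \<Longrightarrow> K c (x, vx 1 c) = x"
  shows "RLP simplex X A E B p"
proof -
  note C = category_simplex
  have v1: "vx 1 c \<in> smap c 1" "vx 0 c \<in> smap c 1" for c by (rule vx_val; simp)+
  note gv = nat_on_val[OF g simplex_Ob] and pv = nat_on_val[OF p simplex_Ob]
  have fstB: "nat_on simplex (B \<times>\<^sub>p \<Delta>1) (cyl B (\<lambda>_. {}) \<Delta>1 (vx 0)) B (\<lambda>_. fst)"
    by (rule nat_onI) auto
  have fstE: "nat_on simplex (E \<times>\<^sub>p \<Delta>1) (val (E \<times>\<^sub>p \<Delta>1)) E (\<lambda>_. fst)"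
    by (rule nat_onI) auto
  have sB: "p c (g c (fst z)) = K c z" if "z \<in> cyl B (\<lambda>_. {}) \<Delta>1 (vx 0) c" for c z
    using that K0 by (cases z) auto
  have gB: "nat_on simplex (B \<times>\<^sub>p \<Delta>1) (cyl B (\<lambda>_. {}) \<Delta>1 (vx 0)) E (\<lambda>c z. g c (fst z))"
    by (rule nat_on_comp[OF C fstB g]) auto
  \<comment> \<open>\<open>K\<close> is lifted with starting value \<open>g\<close>. As
    \<open>K\<close> ends at the identity, the end of the lift is a section of
    \<open>p\<close>.\<close>
  obtain H where H: "nat_on simplex (B \<times>\<^sub>p \<Delta>1) (val (B \<times>\<^sub>p \<Delta>1)) E H"
    "\<And>c z. z \<in> cyl B (\<lambda>_. {}) \<Delta>1 (vx 0) c \<Longrightarrow> H c z = g c (fst z)"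
    "\<And>c z. z \<in> val (B \<times>\<^sub>p \<Delta>1) c \<Longrightarrow> p c (H c z) = K c z"
    using RLP_simplexE[OF r1 gB K sB] by blast
  have H0: "H c (b, vx 0 c) = g c b" if "b \<in> val B c" for c b
    using H(2)[of "(b, vx 0 c)" c] that v1 by simp
  define s where "s = (\<lambda>c b. H c (b, vx 1 c))"
  have s: "nat_on simplex B (val B) E s" unfolding s_def
  proof (rule nat_onI)
    fix c b assume "b \<in> val B c" then show "H c (b, vx 1 c) \<in> val E c"
      using nat_on_val[OF H(1) simplex_Ob] v1 by simp
  next
    fix f b assume "f \<in> Ar simplex" "b \<in> val B (tgt simplex f)"
    then show "H (src simplex f) (act B f b, vx 1 (src simplex f)) = act E f (H (tgt simplex f) (b, vx 1 (tgt simplex f)))"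
      using nat_on_act[OF H(1), of f "tgt simplex f" "src simplex f" "(b, vx 1 (tgt simplex f))"] v1 vx_act[of 1 f] by simp
  qed
  have ps: "p c (s c b) = b" if "b \<in> val B c" for c b
    using H(3)[of "(b, vx 1 c)" c] K1[OF that] that v1 by (simp add: s_def)
  note sv = nat_on_val[OF s simplex_Ob]
  define q where "q = (\<lambda>c z. (p c (fst z), snd z :: smor))"
  have q: "nat_on simplex (E \<times>\<^sub>p \<Delta>1) (val (E \<times>\<^sub>p \<Delta>1)) (B \<times>\<^sub>p \<Delta>1) q"
    using pv nat_on_act[OF p _ refl refl] by (intro nat_onI) (auto simp: q_def)
  note Hq = nat_on_comp[OF C q H(1) nat_on_val[OF q]]
  note gp = nat_on_comp[OF C p g pv]
  note gpf = nat_on_comp[OF C fstE gp nat_on_val[OF fstE]]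
  \<comment> \<open>The square has a constant bottom at \<open>g p\<close>, the lift of
    \<open>K\<close> on one side and \<open>G\<close> on the other; its top leads from
    \<open>s p\<close> to the identity.\<close>
  obtain G' where G': "nat_on simplex (E \<times>\<^sub>p \<Delta>1) (val (E \<times>\<^sub>p \<Delta>1)) E G'"
    "\<And>c e. e \<in> val E c \<Longrightarrow> G' c (e, vx 0 c) = s c (p c e)"
    "\<And>c e. e \<in> val E c \<Longrightarrow> G' c (e, vx 1 c) = e"
    by (rule fill_square[OF E r3 gpf Hq G nat_on_terminal[of _ _ _ "\<lambda>_ _. ()"]])
      (simp_all add: H0 G0 G1 pv q_def s_def that del: mem_Collect_eq)
  note G'v = nat_on_val[OF G'(1) simplex_Ob]
  note pG = nat_on_comp[OF C G'(1) p nat_on_val[OF G'(1)]]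
  note spG = nat_on_comp[OF C pG s nat_on_val[OF pG]]
  \<comment> \<open>The maximum makes this square equal to the path \<open>p G'\<close> at the
    bottom and on the side \<open>a = 0\<close>, and constant at \<open>p e\<close> on the other two
    sides.\<close>
  define v where "v = (\<lambda>c ((e, a), b). p c (G' c (e, smax c a b)))"
  have v: "nat_on simplex (square E) (val (square E)) B v"
  proof (rule nat_onI)
    fix c z assume "z \<in> val (square E) c"
    then obtain e a b where z: "z = ((e, a), b)" "e \<in> val E c" "a \<in> smap c 1" "b \<in> smap c 1"
      by (rule squareE)
    then show "v c z \<in> val B c" using nat_on_val[OF pG simplex_Ob, of "(e, smax c a b)" c] smax_smap[OF z(3,4)]
      by (simp add: v_def)
  next
    fix f z assume f: "f \<in> Ar simplex" and "z \<in> val (square E) (tgt simplex f)"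
    from this(2) obtain e a b where z: "z = ((e, a), b)" "e \<in> val E (tgt simplex f)"
      "a \<in> smap (tgt simplex f) 1" "b \<in> smap (tgt simplex f) 1" by (rule squareE)
    show "v (src simplex f) (act (square E) f z) = act B f (v (tgt simplex f) z)"
      using nat_on_act[OF pG f refl refl, of "(e, smax (tgt simplex f) a b)"] smax_smap[OF z(3,4)] z
        smax_act[OF z(3,4) smap_Ar[OF f]] by (simp add: v_def)
  qed
  \<comment> \<open>Over this square the bottom is \<open>G'\<close>, one side is
    \<open>s p G'\<close> and the other is constant; so the top is a homotopy from
    \<open>s p\<close> to the identity that stays in the fibres of \<open>p\<close>.\<close>
  obtain \<theta> where \<theta>: "nat_on simplex (E \<times>\<^sub>p \<Delta>1) (val (E \<times>\<^sub>p \<Delta>1)) E \<theta>"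
    "\<And>c e. e \<in> val E c \<Longrightarrow> \<theta> c (e, vx 0 c) = s c (p c e)"
    "\<And>c e. e \<in> val E c \<Longrightarrow> \<theta> c (e, vx 1 c) = e"
    "\<And>c e a. e \<in> val E c \<Longrightarrow> a \<in> smap c 1 \<Longrightarrow> p c (\<theta> c (e, a)) = p c e"
  proof (rule fill_square[OF E r2 G'(1) spG fstE v])
    fix c e assume e: "e \<in> val E c"
    show "G' c (e, vx 0 c) = s c (p c (G' c (e, vx 0 c)))"
      using G'(2)[OF e] ps[OF pv[OF e]] by simp
    show "G' c (e, vx 1 c) = fst (e, vx 0 c)" using G'(3)[OF e] by simp
    fix b assume b: "b \<in> smap c 1"
    show "p c (G' c (e, b)) = v c ((e, b), vx 0 c)" by (simp add: v_def smax_vx(1)[OF b])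
    show "p c (s c (p c (G' c (e, b)))) = v c ((e, vx 0 c), b)"
      using ps[OF pv[OF G'v, of "(e, b)" c]] e b by (simp add: v_def smax_vx(3)[OF b])
    show "p c (fst (e, b)) = v c ((e, vx 1 c), b)"
      using G'(3)[OF e] by (simp add: v_def smax_vx(4)[OF b])
  next
    fix \<theta> assume *: "nat_on simplex (E \<times>\<^sub>p \<Delta>1) (val (E \<times>\<^sub>p \<Delta>1)) E \<theta>"
      "\<And>c e. e \<in> val E c \<Longrightarrow> \<theta> c (e, vx 0 c) = s c (p c (G' c (e, vx 1 c)))"
      "\<And>c e. e \<in> val E c \<Longrightarrow> \<theta> c (e, vx 1 c) = fst (e, vx 1 c)"
      "\<And>c e a. e \<in> val E c \<Longrightarrow> a \<in> smap c 1 \<Longrightarrow> p c (\<theta> c (e, a)) = v c ((e, a), vx 1 c)"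
    show thesis
      by (rule that[OF *(1)]) (simp_all add: * G'(3) smax_vx(2) v_def del: mem_Collect_eq)
  qed
  show ?thesis
  proof (rule RLPI)
    fix u w assume u: "nat_on simplex X A E u" and w: "nat_on simplex X (val X) B w"
      and uw: "\<And>c x. c \<in> Ob simplex \<Longrightarrow> x \<in> A c \<Longrightarrow> p c (u c x) = w c x"
    note uv = nat_on_val[OF u simplex_Ob] and wv = nat_on_val[OF w simplex_Ob]
    \<comment> \<open>Over \<open>A\<close> the fibrewise homotopy carries \<open>s p u\<close> to
      \<open>u\<close>; elsewhere only the starting value \<open>s w\<close> is prescribed. The
      solution is read off at the end 1.\<close>
    define k where "k = (\<lambda>c (x, t). if x \<in> A c then \<theta> c (u c x, t) else s c (w c x))"
    have kA: "k c (x, t) = \<theta> c (u c x, t)" if "x \<in> A c" for c x t using that by (simp add: k_def)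
    have k0: "k c (x, vx 0 c) = s c (w c x)" for c x
      using \<theta>(2)[OF uv] uw[OF simplex_Ob] by (simp add: k_def)
    let ?cyl = "cyl X A \<Delta>1 (vx 0)"
    have cases: thesis if z: "z \<in> ?cyl c"
      and "\<And>x t. z = (x, t) \<Longrightarrow> x \<in> A c \<Longrightarrow> x \<in> val X c \<Longrightarrow> t \<in> smap c 1 \<Longrightarrow> thesis"
      and "\<And>x. z = (x, vx 0 c) \<Longrightarrow> x \<in> val X c \<Longrightarrow> thesis" for z c thesis
      using that by (cases z) auto
    have kn: "nat_on simplex (X \<times>\<^sub>p \<Delta>1) ?cyl E k"
    proof (rule nat_onI)
      fix c z assume "z \<in> ?cyl c" then show "k c z \<in> val E c"
        by (rule cases) (use kA k0 nat_on_val[OF \<theta>(1) simplex_Ob] uv sv wv in simp_all)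
    next
      fix f z assume f: "f \<in> Ar simplex" and z: "z \<in> ?cyl (tgt simplex f)"
      from z show "k (src simplex f) (act (X \<times>\<^sub>p \<Delta>1) f z) = act E f (k (tgt simplex f) z)"
      proof (rule cases)
        fix x t assume x: "z = (x, t)" "x \<in> A (tgt simplex f)" "t \<in> smap (tgt simplex f) 1"
        show ?thesis
          using kA[OF x(2)] kA[OF sub_act[OF A f refl refl x(2)]] nat_on_act[OF u f refl refl x(2)]
            nat_on_act[OF \<theta>(1) f refl refl, of "(u (tgt simplex f) x, t)"] uv[OF x(2)] x by simp
      next
        fix x assume x: "z = (x, vx 0 (tgt simplex f))" "x \<in> val X (tgt simplex f)"
        show ?thesis
          using k0 nat_on_act[OF w f refl refl x(2)] nat_on_act[OF s f refl refl wv[OF x(2)]]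
            vx_act[OF _ f, of 0] x by simp
      qed
    qed
    have wn: "nat_on simplex (X \<times>\<^sub>p \<Delta>1) (val (X \<times>\<^sub>p \<Delta>1)) B (\<lambda>c z. w c (fst z))"
      by (rule nat_on_comp[OF C _ w, of _ _ "\<lambda>c. fst"]) (auto intro: nat_onI)
    have pk: "p c (k c z) = w c (fst z)" if "z \<in> ?cyl c" for c z
      using that by (rule cases) (simp_all add: kA k0 \<theta>(4) uv uw ps wv del: mem_Collect_eq)
    obtain h where h: "nat_on simplex (X \<times>\<^sub>p \<Delta>1) (val (X \<times>\<^sub>p \<Delta>1)) E h"
      "\<And>c z. z \<in> ?cyl c \<Longrightarrow> h c z = k c z" "\<And>c z. z \<in> val (X \<times>\<^sub>p \<Delta>1) c \<Longrightarrow> p c (h c z) = w c (fst z)"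
      using RLP_simplexE[OF r4 kn wn pk] by blast
    show "\<exists>h. nat_on simplex X (val X) E h \<and> (\<forall>c\<in>Ob simplex. \<forall>x\<in>A c. h c x = u c x) \<and>
        (\<forall>c\<in>Ob simplex. \<forall>x\<in>val X c. p c (h c x) = w c x)"
    proof (intro exI conjI ballI)
      have "nat_on simplex X (val X) (X \<times>\<^sub>p \<Delta>1) (\<lambda>c x. (x, vx 1 c))"
        using v1 vx_act[of 1] by (intro nat_onI) auto
      from nat_on_comp[OF C this h(1)] v1
      show "nat_on simplex X (val X) E (\<lambda>c x. h c (x, vx 1 c))" by simp
      fix c x
      show "h c (x, vx 1 c) = u c x" if "x \<in> A c"
        using h(2)[of "(x, vx 1 c)" c] kA[OF that] \<theta>(3)[OF uv[OF that]] subD[OF A simplex_Ob that] that v1 by simp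
      show "p c (h c (x, vx 1 c)) = w c x" if "x \<in> val X c"
        using h(3)[of "(x, vx 1 c)" c] that v1 by simp
    qed
  qed
qed


section \<open>Lifting properties of \<open>D\<close>-left fibrations\<close>

lemma dsimp_cat_simps [simp]:
  "(d, k, l) \<in> Ob (dsimp_cat D) \<longleftrightarrow> d \<in> Ob D"
  "(f, \<alpha>, \<beta>) \<in> Ar (dsimp_cat D) \<longleftrightarrow> f \<in> Ar D \<and> \<alpha> \<in> Ar simplex \<and> \<beta> \<in> Ar simplex"
  "src (dsimp_cat D) (f, \<alpha>, \<beta>) = (src D f, src simplex \<alpha>, src simplex \<beta>)"
  "tgt (dsimp_cat D) (f, \<alpha>, \<beta>) = (tgt D f, tgt simplex \<alpha>, tgt simplex \<beta>)"
  "idn (dsimp_cat D) (d, k, l) = (idn D d, idn simplex k, idn simplex l)"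
  "cmp (dsimp_cat D) (f, \<alpha>, \<beta>) (f', \<alpha>', \<beta>') = (cmp D f f', cmp simplex \<alpha> \<alpha>', cmp simplex \<beta> \<beta>')"
  by (simp_all add: dsimp_cat_def)

lemma category_dsimp: "category D \<Longrightarrow> category (dsimp_cat D)"
  unfolding dsimp_cat_def by (intro category_prod category_simplex)

text \<open>The simplicial set \<open>Z(d, n, -)\<close>, spelled so that it is literally the object
  occurring in \<open>objectwise_kan_equivalence\<close> and in
  \<open>left_fibration\<close>.\<close>

abbreviation sl :: "('o, 'm) cat \<Rightarrow> ('o, 'm, 'a) dspace \<Rightarrow> 'o \<Rightarrow> nat \<Rightarrow> 'a sset" where
  "sl D Z d n \<equiv> level (und D d Z) n"

lemma sl_simps [simp]:
  "val (sl D Z d n) l = val Z (d, n, l)" "act (sl D Z d n) \<beta> = act Z (idn D d, idn simplex n, \<beta>)"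
  by (simp_all add: level_def und_def)

lemma sl_restr: "sl D (restr Z A) d n = restr (sl D Z d n) (\<lambda>l. A (d, n, l))"
  by (simp add: level_def und_def restr_def)

lemma idn_simplex_Ar [simp]:
  "idn simplex n \<in> Ar simplex" "src simplex (idn simplex n) = n" "tgt simplex (idn simplex n) = n"
  using idn_smap[of n] by auto

lemma simplex_unit [simp]:
  assumes "\<alpha> \<in> Ar simplex"
  shows "cmp simplex \<alpha> (idn simplex (src simplex \<alpha>)) = \<alpha>" "cmp simplex (idn simplex (tgt simplex \<alpha>)) \<alpha> = \<alpha>"
  using category_unit[OF category_simplex assms] by auto

lemma presheaf_sl:
  assumes "category D" "presheaf (dsimp_cat D) Z" "d \<in> Ob D" shows "presheaf simplex (sl D Z d n)"
proof (rule presheafI, unfold sl_simps)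
  note i = category_idn[OF assms(1,3)]
  fix f x assume f: "f \<in> Ar simplex" "x \<in> val Z (d, n, tgt simplex f)"
  show "act Z (idn D d, idn simplex n, f) x \<in> val Z (d, n, src simplex f)"
    by (rule presheaf_act[OF assms(2) _ _ _ f(2)]) (use i f in simp_all)
next
  note i = category_idn[OF assms(1,3)]
  fix c x assume "x \<in> val Z (d, n, c)"
  then show "act Z (idn D d, idn simplex n, idn simplex c) x = x"
    using presheaf_idn[OF assms(2), of "(d, n, c)" x] assms(3) by simp
next
  note i = category_idn[OF assms(1,3)]
  fix f g x assume f: "f \<in> Ar simplex" "g \<in> Ar simplex" "src simplex g = tgt simplex f"
    "x \<in> val Z (d, n, tgt simplex g)"
  have "cmp (dsimp_cat D) (idn D d, idn simplex n, g) (idn D d, idn simplex n, f) =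
      (idn D d, idn simplex n, cmp simplex g f)"
    using category_unit(1)[OF assms(1) i(1,2)] category_unit(1)[OF category_simplex, of "idn simplex n" n] by simp
  then show "act Z (idn D d, idn simplex n, cmp simplex g f) x =
      act Z (idn D d, idn simplex n, f) (act Z (idn D d, idn simplex n, g) x)"
    using presheaf_cmp[OF assms(2), of "(idn D d, idn simplex n, f)" "(idn D d, idn simplex n, g)" _ x] f i by simp
qed

lemma nat_on_sl:
  assumes "category D" "nat_on (dsimp_cat D) Z A Y t" "d \<in> Ob D"
  shows "nat_on simplex (sl D Z d n) (\<lambda>l. A (d, n, l)) (sl D Y d n) (\<lambda>l. t (d, n, l))"
proof (rule nat_onI, unfold sl_simps)
  fix c x assume "x \<in> A (d, n, c)" then show "t (d, n, c) x \<in> val Y (d, n, c)"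
    using nat_on_val[OF assms(2)] assms(3) by simp
next
  fix f x assume f: "f \<in> Ar simplex" "x \<in> A (d, n, tgt simplex f)"
  then show "t (d, n, src simplex f) (act Z (idn D d, idn simplex n, f) x) =
      act Y (idn D d, idn simplex n, f) (t (d, n, tgt simplex f) x)"
    by (intro nat_on_act[OF assms(2)]) (use category_idn[OF assms(1,3)] in simp_all)
qed

lemma sub_sl:
  assumes "category D" "sub (dsimp_cat D) Z A" "d \<in> Ob D"
  shows "sub simplex (sl D Z d n) (\<lambda>l. A (d, n, l))"
  unfolding sub_def sl_simps
proof (intro conjI ballI subsetI)
  fix c x assume "x \<in> A (d, n, c)" then show "x \<in> val Z (d, n, c)"
    using subD[OF assms(2)] assms(3) by simp
next
  fix f x assume f: "f \<in> Ar simplex" "x \<in> A (d, n, tgt simplex f)"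
  then show "act Z (idn D d, idn simplex n, f) x \<in> A (d, n, src simplex f)"
    by (intro sub_act[OF assms(2)]) (use category_idn[OF assms(1,3)] in simp_all)
qed

text \<open>The deformation is conjugated by \<open>i\<close> and \<open>r\<close>; for this it is
  enough that \<open>Y\<close> is a retract of \<open>X\<close>, compatibly with the
  subobjects.\<close>

lemma contracts_iso:
  assumes C: "category C" and "contracts C I e0 e1 X A"
    and i: "nat_on C X (val X) Y i" and r: "nat_on C Y (val Y) X r"
    and ir: "\<And>c y. c \<in> Ob C \<Longrightarrow> y \<in> val Y c \<Longrightarrow> i c (r c y) = y"
    and iA: "\<And>c x. c \<in> Ob C \<Longrightarrow> x \<in> A c \<Longrightarrow> i c x \<in> B c" and rB: "\<And>c x. c \<in> Ob C \<Longrightarrow> x \<in> B c \<Longrightarrow> r c x \<in> A c"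
  shows "contracts C I e0 e1 Y B"
proof -
  obtain H where H: "nat_on C (X \<times>\<^sub>p I) (val (X \<times>\<^sub>p I)) X H"
     "\<And>c x. c \<in> Ob C \<Longrightarrow> x \<in> val X c \<Longrightarrow> H c (x, e1 c) = x \<and> H c (x, e0 c) \<in> A c"
     "\<And>c x t. c \<in> Ob C \<Longrightarrow> x \<in> A c \<Longrightarrow> t \<in> val I c \<Longrightarrow> H c (x, t) \<in> A c"
    using assms(2) unfolding contracts_def by blast
  have rI: "nat_on C (Y \<times>\<^sub>p I) (val (Y \<times>\<^sub>p I)) (X \<times>\<^sub>p I) (\<lambda>c z. (r c (fst z), snd z))"
    using nat_on_val[OF r] nat_on_act[OF r _ refl refl] by (intro nat_onI) auto
  note 1 = nat_on_comp[OF C rI H(1) nat_on_val[OF rI]]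
  note 2 = nat_on_comp[OF C 1 i nat_on_val[OF 1]]
  show ?thesis
    by (rule contractsI[OF 2]) (use H(2,3) ir iA rB nat_on_val[OF r] in simp_all)
qed

section \<open>Smallness relative to the universe\<close>

definition small_set :: "'u itself \<Rightarrow> 'x set \<Rightarrow> bool" where
  "small_set U A \<longleftrightarrow> A \<lesssim> (UNIV :: 'u set)"

definition small_psh :: "'u itself \<Rightarrow> ('o, 'm) cat \<Rightarrow> ('o, 'm, 'x) psh \<Rightarrow> bool" where
  "small_psh U C X \<longleftrightarrow> (\<forall>c\<in>Ob C. small_set U (val X c))"

lemma small_psh_inj:
  assumes "small_psh (U :: 'u itself) C X"
  obtains \<iota> :: "'o \<Rightarrow> 'x \<Rightarrow> 'u" where "\<And>c. c \<in> Ob C \<Longrightarrow> inj_on (\<iota> c) (val X c)"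
proof -
  have "\<forall>c\<in>Ob C. \<exists>f :: 'x \<Rightarrow> 'u. inj_on f (val X c)"
    using assms unfolding small_psh_def small_set_def lepoll_def by blast
  then show ?thesis using that by metis
qed

lemma small_inj:
  assumes "small_set U B" "inj_on f A" "f ` A \<subseteq> B" shows "small_set U A"
  using lepoll_trans[of A B UNIV] assms unfolding small_set_def lepoll_def by blast

lemma small_subset: "small_set U B \<Longrightarrow> A \<subseteq> B \<Longrightarrow> small_set U A"
  by (rule small_inj[of U B id]) auto

lemma small_base: "small_set (U :: 'u itself) (A :: 'u set)"
  unfolding small_set_def by (rule subset_imp_lepoll) simp

locale universe =
  fixes D :: "('o, 'm) cat" and U :: "'u itself"
  assumes small_in: "small_in U D"
begin

abbreviation \<C> :: "('o dob, 'm dmor) cat" where "\<C> \<equiv> dsimp_cat D"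

lemma catD: "category D"
  using small_in unfolding small_in_def by blast

lemma catC: "category \<C>"
  by (rule category_dsimp[OF catD])

text \<open>The exponent granted by \<open>small_in\<close> is a powerset. An index \<open>s\<close>
  is represented in it by the singleton of \<open>\<kappa> s\<close>, so a function on
  \<open>S\<close> becomes a function on the powerset and then an element of the universe.\<close>

lemma small_functions:
  assumes \<kappa>: "inj_on \<kappa> S" "\<kappa> ` S \<subseteq> Ar D \<times> (UNIV :: nat set)"
    and F: "\<And>f g. f \<in> F \<Longrightarrow> g \<in> F \<Longrightarrow> (\<And>s. s \<in> S \<Longrightarrow> f s = g s) \<Longrightarrow> f = (g :: 's \<Rightarrow> 'u)"
  shows "small_set U F"
proof -
  let ?P = "Pow (Ar D \<times> (UNIV :: nat set))"
  obtain e :: "(('m \<times> nat) set \<Rightarrow> 'u) \<Rightarrow> 'u" where e: "inj_on e (?P \<rightarrow>\<^sub>E UNIV)"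
    using small_in unfolding small_in_def by blast
  define \<phi> where "\<phi> = (\<lambda>f :: 's \<Rightarrow> 'u. \<lambda>T\<in>?P. f (inv_into S \<kappa> (the_elem T)))"
  have "inj_on \<phi> F"
  proof (rule inj_onI, rule F)
    fix f g s assume "\<phi> f = \<phi> g" "s \<in> S"
    moreover have "\<phi> h {\<kappa> s} = h s" for h
      using \<kappa> \<open>s \<in> S\<close> by (auto simp: \<phi>_def)
    ultimately show "f s = g s" by metis
  qed
  moreover have "\<phi> ` F \<subseteq> ?P \<rightarrow>\<^sub>E UNIV"
    by (simp add: \<phi>_def image_subset_iff restrict_PiE_iff)
  ultimately have "inj_on (e \<circ> \<phi>) F" using e by (metis comp_inj_on inj_on_subset)
  then show ?thesis unfolding small_set_def lepoll_def by blast
qed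

text \<open>Points are coded by their indicator functions, with two distinct elements of the
  universe as truth values.\<close>

lemma small_index:
  assumes \<kappa>: "inj_on \<kappa> S" "\<kappa> ` S \<subseteq> Ar D \<times> (UNIV :: nat set)" shows "small_set U S"
proof -
  obtain a b :: 'u where ab: "a \<noteq> b" using small_in unfolding small_in_def by blast
  let ?f = "\<lambda>x s. if s = x then a else b"
  have "small_set U (?f ` S)"
  proof (rule small_functions[OF \<kappa>])
    fix f g assume "f \<in> ?f ` S" "g \<in> ?f ` S" and eq: "\<And>s. s \<in> S \<Longrightarrow> f s = g s"
    then obtain x y where xy: "x \<in> S" "y \<in> S" "f = ?f x" "g = ?f y" by blast
    then have "x = y" using eq[of x] ab by (auto split: if_splits)
    then show "f = g" using xy by simp
  qed
  moreover have "inj_on ?f S" using ab by (intro inj_onI) (metis (mono_tags))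
  ultimately show ?thesis by (rule small_inj) simp
qed

text \<open>A pair is a function on two points. The object \<open>d\<close> supplies an identity
  arrow, which embeds the two points into \<open>Ar D \<times> UNIV\<close>.\<close>

lemma small_times:
  assumes "d \<in> Ob D" "small_set U A" "small_set U B" shows "small_set U (A \<times> B)"
proof -
  obtain f g :: "_ \<Rightarrow> 'u" where fg: "inj_on f A" "inj_on g B"
    using assms(2,3) unfolding small_set_def lepoll_def by blast
  let ?h = "\<lambda>(a, b) (s :: nat). if s = 0 then f a else g b"
  have "small_set U (?h ` (A \<times> B))"
  proof (rule small_functions[of "\<lambda>s. (idn D d, s)" "{0, 1}"])
    fix u v assume "u \<in> ?h ` (A \<times> B)" "v \<in> ?h ` (A \<times> B)" and eq: "\<And>s. s \<in> {0, 1} \<Longrightarrow> u s = v s"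
    then obtain a b a' b' where uv: "u = ?h (a, b)" "v = ?h (a', b')" by blast
    have "f a = f a'" "g b = g b'" using eq[of 0] eq[of 1] unfolding uv by simp_all
    then show "u = v" unfolding uv by (simp cong: if_cong)
  qed (use category_idn[OF catD assms(1)] in \<open>auto simp: inj_on_def\<close>)
  moreover have "inj_on ?h (A \<times> B)"
  proof (rule inj_onI, clarify)
    fix a b a' b' assume *: "a \<in> A" "b \<in> B" "a' \<in> A" "b' \<in> B"
      and "(\<lambda>s :: nat. if s = 0 then f a else g b) = (\<lambda>s. if s = 0 then f a' else g b')"
    then have "f a = f a'" "g b = g b'" by (metis, metis zero_neq_one)
    then show "a = a' \<and> b = b'" using * fg by (auto dest: inj_onD)
  qed
  ultimately show ?thesis by (rule small_inj) simp
qed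

lemma small_countable:
  fixes A :: "'c :: countable set" assumes "d \<in> Ob D" shows "small_set U A"
  by (rule small_index[of "\<lambda>x. (idn D d, to_nat x)"])
    (use category_idn[OF catD assms] in \<open>auto simp: inj_on_def\<close>)

lemma small_arrows': assumes "A \<subseteq> Ar D" shows "small_set U A"
  by (rule small_index[of "\<lambda>f. (f, 0)"]) (use assms in \<open>auto simp: inj_on_def\<close>)

lemma small_prod:
  assumes "small_psh U \<C> X" "small_psh U \<C> Y" shows "small_psh U \<C> (X \<times>\<^sub>p Y)"
  unfolding small_psh_def
proof
  fix c assume c: "c \<in> Ob \<C>"
  then obtain d k l where "c = (d, k, l)" "d \<in> Ob D" by (metis prod_cases3 dsimp_cat_simps(1))
  then show "small_set U (val (X \<times>\<^sub>p Y) c)"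
    unfolding prod_psh_simps using assms c small_times unfolding small_psh_def by blast
qed

text \<open>The gateway to injective fibrations: \<open>Z\<close> is copied into the universe, the
  inclusion is an objectwise Kan equivalence by \<open>kan_equivalence_contracts\<close>, and the
  lifting property is carried back along the copy. The deformations at different
  \<open>(d, n)\<close> may be unrelated; \<open>kP_contracts\<close> relies on this
  freedom.\<close>

lemma injective_fibration_RLP:
  fixes Z :: "('o, 'm, 'z) dspace" and L :: "('o, 'm, 'u) dspace" and W :: "('o, 'm, 'w) dspace"
  assumes p: "injective_fibration D L W p" and Z: "presheaf \<C> Z" and s: "small_psh U \<C> Z" and A: "sub \<C> Z A"
    and con: "\<And>d n. d \<in> Ob D \<Longrightarrow> \<exists>\<epsilon>. (\<epsilon> = 0 \<or> \<epsilon> = 1) \<and> scontracts \<epsilon> (sl D Z d n) (\<lambda>l. A (d, n, l))"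
  shows "RLP \<C> Z A L W p"
proof -
  obtain \<iota> :: "'o dob \<Rightarrow> 'z \<Rightarrow> 'u" where \<iota>: "\<And>c. c \<in> Ob \<C> \<Longrightarrow> inj_on (\<iota> c) (val Z c)"
    using small_psh_inj[OF s] by blast
  let ?B = "copy \<C> \<iota> Z"
  define A' where "A' = (\<lambda>c. \<iota> c ` A c)"
  note F = copy_facts[OF catC Z, of \<iota>, OF \<iota>]
  have ri: "uncopy \<iota> Z c (\<iota> c x) = x" if "c \<in> Ob \<C>" "x \<in> val Z c" for c x
    using \<iota>[OF that(1)] that(2) by simp
  have ir: "\<iota> c (uncopy \<iota> Z c y) = y" if "y \<in> val ?B c" for c y
    using that by (auto simp: f_inv_into_f)
  have A': "sub \<C> ?B A'" unfolding sub_def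
  proof (intro conjI ballI subsetI)
    fix c y assume c: "c \<in> Ob \<C>" "y \<in> A' c"
    then obtain x where "x \<in> A c" "y = \<iota> c x" by (auto simp: A'_def)
    then show "y \<in> val ?B c" using subD[OF A c(1)] by simp
  next
    fix f y assume f: "f \<in> Ar \<C>" "y \<in> A' (tgt \<C> f)"
    then obtain x where x: "x \<in> A (tgt \<C> f)" "y = \<iota> (tgt \<C> f) x" by (auto simp: A'_def)
    have "act ?B f y = \<iota> (src \<C> f) (act Z f x)"
      unfolding x(2) by (rule nat_on_act[OF F(2) f(1) refl refl subD[OF A category_Ob(2)[OF catC f(1)] x(1)], symmetric])
    then show "act ?B f y \<in> A' (src \<C> f)"
      using sub_act[OF A f(1) refl refl x(1)] by (simp only: A'_def imageI)
  qed
  let ?A = "restr ?B A'"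
  let ?j = "id_transf \<C> ?A"
  have PA: "presheaf \<C> ?A" by (rule presheaf_restr[OF catC F(1) A'])
  have "objectwise_kan_equivalence D ?A ?B ?j"
    unfolding objectwise_kan_equivalence_def
  proof (intro ballI allI)
    fix d n assume d: "d \<in> Ob D"
    obtain \<epsilon> where e: "\<epsilon> = 0 \<or> \<epsilon> = 1" "scontracts \<epsilon> (sl D Z d n) (\<lambda>l. A (d, n, l))" using con[OF d] by blast
    have con': "scontracts \<epsilon> (sl D ?B d n) (\<lambda>l. A' (d, n, l))"
    proof (rule contracts_iso[OF category_simplex e(2)])
      show "nat_on simplex (sl D Z d n) (val (sl D Z d n)) (sl D ?B d n) (\<lambda>l. \<iota> (d, n, l))"
        using nat_on_sl[OF catD F(2) d, of n] by (simp add: level_def und_def)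
      show "nat_on simplex (sl D ?B d n) (val (sl D ?B d n)) (sl D Z d n) (\<lambda>l. uncopy \<iota> Z (d, n, l))"
        using nat_on_sl[OF catD F(3) d, of n] by (simp add: level_def und_def)
    qed (use ir ri d subD[OF A] in \<open>auto simp: A'_def\<close>)
    have "level_map n (und_map d ?j) = id_transf simplex (restr (sl D ?B d n) (\<lambda>l. A' (d, n, l)))"
      using d by (auto simp: level_map_def und_map_def id_transf_def transf_def fun_eq_iff restrict_def)
    then show "kan_equivalence (sl D ?A d n) (sl D ?B d n) (level_map n (und_map d ?j))"
      unfolding sl_restr
      using kan_equivalence_contracts[OF presheaf_sl[OF catD F(1) d] sub_sl[OF catD A' d] e(1) con'] by simp
  qed
  moreover have "mono_transf \<C> ?A ?j"
    unfolding mono_transf_def id_transf_def by (auto simp: inj_on_def)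
  ultimately have "lifts \<C> ?A ?B ?j L W p"
    using p PA F(1) incl_hom[OF catC F(1) A'] unfolding injective_fibration_def by blast
  then have l: "lifts \<C> ?A ?B ?j L W p" .
  have "RLP \<C> ?B A' L W p" by (rule RLP_of_lifts[OF catC F(1) A' l])
  then show ?thesis
    by (rule RLP_retract[OF catC _ A A' F(2) F(3)]) (use ri subD[OF A] in \<open>auto simp: A'_def\<close>)
qed

end

text \<open>External product of the presheaf represented by \<open>d\<close>, a simplicial set
  \<open>T\<close> in the simplicial direction and a simplicial set \<open>X\<close> in the space
  direction.\<close>

definition box :: "('o, 'm) cat \<Rightarrow> 'o \<Rightarrow> 't sset \<Rightarrow> 'x sset \<Rightarrow> ('o, 'm, 'm \<times> 't \<times> 'x) dspace" where
  "box D d T X = \<lparr>val = (\<lambda>(d', k, l). {g \<in> Ar D. src D g = d' \<and> tgt D g = d} \<times> val T k \<times> val X l),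
     act = (\<lambda>(f, \<alpha>, \<beta>) (g, \<tau>, x). (cmp D g f, act T \<alpha> \<tau>, act X \<beta> x))\<rparr>"

definition box_corner ::
  "('o, 'm) cat \<Rightarrow> 'o \<Rightarrow> 't sset \<Rightarrow> (nat \<Rightarrow> 't set) \<Rightarrow> 'x sset \<Rightarrow> (nat \<Rightarrow> 'x set) \<Rightarrow>
   'o dob \<Rightarrow> ('m \<times> 't \<times> 'x) set" where
  "box_corner D d T S X A = (\<lambda>(d', k, l). {(g, \<tau>, x) \<in> val (box D d T X) (d', k, l). \<tau> \<in> S k \<or> x \<in> A l})"

lemma box_simps [simp]:
  "(g, \<tau>, x) \<in> val (box D d T X) (d', k, l) \<longleftrightarrow>
     g \<in> Ar D \<and> src D g = d' \<and> tgt D g = d \<and> \<tau> \<in> val T k \<and> x \<in> val X l"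
  "act (box D d T X) (f, \<alpha>, \<beta>) (g, \<tau>, x) = (cmp D g f, act T \<alpha> \<tau>, act X \<beta> x)"
  "(g, \<tau>, x) \<in> box_corner D d T S X A (d', k, l) \<longleftrightarrow>
     g \<in> Ar D \<and> src D g = d' \<and> tgt D g = d \<and> \<tau> \<in> val T k \<and> x \<in> val X l \<and> (\<tau> \<in> S k \<or> x \<in> A l)"
  by (auto simp: box_def box_corner_def)

lemma presheaf_box:
  assumes "category D" "presheaf simplex T" "presheaf simplex X" shows "presheaf (dsimp_cat D) (box D d T X)"
proof (rule presheafI)
  fix f z assume f: "f \<in> Ar (dsimp_cat D)" "z \<in> val (box D d T X) (tgt (dsimp_cat D) f)"
  obtain f0 \<alpha> \<beta> g \<tau> x where *: "f = (f0, \<alpha>, \<beta>)" "z = (g, \<tau>, x)" by (metis prod_cases3)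
  show "act (box D d T X) f z \<in> val (box D d T X) (src (dsimp_cat D) f)"
    using f assms unfolding * by (simp add: category_cmp presheaf_act)
next
  fix c z assume f: "c \<in> Ob (dsimp_cat D)" "z \<in> val (box D d T X) c"
  obtain d' k l g \<tau> x where *: "c = (d', k, l)" "z = (g, \<tau>, x)" by (metis prod_cases3)
  show "act (box D d T X) (idn (dsimp_cat D) c) z = z"
    using f assms unfolding * by (simp add: category_unit presheaf_idn)
next
  fix f h z assume f: "f \<in> Ar (dsimp_cat D)" "h \<in> Ar (dsimp_cat D)" "src (dsimp_cat D) h = tgt (dsimp_cat D) f"
    "z \<in> val (box D d T X) (tgt (dsimp_cat D) h)"
  obtain f0 \<alpha> \<beta> f1 \<alpha>1 \<beta>1 g \<tau> x where *: "f = (f0, \<alpha>, \<beta>)" "h = (f1, \<alpha>1, \<beta>1)" "z = (g, \<tau>, x)"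
    by (metis prod_cases3)
  show "act (box D d T X) (cmp (dsimp_cat D) h f) z = act (box D d T X) f (act (box D d T X) h z)"
    using f assms unfolding * by (simp add: category_assoc[OF assms(1)] presheaf_cmp)
qed

lemma sub_box:
  assumes "category D" "presheaf simplex T" "presheaf simplex X" "sub simplex T S" "sub simplex X A"
  shows "sub (dsimp_cat D) (box D d T X) (box_corner D d T S X A)"
  unfolding sub_def
proof (intro conjI ballI subsetI)
  fix c z assume "z \<in> box_corner D d T S X A c" then show "z \<in> val (box D d T X) c"
    by (cases c) (auto simp: box_corner_def)
next
  fix f z assume f: "f \<in> Ar (dsimp_cat D)" "z \<in> box_corner D d T S X A (tgt (dsimp_cat D) f)"
  obtain f0 \<alpha> \<beta> g \<tau> x where *: "f = (f0, \<alpha>, \<beta>)" "z = (g, \<tau>, x)" by (metis prod_cases3)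
  show "act (box D d T X) f z \<in> box_corner D d T S X A (src (dsimp_cat D) f)"
    using f assms(1-3) sub_act[OF assms(4), of \<alpha>] sub_act[OF assms(5), of \<beta>] unfolding *
    by (auto simp: category_cmp presheaf_act)
qed

text \<open>The deformation acts on the space coordinate only, so simplices over \<open>S\<close>
  stay over \<open>S\<close>.\<close>

lemma box_contracts:
  assumes D: "category D" and X: "presheaf simplex X" and A: "sub simplex X A" and T: "presheaf simplex T"
    and con: "scontracts \<epsilon> X A" and d': "d' \<in> Ob D"
  shows "scontracts \<epsilon> (sl D (box D d T X) d' k) (\<lambda>l. box_corner D d T S X A (d', k, l))"
proof -
  obtain H where H: "nat_on simplex (X \<times>\<^sub>p \<Delta>1) (val (X \<times>\<^sub>p \<Delta>1)) X H"
     "\<And>c x. c \<in> Ob simplex \<Longrightarrow> x \<in> val X c \<Longrightarrow> H c (x, vx (1 - \<epsilon>) c) = x \<and> H c (x, vx \<epsilon> c) \<in> A c"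
     "\<And>c x t. c \<in> Ob simplex \<Longrightarrow> x \<in> A c \<Longrightarrow> t \<in> val \<Delta>1 c \<Longrightarrow> H c (x, t) \<in> A c"
    using con unfolding contracts_def by blast
  have Hv: "H c (x, t) \<in> val X c" if "x \<in> val X c" "t \<in> val \<Delta>1 c" for c x t
    using nat_on_val[OF H(1), of c "(x, t)"] that by simp
  define K where "K = (\<lambda>c ((g :: 'b, \<tau> :: 'd, x), t). (g, \<tau>, H c (x, t)))"
  have K: "K c ((g, \<tau>, x), t) = (g, \<tau>, H c (x, t))" for c g \<tau> x t by (simp add: K_def)
  let ?Z = "sl D (box D d T X) d' k"
  show ?thesis
  proof (rule contractsI)
    show "nat_on simplex (?Z \<times>\<^sub>p \<Delta>1) (val (?Z \<times>\<^sub>p \<Delta>1)) ?Z K"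
    proof (rule nat_onI)
      fix c z assume z: "z \<in> val (?Z \<times>\<^sub>p \<Delta>1) c"
      obtain g \<tau> x t where *: "z = ((g, \<tau>, x), t)" by (metis prod.collapse)
      show "K c z \<in> val ?Z c" using z Hv[of x c t] unfolding * K by simp
    next
      fix f z assume f: "f \<in> Ar simplex" "z \<in> val (?Z \<times>\<^sub>p \<Delta>1) (tgt simplex f)"
      obtain g \<tau> x t where *: "z = ((g, \<tau>, x), t)" by (metis prod.collapse)
      show "K (src simplex f) (act (?Z \<times>\<^sub>p \<Delta>1) f z) = act ?Z f (K (tgt simplex f) z)"
        using f nat_on_act[OF H(1) f(1) refl refl, of "(x, t)"] unfolding * by (simp add: K)
    qed
  next
    fix c z assume z: "z \<in> val ?Z c"
    obtain g \<tau> x where *: "z = (g, \<tau>, x)" by (metis prod_cases3)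
    show "K c (z, vx (1 - \<epsilon>) c) = z" using z H(2) unfolding * by (simp add: K)
    show "K c (z, vx \<epsilon> c) \<in> box_corner D d T S X A (d', k, c)"
      using z H(2) subD[OF A simplex_Ob] unfolding * by (simp add: K)
  next
    fix c z t assume z: "z \<in> box_corner D d T S X A (d', k, c)" "t \<in> val \<Delta>1 c"
    obtain g \<tau> x where *: "z = (g, \<tau>, x)" by (metis prod_cases3)
    have x: "x \<in> val X c" "\<tau> \<in> S k \<or> x \<in> A c" using z(1) unfolding * by simp_all
    show "K c (z, t) \<in> box_corner D d T S X A (d', k, c)"
      using z(1) x(2) Hv[OF x(1) z(2)] H(3)[OF simplex_Ob _ z(2), of x] unfolding * K box_simps by blast
  qed
qed

lemma (in universe) small_box:
  assumes "\<And>k. small_set U (val T k)" "\<And>l. small_set U (val X l)"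
  shows "small_psh U \<C> (box D d T X)"
  unfolding small_psh_def
proof
  fix c assume "c \<in> Ob \<C>"
  then obtain d' k l where c: "c = (d', k, l)" "d' \<in> Ob D" by (metis prod_cases3 dsimp_cat_simps(1))
  have "small_set U (Ar D \<times> val T k \<times> val X l)"
    by (intro small_times[OF c(2)] small_arrows' assms) simp
  then show "small_set U (val (box D d T X) c)"
    by (rule small_subset) (auto simp: c(1))
qed

lemma (in universe) injective_fibration_box:
  fixes L :: "('o, 'm, 'u) dspace"
  assumes p: "injective_fibration D L W p" and T: "presheaf simplex T" "sub simplex T S" "\<And>k. small_set U (val T k)"
    and X: "presheaf simplex X" "sub simplex X A" "\<And>k. small_set U (val X k)"
    and e: "\<epsilon> = 0 \<or> \<epsilon> = 1" "scontracts \<epsilon> X A"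
  shows "RLP \<C> (box D d T X) (box_corner D d T S X A) L W p"
  by (rule injective_fibration_RLP[OF p presheaf_box[OF catD T(1) X(1)] small_box[OF T(3) X(3)]
        sub_box[OF catD T(1) X(1) T(2) X(2)]])
    (use box_contracts[OF catD X(1,2) T(1) e(2)] e(1) in blast)

section \<open>Yoneda correspondence between levels and external products\<close>

abbreviation iv :: "nat \<Rightarrow> nat \<Rightarrow> smor set" where "iv n k \<equiv> {const_mor k n 0}"

lemma presheaf_pullback:
  assumes C: "category C" and X: "presheaf C X" and Y: "presheaf C Y"
    and u: "nat_on C X (val X) S u" and v: "nat_on C Y (val Y) S v"
  shows "presheaf C (pullback_psh X Y u v)"
proof (rule presheafI)
  fix f z assume f: "f \<in> Ar C" "z \<in> val (pullback_psh X Y u v) (tgt C f)"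
  then show "act (pullback_psh X Y u v) f z \<in> val (pullback_psh X Y u v) (src C f)"
    using presheaf_act[OF X f(1) refl refl] presheaf_act[OF Y f(1) refl refl]
      nat_on_act[OF u f(1) refl refl] nat_on_act[OF v f(1) refl refl]
    by (auto simp: pullback_psh_def)
qed (auto simp: pullback_psh_def presheaf_idn[OF X] presheaf_idn[OF Y] presheaf_cmp[OF X] presheaf_cmp[OF Y])

lemma const_mor_Ar [simp]:
  assumes "i \<le> n"
  shows "const_mor k n i \<in> Ar simplex" "src simplex (const_mor k n i) = k" "tgt simplex (const_mor k n i) = n"
  using const_mor_smap[OF assms, of k] by auto

lemma const_mor_00: "const_mor 0 0 0 = idn simplex 0"
  by (rule smap_ext[OF const_mor_smap idn_smap]) auto

lemma const_mor_cmp: "cmp simplex (const_mor 0 n 0) (const_mor k 0 0) = const_mor k n 0"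
  by (rule const_mor_act[OF const_mor_smap]) auto

lemma level_act_apply:
  assumes "i \<le> n" "w \<in> val W (d, n, l)"
  shows "level_act (und D d W) (const_mor k n i) l w = act W (idn D d, const_mor k n i, idn simplex l) w"
  using assms by (simp add: level_act_def und_def level_def)

lemma simplex_cmp [simp]:
  assumes "f \<in> Ar simplex" "g \<in> Ar simplex" "src simplex g = tgt simplex f"
  shows "cmp simplex g f \<in> Ar simplex" "src simplex (cmp simplex g f) = src simplex f"
    "tgt simplex (cmp simplex g f) = tgt simplex g"
  using category_cmp[OF category_simplex assms] by auto

context universe
begin

lemma act_cmp:
  assumes Z: "presheaf \<C> Z" and z: "z \<in> val Z (tgt D f, tgt simplex \<alpha>, tgt simplex \<beta>)"
    and f: "f \<in> Ar D" "\<alpha> \<in> Ar simplex" "\<beta> \<in> Ar simplex" "f' \<in> Ar D" "\<alpha>' \<in> Ar simplex" "\<beta>' \<in> Ar simplex"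
    and s: "src D f = tgt D f'" "src simplex \<alpha> = tgt simplex \<alpha>'" "src simplex \<beta> = tgt simplex \<beta>'"
  shows "act Z (f', \<alpha>', \<beta>') (act Z (f, \<alpha>, \<beta>) z) = act Z (cmp D f f', cmp simplex \<alpha> \<alpha>', cmp simplex \<beta> \<beta>') z"
  using presheaf_cmp[OF Z, of "(f', \<alpha>', \<beta>')" "(f, \<alpha>, \<beta>)" _ z] assms by simp

lemma idn_D [simp]:
  "d \<in> Ob D \<Longrightarrow> idn D d \<in> Ar D" "d \<in> Ob D \<Longrightarrow> src D (idn D d) = d" "d \<in> Ob D \<Longrightarrow> tgt D (idn D d) = d"
  using category_idn[OF catD] by auto

lemma unit_D [simp]:
  assumes "f \<in> Ar D"
  shows "cmp D f (idn D (src D f)) = f" "cmp D (idn D (tgt D f)) f = f"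
  using category_unit[OF catD assms] by auto

lemma Ob_D [simp]: "f \<in> Ar D \<Longrightarrow> src D f \<in> Ob D" "f \<in> Ar D \<Longrightarrow> tgt D f \<in> Ob D"
  using category_Ob[OF catD] by auto

text \<open>The map out of an external product with a simplex that corresponds, by the Yoneda lemma,
  to a map \<open>t\<close> from \<open>X\<close> to \<open>Z(d, n, -)\<close>.\<close>

definition ext :: "('o, 'm, 'z) dspace \<Rightarrow> (nat \<Rightarrow> 'x \<Rightarrow> 'z) \<Rightarrow> 'o dob \<Rightarrow> 'm \<times> smor \<times> 'x \<Rightarrow> 'z" where
  "ext Z t = (\<lambda>(d', k, l) (g, \<alpha>, x). act Z (g, \<alpha>, idn simplex l) (t l x))"

lemma ext_simp [simp]: "ext Z t (d', k, l) (g, \<alpha>, x) = act Z (g, \<alpha>, idn simplex l) (t l x)"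
  by (simp add: ext_def)

lemma ext_val:
  assumes "presheaf \<C> Z" "g \<in> Ar D" "\<alpha> \<in> smap k n" "z \<in> val Z (tgt D g, n, l)"
  shows "act Z (g, \<alpha>, idn simplex l) z \<in> val Z (src D g, k, l)"
  by (rule presheaf_act[OF assms(1) _ _ _ assms(4)]) (use assms(2,3) in auto)

text \<open>Both sides are the action of one composite arrow, factored with its space part applied
  first or last.\<close>

lemma ext_act:
  assumes Z: "presheaf \<C> Z" and g: "g \<in> Ar D" "\<alpha> \<in> smap k n" and t: "nat_on simplex X A (sl D Z (tgt D g) n) t"
    and f: "f \<in> Ar D" "tgt D f = src D g" "\<alpha>' \<in> smap k' k" "\<beta> \<in> smap l' l" and x: "x \<in> A l"
  shows "act Z (cmp D g f, cmp simplex \<alpha> \<alpha>', idn simplex l') (t l' (act X \<beta> x)) =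
    act Z (f, \<alpha>', \<beta>) (act Z (g, \<alpha>, idn simplex l) (t l x))"
proof -
  have tx: "t l x \<in> val Z (tgt D g, n, l)" using nat_on_val[OF t simplex_Ob x] by simp
  have 1: "t l' (act X \<beta> x) = act Z (idn D (tgt D g), idn simplex n, \<beta>) (t l x)"
    using nat_on_act[OF t _ _ _ x, of \<beta> l'] f by simp
  have a: "cmp simplex \<alpha> \<alpha>' \<in> Ar simplex" "src simplex (cmp simplex \<alpha> \<alpha>') = k'" "tgt simplex (cmp simplex \<alpha> \<alpha>') = n"
    using cmp_smap(1)[OF f(3) g(2)] by auto
  have b: "cmp D g f \<in> Ar D" "tgt D (cmp D g f) = tgt D g" "src D (cmp D g f) = src D f"
    using category_cmp[OF catD f(1) g(1)] f(2) by auto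
  have u: "cmp D (idn D (tgt D g)) (cmp D g f) = cmp D g f" using unit_D(2)[OF b(1)] b(2) by simp
  have u': "cmp simplex (idn simplex n) (cmp simplex \<alpha> \<alpha>') = cmp simplex \<alpha> \<alpha>'" using simplex_unit(2)[OF a(1)] a(3) by simp
  have u'': "cmp simplex \<beta> (idn simplex l') = \<beta>" "cmp simplex (idn simplex l) \<beta> = \<beta>"
    using simplex_unit[of \<beta>] f(4) by auto
  have "act Z (cmp D g f, cmp simplex \<alpha> \<alpha>', idn simplex l') (t l' (act X \<beta> x)) =
      act Z (cmp D (idn D (tgt D g)) (cmp D g f), cmp simplex (idn simplex n) (cmp simplex \<alpha> \<alpha>'), cmp simplex \<beta> (idn simplex l')) (t l x)"
    unfolding 1 by (rule act_cmp[OF Z]) (use tx f g a b in simp_all)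
  also have "\<dots> = act Z (cmp D g f, cmp simplex \<alpha> \<alpha>', cmp simplex (idn simplex l) \<beta>) (t l x)"
    unfolding u u' u'' ..
  also have "\<dots> = act Z (f, \<alpha>', \<beta>) (act Z (g, \<alpha>, idn simplex l) (t l x))"
    by (rule act_cmp[OF Z, symmetric]) (use tx f g in simp_all)
  finally show ?thesis .
qed

lemma nat_ext:
  assumes Z: "presheaf \<C> Z" and T: "T = std_simplex n" and X: "presheaf simplex X"
    and t: "nat_on simplex X (val X) (sl D Z d n) t"
  shows "nat_on \<C> (box D d T X) (val (box D d T X)) Z (ext Z t)"
proof (rule nat_onI)
  fix c z assume c: "c \<in> Ob \<C>" "z \<in> val (box D d T X) c"
  obtain d' k l g \<tau> x where *: "c = (d', k, l)" "z = (g, \<tau>, x)" by (metis prod_cases3)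
  have g: "g \<in> Ar D" "src D g = d'" "tgt D g = d" "\<tau> \<in> smap k n" "x \<in> val X l" using c(2) unfolding * T by simp_all
  have "t l x \<in> val Z (tgt D g, n, l)" using nat_on_val[OF t simplex_Ob g(5)] g(3) by simp
  from ext_val[OF Z g(1,4) this] show "ext Z t c z \<in> val Z c" unfolding * using g(2) by simp
next
  fix f z assume c: "f \<in> Ar \<C>" "z \<in> val (box D d T X) (tgt \<C> f)"
  obtain f0 \<alpha> \<beta> g \<tau> x where *: "f = (f0, \<alpha>, \<beta>)" "z = (g, \<tau>, x)" by (metis prod_cases3)
  have g: "g \<in> Ar D" "src D g = tgt D f0" "tgt D g = d" "\<tau> \<in> smap (tgt simplex \<alpha>) n" "x \<in> val X (tgt simplex \<beta>)"
    and f: "f0 \<in> Ar D" "\<alpha> \<in> smap (src simplex \<alpha>) (tgt simplex \<alpha>)" "\<beta> \<in> smap (src simplex \<beta>) (tgt simplex \<beta>)"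
    using c unfolding * T by simp_all
  show "ext Z t (src \<C> f) (act (box D d T X) f z) = act Z f (ext Z t (tgt \<C> f) z)"
    using ext_act[OF Z g(1,4) t[folded g(3)] f(1) g(2)[symmetric] f(2,3) g(5)] unfolding * T by simp
qed

abbreviation left_base where
  "left_base L W p d n \<equiv> pullback_psh (sl D L d 0) (sl D W d n) (level_map 0 (und_map d p))
     (level_act (und D d W) (const_mor 0 n 0))"

abbreviation left_map where
  "left_map L p d n \<equiv> transf simplex (sl D L d n)
     (\<lambda>l x. (level_act (und D d L) (const_mor 0 n 0) l x, und_map d p (n, l) x))"

lemma left_base_iff:
  "(y, w) \<in> val (left_base L W p d n) l \<longleftrightarrow> y \<in> val L (d, 0, l) \<and> w \<in> val W (d, n, l) \<and>
     p (d, 0, l) y = act W (idn D d, const_mor 0 n 0, idn simplex l) w"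
  using level_act_apply[of 0 n w W d l D 0] by (auto simp: pullback_psh_def level_map_def und_map_def)

lemma left_base_act [simp]:
  "act (left_base L W p d n) \<beta> (y, w) =
    (act L (idn D d, idn simplex 0, \<beta>) y, act W (idn D d, idn simplex n, \<beta>) w)"
  by (simp add: pullback_psh_def)

lemma left_map_apply:
  assumes "x \<in> val L (d, n, l)"
  shows "left_map L p d n l x = (act L (idn D d, const_mor 0 n 0, idn simplex l) x, p (d, n, l) x)"
  using level_act_apply[of 0 n x L d l D 0] assms by (simp add: und_map_def)

lemma act_swap:
  assumes Z: "presheaf \<C> Z" and d: "d \<in> Ob D" and z: "z \<in> val Z (d, n, l)" and a: "\<alpha> \<in> smap k n" "\<beta> \<in> smap l' l"
  shows "act Z (idn D d, \<alpha>, idn simplex l') (act Z (idn D d, idn simplex n, \<beta>) z) =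
    act Z (idn D d, idn simplex k, \<beta>) (act Z (idn D d, \<alpha>, idn simplex l) z)"
proof -
  have u: "cmp simplex \<beta> (idn simplex l') = \<beta>" "cmp simplex (idn simplex l) \<beta> = \<beta>"
     "cmp simplex \<alpha> (idn simplex k) = \<alpha>" "cmp simplex (idn simplex n) \<alpha> = \<alpha>"
    using simplex_unit[of \<beta>] simplex_unit[of \<alpha>] a by auto
  have "act Z (idn D d, \<alpha>, idn simplex l') (act Z (idn D d, idn simplex n, \<beta>) z) =
     act Z (cmp D (idn D d) (idn D d), cmp simplex (idn simplex n) \<alpha>, cmp simplex \<beta> (idn simplex l')) z"
    by (rule act_cmp[OF Z]) (use z a d in simp_all)
  also have "\<dots> = act Z (cmp D (idn D d) (idn D d), cmp simplex \<alpha> (idn simplex k), cmp simplex (idn simplex l) \<beta>) z"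
    unfolding u ..
  also have "\<dots> = act Z (idn D d, idn simplex k, \<beta>) (act Z (idn D d, \<alpha>, idn simplex l) z)"
    by (rule act_cmp[OF Z, symmetric]) (use z a d in simp_all)
  finally show ?thesis .
qed

lemma presheaf_left_base:
  assumes L: "presheaf \<C> L" and W: "presheaf \<C> W" and p: "nat_on \<C> L (val L) W p" and d: "d \<in> Ob D"
  shows "presheaf simplex (left_base L W p d n)"
proof (rule presheaf_pullback[OF category_simplex presheaf_sl[OF catD L d] presheaf_sl[OF catD W d]])
  show "nat_on simplex (sl D L d 0) (val (sl D L d 0)) (sl D W d 0) (level_map 0 (und_map d p))"
    using nat_on_sl[OF catD p d, of 0] by (simp add: level_map_def und_map_def level_def und_def)
  show "nat_on simplex (sl D W d n) (val (sl D W d n)) (sl D W d 0) (level_act (und D d W) (const_mor 0 n 0))"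
  proof (rule nat_onI)
    fix c x assume "x \<in> val (sl D W d n) c"
    then show "level_act (und D d W) (const_mor 0 n 0) c x \<in> val (sl D W d 0) c"
      using ext_val[OF W, of "idn D d" "const_mor 0 n 0" 0 n x c] d by (simp add: level_act_apply)
  next
    fix f x assume f: "f \<in> Ar simplex" "x \<in> val (sl D W d n) (tgt simplex f)"
    have "act W (idn D d, idn simplex n, f) x \<in> val W (d, n, src simplex f)"
      using presheaf_act[OF presheaf_sl[OF catD W d, of n] f(1) refl refl f(2)] by simp
    then show "level_act (und D d W) (const_mor 0 n 0) (src simplex f) (act (sl D W d n) f x) =
         act (sl D W d 0) f (level_act (und D d W) (const_mor 0 n 0) (tgt simplex f) x)"
      using act_swap[OF W d _ const_mor_smap smap_Ar[OF f(1)], of x n 0 0] f by (simp add: level_act_apply)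
  qed
qed

lemma nat_left_map:
  assumes L: "presheaf \<C> L" and W: "presheaf \<C> W" and p: "nat_on \<C> L (val L) W p" and d: "d \<in> Ob D"
  shows "nat_on simplex (sl D L d n) (val (sl D L d n)) (left_base L W p d n) (left_map L p d n)"
proof (rule nat_onI)
  fix c x assume x: "x \<in> val (sl D L d n) c"
  then show "left_map L p d n c x \<in> val (left_base L W p d n) c"
    using ext_val[OF L, of "idn D d" "const_mor 0 n 0" 0 n x c] nat_on_val[OF p, of "(d, n, c)" x] d
      nat_on_act[OF p, of "(idn D d, const_mor 0 n 0, idn simplex c)" "(d, n, c)" "(d, 0, c)" x]
    by (subst left_map_apply) (simp_all add: left_base_iff)
next
  fix f x assume f: "f \<in> Ar simplex" "x \<in> val (sl D L d n) (tgt simplex f)"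
  have y: "act L (idn D d, idn simplex n, f) x \<in> val L (d, n, src simplex f)"
    using presheaf_act[OF presheaf_sl[OF catD L d, of n] f(1) refl refl f(2)] by simp
  have x: "x \<in> val L (d, n, tgt simplex f)" using f(2) by simp
  show "left_map L p d n (src simplex f) (act (sl D L d n) f x) =
      act (left_base L W p d n) f (left_map L p d n (tgt simplex f) x)"
    unfolding sl_simps left_map_apply[where L = L, OF y] left_map_apply[where L = L, OF x] left_base_act
    using act_swap[OF L d x const_mor_smap smap_Ar[OF f(1)], of 0 0] d f x
      nat_on_act[OF p, of "(idn D d, idn simplex n, f)" "(d, n, tgt simplex f)" "(d, n, src simplex f)" x]
    by simp
qed

text \<open>A constant simplex at the initial vertex factors through \<open>[0]\<close>; hence on
  \<open>iv n\<close> a map is determined by its values in level 0.\<close>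

lemma const_split:
  assumes Z: "presheaf \<C> Z" and g: "g \<in> Ar D" and z: "z \<in> val Z (tgt D g, n, l)"
  shows "act Z (g, const_mor k n 0, idn simplex l) z =
    act Z (g, const_mor k 0 0, idn simplex l) (act Z (idn D (tgt D g), const_mor 0 n 0, idn simplex l) z)"
proof -
  have u: "cmp simplex (idn simplex l) (idn simplex l) = idn simplex l" using simplex_unit[of "idn simplex l"] by simp
  show ?thesis
    using act_cmp[OF Z, of z "idn D (tgt D g)" "const_mor 0 n 0" "idn simplex l" g "const_mor k 0 0" "idn simplex l"] g z
    by (simp add: u const_mor_cmp)
qed

lemma act_id:
  assumes "presheaf \<C> Z" "d \<in> Ob D" "z \<in> val Z (d, n, l)"
  shows "act Z (idn D d, idn simplex n, idn simplex l) z = z"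
  using presheaf_idn[OF assms(1), of "(d, n, l)" z] assms by simp

text \<open>By the Yoneda lemma, lifting problems for \<open>L\<^sub>n \<rightarrow> L\<^sub>0 \<times>\<^bsub>W\<^sub>0\<^esub> W\<^sub>n\<close> and for \<open>L \<rightarrow> W\<close> correspond.\<close>

lemma box_to_level:
  assumes L: "presheaf \<C> L" and W: "presheaf \<C> W" and p: "nat_on \<C> L (val L) W p" and d: "d \<in> Ob D"
    and X: "presheaf simplex X" and A: "sub simplex X A"
    and rlp: "RLP \<C> (box D d (std_simplex n) X) (box_corner D d (std_simplex n) (iv n) X A) L W p"
  shows "RLP simplex X A (sl D L d n) (left_base L W p d n) (left_map L p d n)"
proof (rule RLPI)
  fix u v assume u: "nat_on simplex X A (sl D L d n) u"
    and v: "nat_on simplex X (val X) (left_base L W p d n) v"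
    and "\<And>c x. c \<in> Ob simplex \<Longrightarrow> x \<in> A c \<Longrightarrow> left_map L p d n c (u c x) = v c x"
  then have uv: "left_map L p d n l (u l x) = v l x" if "x \<in> A l" for l x using that by simp
  define v0 where "v0 = (\<lambda>l x. fst (v l x))"
  define v1 where "v1 = (\<lambda>l x. snd (v l x))"
  have vv: "v l x = (v0 l x, v1 l x)" for l x by (simp add: v0_def v1_def)
  have vB: "v0 l x \<in> val L (d, 0, l)" "v1 l x \<in> val W (d, n, l)"
    "p (d, 0, l) (v0 l x) = act W (idn D d, const_mor 0 n 0, idn simplex l) (v1 l x)" if "x \<in> val X l" for l x
    using nat_on_val[OF v simplex_Ob that] unfolding vv left_base_iff by auto
  have va: "v0 (src simplex f) (act X f x) = act L (idn D d, idn simplex 0, f) (v0 (tgt simplex f) x)"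
     "v1 (src simplex f) (act X f x) = act W (idn D d, idn simplex n, f) (v1 (tgt simplex f) x)"
    if "f \<in> Ar simplex" "x \<in> val X (tgt simplex f)" for f x
    using nat_on_act[OF v that(1) refl refl that(2)] unfolding vv left_base_act by auto
  have n0: "nat_on simplex X (val X) (sl D L d 0) v0" and n1: "nat_on simplex X (val X) (sl D W d n) v1"
    using vB va by (auto intro!: nat_onI)
  have uL: "u l x \<in> val L (d, n, l)" if "x \<in> A l" for l x using nat_on_val[OF u simplex_Ob that] by simp
  have u0: "act L (idn D d, const_mor 0 n 0, idn simplex l) (u l x) = v0 l x" "p (d, n, l) (u l x) = v1 l x"
    if "x \<in> A l" for l x
    using uv[OF that] unfolding vv left_map_apply[where L = L, OF uL[OF that]] by auto
  define V where "V = ext W v1"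
  \<comment> \<open>On the corner either \<open>x\<close> lies in \<open>A\<close> and
    \<open>u\<close> applies, or \<open>\<alpha>\<close> is constant at the initial vertex and the
    level 0 component \<open>v0\<close> is used; \<open>TS\<close> shows that they agree on the
    overlap.\<close>
  define T where "T = (\<lambda>(d' :: 'o, k, l) (g, \<alpha>, x). if x \<in> A l then act L (g, \<alpha>, idn simplex l) (u l x)
     else act L (g, const_mor k 0 0, idn simplex l) (v0 l x))"
  have TA: "T (d', k, l) (g, \<alpha>, x) = act L (g, \<alpha>, idn simplex l) (u l x)" if "x \<in> A l" for d' k l g \<alpha> x
    using that by (simp add: T_def)
  have TS: "T (d', k, l) (g, const_mor k n 0, x) = act L (g, const_mor k 0 0, idn simplex l) (v0 l x)"
    if "g \<in> Ar D" "tgt D g = d" for d' k l g x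
  proof (cases "x \<in> A l")
    case True
    then show ?thesis using const_split[OF L that(1), of "u l x" n l k] uL[OF True] u0(1)[OF True] that
      by (simp add: TA)
  qed (simp add: T_def)
  let ?B = "box D d (std_simplex n) X" and ?S = "box_corner D d (std_simplex n) (iv n) X A"
  have nT: "nat_on \<C> ?B ?S L T"
  proof (rule nat_onI)
    fix c z assume c: "c \<in> Ob \<C>" "z \<in> ?S c"
    obtain d' k l g \<alpha> x where *: "c = (d', k, l)" "z = (g, \<alpha>, x)" by (metis prod_cases3)
    have g: "g \<in> Ar D" "src D g = d'" "tgt D g = d" "\<alpha> \<in> smap k n" "x \<in> val X l" "\<alpha> = const_mor k n 0 \<or> x \<in> A l"
      using c(2) unfolding * by simp_all
    from g(6) show "T c z \<in> val L c"
    proof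
      assume a: "\<alpha> = const_mor k n 0"
      show ?thesis unfolding * a TS[OF g(1,3)] g(2)[symmetric]
        by (rule ext_val[OF L g(1) const_mor_smap]) (use vB(1)[OF g(5)] g(3) in simp_all)
    next
      assume a: "x \<in> A l"
      show ?thesis unfolding * TA[OF a] g(2)[symmetric]
        by (rule ext_val[OF L g(1,4)]) (use uL[OF a] g(3) in simp_all)
    qed
  next
    fix f z assume c: "f \<in> Ar \<C>" "z \<in> ?S (tgt \<C> f)"
    obtain f0 \<alpha>' \<beta> g \<alpha> x where *: "f = (f0, \<alpha>', \<beta>)" "z = (g, \<alpha>, x)" by (metis prod_cases3)
    have g: "g \<in> Ar D" "src D g = tgt D f0" "tgt D g = d" "\<alpha> \<in> smap (tgt simplex \<alpha>') n" "x \<in> val X (tgt simplex \<beta>)"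
        "\<alpha> = const_mor (tgt simplex \<alpha>') n 0 \<or> x \<in> A (tgt simplex \<beta>)"
      and f: "f0 \<in> Ar D" "\<alpha>' \<in> smap (src simplex \<alpha>') (tgt simplex \<alpha>')" "\<beta> \<in> smap (src simplex \<beta>) (tgt simplex \<beta>)"
      using c unfolding * by simp_all
    have gf: "cmp D g f0 \<in> Ar D" "tgt D (cmp D g f0) = d" using category_cmp[OF catD f(1) g(1)] g by auto
    from g(6) show "T (src \<C> f) (act ?B f z) = act L f (T (tgt \<C> f) z)"
    proof
      assume a: "\<alpha> = const_mor (tgt simplex \<alpha>') n 0"
      have "cmp simplex \<alpha> \<alpha>' = const_mor (src simplex \<alpha>') n 0" unfolding a by (rule const_mor_act[OF f(2)]) simp
      moreover have "cmp simplex (const_mor (tgt simplex \<alpha>') 0 0) \<alpha>' = const_mor (src simplex \<alpha>') 0 0"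
        by (rule const_mor_act[OF f(2)]) simp
      ultimately show ?thesis
        using ext_act[OF L g(1) const_mor_smap n0[folded g(3)] f(1) g(2)[symmetric] f(2,3) g(5)] TS[OF gf] TS[OF g(1,3)]
        unfolding * by (simp add: a)
    next
      assume a: "x \<in> A (tgt simplex \<beta>)"
      have "act X \<beta> x \<in> A (src simplex \<beta>)" using sub_act[OF A _ refl refl a] f(3) by simp
      then show ?thesis
        using ext_act[OF L g(1,4) u[folded g(3)] f(1) g(2)[symmetric] f(2,3) a] unfolding * by (simp add: TA a)
    qed
  qed
  have nV: "nat_on \<C> ?B (val ?B) W V" unfolding V_def by (rule nat_ext[OF W refl X n1])
  have pT: "p c (T c z) = V c z" if c: "c \<in> Ob \<C>" "z \<in> ?S c" for c z
  proof -
    obtain d' k l g \<alpha> x where *: "c = (d', k, l)" "z = (g, \<alpha>, x)" by (metis prod_cases3)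
    have g: "g \<in> Ar D" "src D g = d'" "tgt D g = d" "\<alpha> \<in> smap k n" "x \<in> val X l" "\<alpha> = const_mor k n 0 \<or> x \<in> A l"
      using c(2) unfolding * by simp_all
    from g(6) show ?thesis
    proof
      assume a: "\<alpha> = const_mor k n 0"
      have "p (d', k, l) (act L (g, const_mor k 0 0, idn simplex l) (v0 l x)) =
          act W (g, const_mor k 0 0, idn simplex l) (p (d, 0, l) (v0 l x))"
        by (rule nat_on_act[OF p]) (use g vB in simp_all)
      then show ?thesis unfolding * a TS[OF g(1,3)] V_def ext_simp vB(3)[OF g(5)]
        using const_split[OF W g(1), of "v1 l x" n l k] vB(2)[OF g(5)] g(3) by simp
    next
      assume a: "x \<in> A l"
      have "p (d', k, l) (act L (g, \<alpha>, idn simplex l) (u l x)) = act W (g, \<alpha>, idn simplex l) (p (d, n, l) (u l x))"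
        by (rule nat_on_act[OF p]) (use g uL[OF a] in simp_all)
      then show ?thesis unfolding * TA[OF a] V_def ext_simp u0(2)[OF a] .
    qed
  qed
  obtain H where H: "nat_on \<C> ?B (val ?B) L H" "\<And>c z. c \<in> Ob \<C> \<Longrightarrow> z \<in> ?S c \<Longrightarrow> H c z = T c z"
    "\<And>c z. c \<in> Ob \<C> \<Longrightarrow> z \<in> val ?B c \<Longrightarrow> p c (H c z) = V c z"
    using RLPE[OF rlp nT nV pT] by blast
  \<comment> \<open>The other direction of Yoneda: evaluate at the universal element.\<close>
  define h where "h = (\<lambda>l x. H (d, n, l) (idn D d, idn simplex n, x))"
  have hv: "h l x \<in> val L (d, n, l)" if "x \<in> val X l" for l x
    unfolding h_def by (rule nat_on_val[OF H(1)]) (use d that in simp_all)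
  show "\<exists>h. nat_on simplex X (val X) (sl D L d n) h \<and> (\<forall>c\<in>Ob simplex. \<forall>x\<in>A c. h c x = u c x) \<and>
      (\<forall>c\<in>Ob simplex. \<forall>x\<in>val X c. left_map L p d n c (h c x) = v c x)"
  proof (intro exI conjI ballI)
    show "nat_on simplex X (val X) (sl D L d n) h"
    proof (rule nat_onI)
      fix f x assume f: "f \<in> Ar simplex" "x \<in> val X (tgt simplex f)"
      have "H (d, n, src simplex f) (act ?B (idn D d, idn simplex n, f) (idn D d, idn simplex n, x)) =
          act L (idn D d, idn simplex n, f) (H (d, n, tgt simplex f) (idn D d, idn simplex n, x))"
        by (rule nat_on_act[OF H(1)]) (use f d in simp_all)
      then show "h (src simplex f) (act X f x) = act (sl D L d n) f (h (tgt simplex f) x)"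
        using unit_D[OF idn_D(1)[OF d]] simplex_unit[of "idn simplex n"] d by (simp add: h_def)
    qed (use hv in simp)
    fix l x
    show "h l x = u l x" if x: "x \<in> A l"
      using H(2)[of "(d, n, l)" "(idn D d, idn simplex n, x)"] d subD[OF A simplex_Ob x] x act_id[OF L d uL[OF x]]
      by (simp add: h_def TA)
    show "left_map L p d n l (h l x) = v l x" if x: "x \<in> val X l"
    proof -
      have u: "cmp simplex (idn simplex n) (const_mor 0 n 0) = const_mor 0 n 0"
        using simplex_unit(2)[of "const_mor 0 n 0"] by simp
      have u': "cmp D (idn D d) (idn D d) = idn D d" using unit_D[OF idn_D(1)[OF d]] d by simp
      have "act L (idn D d, const_mor 0 n 0, idn simplex l) (h l x) =
        H (d, 0, l) (act ?B (idn D d, const_mor 0 n 0, idn simplex l) (idn D d, idn simplex n, x))"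
        unfolding h_def by (rule nat_on_act[OF H(1), symmetric]) (use d x in simp_all)
      also have "\<dots> = H (d, 0, l) (idn D d, const_mor 0 n 0, x)"
        using u u' presheaf_idn[OF X simplex_Ob x] by simp
      also have "\<dots> = v0 l x"
        using H(2)[of "(d, 0, l)" "(idn D d, const_mor 0 n 0, x)"] d x TS[of "idn D d" d 0 l x] act_id[OF L d vB(1)[OF x]]
        by (simp add: const_mor_00)
      finally have 1: "act L (idn D d, const_mor 0 n 0, idn simplex l) (h l x) = v0 l x" .
      have "p (d, n, l) (h l x) = v1 l x"
        using H(3)[of "(d, n, l)" "(idn D d, idn simplex n, x)"] d x act_id[OF W d vB(2)[OF x]]
        by (simp add: h_def V_def)
      then show ?thesis unfolding left_map_apply[where L = L, OF hv[OF x]] vv 1 by simp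
    qed
  qed
qed

text \<open>The data on the external product are evaluated at the universal element of the simplex
  and at its initial vertex, which gives a problem in level \<open>n\<close>; its solution is
  extended back by \<open>ext\<close>.\<close>

lemma level_to_box:
  assumes L: "presheaf \<C> L" and W: "presheaf \<C> W" and p: "nat_on \<C> L (val L) W p" and d: "d \<in> Ob D"
    and X: "presheaf simplex X" and A: "sub simplex X A"
    and rlp: "RLP simplex X A (sl D L d n) (left_base L W p d n) (left_map L p d n)"
  shows "RLP \<C> (box D d (std_simplex n) X) (box_corner D d (std_simplex n) (iv n) X A) L W p"
proof (rule RLPI)
  let ?B = "box D d (std_simplex n) X" and ?S = "box_corner D d (std_simplex n) (iv n) X A"
  fix U V assume U: "nat_on \<C> ?B ?S L U" and V: "nat_on \<C> ?B (val ?B) W V"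
    and UV: "\<And>c z. c \<in> Ob \<C> \<Longrightarrow> z \<in> ?S c \<Longrightarrow> p c (U c z) = V c z"
  define u where "u = (\<lambda>l x. U (d, n, l) (idn D d, idn simplex n, x))"
  define v0 where "v0 = (\<lambda>l x. U (d, 0, l) (idn D d, const_mor 0 n 0, x))"
  define v1 where "v1 = (\<lambda>l x. V (d, n, l) (idn D d, idn simplex n, x))"
  have i: "cmp D (idn D d) (idn D d) = idn D d" using unit_D[OF idn_D(1)[OF d]] d by simp
  have j: "cmp simplex (idn simplex m) (idn simplex m) = idn simplex m" for m
    using simplex_unit[of "idn simplex m"] by simp
  have cn: "cmp simplex (idn simplex n) (const_mor 0 n 0) = const_mor 0 n 0"
    "cmp simplex (const_mor 0 n 0) (idn simplex 0) = const_mor 0 n 0"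
    using simplex_unit[of "const_mor 0 n 0"] by simp_all
  have uv: "u l x \<in> val L (d, n, l)" if "x \<in> A l" for l x
    unfolding u_def by (rule nat_on_val[OF U]) (use d that subD[OF A simplex_Ob that] in simp_all)
  have v0v: "v0 l x \<in> val L (d, 0, l)" if "x \<in> val X l" for l x
    unfolding v0_def by (rule nat_on_val[OF U]) (use d that in simp_all)
  have v1v: "v1 l x \<in> val W (d, n, l)" if "x \<in> val X l" for l x
    unfolding v1_def by (rule nat_on_val[OF V]) (use d that in simp_all)
  have v01: "p (d, 0, l) (v0 l x) = act W (idn D d, const_mor 0 n 0, idn simplex l) (v1 l x)" if x: "x \<in> val X l" for l x
  proof -
    have "V (d, 0, l) (act ?B (idn D d, const_mor 0 n 0, idn simplex l) (idn D d, idn simplex n, x)) =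
       act W (idn D d, const_mor 0 n 0, idn simplex l) (v1 l x)"
      unfolding v1_def by (rule nat_on_act[OF V]) (use d x in simp_all)
    then show ?thesis
      using UV[of "(d, 0, l)" "(idn D d, const_mor 0 n 0, x)"] d x presheaf_idn[OF X simplex_Ob x] i cn
      by (simp add: v0_def)
  qed
  have uN: "nat_on simplex X A (sl D L d n) u"
  proof (rule nat_onI)
    fix f x assume f: "f \<in> Ar simplex" "x \<in> A (tgt simplex f)"
    have "U (d, n, src simplex f) (act ?B (idn D d, idn simplex n, f) (idn D d, idn simplex n, x)) =
          act L (idn D d, idn simplex n, f) (U (d, n, tgt simplex f) (idn D d, idn simplex n, x))"
      by (rule nat_on_act[OF U]) (use f d subD[OF A simplex_Ob f(2)] in simp_all)
    then show "u (src simplex f) (act X f x) = act (sl D L d n) f (u (tgt simplex f) x)"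
      using i j by (simp add: u_def)
  qed (use uv in simp)
  have vN: "nat_on simplex X (val X) (left_base L W p d n) (\<lambda>l x. (v0 l x, v1 l x))"
  proof (rule nat_onI)
    fix f x assume f: "f \<in> Ar simplex" "x \<in> val X (tgt simplex f)"
    have "U (d, 0, src simplex f) (act ?B (idn D d, idn simplex 0, f) (idn D d, const_mor 0 n 0, x)) =
          act L (idn D d, idn simplex 0, f) (U (d, 0, tgt simplex f) (idn D d, const_mor 0 n 0, x))"
      by (rule nat_on_act[OF U]) (use f d in simp_all)
    moreover have "V (d, n, src simplex f) (act ?B (idn D d, idn simplex n, f) (idn D d, idn simplex n, x)) =
          act W (idn D d, idn simplex n, f) (V (d, n, tgt simplex f) (idn D d, idn simplex n, x))"
      by (rule nat_on_act[OF V]) (use f d in simp_all)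
    ultimately show "(v0 (src simplex f) (act X f x), v1 (src simplex f) (act X f x)) =
        act (left_base L W p d n) f (v0 (tgt simplex f) x, v1 (tgt simplex f) x)"
      using i j cn by (simp add: v0_def v1_def)
  qed (use v0v v1v v01 in \<open>simp add: left_base_iff\<close>)
  have fu: "left_map L p d n l (u l x) = (v0 l x, v1 l x)" if x: "x \<in> A l" for l x
  proof -
    note xX = subD[OF A simplex_Ob x]
    have "U (d, 0, l) (act ?B (idn D d, const_mor 0 n 0, idn simplex l) (idn D d, idn simplex n, x)) =
          act L (idn D d, const_mor 0 n 0, idn simplex l) (u l x)"
      unfolding u_def by (rule nat_on_act[OF U]) (use d x xX in simp_all)
    then have "act L (idn D d, const_mor 0 n 0, idn simplex l) (u l x) = v0 l x"
      using presheaf_idn[OF X simplex_Ob xX] i cn by (simp add: v0_def)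
    moreover have "p (d, n, l) (u l x) = v1 l x"
      using UV[of "(d, n, l)" "(idn D d, idn simplex n, x)"] d x xX by (simp add: u_def v1_def)
    ultimately show ?thesis unfolding left_map_apply[where L = L, OF uv[OF x]] by simp
  qed
  obtain h where h: "nat_on simplex X (val X) (sl D L d n) h" "\<And>l x. x \<in> A l \<Longrightarrow> h l x = u l x"
    "\<And>l x. x \<in> val X l \<Longrightarrow> left_map L p d n l (h l x) = (v0 l x, v1 l x)"
    using RLP_simplexE[OF rlp uN vN fu] by blast
  have hv: "h l x \<in> val L (d, n, l)" if "x \<in> val X l" for l x using nat_on_val[OF h(1) simplex_Ob that] by simp
  have h0: "act L (idn D d, const_mor 0 n 0, idn simplex l) (h l x) = v0 l x" "p (d, n, l) (h l x) = v1 l x"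
    if "x \<in> val X l" for l x
    using h(3)[OF that] unfolding left_map_apply[where L = L, OF hv[OF that]] by auto
  show "\<exists>h. nat_on \<C> ?B (val ?B) L h \<and> (\<forall>c\<in>Ob \<C>. \<forall>x\<in>?S c. h c x = U c x) \<and>
      (\<forall>c\<in>Ob \<C>. \<forall>x\<in>val ?B c. p c (h c x) = V c x)"
  proof (intro exI conjI ballI)
    show "nat_on \<C> ?B (val ?B) L (ext L h)" by (rule nat_ext[OF L refl X h(1)])
    fix c z assume c: "c \<in> Ob \<C>" "z \<in> ?S c"
    obtain d' k l g \<alpha> x where *: "c = (d', k, l)" "z = (g, \<alpha>, x)" by (metis prod_cases3)
    have g: "g \<in> Ar D" "src D g = d'" "tgt D g = d" "\<alpha> \<in> smap k n" "x \<in> val X l" "\<alpha> = const_mor k n 0 \<or> x \<in> A l"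
      using c(2) unfolding * by simp_all
    have ug: "cmp D (idn D d) g = g" using unit_D(2)[OF g(1)] g(3) by simp
    have ua: "cmp simplex (idn simplex n) \<alpha> = \<alpha>" using category_unit(2)[OF category_simplex, of \<alpha> n] g(4) by simp
    from g(6) show "ext L h c z = U c z"
    proof
      assume a: "\<alpha> = const_mor k n 0"
      have "U (d', k, l) (act ?B (g, const_mor k 0 0, idn simplex l) (idn D d, const_mor 0 n 0, x)) =
          act L (g, const_mor k 0 0, idn simplex l) (v0 l x)"
        unfolding v0_def by (rule nat_on_act[OF U]) (use d g in simp_all)
      then show ?thesis
        using const_split[OF L g(1), of "h l x" n l k] hv[OF g(5)] h0(1)[OF g(5)] g(3)
          presheaf_idn[OF X simplex_Ob g(5)] ug const_mor_cmp unfolding * a by simp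
    next
      assume a: "x \<in> A l"
      have "U (d', k, l) (act ?B (g, \<alpha>, idn simplex l) (idn D d, idn simplex n, x)) =
          act L (g, \<alpha>, idn simplex l) (u l x)"
        unfolding u_def by (rule nat_on_act[OF U]) (use d g a in simp_all)
      then show ?thesis using h(2)[OF a] presheaf_idn[OF X simplex_Ob g(5)] ug ua unfolding * by simp
    qed
  next
    fix c z assume c: "c \<in> Ob \<C>" "z \<in> val ?B c"
    obtain d' k l g \<alpha> x where *: "c = (d', k, l)" "z = (g, \<alpha>, x)" by (metis prod_cases3)
    have g: "g \<in> Ar D" "src D g = d'" "tgt D g = d" "\<alpha> \<in> smap k n" "x \<in> val X l"
      using c(2) unfolding * by simp_all
    have ug: "cmp D (idn D d) g = g" using unit_D(2)[OF g(1)] g(3) by simp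
    have ua: "cmp simplex (idn simplex n) \<alpha> = \<alpha>" using category_unit(2)[OF category_simplex, of \<alpha> n] g(4) by simp
    have "V (d', k, l) (act ?B (g, \<alpha>, idn simplex l) (idn D d, idn simplex n, x)) =
        act W (g, \<alpha>, idn simplex l) (v1 l x)"
      unfolding v1_def by (rule nat_on_act[OF V]) (use d g in simp_all)
    moreover have "p (d', k, l) (act L (g, \<alpha>, idn simplex l) (h l x)) = act W (g, \<alpha>, idn simplex l) (p (d, n, l) (h l x))"
      by (rule nat_on_act[OF p]) (use g hv[OF g(5)] in simp_all)
    ultimately show "p c (ext L h c z) = V c z"
      using h0(2)[OF g(5)] presheaf_idn[OF X simplex_Ob g(5)] ug ua unfolding * by simp
  qed
qed

text \<open>The case without a prescribed vertex: no value in level 0 is fixed beforehand, so the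
  target is the level of \<open>W\<close> itself instead of a fibre product.\<close>

lemma box_to_level_empty:
  assumes L: "presheaf \<C> L" and W: "presheaf \<C> W" and d: "d \<in> Ob D"
    and X: "presheaf simplex X" and A: "sub simplex X A" and p: "nat_on \<C> L (val L) W p"
    and rlp: "RLP \<C> (box D d (std_simplex n) X) (box_corner D d (std_simplex n) (\<lambda>_. {}) X A) L W p"
  shows "RLP simplex X A (sl D L d n) (sl D W d n) (\<lambda>l. p (d, n, l))"
proof (rule RLPI)
  fix u v assume u: "nat_on simplex X A (sl D L d n) u"
    and v: "nat_on simplex X (val X) (sl D W d n) v"
    and uv: "\<And>l x. l \<in> Ob simplex \<Longrightarrow> x \<in> A l \<Longrightarrow> p (d, n, l) (u l x) = v l x"
  let ?B = "box D d (std_simplex n) X" and ?S = "box_corner D d (std_simplex n) (\<lambda>_. {}) X A"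
  have uL: "u l x \<in> val L (d, n, l)" if "x \<in> A l" for l x using nat_on_val[OF u simplex_Ob that] by simp
  have vW: "v l x \<in> val W (d, n, l)" if "x \<in> val X l" for l x using nat_on_val[OF v simplex_Ob that] by simp
  have nT: "nat_on \<C> ?B ?S L (ext L u)"
  proof -
    have "nat_on \<C> (box D d (std_simplex n) (restr X A)) (val (box D d (std_simplex n) (restr X A))) L (ext L u)"
      by (rule nat_ext[OF L refl presheaf_restr[OF category_simplex X A]]) (use u in simp)
    moreover have "act (box D d (std_simplex n) (restr X A)) = act ?B"
      "val (box D d (std_simplex n) (restr X A)) = ?S"
      using subD[OF A simplex_Ob] by (auto simp: box_def box_corner_def fun_eq_iff)
    ultimately show ?thesis unfolding nat_on_def by simp
  qed
  have nV: "nat_on \<C> ?B (val ?B) W (ext W v)" by (rule nat_ext[OF W refl X v])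
  have pT: "p c (ext L u c z) = ext W v c z" if c: "c \<in> Ob \<C>" "z \<in> ?S c" for c z
  proof -
    obtain d' k l g \<alpha> x where *: "c = (d', k, l)" "z = (g, \<alpha>, x)" by (metis prod_cases3)
    have g: "g \<in> Ar D" "src D g = d'" "tgt D g = d" "\<alpha> \<in> smap k n" "x \<in> val X l" "x \<in> A l"
      using c(2) unfolding * by simp_all
    have "p (d', k, l) (act L (g, \<alpha>, idn simplex l) (u l x)) = act W (g, \<alpha>, idn simplex l) (p (d, n, l) (u l x))"
      by (rule nat_on_act[OF p]) (use g uL[OF g(6)] in simp_all)
    then show ?thesis unfolding * using uv[OF simplex_Ob g(6)] by simp
  qed
  obtain H where H: "nat_on \<C> ?B (val ?B) L H" "\<And>c z. c \<in> Ob \<C> \<Longrightarrow> z \<in> ?S c \<Longrightarrow> H c z = ext L u c z"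
    "\<And>c z. c \<in> Ob \<C> \<Longrightarrow> z \<in> val ?B c \<Longrightarrow> p c (H c z) = ext W v c z"
    using RLPE[OF rlp nT nV pT] by blast
  define h where "h = (\<lambda>l x. H (d, n, l) (idn D d, idn simplex n, x))"
  show "\<exists>h. nat_on simplex X (val X) (sl D L d n) h \<and> (\<forall>c\<in>Ob simplex. \<forall>x\<in>A c. h c x = u c x) \<and>
      (\<forall>c\<in>Ob simplex. \<forall>x\<in>val X c. p (d, n, c) (h c x) = v c x)"
  proof (intro exI conjI ballI)
    show "nat_on simplex X (val X) (sl D L d n) h"
    proof (rule nat_onI)
      fix c x assume "x \<in> val X c" then show "h c x \<in> val (sl D L d n) c"
        unfolding h_def sl_simps by (intro nat_on_val[OF H(1)]) (use d in simp_all)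
    next
      fix f x assume f: "f \<in> Ar simplex" "x \<in> val X (tgt simplex f)"
      have "H (d, n, src simplex f) (act ?B (idn D d, idn simplex n, f) (idn D d, idn simplex n, x)) =
          act L (idn D d, idn simplex n, f) (H (d, n, tgt simplex f) (idn D d, idn simplex n, x))"
        by (rule nat_on_act[OF H(1)]) (use f d in simp_all)
      then show "h (src simplex f) (act X f x) = act (sl D L d n) f (h (tgt simplex f) x)"
        using unit_D[OF idn_D(1)[OF d]] simplex_unit[of "idn simplex n"] d by (simp add: h_def)
    qed
    fix l x
    show "h l x = u l x" if x: "x \<in> A l"
      using H(2)[of "(d, n, l)" "(idn D d, idn simplex n, x)"] d subD[OF A simplex_Ob x] x act_id[OF L d uL[OF x]]
      by (simp add: h_def)
    show "p (d, n, l) (h l x) = v l x" if x: "x \<in> val X l"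
      using H(3)[of "(d, n, l)" "(idn D d, idn simplex n, x)"] d x act_id[OF W d vW[OF x]] by (simp add: h_def)
  qed
qed

end

section \<open>Left fibrations and the initial vertex\<close>

lemma presheaf_terminal: "presheaf C terminal_psh"
  by (rule presheafI) auto

locale left_fibration_over_fibrant = universe D U
  for D :: "('o, 'm) cat" and U :: "'u itself" +
  fixes L W :: "('o, 'm, 'u) dspace" and p
  assumes L: "presheaf \<C> L" and W: "presheaf \<C> W"
    and left: "D_left_fibration D L W p"
    and fibrant: "injective_fibration D W terminal_psh (to_terminal \<C> W)"
begin

lemma inj: "injective_fibration D L W p"
  using left unfolding D_left_fibration_def by blast

lemma nat_p: "nat_on \<C> L (val L) W p"
  using inj homD unfolding injective_fibration_def by blast

context
  fixes d assumes d: "d \<in> Ob D"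
begin

lemma small_simplex: "small_set U (val (std_simplex n) k)"
  by (rule small_countable[OF d])

lemma small_prod_simplex:
  "(\<And>k. small_set U (val X k)) \<Longrightarrow> small_set U (val (X \<times>\<^sub>p \<Delta>1) k)"
  unfolding prod_psh_simps by (intro small_times[OF d] small_simplex)

text \<open>What injective fibrancy gives at a fixed \<open>(d, n)\<close>: \<open>p\<close> and
  \<open>W\<close> are tested on external products with a simplex. Fibrancy of the level of
  \<open>L\<close> follows by first extending the image in \<open>W\<close>; for the fibre product
  one extends the \<open>W\<close>-component and then lifts the \<open>L\<close>-component over
  it.\<close>

lemma level_map_RLP:
  assumes X: "presheaf simplex X" "sub simplex X A" "\<And>k. small_set U (val X k)"
    and e: "\<epsilon> = 0 \<or> \<epsilon> = 1" "scontracts \<epsilon> X A"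
  shows "RLP simplex X A (sl D L d n) (left_base L W p d n) (left_map L p d n)"
    and "RLP simplex X A (sl D L d n) (sl D W d n) (\<lambda>l. p (d, n, l))"
    and "RLP simplex X A (sl D W d n) terminal_psh q"
    and "RLP simplex X A (sl D L d n) terminal_psh q"
    and "RLP simplex X A (left_base L W p d n) terminal_psh r"
proof -
  have iv: "sub simplex (std_simplex n) (iv n)" for n
    by (rule sub_point) (auto simp: point_def const_mor_act[OF smap_Ar])
  have emp: "sub simplex (std_simplex n) (\<lambda>_. {})" for n unfolding sub_def by simp
  show "RLP simplex X A (sl D L d n) (left_base L W p d n) (left_map L p d n)"
    by (rule box_to_level[OF L W nat_p d X(1,2)
          injective_fibration_box[OF inj presheaf_simplex iv small_simplex X e]])
  show *: "RLP simplex X A (sl D L d n) (sl D W d n) (\<lambda>l. p (d, n, l))" for n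
    by (rule box_to_level_empty[OF L W d X(1,2) nat_p
          injective_fibration_box[OF inj presheaf_simplex emp small_simplex X e]])
  have W1: "RLP simplex X A (sl D W d n) (sl D terminal_psh d n) (\<lambda>l. to_terminal \<C> W (d, n, l))" for n
    by (rule box_to_level_empty[OF W presheaf_terminal d X(1,2) nat_on_terminal
          injective_fibration_box[OF fibrant presheaf_simplex emp small_simplex X e]])
  show WT: "RLP simplex X A (sl D W d n) terminal_psh q" for n q
  proof (rule RLPI)
    fix u v assume u: "nat_on simplex X A (sl D W d n) u"
    have v: "nat_on simplex X (val X) (sl D terminal_psh d n) (\<lambda>_ _. ())" unfolding nat_on_def by simp
    show "\<exists>h. nat_on simplex X (val X) (sl D W d n) h \<and> (\<forall>c\<in>Ob simplex. \<forall>x\<in>A c. h c x = u c x) \<and>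
        (\<forall>c\<in>Ob simplex. \<forall>x\<in>val X c. q c (h c x) = v c x)" for v
      using RLP_simplexE[OF W1 u v] by (metis unit_eq)
  qed
  show "RLP simplex X A (sl D L d n) terminal_psh q"
  proof (rule RLPI)
    fix u v assume u: "nat_on simplex X A (sl D L d n) u"
    have pu: "nat_on simplex X A (sl D W d n) (\<lambda>l x. p (d, n, l) (u l x))"
      by (rule nat_on_comp[OF category_simplex u nat_on_sl[OF catD nat_p d]])
        (use nat_on_val[OF u] in simp)
    obtain w where w: "nat_on simplex X (val X) (sl D W d n) w" "\<And>l x. x \<in> A l \<Longrightarrow> w l x = p (d, n, l) (u l x)"
      by (rule RLP_simplexE[OF WT[of n "\<lambda>_ _. ()"] pu nat_on_terminal[of _ _ _ "\<lambda>_ _. ()"]]) (simp, blast)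
    obtain h where "nat_on simplex X (val X) (sl D L d n) h" "\<And>l x. x \<in> A l \<Longrightarrow> h l x = u l x"
      by (rule RLP_simplexE[OF * u w(1)]) (use w(2) in \<open>simp, blast\<close>)
    then show "\<exists>h. nat_on simplex X (val X) (sl D L d n) h \<and> (\<forall>c\<in>Ob simplex. \<forall>x\<in>A c. h c x = u c x) \<and>
        (\<forall>c\<in>Ob simplex. \<forall>x\<in>val X c. q c (h c x) = v c x)"
      by (intro exI[of _ h]) simp
  qed
  show "RLP simplex X A (left_base L W p d n) terminal_psh r"
  proof (rule RLPI)
    fix u v assume u: "nat_on simplex X A (left_base L W p d n) u"
    have uB: "fst (u l x) \<in> val L (d, 0, l)" "snd (u l x) \<in> val W (d, n, l)"
      "p (d, 0, l) (fst (u l x)) = act W (idn D d, const_mor 0 n 0, idn simplex l) (snd (u l x))"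
      if "x \<in> A l" for l x
      using nat_on_val[OF u simplex_Ob that] left_base_iff[where y = "fst (u l x)" and w = "snd (u l x)" and L = L and W = W and p = p and n = n and d = d and l = l] by simp_all
    have ua: "u (src simplex f) (act X f x) =
        (act L (idn D d, idn simplex 0, f) (fst (u (tgt simplex f) x)), act W (idn D d, idn simplex n, f) (snd (u (tgt simplex f) x)))"
      if "f \<in> Ar simplex" "x \<in> A (tgt simplex f)" for f x
      using nat_on_act[OF u that(1) refl refl that(2)]
        left_base_act[where \<beta> = f and y = "fst (u (tgt simplex f) x)" and w = "snd (u (tgt simplex f) x)" and L = L and W = W and p = p and n = n and d = d] by simp
    have u0: "nat_on simplex X A (sl D L d 0) (\<lambda>l x. fst (u l x))" and u1: "nat_on simplex X A (sl D W d n) (\<lambda>l x. snd (u l x))"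
      using uB ua by (auto intro!: nat_onI)
    obtain w where w: "nat_on simplex X (val X) (sl D W d n) w" "\<And>l x. x \<in> A l \<Longrightarrow> w l x = snd (u l x)"
      by (rule RLP_simplexE[OF WT[of n "\<lambda>_ _. ()"] u1 nat_on_terminal[of _ _ _ "\<lambda>_ _. ()"]]) (simp, blast)
    define w0 where "w0 = (\<lambda>l x. act W (idn D d, const_mor 0 n 0, idn simplex l) (w l x))"
    have wv: "w l x \<in> val W (d, n, l)" if "x \<in> val X l" for l x using nat_on_val[OF w(1) simplex_Ob that] by simp
    have w0: "nat_on simplex X (val X) (sl D W d 0) w0"
    proof (rule nat_onI)
      fix l x assume "x \<in> val X l" then show "w0 l x \<in> val (sl D W d 0) l"
        unfolding w0_def using ext_val[OF W, of "idn D d" "const_mor 0 n 0" 0 n _ l] wv d by simp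
    next
      fix f x assume f: "f \<in> Ar simplex" "x \<in> val X (tgt simplex f)"
      show "w0 (src simplex f) (act X f x) = act (sl D W d 0) f (w0 (tgt simplex f) x)"
        using act_swap[OF W d wv[OF f(2)] const_mor_smap smap_Ar[OF f(1)], of 0 0]
          nat_on_act[OF w(1) f(1) refl refl f(2)] by (simp add: w0_def)
    qed
    obtain h where h: "nat_on simplex X (val X) (sl D L d 0) h" "\<And>l x. x \<in> A l \<Longrightarrow> h l x = fst (u l x)"
      "\<And>l x. x \<in> val X l \<Longrightarrow> p (d, 0, l) (h l x) = w0 l x"
      by (rule RLP_simplexE[OF *[of 0] u0 w0]) (use w(2) uB(3) in \<open>simp add: w0_def, blast\<close>)
    have "nat_on simplex X (val X) (left_base L W p d n) (\<lambda>l x. (h l x, w l x))"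
      using nat_on_val[OF h(1)] nat_on_act[OF h(1) _ refl refl] wv nat_on_act[OF w(1) _ refl refl] h(3)
      by (intro nat_onI) (auto simp: left_base_iff w0_def)
    then show "\<exists>h. nat_on simplex X (val X) (left_base L W p d n) h \<and> (\<forall>c\<in>Ob simplex. \<forall>x\<in>A c. h c x = u c x) \<and>
        (\<forall>c\<in>Ob simplex. \<forall>x\<in>val X c. r c (h c x) = v c x)"
      using h(2) w(2) by (intro exI[of _ "\<lambda>l x. (h l x, w l x)"]) simp
  qed
qed

text \<open>The left fibration condition makes \<open>left_map\<close> a Kan equivalence between Kan
  complexes, and \<open>trivial_fibration\<close> upgrades it to a trivial fibration. All auxiliary
  problems there are cylinders, which contract, so \<open>level_map_RLP\<close> solves them; no
  contraction of \<open>A\<close> in \<open>X\<close> is involved.\<close>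

lemma level_trivial:
  assumes X: "presheaf simplex X" "sub simplex X A" "\<And>k. small_set U (val X k)"
  shows "RLP simplex X A (sl D L d n) (left_base L W p d n) (left_map L p d n)"
proof -
  let ?E = "sl D L d n" and ?B = "left_base L W p d n"
  have E: "presheaf simplex ?E" by (rule presheaf_sl[OF catD L d])
  have B: "presheaf simplex ?B" by (rule presheaf_left_base[OF L W nat_p d])
  have sE: "small_set U (val ?E k)" for k by (rule small_base)
  have sB: "small_set U (val ?B k)" for k
    by (rule small_subset[OF small_times[OF d small_base small_base, of "UNIV :: 'u set" "UNIV :: 'u set"]]) simp
  have keq: "kan_equivalence ?E ?B (left_map L p d n)"
    using left d unfolding D_left_fibration_def left_fibration_def by blast
  \<comment> \<open>Horn inclusions contract, so horn filling in source and target is a case of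
    \<open>level_map_RLP\<close>.\<close>
  have horn: "RLP simplex (std_simplex m) (val (horn m k)) ?E terminal_psh q"
      "RLP simplex (std_simplex m) (val (horn m k)) ?B terminal_psh r" if mk: "1 \<le> m" "k \<le> m" for m k q r
  proof -
    obtain \<epsilon> where e: "\<epsilon> = 0 \<or> \<epsilon> = 1" "scontracts \<epsilon> (std_simplex m) (val (horn m k))"
      by (rule horn_contracts[OF mk])
    show "RLP simplex (std_simplex m) (val (horn m k)) ?E terminal_psh q"
      by (rule level_map_RLP(4)[OF presheaf_simplex sub_horn small_simplex e])
    show "RLP simplex (std_simplex m) (val (horn m k)) ?B terminal_psh r"
      by (rule level_map_RLP(5)[OF presheaf_simplex sub_horn small_simplex e])
  qed
  obtain g G K where g: "nat_on simplex ?B (val ?B) ?E g"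
    "nat_on simplex (?E \<times>\<^sub>p \<Delta>1) (val (?E \<times>\<^sub>p \<Delta>1)) ?E G"
    "\<And>c x. x \<in> val ?E c \<Longrightarrow> G c (x, vx 0 c) = g c (left_map L p d n c x)"
    "\<And>c x. x \<in> val ?E c \<Longrightarrow> G c (x, vx 1 c) = x"
    "nat_on simplex (?B \<times>\<^sub>p \<Delta>1) (val (?B \<times>\<^sub>p \<Delta>1)) ?B K"
    "\<And>c x. x \<in> val ?B c \<Longrightarrow> K c (x, vx 0 c) = left_map L p d n c (g c x)"
    "\<And>c x. x \<in> val ?B c \<Longrightarrow> K c (x, vx 1 c) = x"
    using kan_equivalence_inverse[OF E B keq horn] by blast
  have emp: "sub simplex Y (\<lambda>_. {})" for Y :: "'y sset" unfolding sub_def by simp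
  have cyl: "presheaf simplex (Y \<times>\<^sub>p \<Delta>1)" "sub simplex (Y \<times>\<^sub>p \<Delta>1) (cyl Y S \<Delta>1 (vx 0))"
    if "presheaf simplex Y" "sub simplex Y S" for Y :: "'y sset" and S
    using presheaf_prod[OF that(1) presheaf_simplex] sub_corner[OF that(1) presheaf_simplex that(2) sub_point[OF point_vx]]
    by simp_all
  note c0 = cyl_contracts[of 0, OF disjI1[OF refl]]
  have E1: "presheaf simplex (?E \<times>\<^sub>p \<Delta>1)" by (rule presheaf_prod[OF E presheaf_simplex])
  have E1s: "sub simplex (?E \<times>\<^sub>p \<Delta>1) (corner ?E (\<lambda>_. {}) \<Delta>1 ends)"
    by (rule sub_corner[OF E presheaf_simplex emp sub_ends])
  show ?thesis
  proof (rule trivial_fibration[OF E B X(1,2) nat_left_map[OF L W nat_p d] _ _ _ _ g])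
    show "RLP simplex (?B \<times>\<^sub>p \<Delta>1) (cyl ?B (\<lambda>_. {}) \<Delta>1 (vx 0)) ?E ?B (left_map L p d n)"
      by (rule level_map_RLP(1)[OF cyl[OF B emp] small_prod_simplex[OF sB] _ c0]) simp
    show "RLP simplex (square ?E) (open_square ?E) ?E ?B (left_map L p d n)"
      by (rule level_map_RLP(1)[OF cyl[OF E1 E1s] small_prod_simplex[OF small_prod_simplex[OF sE]] _ c0]) simp
    show "RLP simplex (square ?E) (open_square ?E) ?E terminal_psh (\<lambda>_ _. ())"
      by (rule level_map_RLP(4)[OF cyl[OF E1 E1s] small_prod_simplex[OF small_prod_simplex[OF sE]] _ c0]) simp
    show "RLP simplex (X \<times>\<^sub>p \<Delta>1) (cyl X A \<Delta>1 (vx 0)) ?E ?B (left_map L p d n)"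
      by (rule level_map_RLP(1)[OF cyl[OF X(1,2)] small_prod_simplex[OF X(3)] _ c0]) simp
  qed
qed

text \<open>The starting point of the right cancellation: the initial vertex combined with an
  arbitrary monomorphism in the space direction.\<close>

lemma box_initial_vertex:
  assumes X: "presheaf simplex X" "sub simplex X A" "\<And>k. small_set U (val X k)"
  shows "RLP \<C> (box D d (std_simplex n) X) (box_corner D d (std_simplex n) (iv n) X A) L W p"
  by (rule level_to_box[OF L W nat_p d X(1,2) level_trivial[OF X]])

end

end

text \<open>Right cancellation: if \<open>S0 \<subseteq> T\<close> and \<open>S0 \<subseteq> S1\<close> have the lifting property, a lift relative to
  \<open>S0\<close> is homotopic on \<open>S1\<close> to the prescribed values, and is corrected by homotopy extension.\<close>

lemma box_cancel:
  fixes D :: "('a, 'b) cat" and T :: "'t sset" and X :: "'x sset"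
  assumes D: "category D" and T: "presheaf simplex T" and S0: "sub simplex T S0" and S1: "sub simplex T S1"
    and le: "\<And>k. S0 k \<subseteq> S1 k" and X: "presheaf simplex X" and A: "sub simplex X A"
    and h1: "RLP (dsimp_cat D) (box D d T X) (box_corner D d T S0 X A) L W p"
    and h2: "RLP (dsimp_cat D) (box D d (restr T S1) (X \<times>\<^sub>p \<Delta>1))
        (box_corner D d (restr T S1) S0 (X \<times>\<^sub>p \<Delta>1) (corner X A \<Delta>1 ends)) L W p"
    and h3: "RLP (dsimp_cat D) (box D d T (X \<times>\<^sub>p \<Delta>1))
        (box_corner D d T S1 (X \<times>\<^sub>p \<Delta>1) (cyl X A \<Delta>1 (vx 0))) L W p"
  shows "RLP (dsimp_cat D) (box D d T X) (box_corner D d T S1 X A) L W p"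
proof (rule RLPI)
  let ?C = "dsimp_cat D"
  note C = category_dsimp[OF D]
  let ?B = "box D d T X" and ?B2 = "box D d (restr T S1) (X \<times>\<^sub>p \<Delta>1)" and ?B3 = "box D d T (X \<times>\<^sub>p \<Delta>1)"
  let ?A0 = "box_corner D d T S0 X A" and ?A1 = "box_corner D d T S1 X A"
  let ?A2 = "box_corner D d (restr T S1) S0 (X \<times>\<^sub>p \<Delta>1) (corner X A \<Delta>1 ends)"
  let ?A3 = "box_corner D d T S1 (X \<times>\<^sub>p \<Delta>1) (cyl X A \<Delta>1 (vx 0))"
  fix u v assume u: "nat_on ?C ?B ?A1 L u" and v: "nat_on ?C ?B (val ?B) W v"
    and uv: "\<And>c x. c \<in> Ob ?C \<Longrightarrow> x \<in> ?A1 c \<Longrightarrow> p c (u c x) = v c x"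
  have A01: "?A0 c \<subseteq> ?A1 c" for c using le by (cases c) (auto simp: box_corner_def)
  have v0 [simp]: "vx 0 l \<in> Ar simplex" "src simplex (vx 0 l) = l" "tgt simplex (vx 0 l) = 1"
    "vx 1 l \<in> Ar simplex" "src simplex (vx 1 l) = l" "tgt simplex (vx 1 l) = 1" for l
    using vx_val[of 0 l] vx_val[of 1 l] by auto
  \<comment> \<open>A first lift, correct on \<open>S0\<close> and over \<open>A\<close>
    only.\<close>
  obtain h where h: "nat_on ?C ?B (val ?B) L h" "\<And>c z. c \<in> Ob ?C \<Longrightarrow> z \<in> ?A0 c \<Longrightarrow> h c z = u c z"
    "\<And>c z. c \<in> Ob ?C \<Longrightarrow> z \<in> val ?B c \<Longrightarrow> p c (h c z) = v c z"
    using RLPE[OF h1 nat_on_mono[OF C u A01] v] uv A01 by blast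
  have vB: "nat_on ?C ?B3 (val ?B3) W (\<lambda>c (g, \<tau>, x, t). v c (g, \<tau>, x))"
  proof (rule nat_onI)
    fix c z assume c: "c \<in> Ob ?C" "z \<in> val ?B3 c"
    obtain d' k l g \<tau> x t where *: "c = (d', k, l)" "z = (g, \<tau>, x, t)" by (metis prod_cases3)
    show "(case z of (g, \<tau>, x, t) \<Rightarrow> v c (g, \<tau>, x)) \<in> val W c"
      using c nat_on_val[OF v c(1), of "(g, \<tau>, x)"] unfolding * by simp
  next
    fix f z assume f: "f \<in> Ar ?C" "z \<in> val ?B3 (tgt ?C f)"
    obtain f0 \<alpha> \<beta> g \<tau> x t where *: "f = (f0, \<alpha>, \<beta>)" "z = (g, \<tau>, x, t)" by (metis prod_cases3)
    show "(case act ?B3 f z of (g, \<tau>, x, t) \<Rightarrow> v (src ?C f) (g, \<tau>, x)) = act W f (case z of (g, \<tau>, x, t) \<Rightarrow> v (tgt ?C f) (g, \<tau>, x))"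
      using f nat_on_act[OF v f(1) refl refl, of "(g, \<tau>, x)"] unfolding * by simp
  qed
  \<comment> \<open>On \<open>S1\<close> the lift \<open>h\<close> and the prescribed
    \<open>u\<close> agree over \<open>S0\<close> and over \<open>A\<close>, so they can be joined
    by a homotopy over \<open>W\<close> that is constant there; this is the problem of
    \<open>h2\<close>.\<close>
  define k where "k = (\<lambda>c :: 'a dob. \<lambda>(g, \<tau>, x, t). if t = vx 0 (snd (snd c)) then h c (g, \<tau>, x) else u c (g, \<tau>, x))"
  have k0: "k (d', m, l) (g, \<tau>, x, vx 0 l) = h (d', m, l) (g, \<tau>, x)" for d' m l g \<tau> x by (simp add: k_def)
  have k1: "k (d', m, l) (g, \<tau>, x, t) = u (d', m, l) (g, \<tau>, x)"
    if "(d', m, l) \<in> Ob ?C" "(g, \<tau>, x) \<in> ?A0 (d', m, l) \<or> t = vx 1 l" for d' m l g \<tau> x t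
    using that h(2) by (auto simp: k_def)
  have nk: "nat_on ?C ?B2 ?A2 L k"
  proof (rule nat_onI)
    fix c z assume c: "c \<in> Ob ?C" "z \<in> ?A2 c"
    obtain d' m l g \<tau> x t where *: "c = (d', m, l)" "z = (g, \<tau>, x, t)" by (metis prod_cases3)
    have B: "(g, \<tau>, x) \<in> val ?B c" "(g, \<tau>, x) \<in> ?A1 c" "(g, \<tau>, x) \<in> ?A0 c \<or> t = vx 0 l \<or> t = vx 1 l"
      using c(2) subD[OF S1 simplex_Ob] unfolding * by auto
    then show "k c z \<in> val L c"
      using k0 k1[of d' m l g \<tau> x t] nat_on_val[OF h(1) c(1) B(1)] nat_on_val[OF u c(1) B(2)] c(1) unfolding * by auto
  next
    fix f z assume f: "f \<in> Ar ?C" "z \<in> ?A2 (tgt ?C f)"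
    obtain f0 \<alpha> \<beta> g \<tau> x t where *: "f = (f0, \<alpha>, \<beta>)" "z = (g, \<tau>, x, t)" by (metis prod_cases3)
    have o: "src ?C f \<in> Ob ?C" "tgt ?C f \<in> Ob ?C" by (rule category_Ob[OF C f(1)])+
    have \<beta>: "\<beta> \<in> Ar simplex" using f(1) unfolding * by simp
    have B: "(g, \<tau>, x) \<in> val ?B (tgt ?C f)" "(g, \<tau>, x) \<in> ?A1 (tgt ?C f)"
       "(g, \<tau>, x) \<in> ?A0 (tgt ?C f) \<or> t = vx 0 (tgt simplex \<beta>) \<or> t = vx 1 (tgt simplex \<beta>)"
      using f(2) subD[OF S1 simplex_Ob] unfolding * by auto
    have a: "act ?B f (g, \<tau>, x) \<in> ?A0 (src ?C f)" if "(g, \<tau>, x) \<in> ?A0 (tgt ?C f)"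
      using sub_act[OF sub_box[OF D T X S0 A] f(1) refl refl that] .
    note N = nat_on_act[OF h(1) f(1) refl refl B(1)] nat_on_act[OF u f(1) refl refl B(2)]
    from B(3) show "k (src ?C f) (act ?B2 f z) = act L f (k (tgt ?C f) z)"
    proof (elim disjE)
      assume b: "(g, \<tau>, x) \<in> ?A0 (tgt ?C f)"
      show ?thesis using a[OF b] b N(2) o unfolding * by (simp add: k1)
    next
      assume b: "t = vx 0 (tgt simplex \<beta>)"
      show ?thesis using N(1) vx_act[OF _ \<beta>, of 0] unfolding * b by (simp add: k0)
    next
      assume b: "t = vx 1 (tgt simplex \<beta>)"
      show ?thesis using N(2) o vx_act[OF _ \<beta>, of 1] unfolding * b by (simp add: k1)
    qed
  qed
  have B23: "val ?B2 c \<subseteq> val ?B3 c" for c using subD[OF S1 simplex_Ob] by (cases c) (auto simp: box_def)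
  have act23: "act ?B2 = act ?B3" by (simp add: box_def)
  have vB2: "nat_on ?C ?B2 (val ?B2) W (\<lambda>c (g, \<tau>, x, t). v c (g, \<tau>, x))"
    using nat_on_mono[OF C vB B23] unfolding nat_on_def act23 .
  have pk: "p c (k c z) = (case z of (g, \<tau>, x, t) \<Rightarrow> v c (g, \<tau>, x))" if c: "c \<in> Ob ?C" "z \<in> ?A2 c" for c z
  proof -
    obtain d' m l g \<tau> x t where *: "c = (d', m, l)" "z = (g, \<tau>, x, t)" by (metis prod_cases3)
    have B: "(g, \<tau>, x) \<in> val ?B c" "(g, \<tau>, x) \<in> ?A1 c" "(g, \<tau>, x) \<in> ?A0 c \<or> t = vx 0 l \<or> t = vx 1 l"
      using c(2) subD[OF S1 simplex_Ob] unfolding * by auto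
    then show ?thesis using k0 k1[of d' m l g \<tau> x t] h(3)[OF c(1) B(1)] uv[OF c(1) B(2)] c(1) unfolding * by auto
  qed
  obtain H where H: "nat_on ?C ?B2 (val ?B2) L H" "\<And>c z. c \<in> Ob ?C \<Longrightarrow> z \<in> ?A2 c \<Longrightarrow> H c z = k c z"
    "\<And>c z. c \<in> Ob ?C \<Longrightarrow> z \<in> val ?B2 c \<Longrightarrow> p c (H c z) = (case z of (g, \<tau>, x, t) \<Rightarrow> v c (g, \<tau>, x))"
    using RLPE[OF h2 nk vB2 pk] by blast
  \<comment> \<open>The homotopy from \<open>h\<close> to \<open>u\<close> on \<open>S1\<close>,
    constant over \<open>A\<close>, is to be extended to \<open>T\<close> with start
    \<open>h\<close>: the homotopy extension problem of \<open>h3\<close>.\<close>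
  define w where "w = (\<lambda>c (g, \<tau>, x, t). if \<tau> \<in> S1 (fst (snd c)) then H c (g, \<tau>, x, t) else h c (g, \<tau>, x))"
  have w1: "w (d', m, l) (g, \<tau>, x, t) = H (d', m, l) (g, \<tau>, x, t)" if "\<tau> \<in> S1 m" for d' m l g \<tau> x t
    using that by (simp add: w_def)
  have w0: "w (d', m, l) (g, \<tau>, x, t) = h (d', m, l) (g, \<tau>, x)"
    if c: "(d', m, l) \<in> Ob ?C" and z: "(g, \<tau>, x) \<in> val ?B (d', m, l)" "x \<in> A l \<or> t = vx 0 l" "t \<in> val \<Delta>1 l" for d' m l g \<tau> x t
  proof (cases "\<tau> \<in> S1 m")
    case True
    then have "(g, \<tau>, x, t) \<in> ?A2 (d', m, l)" using z by auto
    then have "H (d', m, l) (g, \<tau>, x, t) = k (d', m, l) (g, \<tau>, x, t)" by (rule H(2)[OF c])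
    moreover have "(g, \<tau>, x) \<in> ?A0 (d', m, l)" if "x \<in> A l" using z(1) that by simp
    ultimately show ?thesis using z(2) k0 k1[OF c, of g \<tau> x t] h(2)[OF c, of "(g, \<tau>, x)"] w1[OF True] by auto
  qed (simp add: w_def)
  have cases3: thesis
    if z: "z \<in> ?A3 (d', m, l)"
      and "\<And>g \<tau> x t. z = (g, \<tau>, x, t) \<Longrightarrow> (g, \<tau>, x, t) \<in> val ?B2 (d', m, l) \<Longrightarrow> \<tau> \<in> S1 m \<Longrightarrow> thesis"
      and "\<And>g \<tau> x t. z = (g, \<tau>, x, t) \<Longrightarrow> (g, \<tau>, x) \<in> val ?B (d', m, l) \<Longrightarrow> x \<in> A l \<or> t = vx 0 l \<Longrightarrow> t \<in> val \<Delta>1 l \<Longrightarrow> thesis"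
    for z d' m l thesis
  proof -
    obtain g \<tau> x t where *: "z = (g, \<tau>, x, t)" by (metis prod_cases3)
    have a: "g \<in> Ar D" "src D g = d'" "tgt D g = d" "\<tau> \<in> val T m" "x \<in> val X l" "t \<in> val \<Delta>1 l"
      "\<tau> \<in> S1 m \<or> x \<in> A l \<or> t = vx 0 l"
      using z unfolding * by auto
    show thesis
    proof (cases "\<tau> \<in> S1 m")
      case True show thesis by (rule that(2)[OF * _ True]) (use a True in simp)
    next
      case False show thesis by (rule that(3)[OF *]) (use a False in simp_all)
    qed
  qed
  have nw: "nat_on ?C ?B3 ?A3 L w"
  proof (rule nat_onI)
    fix c z assume c: "c \<in> Ob ?C" "z \<in> ?A3 c"
    obtain d' m l where *: "c = (d', m, l)" by (metis prod_cases3)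
    from c(2)[unfolded *] show "w c z \<in> val L c"
    proof (rule cases3)
      fix g \<tau> x t assume z: "z = (g, \<tau>, x, t)" "(g, \<tau>, x, t) \<in> val ?B2 (d', m, l)" "\<tau> \<in> S1 m"
      show ?thesis using nat_on_val[OF H(1) c(1)[unfolded *] z(2)] w1[OF z(3)] unfolding * z(1) by simp
    next
      fix g \<tau> x t assume z: "z = (g, \<tau>, x, t)" "(g, \<tau>, x) \<in> val ?B (d', m, l)" "x \<in> A l \<or> t = vx 0 l" "t \<in> val \<Delta>1 l"
      show ?thesis using nat_on_val[OF h(1) c(1)[unfolded *] z(2)] w0[OF c(1)[unfolded *] z(2-4)] unfolding * z(1) by simp
    qed
  next
    fix f z assume f: "f \<in> Ar ?C" "z \<in> ?A3 (tgt ?C f)"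
    obtain f0 \<alpha> \<beta> where *: "f = (f0, \<alpha>, \<beta>)" by (metis prod_cases3)
    have o: "(src D f0, src simplex \<alpha>, src simplex \<beta>) \<in> Ob ?C" "(tgt D f0, tgt simplex \<alpha>, tgt simplex \<beta>) \<in> Ob ?C"
      using category_Ob[OF C f(1)] unfolding * by simp_all
    have f': "f0 \<in> Ar D" "\<alpha> \<in> Ar simplex" "\<beta> \<in> Ar simplex" using f(1) unfolding * by simp_all
    have "z \<in> ?A3 (tgt D f0, tgt simplex \<alpha>, tgt simplex \<beta>)" using f(2) unfolding * by simp
    then show "w (src ?C f) (act ?B3 f z) = act L f (w (tgt ?C f) z)"
    proof (rule cases3)
      fix g \<tau> x t assume z: "z = (g, \<tau>, x, t)" "(g, \<tau>, x, t) \<in> val ?B2 (tgt D f0, tgt simplex \<alpha>, tgt simplex \<beta>)" "\<tau> \<in> S1 (tgt simplex \<alpha>)"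
      have "(g, \<tau>, x, t) \<in> val ?B2 (tgt ?C f)" using z(2) unfolding * by simp
      from nat_on_act[OF H(1) f(1) refl refl this] show ?thesis
        using w1[OF sub_act[OF S1 f'(2) refl refl z(3)]] w1[OF z(3)] unfolding * z(1) by simp
    next
      fix g \<tau> x t assume z: "z = (g, \<tau>, x, t)" "(g, \<tau>, x) \<in> val ?B (tgt D f0, tgt simplex \<alpha>, tgt simplex \<beta>)"
        "x \<in> A (tgt simplex \<beta>) \<or> t = vx 0 (tgt simplex \<beta>)" "t \<in> val \<Delta>1 (tgt simplex \<beta>)"
      have zB: "(g, \<tau>, x) \<in> val ?B (tgt ?C f)" using z(2) unfolding * by simp
      have b: "act ?B f (g, \<tau>, x) \<in> val ?B (src ?C f)"
        by (rule presheaf_act[OF presheaf_box[OF D T X] f(1) refl refl zB])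
      have c: "act X \<beta> x \<in> A (src simplex \<beta>) \<or> cmp simplex t \<beta> = vx 0 (src simplex \<beta>)"
        using z(3) sub_act[OF A f'(3) refl refl] vx_act[OF _ f'(3), of 0] by auto
      have e: "cmp simplex t \<beta> \<in> val \<Delta>1 (src simplex \<beta>)"
        using cmp_smap(1)[OF smap_Ar[OF f'(3)], of t 1] z(4) by simp
      have b': "(cmp D g f0, act T \<alpha> \<tau>, act X \<beta> x) \<in> val ?B (src D f0, src simplex \<alpha>, src simplex \<beta>)"
        using b unfolding * by simp
      show ?thesis using nat_on_act[OF h(1) f(1) refl refl zB] w0[OF o(2) z(2-4)] w0[OF o(1) b' c e]
        unfolding * z(1) by simp
    qed
  qed
  have pw: "p c (w c z) = (case z of (g, \<tau>, x, t) \<Rightarrow> v c (g, \<tau>, x))" if c: "c \<in> Ob ?C" "z \<in> ?A3 c" for c z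
  proof -
    obtain d' m l where *: "c = (d', m, l)" by (metis prod_cases3)
    from c(2)[unfolded *] show ?thesis
    proof (rule cases3)
      fix g \<tau> x t assume z: "z = (g, \<tau>, x, t)" "(g, \<tau>, x, t) \<in> val ?B2 (d', m, l)" "\<tau> \<in> S1 m"
      show ?thesis using H(3)[OF c(1)[unfolded *] z(2)] w1[OF z(3)] unfolding * z(1) by simp
    next
      fix g \<tau> x t assume z: "z = (g, \<tau>, x, t)" "(g, \<tau>, x) \<in> val ?B (d', m, l)" "x \<in> A l \<or> t = vx 0 l" "t \<in> val \<Delta>1 l"
      show ?thesis using h(3)[OF c(1)[unfolded *] z(2)] w0[OF c(1)[unfolded *] z(2-4)] unfolding * z(1) by simp
    qed
  qed
  obtain q where q: "nat_on ?C ?B3 (val ?B3) L q" "\<And>c z. c \<in> Ob ?C \<Longrightarrow> z \<in> ?A3 c \<Longrightarrow> q c z = w c z"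
    "\<And>c z. c \<in> Ob ?C \<Longrightarrow> z \<in> val ?B3 c \<Longrightarrow> p c (q c z) = (case z of (g, \<tau>, x, t) \<Rightarrow> v c (g, \<tau>, x))"
    using RLPE[OF h3 nw vB pw] by blast
  \<comment> \<open>Inclusion at the end 1, where the extended homotopy is the corrected
    lift.\<close>
  define e where "e = (\<lambda>c :: 'a dob. \<lambda>(g :: 'b, \<tau> :: 't, x :: 'x). (g, \<tau>, x, vx 1 (snd (snd c))))"
  have e: "e (d', m, l) (g, \<tau>, x) = (g, \<tau>, x, vx 1 l)" for d' m l g \<tau> x by (simp add: e_def)
  have ne: "nat_on ?C ?B (val ?B) ?B3 e"
  proof (rule nat_onI)
    fix c z assume c: "c \<in> Ob ?C" "z \<in> val ?B c"
    obtain d' m l g \<tau> x where *: "c = (d', m, l)" "z = (g, \<tau>, x)" by (metis prod_cases3)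
    show "e c z \<in> val ?B3 c" using c(2) unfolding * e by simp
  next
    fix f z assume f: "f \<in> Ar ?C" "z \<in> val ?B (tgt ?C f)"
    obtain f0 \<alpha> \<beta> g \<tau> x where *: "f = (f0, \<alpha>, \<beta>)" "z = (g, \<tau>, x)" by (metis prod_cases3)
    show "e (src ?C f) (act ?B f z) = act ?B3 f (e (tgt ?C f) z)"
      using f(1) vx_act[of 1 \<beta>] unfolding * by (simp add: e)
  qed
  show "\<exists>h. nat_on ?C ?B (val ?B) L h \<and> (\<forall>c\<in>Ob ?C. \<forall>x\<in>?A1 c. h c x = u c x) \<and>
      (\<forall>c\<in>Ob ?C. \<forall>x\<in>val ?B c. p c (h c x) = v c x)"
  proof (intro exI conjI ballI)
    show "nat_on ?C ?B (val ?B) L (\<lambda>c z. q c (e c z))" by (rule nat_on_comp[OF C ne q(1) nat_on_val[OF ne]])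
    fix c and z :: "'b \<times> 't \<times> 'x" assume c: "c \<in> Ob ?C"
    obtain d' m l g \<tau> x where *: "c = (d', m, l)" "z = (g, \<tau>, x)" by (metis prod_cases3)
    show "q c (e c z) = u c z" if z: "z \<in> ?A1 c"
    proof -
      have a: "g \<in> Ar D" "src D g = d'" "tgt D g = d" "\<tau> \<in> val T m" "x \<in> val X l" "\<tau> \<in> S1 m \<or> x \<in> A l"
        using z unfolding * by simp_all
      have 1: "q c (e c z) = w c (e c z)" by (rule q(2)[OF c]) (use a in \<open>auto simp: * e\<close>)
      show ?thesis
      proof (cases "\<tau> \<in> S1 m")
        case True
        have "H c (g, \<tau>, x, vx 1 l) = k c (g, \<tau>, x, vx 1 l)" by (rule H(2)[OF c]) (use a True in \<open>auto simp: *\<close>)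
        then show ?thesis using 1 k1[OF c[unfolded *], of g \<tau> x "vx 1 l"] w1[OF True] unfolding * by (simp add: e)
      next
        case False
        then have "x \<in> A l" using a(6) by simp
        then have "w c (g, \<tau>, x, vx 1 l) = h c (g, \<tau>, x)" "h c (g, \<tau>, x) = u c (g, \<tau>, x)"
          using w0[OF c[unfolded *], of g \<tau> x "vx 1 l"] h(2)[OF c, of "(g, \<tau>, x)"] a by (simp_all add: *)
        then show ?thesis using 1 unfolding * by (simp add: e)
      qed
    qed
    show "p c (q c (e c z)) = v c z" if z: "z \<in> val ?B c"
      using q(3)[OF c nat_on_val[OF ne c z]] unfolding * by (simp add: e)
  qed
qed

text \<open>Faces are indexed by \<open>Suc j\<close> so that the omitted vertex is never 0: each of
  them contains the initial vertex.\<close>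

abbreviation face :: "nat \<Rightarrow> nat \<Rightarrow> nat \<Rightarrow> smor set" where
  "face n j \<equiv> \<lambda>k. {\<beta> \<in> smap k (Suc n). \<forall>p\<le>k. ev \<beta> p \<noteq> Suc j}"

lemma sub_face: "sub simplex (std_simplex (Suc n)) (face n j)"
  unfolding sub_def
proof (intro conjI ballI subsetI)
  fix f x assume f: "f \<in> Ar simplex" "x \<in> face n j (tgt simplex f)"
  then have x: "x \<in> smap (tgt simplex f) (Suc n)" "\<And>p. p \<le> tgt simplex f \<Longrightarrow> ev x p \<noteq> Suc j" by simp_all
  note f' = smap_Ar[OF f(1)]
  show "act (std_simplex (Suc n)) f x \<in> face n j (src simplex f)"
    using cmp_smap(1)[OF f' x(1)] cmp_smap(2)[OF f' x(1)] x(2)[OF smap_le[OF f']] by simp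
qed simp

lemma sub_iv: "sub simplex (std_simplex n) (iv n)"
  by (rule sub_point) (auto simp: point_def const_mor_act[OF smap_Ar])

definition coface :: "nat \<Rightarrow> nat \<Rightarrow> smor" where
  "coface n j = mk n (Suc n) (\<lambda>p. if p \<le> j then p else Suc p)"

lemma coface_smap: "coface n j \<in> smap n (Suc n)"
  unfolding coface_def by (rule mk_smap) auto

lemma coface_face:
  assumes "j \<le> n" "\<gamma> \<in> smap k n" shows "cmp simplex (coface n j) \<gamma> \<in> face n j k"
proof -
  have "ev (cmp simplex (coface n j) \<gamma>) p \<noteq> Suc j" if "p \<le> k" for p
    unfolding cmp_smap(2)[OF assms(2) coface_smap that] using smap_le[OF assms(2) that] by (simp add: coface_def)
  then show ?thesis using cmp_smap(1)[OF assms(2) coface_smap] by simp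
qed

text \<open>On the face opposite to \<open>Suc j\<close> the degeneracy \<open>prism_fst n j\<close>
  only relabels vertices, and \<open>coface n j\<close> undoes it. As both maps send 0 to 0, the
  face with its initial vertex is an \<open>n\<close>-simplex with its initial vertex.\<close>

lemma coface_prism_fst:
  assumes j: "j \<le> n" and \<beta>: "\<beta> \<in> face n j k"
  shows "cmp simplex (coface n j) (cmp simplex (prism_fst n j) \<beta>) = \<beta>"
proof -
  have b: "\<beta> \<in> smap k (Suc n)" "\<And>p. p \<le> k \<Longrightarrow> ev \<beta> p \<noteq> Suc j" using \<beta> by simp_all
  note s = cmp_smap[OF b(1) prism_fst_smap[OF j]]
  show ?thesis
  proof (rule smap_ext[OF cmp_smap(1)[OF s(1) coface_smap] b(1)])
    fix p assume p: "p \<le> k"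
    have "ev \<beta> p \<le> Suc n" by (rule smap_le[OF b(1) p])
    moreover have "ev \<beta> p \<noteq> Suc j" by (rule b(2)[OF p])
    ultimately show "ev (cmp simplex (coface n j) (cmp simplex (prism_fst n j) \<beta>)) p = ev \<beta> p"
      unfolding cmp_smap(2)[OF s(1) coface_smap p] s(2)[OF p] using j
      by (auto simp: coface_def prism_fst_def)
  qed
qed

lemma iv_act: "\<gamma> \<in> smap n m \<Longrightarrow> ev \<gamma> 0 = 0 \<Longrightarrow> cmp simplex \<gamma> (const_mor k n 0) = const_mor k m 0"
  by (rule smap_const[OF cmp_smap(1)[OF const_mor_smap]]) (simp_all add: cmp_smap(2)[OF const_mor_smap])

section \<open>Faces through the initial vertex, and prisms\<close>

context left_fibration_over_fibrant
begin

context
  fixes d assumes d: "d \<in> Ob D"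
begin

text \<open>Right cancellation for the initial vertex inside a face inside the simplex. The face is
  again a simplex with the same initial vertex, so \<open>box_initial_vertex\<close> handles both
  smaller inclusions; the homotopy extension problem contracts and needs only that \<open>p\<close>
  is an injective fibration.\<close>

lemma box_face:
  assumes j: "j \<le> n" and X: "presheaf simplex X" "sub simplex X A" "\<And>k. small_set U (val X k)"
  shows "RLP \<C> (box D d (std_simplex (Suc n)) X) (box_corner D d (std_simplex (Suc n)) (face n j) X A) L W p"
proof -
  let ?T = "std_simplex (Suc n)"
  have ivf: "iv (Suc n) k \<subseteq> face n j k" for k by auto
  have Y: "presheaf simplex (X \<times>\<^sub>p \<Delta>1)" "sub simplex (X \<times>\<^sub>p \<Delta>1) (corner X A \<Delta>1 ends)"
    by (intro presheaf_prod X presheaf_simplex, rule sub_corner[OF X(1) presheaf_simplex X(2) sub_ends])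
  have cyl: "sub simplex (X \<times>\<^sub>p \<Delta>1) (cyl X A \<Delta>1 (vx 0))"
    by (rule sub_corner[OF X(1) presheaf_simplex X(2) sub_point[OF point_vx]]) simp
  have sY: "small_set U (val (X \<times>\<^sub>p \<Delta>1) k)" for k by (rule small_prod_simplex[OF d X(3)])
  have F: "presheaf simplex (restr ?T (face n j))"
    by (rule presheaf_restr[OF category_simplex presheaf_simplex sub_face])
  have ivF: "sub simplex (restr ?T (face n j)) (iv (Suc n))"
    using sub_iv[of "Suc n"] ivf unfolding sub_def restr_simps by blast
  let ?R = "box D d (restr ?T (face n j)) (X \<times>\<^sub>p \<Delta>1)" and ?N = "box D d (std_simplex n) (X \<times>\<^sub>p \<Delta>1)"
  have pf: "prism_fst n j \<in> Ar simplex" "src simplex (prism_fst n j) = Suc n" "tgt simplex (prism_fst n j) = n"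
    using prism_fst_smap[OF j] by auto
  have cf: "coface n j \<in> Ar simplex" "src simplex (coface n j) = n" "tgt simplex (coface n j) = Suc n"
    using coface_smap[of n j] by auto
  have h2: "RLP \<C> ?R (box_corner D d (restr ?T (face n j)) (iv (Suc n)) (X \<times>\<^sub>p \<Delta>1) (corner X A \<Delta>1 ends)) L W p"
  proof (rule RLP_retract[OF catC box_initial_vertex[OF d Y sY, of n] sub_box[OF catD F Y(1) ivF Y(2)]
        sub_box[OF catD presheaf_simplex Y(1) sub_iv Y(2)]])
    show "nat_on \<C> ?R (val ?R) ?N (\<lambda>c (g, \<beta>, y). (g, cmp simplex (prism_fst n j) \<beta>, y))"
    proof (rule nat_onI)
      fix c z assume c: "z \<in> val ?R c"
      obtain d' m l g \<beta> y where *: "c = (d', m, l)" "z = (g, \<beta>, y)" by (metis prod_cases3)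
      show "(case z of (g, \<beta>, y) \<Rightarrow> (g, cmp simplex (prism_fst n j) \<beta>, y)) \<in> val ?N c"
        using c pf unfolding * by (cases y) simp
    next
      fix f z assume c: "f \<in> Ar \<C>" "z \<in> val ?R (tgt \<C> f)"
      obtain f0 \<alpha> \<alpha>' g \<beta> y where *: "f = (f0, \<alpha>, \<alpha>')" "z = (g, \<beta>, y)" by (metis prod_cases3)
      show "(case act ?R f z of (g, \<beta>, y) \<Rightarrow> (g, cmp simplex (prism_fst n j) \<beta>, y)) =
          act ?N f (case z of (g, \<beta>, y) \<Rightarrow> (g, cmp simplex (prism_fst n j) \<beta>, y))"
        using c pf category_assoc[OF category_simplex, of \<alpha> \<beta> "prism_fst n j"] unfolding * by (cases y) simp
    qed
    show "nat_on \<C> ?N (val ?N) ?R (\<lambda>c (g, \<gamma>, y). (g, cmp simplex (coface n j) \<gamma>, y))"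
    proof (rule nat_onI)
      fix c z assume c: "z \<in> val ?N c"
      obtain d' m l g \<beta> y where *: "c = (d', m, l)" "z = (g, \<beta>, y)" by (metis prod_cases3)
      show "(case z of (g, \<beta>, y) \<Rightarrow> (g, cmp simplex (coface n j) \<beta>, y)) \<in> val ?R c"
        using c coface_face[OF j, of \<beta> m] unfolding * by (cases y) simp
    next
      fix f z assume c: "f \<in> Ar \<C>" "z \<in> val ?N (tgt \<C> f)"
      obtain f0 \<alpha> \<alpha>' g \<beta> y where *: "f = (f0, \<alpha>, \<alpha>')" "z = (g, \<beta>, y)" by (metis prod_cases3)
      show "(case act ?N f z of (g, \<beta>, y) \<Rightarrow> (g, cmp simplex (coface n j) \<beta>, y)) =
          act ?R f (case z of (g, \<beta>, y) \<Rightarrow> (g, cmp simplex (coface n j) \<beta>, y))"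
        using c cf category_assoc[OF category_simplex, of \<alpha> \<beta> "coface n j"] unfolding * by (cases y) simp
    qed
  next
    fix c z assume c: "z \<in> val ?R c"
    obtain d' m l g \<beta> y where *: "c = (d', m, l)" "z = (g, \<beta>, y)" by (metis prod_cases3)
    have "\<beta> \<in> face n j m" using c unfolding * by simp
    from coface_prism_fst[OF j this]
    show "(case case z of (g, \<beta>, y) \<Rightarrow> (g, cmp simplex (prism_fst n j) \<beta>, y) of (g, \<gamma>, y) \<Rightarrow> (g, cmp simplex (coface n j) \<gamma>, y)) = z"
      unfolding * by simp
  next
    fix c z assume c: "z \<in> box_corner D d (restr ?T (face n j)) (iv (Suc n)) (X \<times>\<^sub>p \<Delta>1) (corner X A \<Delta>1 ends) c"
    obtain d' m l g \<beta> y where *: "c = (d', m, l)" "z = (g, \<beta>, y)" by (metis prod_cases3)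
    have i: "cmp simplex (prism_fst n j) (const_mor m (Suc n) 0) = const_mor m n 0"
      by (rule iv_act[OF prism_fst_smap[OF j]]) (simp add: prism_fst_def)
    show "(case z of (g, \<beta>, y) \<Rightarrow> (g, cmp simplex (prism_fst n j) \<beta>, y)) \<in>
        box_corner D d (std_simplex n) (iv n) (X \<times>\<^sub>p \<Delta>1) (corner X A \<Delta>1 ends) c"
      using c pf i unfolding * by (cases y) auto
  next
    fix c z assume c: "z \<in> box_corner D d (std_simplex n) (iv n) (X \<times>\<^sub>p \<Delta>1) (corner X A \<Delta>1 ends) c"
    obtain d' m l g \<beta> y where *: "c = (d', m, l)" "z = (g, \<beta>, y)" by (metis prod_cases3)
    have i: "cmp simplex (coface n j) (const_mor m n 0) = const_mor m (Suc n) 0"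
      by (rule iv_act[OF coface_smap]) (simp add: coface_def)
    have b: "cmp simplex (coface n j) \<beta> \<in> face n j m" by (rule coface_face[OF j]) (use c in \<open>simp add: *\<close>)
    show "(case z of (g, \<gamma>, y) \<Rightarrow> (g, cmp simplex (coface n j) \<gamma>, y)) \<in>
        box_corner D d (restr ?T (face n j)) (iv (Suc n)) (X \<times>\<^sub>p \<Delta>1) (corner X A \<Delta>1 ends) c"
      using c i b unfolding * prod.case box_simps restr_simps by auto
  qed
  have h3: "RLP \<C> (box D d ?T (X \<times>\<^sub>p \<Delta>1)) (box_corner D d ?T (face n j) (X \<times>\<^sub>p \<Delta>1) (cyl X A \<Delta>1 (vx 0))) L W p"
    by (rule injective_fibration_box[OF inj presheaf_simplex sub_face small_simplex[OF d] Y(1) cyl sY disjI1[OF refl]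
          cyl_contracts[OF disjI1[OF refl]]])
  show ?thesis
    by (rule box_cancel[OF catD presheaf_simplex sub_iv sub_face ivf X(1,2) box_initial_vertex[OF d X] h2 h3])
qed

text \<open>With empty \<open>F\<close> each simplex of the prism is attached along the single face
  opposite to \<open>Suc j\<close>, the case of \<open>box_face\<close>. The direction matters:
  building the prism from its end 1 would also use the face opposite to vertex 0, which lacks the
  initial vertex.\<close>

lemma box_prism:
  assumes X: "presheaf simplex X" "sub simplex X A" "\<And>k. small_set U (val X k)"
  shows "RLP \<C> (box D d (std_simplex n \<times>\<^sub>p \<Delta>1) X)
    (box_corner D d (std_simplex n \<times>\<^sub>p \<Delta>1) (cyl (std_simplex n) (\<lambda>_. {}) \<Delta>1 (vx 0)) X A) L W p"
proof -
  let ?P = "std_simplex n \<times>\<^sub>p \<Delta>1"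
  let ?Z = "box D d ?P X" and ?Y = "box D d (std_simplex (Suc n)) X"
  let ?F = "\<lambda>_ :: nat. {} :: smor set"
  let ?G = "\<lambda>j. box_corner D d ?P (prism_upper n ?F j) X A"
  have emp: "sub simplex (std_simplex n) ?F" unfolding sub_def by simp
  have P: "presheaf simplex ?P" by (intro presheaf_prod presheaf_simplex)
  note sub = sub_prism_upper[OF emp]
  have sG: "sub \<C> ?Z (?G j)" for j by (rule sub_box[OF catD P X(1) sub X(2)])
  have step: "RLP \<C> (restr ?Z (?G j)) (?G (Suc j)) L W p" if j: "j \<le> n" for j
  proof (rule RLP_pushout[OF catC sG presheaf_box[OF catD presheaf_simplex X(1)] sG])
    let ?s = "\<lambda>c :: 'o dob. \<lambda>(g :: 'm, \<beta>, x). (g, prism n j \<beta>, x)"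
    show "nat_on \<C> ?Y (val ?Y) ?Z ?s"
    proof (rule nat_onI)
      fix c z assume c: "z \<in> val ?Y c"
      obtain d' m l g \<beta> y where *: "c = (d', m, l)" "z = (g, \<beta>, y)" by (metis prod_cases3)
      show "?s c z \<in> val ?Z c"
        using c nat_on_val[OF nat_prism[OF j] simplex_Ob, of \<beta> m] unfolding * by simp
    next
      fix f z assume c: "f \<in> Ar \<C>" "z \<in> val ?Y (tgt \<C> f)"
      obtain f0 \<alpha> \<alpha>' g \<beta> y where *: "f = (f0, \<alpha>, \<alpha>')" "z = (g, \<beta>, y)" by (metis prod_cases3)
      show "?s (src \<C> f) (act ?Y f z) = act ?Z f (?s (tgt \<C> f) z)"
        using c nat_on_act[OF nat_prism[OF j], of \<alpha> _ _ \<beta>] unfolding * by simp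
    qed
    fix c :: "'o dob"
    obtain d' m l where *: "c = (d', m, l)" by (metis prod_cases3)
    show "?G j c = ?G (Suc j) c \<union> ?s c ` val ?Y c"
    proof (intro equalityI subsetI)
      fix z assume z: "z \<in> ?G j c"
      obtain g \<tau> x where **: "z = (g, \<tau>, x)" by (metis prod_cases3)
      show "z \<in> ?G (Suc j) c \<union> ?s c ` val ?Y c"
      proof (cases "\<tau> \<in> prism n j ` smap m (Suc n)")
        case True
        then obtain \<beta> where b: "\<beta> \<in> smap m (Suc n)" "\<tau> = prism n j \<beta>" by (rule imageE)
        have "(g, \<beta>, x) \<in> val ?Y c" "z = ?s c (g, \<beta>, x)" using z b unfolding * ** by simp_all
        then show ?thesis by blast
      next
        case False
        then have "z \<in> ?G (Suc j) c"
          using z prism_upper_step[OF j, of ?F m] unfolding * ** box_simps by blast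
        then show ?thesis by blast
      qed
    next
      fix z assume "z \<in> ?G (Suc j) c \<union> ?s c ` val ?Y c"
      then consider "z \<in> ?G (Suc j) c" | y where "y \<in> val ?Y c" "z = ?s c y" by blast
      then show "z \<in> ?G j c"
      proof cases
        case 1
        obtain g \<tau> x where **: "z = (g, \<tau>, x)" by (metis prod_cases3)
        show ?thesis using 1 prism_upper_step[OF j, of ?F m] unfolding * ** box_simps by blast
      next
        case 2
        obtain g \<beta> x where **: "y = (g, \<beta>, x)" by (metis prod_cases3)
        have b: "\<beta> \<in> smap m (Suc n)" using 2(1) unfolding * ** by simp
        have "prism n j \<beta> \<in> prism_upper n ?F j m" using prism_upper_step[OF j, of ?F m] b by blast
        moreover have "prism n j \<beta> \<in> val ?P m" using nat_on_val[OF nat_prism[OF j] simplex_Ob, of \<beta> m] b by simp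
        ultimately show ?thesis using 2(1) unfolding 2(2) * ** by simp
      qed
    qed
    fix y y' assume y: "y \<in> val ?Y c" "y' \<in> val ?Y c" "?s c y = ?s c y'"
    obtain g \<beta> x g' \<beta>' x' where **: "y = (g, \<beta>, x)" "y' = (g', \<beta>', x')" by (metis prod_cases3)
    show "y = y'" using y prism_inj[OF j, of \<beta> m \<beta>'] unfolding * ** by simp
  next
    let ?s = "\<lambda>c :: 'o dob. \<lambda>(g :: 'm, \<beta>, x). (g, prism n j \<beta>, x)"
    show "RLP \<C> ?Y (\<lambda>c. {y \<in> val ?Y c. ?s c y \<in> ?G (Suc j) c}) L W p"
    proof (rule RLP_cong_sub[OF catC box_face[OF j X]])
      fix c :: "'o dob"
      obtain d' m l where *: "c = (d', m, l)" by (metis prod_cases3)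
      have eq: "z \<in> box_corner D d (std_simplex (Suc n)) (face n j) X A c \<longleftrightarrow> z \<in> {y \<in> val ?Y c. ?s c y \<in> ?G (Suc j) c}" for z
      proof -
        obtain g \<beta> x where **: "z = (g, \<beta>, x)" by (metis prod_cases3)
        show ?thesis
          using prism_upper_preimage[OF j, of \<beta> m ?F] nat_on_val[OF nat_prism[OF j] simplex_Ob, of \<beta> m]
          unfolding * ** by auto
      qed
      show "box_corner D d (std_simplex (Suc n)) (face n j) X A c = {y \<in> val ?Y c. ?s c y \<in> ?G (Suc j) c}"
        by (rule set_eqI, rule eq)
    qed
  qed
  have "RLP \<C> ?Z (?G j) L W p" if "j \<le> Suc n" for j
    using that
  proof (induction j)
    case 0
    have "prism_upper n ?F 0 = val ?P" using prism_upper_0[of n ?F] by (auto simp: fun_eq_iff)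
    then have "?G 0 = val ?Z" by (auto simp: fun_eq_iff box_def box_corner_def)
    then show ?case using RLP_refl[of \<C> ?Z "val ?Z" L W p] by (simp only: restr_val)
  next
    case (Suc j)
    then have j: "j \<le> n" by simp
    have "?G (Suc j) c \<subseteq> ?G j c" for c
      using prism_upper_step[OF j, of ?F] unfolding box_corner_def by (cases c) blast
    moreover have "?G j c \<subseteq> val ?Z c" for c unfolding box_corner_def by (cases c) blast
    moreover have "RLP \<C> ?Z (?G j) L W p" using Suc by simp
    ultimately show ?case by (intro RLP_trans[OF catC step[OF j]])
  qed
  from this[OF order_refl] show ?thesis
    by (rule RLP_cong_sub[OF catC]) (simp only: prism_upper_Suc box_corner_def)
qed

end

end

section \<open>Internal homs and cofree presheaves\<close>

lemma presheaf_exp: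
  assumes C: "category C" and Z: "presheaf C Z" and Y: "presheaf C Y"
  shows "presheaf C (exp_psh C Z Y)"
proof -
  let ?R = "\<lambda>c. representable C c \<times>\<^sub>p Z"
  have R: "presheaf C (?R c)" for c by (intro presheaf_prod presheaf_representable C Z)
  have A: "act (exp_psh C Z Y) f \<theta> \<in> hom C (?R (src C f)) Y" if f: "f \<in> Ar C" and \<theta>: "\<theta> \<in> hom C (?R (tgt C f)) Y" for f \<theta>
  proof -
    have "nat_on C (?R (src C f)) (val (?R (src C f))) (?R (tgt C f)) (\<lambda>b (g, z). (cmp C f g, z))"
      using f category_cmp[OF C] category_assoc[OF C] by (intro nat_onI) auto
    from nat_on_comp[OF C this homD[OF \<theta>] nat_on_val[OF this]]
    have "nat_on C (?R (src C f)) (val (?R (src C f))) Y (\<lambda>b (g, z). \<theta> b (cmp C f g, z))"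
      by (simp add: case_prod_beta')
    from transf_hom[OF C R this] show ?thesis by (simp add: exp_psh_def)
  qed
  show ?thesis
  proof (rule presheafI)
    fix f \<theta> assume "f \<in> Ar C" "\<theta> \<in> val (exp_psh C Z Y) (tgt C f)"
    then show "act (exp_psh C Z Y) f \<theta> \<in> val (exp_psh C Z Y) (src C f)" using A by (simp add: exp_psh_def)
  next
    fix c \<theta> assume c: "c \<in> Ob C" "\<theta> \<in> val (exp_psh C Z Y) c"
    note i = category_idn[OF C c(1)]
    have \<theta>: "\<theta> \<in> hom C (?R c) Y" using c(2) by (simp add: exp_psh_def)
    have "act (exp_psh C Z Y) (idn C c) \<theta> \<in> hom C (?R c) Y" using A[of "idn C c" \<theta>] i \<theta> by simp
    then show "act (exp_psh C Z Y) (idn C c) \<theta> = \<theta>"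
    proof (rule hom_ext[OF _ \<theta>])
      fix b z assume "b \<in> Ob C" "z \<in> val (?R c) b"
      then show "act (exp_psh C Z Y) (idn C c) \<theta> b z = \<theta> b z"
        using i category_unit(2)[OF C] by (auto simp: exp_psh_def)
    qed
  next
    fix f g \<theta> assume f: "f \<in> Ar C" "g \<in> Ar C" "src C g = tgt C f" "\<theta> \<in> val (exp_psh C Z Y) (tgt C g)"
    have \<theta>: "\<theta> \<in> hom C (?R (tgt C g)) Y" using f(4) by (simp add: exp_psh_def)
    note gf = category_cmp[OF C f(1-3)]
    have 1: "act (exp_psh C Z Y) (cmp C g f) \<theta> \<in> hom C (?R (src C f)) Y" using A[OF gf(1)] gf \<theta> by simp
    have 2: "act (exp_psh C Z Y) f (act (exp_psh C Z Y) g \<theta>) \<in> hom C (?R (src C f)) Y"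
      using A[OF f(1)] A[OF f(2) \<theta>] f(3) by simp
    show "act (exp_psh C Z Y) (cmp C g f) \<theta> = act (exp_psh C Z Y) f (act (exp_psh C Z Y) g \<theta>)"
    proof (rule hom_ext[OF 1 2])
      fix b z assume b: "b \<in> Ob C" "z \<in> val (?R (src C f)) b"
      then show "act (exp_psh C Z Y) (cmp C g f) \<theta> b z = act (exp_psh C Z Y) f (act (exp_psh C Z Y) g \<theta>) b z"
        using f gf category_cmp[OF C] category_assoc[OF C] by (auto simp: exp_psh_def)
    qed
  qed
qed

text \<open>The right adjoint to evaluating a presheaf on all objects: natural maps into it are
  arbitrary families of functions, so it is injective with respect to monomorphisms.\<close>

definition cofree :: "('o, 'm) cat \<Rightarrow> ('o, 'm, 'm \<Rightarrow> 'b) psh" where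
  "cofree C = \<lparr>val = (\<lambda>c. {f \<in> Ar C. tgt C f = c} \<rightarrow>\<^sub>E UNIV),
     act = (\<lambda>g \<phi>. \<lambda>f\<in>{f \<in> Ar C. tgt C f = src C g}. \<phi> (cmp C g f))\<rparr>"

text \<open>The adjunct of a family of functions that need not be natural.\<close>

definition to_cofree :: "('o, 'm) cat \<Rightarrow> ('o, 'm, 'a) psh \<Rightarrow> ('o \<Rightarrow> 'a \<Rightarrow> 'b) \<Rightarrow> 'o \<Rightarrow> 'a \<Rightarrow> 'm \<Rightarrow> 'b" where
  "to_cofree C X t = (\<lambda>c x. \<lambda>f\<in>{f \<in> Ar C. tgt C f = c}. t (src C f) (act X f x))"

lemma cofree_ext:
  assumes "\<phi> \<in> val (cofree C) c" "\<psi> \<in> val (cofree C) c" "\<And>f. f \<in> Ar C \<Longrightarrow> tgt C f = c \<Longrightarrow> \<phi> f = \<psi> f"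
  shows "\<phi> = \<psi>"
  using assms unfolding cofree_def by (intro PiE_ext[of \<phi> "{f \<in> Ar C. tgt C f = c}" "\<lambda>_. UNIV"]) auto

lemma cofree_act [simp]:
  "f \<in> Ar C \<Longrightarrow> tgt C f = src C g \<Longrightarrow> act (cofree C) g \<phi> f = \<phi> (cmp C g f)"
  by (simp add: cofree_def)

lemma cofree_act_val: "act (cofree C) g \<phi> \<in> val (cofree C) (src C g)"
  by (simp add: cofree_def restrict_PiE_iff)

lemma presheaf_cofree:
  assumes C: "category C" shows "presheaf C (cofree C)"
proof (rule presheafI)
  fix f \<phi> show "act (cofree C) f \<phi> \<in> val (cofree C) (src C f)" by (rule cofree_act_val)
next
  fix c \<phi> assume c: "c \<in> Ob C" "\<phi> \<in> val (cofree C) c"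
  note i = category_idn[OF C c(1)]
  show "act (cofree C) (idn C c) \<phi> = \<phi>"
    by (rule cofree_ext[OF _ c(2)]) (use cofree_act_val[of C "idn C c" \<phi>] i category_unit(2)[OF C] in auto)
next
  fix f g \<phi> assume f: "f \<in> Ar C" "g \<in> Ar C" "src C g = tgt C f"
  note gf = category_cmp[OF C f]
  show "act (cofree C) (cmp C g f) \<phi> = act (cofree C) f (act (cofree C) g \<phi>)"
  proof (rule cofree_ext[OF _ cofree_act_val])
    show "act (cofree C) (cmp C g f) \<phi> \<in> val (cofree C) (src C f)"
      using cofree_act_val[of C "cmp C g f" \<phi>] gf(2) by simp
    fix h assume h: "h \<in> Ar C" "tgt C h = src C f"
    show "act (cofree C) (cmp C g f) \<phi> h = act (cofree C) f (act (cofree C) g \<phi>) h"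
      using h gf f category_cmp[OF C h(1) f(1)] category_assoc[OF C h(1) f(1,2)] by simp
  qed
qed

lemma to_cofree_apply [simp]: "f \<in> Ar C \<Longrightarrow> tgt C f = c \<Longrightarrow> to_cofree C X t c x f = t (src C f) (act X f x)"
  by (simp add: to_cofree_def)

lemma to_cofree_val: "to_cofree C X t c x \<in> val (cofree C) c"
  by (simp add: to_cofree_def cofree_def restrict_PiE_iff)

text \<open>Naturality is built in: both sides list the values of \<open>t\<close> on further
  restrictions of \<open>x\<close>.\<close>

lemma nat_to_cofree:
  assumes C: "category C" and X: "presheaf C X" and A: "sub C X A"
  shows "nat_on C X A (cofree C) (to_cofree C X t)"
proof (rule nat_onI)
  fix f x assume f: "f \<in> Ar C" "x \<in> A (tgt C f)"
  have x: "x \<in> val X (tgt C f)" by (rule subD[OF A category_Ob(2)[OF C f(1)] f(2)])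
  show "to_cofree C X t (src C f) (act X f x) = act (cofree C) f (to_cofree C X t (tgt C f) x)"
    by (rule cofree_ext[OF to_cofree_val cofree_act_val])
      (use f x category_cmp[OF C _ f(1)] presheaf_cmp[OF X _ f(1)] in auto)
qed (rule to_cofree_val)


section \<open>Lifting against \<open>D[1]\<close>-cylinders\<close>

lemma dsimp_simps [simp]:
  "val (dsimp n) (d, k, l) = smap k n" "act (dsimp n) (f, \<alpha>, \<beta>) \<gamma> = cmp simplex \<gamma> \<alpha>"
  by (simp_all add: dsimp_def)

lemma presheaf_dsimp: "presheaf (dsimp_cat D) (dsimp n)"
proof (rule presheafI)
  fix f :: "'b \<times> smor \<times> smor" and x assume f: "f \<in> Ar (dsimp_cat D)" "x \<in> val (dsimp n) (tgt (dsimp_cat D) f)"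
  obtain f0 \<alpha> \<beta> where *: "f = (f0, \<alpha>, \<beta>)" by (metis prod_cases3)
  show "act (dsimp n) f x \<in> val (dsimp n) (src (dsimp_cat D) f)" using f unfolding * by simp
next
  fix c and x :: smor assume c: "c \<in> Ob (dsimp_cat D)" "x \<in> val (dsimp n) c"
  obtain d k l where *: "c = (d, k, l)" by (metis prod_cases3)
  show "act (dsimp n) (idn (dsimp_cat D) c) x = x"
    using c category_unit(1)[OF category_simplex, of x k] unfolding * by simp
next
  fix f g :: "'b \<times> smor \<times> smor" and x :: smor
  assume f: "f \<in> Ar (dsimp_cat D)" "g \<in> Ar (dsimp_cat D)" "src (dsimp_cat D) g = tgt (dsimp_cat D) f"
    "x \<in> val (dsimp n) (tgt (dsimp_cat D) g)"
  obtain f0 \<alpha> \<beta> g0 \<alpha>' \<beta>' where *: "f = (f0, \<alpha>, \<beta>)" "g = (g0, \<alpha>', \<beta>')" by (metis prod_cases3)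
  show "act (dsimp n) (cmp (dsimp_cat D) g f) x = act (dsimp n) f (act (dsimp n) g x)"
    using f category_assoc[OF category_simplex, of \<alpha> \<alpha>' x] unfolding * by simp
qed

definition dvx :: "nat \<Rightarrow> 'o dob \<Rightarrow> smor" where
  "dvx i = (\<lambda>(d, k, l). vx i k)"

lemma dvx_simp [simp]: "dvx i (d, k, l) = vx i k"
  by (simp add: dvx_def)

lemma point_dvx:
  assumes "i \<le> 1" shows "point (dsimp_cat D) (dsimp 1) (dvx i)"
  unfolding point_def
proof (intro conjI ballI)
  fix c assume "c \<in> Ob (dsimp_cat D)"
  show "dvx i c \<in> val (dsimp 1) c" by (cases c) (use vx_val[OF assms] in simp)
next
  fix f assume f: "f \<in> Ar (dsimp_cat D)"
  obtain f0 \<alpha> \<beta> where *: "f = (f0, \<alpha>, \<beta>)" by (metis prod_cases3)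
  show "act (dsimp 1) f (dvx i (tgt (dsimp_cat D) f)) = dvx i (src (dsimp_cat D) f)"
    using f vx_act[OF assms, of \<alpha>] unfolding * by simp
qed

lemma sl_prod: "sl D (X \<times>\<^sub>p Y) d n = sl D X d n \<times>\<^sub>p sl D Y d n"
  by (simp add: level_def und_def prod_psh_def)

context universe
begin

text \<open>A natural transformation is determined by its values, and the object of evaluation is
  the source of the arrow argument; so it is a function on pairs of an arrow of \<open>\<C>\<close>
  and a simplex, where everything except the \<open>D\<close>-part is countable.\<close>

lemma small_hom:
  fixes L :: "('o, 'm, 'u) dspace"
  shows "small_set U (hom \<C> (representable \<C> c \<times>\<^sub>p dsimp 1) L)"
proof -
  let ?R = "representable \<C> c \<times>\<^sub>p dsimp 1 :: ('o, 'm, 'm dmor \<times> smor) dspace"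
  let ?S = "Ar \<C> \<times> (UNIV :: smor set)"
  define \<Phi> where "\<Phi> = (\<lambda>(\<xi> :: 'o dob \<Rightarrow> 'm dmor \<times> smor \<Rightarrow> 'u) z. if z \<in> ?S then \<xi> (src \<C> (fst z)) z else undefined)"
  have "small_set U (\<Phi> ` hom \<C> ?R L)"
  proof (rule small_functions[of "\<lambda>((f, \<alpha>), t). (f, to_nat (\<alpha>, t))" ?S])
    fix \<phi> \<psi> assume "\<phi> \<in> \<Phi> ` hom \<C> ?R L" "\<psi> \<in> \<Phi> ` hom \<C> ?R L" and eq: "\<And>s. s \<in> ?S \<Longrightarrow> \<phi> s = \<psi> s"
    then obtain \<xi> \<zeta> where *: "\<phi> = \<Phi> \<xi>" "\<psi> = \<Phi> \<zeta>" by blast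
    show "\<phi> = \<psi>"
    proof
      fix s show "\<phi> s = \<psi> s" using eq[of s] by (cases "s \<in> ?S") (auto simp: * \<Phi>_def)
    qed
  qed (auto simp: inj_on_def dsimp_cat_def prod_cat_sets)
  moreover have "inj_on \<Phi> (hom \<C> ?R L)"
  proof (rule inj_onI)
    fix \<xi> \<zeta> assume h: "\<xi> \<in> hom \<C> ?R L" "\<zeta> \<in> hom \<C> ?R L" and eq: "\<Phi> \<xi> = \<Phi> \<zeta>"
    show "\<xi> = \<zeta>"
    proof (rule hom_ext[OF h])
      fix b z assume z: "z \<in> val ?R b"
      then have "fst z \<in> Ar \<C>" "src \<C> (fst z) = b" by auto
      moreover have "\<Phi> \<xi> z = \<Phi> \<zeta> z" using eq by simp
      ultimately show "\<xi> b z = \<zeta> b z" by (cases z) (simp add: \<Phi>_def)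
    qed
  qed
  ultimately show ?thesis by (rule small_inj) simp
qed

lemma small_cofree: "small_set U (val (cofree \<C> :: ('o, 'm, 'm dmor \<Rightarrow> 'u) dspace) c)"
  by (rule small_functions[of "\<lambda>(f, \<alpha>). (f, to_nat \<alpha>)" "{f \<in> Ar \<C>. tgt \<C> f = c}"])
    (auto simp: inj_on_def dsimp_cat_def prod_cat_sets intro!: cofree_ext[of _ \<C> c])

lemma small_dsimp: "small_psh U \<C> (dsimp n)"
  unfolding small_psh_def
proof
  fix c :: "'o dob" assume "c \<in> Ob \<C>"
  moreover obtain d k l where "c = (d, k, l)" by (metis prod_cases3)
  ultimately show "small_set U (val (dsimp n) c)" using small_countable[of d] by simp
qed

end

section \<open>The presheaf of local lifts\<close>

locale cylinder_problem = left_fibration_over_fibrant D U L W p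
  for D :: "('o, 'm) cat" and U :: "'u itself" and L W :: "('o, 'm, 'u) dspace" and p +
  fixes X :: "('o, 'm, 'x) dspace" and A u v
  assumes X: "presheaf \<C> X" and sX: "small_psh U \<C> X" and A: "sub \<C> X A"
    and u: "nat_on \<C> (X \<times>\<^sub>p dsimp 1) (cyl X A (dsimp 1) (dvx 0)) L u"
    and v: "nat_on \<C> (X \<times>\<^sub>p dsimp 1) (val (X \<times>\<^sub>p dsimp 1)) W v"
    and uv: "\<And>c z. c \<in> Ob \<C> \<Longrightarrow> z \<in> cyl X A (dsimp 1) (dvx 0) c \<Longrightarrow> p c (u c z) = v c z"
begin

abbreviation D1 :: "('o, 'm, smor) dspace" where "D1 \<equiv> dsimp 1"
abbreviation Rp where "Rp c \<equiv> representable \<C> c \<times>\<^sub>p D1"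
abbreviation XE where "XE \<equiv> X \<times>\<^sub>p exp_psh \<C> D1 L"

text \<open>\<open>P\<close> is the pullback of \<open>L\<^bsup>D[1]\<^esup> \<rightarrow> L \<times>\<^bsub>W\<^esub> W\<^bsup>D[1]\<^esup>\<close> to \<open>X\<close>, an objectwise trivial fibration
  over \<open>X\<close> with a section over \<open>A\<close>. It embeds into \<open>M\<close>, the product of \<open>X\<close> with a
  cofree presheaf, to which the section extends.\<close>

definition P :: "'o dob \<Rightarrow> ('x \<times> ('o dob \<Rightarrow> 'm dmor \<times> smor \<Rightarrow> 'u)) set" where
  "P c = {(x, \<xi>). x \<in> val X c \<and> \<xi> \<in> hom \<C> (Rp c) L \<and>
     (\<forall>f\<in>Ar \<C>. \<forall>t\<in>val D1 (src \<C> f). tgt \<C> f = c \<longrightarrow>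
        p (src \<C> f) (\<xi> (src \<C> f) (f, t)) = v (src \<C> f) (act X f x, t) \<and>
        (t = dvx 0 (src \<C> f) \<longrightarrow> \<xi> (src \<C> f) (f, t) = u (src \<C> f) (act X f x, t)))}"

lemma P_iff:
  "(x, \<xi>) \<in> P c \<longleftrightarrow> x \<in> val X c \<and> \<xi> \<in> hom \<C> (Rp c) L \<and>
     (\<forall>f\<in>Ar \<C>. \<forall>t\<in>val D1 (src \<C> f). tgt \<C> f = c \<longrightarrow>
        p (src \<C> f) (\<xi> (src \<C> f) (f, t)) = v (src \<C> f) (act X f x, t) \<and>
        (t = dvx 0 (src \<C> f) \<longrightarrow> \<xi> (src \<C> f) (f, t) = u (src \<C> f) (act X f x, t)))"
  by (simp add: P_def)

lemma presheaf_D1: "presheaf \<C> D1"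
  by (rule presheaf_dsimp)

lemma presheaf_E: "presheaf \<C> (exp_psh \<C> D1 L)"
  by (rule presheaf_exp[OF catC presheaf_D1 L])

lemma presheaf_XE: "presheaf \<C> XE"
  by (rule presheaf_prod[OF X presheaf_E])

lemma presheaf_Rp: "presheaf \<C> (Rp c)"
  by (intro presheaf_prod presheaf_representable catC presheaf_D1)

lemma E_act:
  assumes "f \<in> Ar \<C>" "tgt \<C> f = src \<C> g" "t \<in> val D1 (src \<C> f)"
  shows "act (exp_psh \<C> D1 L) g \<xi> (src \<C> f) (f, t) = \<xi> (src \<C> f) (cmp \<C> g f, t)"
  using assms category_Ob[OF catC assms(1)] by (simp add: exp_psh_def)

lemma dvx_val: "c \<in> Ob \<C> \<Longrightarrow> i \<le> 1 \<Longrightarrow> dvx i c \<in> val D1 c"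
  using point_dvx[of i D] unfolding point_def by blast

lemma dvx_act: "f \<in> Ar \<C> \<Longrightarrow> i \<le> 1 \<Longrightarrow> act D1 f (dvx i (tgt \<C> f)) = dvx i (src \<C> f)"
  using point_dvx[of i D] unfolding point_def by blast

lemma sub_P: "sub \<C> XE P"
  unfolding sub_def
proof (intro conjI ballI subsetI)
  fix c z assume "z \<in> P c" then show "z \<in> val XE c" by (auto simp: P_def exp_psh_def)
next
  fix g z assume g: "g \<in> Ar \<C>" and z: "z \<in> P (tgt \<C> g)"
  obtain x \<xi> where *: "z = (x, \<xi>)" by (cases z)
  have x: "x \<in> val X (tgt \<C> g)" "\<xi> \<in> hom \<C> (Rp (tgt \<C> g)) L" using z unfolding * P_iff by blast+
  have 1: "act X g x \<in> val X (src \<C> g)" by (rule presheaf_act[OF X g refl refl x(1)])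
  have 2: "act (exp_psh \<C> D1 L) g \<xi> \<in> hom \<C> (Rp (src \<C> g)) L"
    using presheaf_act[OF presheaf_E g refl refl, of \<xi>] x(2) by (simp add: exp_psh_def)
  have 3: "p (src \<C> f) (act (exp_psh \<C> D1 L) g \<xi> (src \<C> f) (f, t)) = v (src \<C> f) (act X f (act X g x), t) \<and>
        (t = dvx 0 (src \<C> f) \<longrightarrow> act (exp_psh \<C> D1 L) g \<xi> (src \<C> f) (f, t) = u (src \<C> f) (act X f (act X g x), t))"
    if f: "f \<in> Ar \<C>" "t \<in> val D1 (src \<C> f)" "tgt \<C> f = src \<C> g" for f t
  proof -
    note c = category_cmp[OF catC f(1) g f(3)[symmetric]]
    have "t \<in> val D1 (src \<C> (cmp \<C> g f))" using f c by simp
    then show ?thesis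
      using z c f E_act[OF f(1,3,2), of \<xi>] presheaf_cmp[OF X f(1) g f(3)[symmetric] refl x(1)]
      unfolding * P_iff by metis
  qed
  show "act XE g z \<in> P (src \<C> g)" unfolding * prod_psh_simps P_iff using 1 2 3 by blast
qed

text \<open>An arbitrary injection of the local lifts at \<open>c\<close> into the universe, without
  any naturality; \<open>to_cofree\<close> makes a natural map out of it.\<close>

definition code :: "'o dob \<Rightarrow> 'x \<times> ('o dob \<Rightarrow> 'm dmor \<times> smor \<Rightarrow> 'u) \<Rightarrow> 'u" where
  "code c = (SOME f. inj_on f (P c))"

lemma inj_code: assumes c: "c \<in> Ob \<C>" shows "inj_on (code c) (P c)"
proof -
  obtain d k l where *: "c = (d, k, l)" by (metis prod_cases3)
  have d: "d \<in> Ob D" using c unfolding * by simp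
  have "P c \<subseteq> val X c \<times> hom \<C> (Rp c) L" by (auto simp: P_def)
  then have "small_set U (P c)"
    using small_times[OF d _ small_hom] sX c small_subset unfolding small_psh_def by blast
  then have "\<exists>f :: _ \<Rightarrow> 'u. inj_on f (P c)" unfolding small_set_def lepoll_def by blast
  then show ?thesis unfolding code_def by (rule someI_ex)
qed

abbreviation M :: "('o, 'm, 'x \<times> ('m dmor \<Rightarrow> 'u)) dspace" where "M \<equiv> X \<times>\<^sub>p cofree \<C>"

definition k where "k c \<pi> = (fst \<pi>, to_cofree \<C> XE code c \<pi>)"

definition kP where "kP c = k c ` P c"

abbreviation unk where "unk c \<equiv> inv_into (P c) (k c)"

lemma presheaf_M: "presheaf \<C> M"
  by (rule presheaf_prod[OF X presheaf_cofree[OF catC]])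

lemma small_M: "small_psh U \<C> M"
  by (rule small_prod[OF sX]) (simp add: small_psh_def small_cofree)

lemma nat_k: "nat_on \<C> XE P M k"
proof (rule nat_onI)
  fix c \<pi> assume "c \<in> Ob \<C>" "\<pi> \<in> P c"
  then show "k c \<pi> \<in> val M c" using to_cofree_val[of \<C> XE code c \<pi>] by (cases \<pi>) (simp add: k_def P_def)
next
  fix f \<pi> assume f: "f \<in> Ar \<C>" "\<pi> \<in> P (tgt \<C> f)"
  show "k (src \<C> f) (act XE f \<pi>) = act M f (k (tgt \<C> f) \<pi>)"
    using nat_on_act[OF nat_to_cofree[OF catC presheaf_XE sub_P, of code] f(1) refl refl f(2)]
    by (cases \<pi>) (simp add: k_def)
qed

text \<open>The cofree component evaluated at the identity returns \<open>code\<close>, which is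
  injective.\<close>

lemma inj_k: assumes c: "c \<in> Ob \<C>" shows "inj_on (k c) (P c)"
proof (rule inj_onI)
  fix \<pi> \<pi>' assume \<pi>: "\<pi> \<in> P c" "\<pi>' \<in> P c" and eq: "k c \<pi> = k c \<pi>'"
  note i = category_idn[OF catC c]
  have "to_cofree \<C> XE code c \<pi> (idn \<C> c) = to_cofree \<C> XE code c \<pi>' (idn \<C> c)"
    using eq by (simp add: k_def)
  then have "code c \<pi> = code c \<pi>'"
    using i presheaf_idn[OF presheaf_XE c subD[OF sub_P c \<pi>(1)]] presheaf_idn[OF presheaf_XE c subD[OF sub_P c \<pi>(2)]]
    by simp
  then show "\<pi> = \<pi>'" using inj_code[OF c] \<pi> by (auto dest: inj_onD)
qed

lemma unk_k: "c \<in> Ob \<C> \<Longrightarrow> \<pi> \<in> P c \<Longrightarrow> unk c (k c \<pi>) = \<pi>"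
  using inj_k by simp

lemma kP_E:
  assumes "c \<in> Ob \<C>" "m \<in> kP c"
  obtains x \<xi> where "(x, \<xi>) \<in> P c" "m = k c (x, \<xi>)" "unk c m = (x, \<xi>)" "fst m = x"
  using assms unk_k[OF assms(1)] unfolding kP_def by (auto simp: k_def)

lemma sub_kP: "sub \<C> M kP"
  unfolding sub_def
proof (intro conjI ballI subsetI)
  fix c m assume "c \<in> Ob \<C>" "m \<in> kP c" then show "m \<in> val M c"
    using nat_on_val[OF nat_k] unfolding kP_def by blast
next
  fix f m assume f: "f \<in> Ar \<C>" "m \<in> kP (tgt \<C> f)"
  then obtain \<pi> where \<pi>: "\<pi> \<in> P (tgt \<C> f)" "m = k (tgt \<C> f) \<pi>" unfolding kP_def by blast
  show "act M f m \<in> kP (src \<C> f)"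
    using nat_on_act[OF nat_k f(1) refl refl \<pi>(1)] sub_act[OF sub_P f(1) refl refl \<pi>(1)] unfolding \<pi>(2) kP_def
    by (metis image_eqI)
qed

lemma unk_act:
  assumes f: "f \<in> Ar \<C>" "m \<in> kP (tgt \<C> f)"
  shows "unk (src \<C> f) (act M f m) = act XE f (unk (tgt \<C> f) m)"
proof -
  obtain \<pi> where \<pi>: "\<pi> \<in> P (tgt \<C> f)" "m = k (tgt \<C> f) \<pi>" using f(2) unfolding kP_def by blast
  note o = category_Ob[OF catC f(1)]
  show ?thesis
    using nat_on_act[OF nat_k f(1) refl refl \<pi>(1)] unk_k[OF o(1) sub_act[OF sub_P f(1) refl refl \<pi>(1)]] unk_k[OF o(2) \<pi>(1)]
    unfolding \<pi>(2) by simp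
qed

text \<open>The tautological lift: a point of \<open>kP\<close> is a local lift and gets evaluated,
  any other point can only use \<open>u\<close> at the end 0. The arrow \<open>f\<close> stands for
  a restriction of \<open>m\<close>, so that naturality in the evaluation (\<open>taut_act\<close>)
  and in the point (\<open>taut_change\<close>) are treated separately.\<close>

definition taut where
  "taut c m f t = (if m \<in> kP c then snd (unk c m) (src \<C> f) (f, t) else u (src \<C> f) (act X f (fst m), t))"

context
  fixes c m f t
  assumes m: "m \<in> val M c" and f: "f \<in> Ar \<C>" "tgt \<C> f = c" and t: "t \<in> val D1 (src \<C> f)"
    and z: "m \<in> kP c \<or> t = dvx 0 (src \<C> f)"
begin

lemma c_Ob: "c \<in> Ob \<C>"
  using category_Ob[OF catC f(1)] f(2) by simp

lemma fst_m: "fst m \<in> val X c"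
  using m by (cases m) simp

lemma fst_m_act: "act X f (fst m) \<in> val X (src \<C> f)"
  by (rule presheaf_act[OF X f refl fst_m])

lemma taut_base:
  assumes "t = dvx 0 (src \<C> f)" shows "taut c m f t = u (src \<C> f) (act X f (fst m), t)"
proof (cases "m \<in> kP c")
  case True
  then obtain x \<xi> where "(x, \<xi>) \<in> P c" "unk c m = (x, \<xi>)" "fst m = x" by (rule kP_E[OF c_Ob])
  then show ?thesis using True f t assms by (auto simp: taut_def P_iff)
qed (simp add: taut_def)

lemma taut_proj: "p (src \<C> f) (taut c m f t) = v (src \<C> f) (act X f (fst m), t)"
proof (cases "m \<in> kP c")
  case True
  then obtain x \<xi> where "(x, \<xi>) \<in> P c" "unk c m = (x, \<xi>)" "fst m = x" by (rule kP_E[OF c_Ob])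
  then show ?thesis using True f t by (auto simp: taut_def P_iff)
next
  case False
  have "(act X f (fst m), t) \<in> cyl X A D1 (dvx 0) (src \<C> f)" using z False t fst_m_act by simp
  then show ?thesis using uv[OF category_Ob(1)[OF catC f(1)]] False by (simp add: taut_def)
qed

lemma taut_val: "taut c m f t \<in> val L (src \<C> f)"
proof (cases "m \<in> kP c")
  case True
  then obtain x \<xi> where x: "(x, \<xi>) \<in> P c" "unk c m = (x, \<xi>)" by (rule kP_E[OF c_Ob])
  have "\<xi> (src \<C> f) (f, t) \<in> val L (src \<C> f)"
    by (rule nat_on_val[OF homD category_Ob(1)[OF catC f(1)]]) (use x(1) f t in \<open>auto simp: P_iff\<close>)
  then show ?thesis using True x(2) by (simp add: taut_def)
next
  case False
  have "(act X f (fst m), t) \<in> cyl X A D1 (dvx 0) (src \<C> f)" using z False t fst_m_act by simp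
  then show ?thesis using nat_on_val[OF u category_Ob(1)[OF catC f(1)]] False by (simp add: taut_def)
qed

lemma taut_act:
  assumes h: "h \<in> Ar \<C>" "tgt \<C> h = src \<C> f"
  shows "taut c m (cmp \<C> f h) (act D1 h t) = act L h (taut c m f t)"
proof -
  note fh = category_cmp[OF catC h(1) f(1) h(2)[symmetric]]
  show ?thesis
  proof (cases "m \<in> kP c")
    case True
    then obtain x \<xi> where x: "(x, \<xi>) \<in> P c" "unk c m = (x, \<xi>)" by (rule kP_E[OF c_Ob])
    have "\<xi> (src \<C> h) (act (Rp c) h (f, t)) = act L h (\<xi> (src \<C> f) (f, t))"
      by (rule nat_on_act[OF homD h(1,2) refl]) (use x(1) f t in \<open>auto simp: P_iff\<close>)
    then show ?thesis using True x(2) fh by (simp add: taut_def)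
  next
    case False
    have "(act X f (fst m), t) \<in> cyl X A D1 (dvx 0) (src \<C> f)" using z False t fst_m_act by simp
    from nat_on_act[OF u h(1,2) refl this] show ?thesis
      using False fh presheaf_cmp[OF X h(1) f(1) h(2)[symmetric] f(2) fst_m] by (simp add: taut_def)
  qed
qed

end

lemma taut_change:
  assumes m: "m \<in> val M (tgt \<C> g)" and g: "g \<in> Ar \<C>" and f: "f \<in> Ar \<C>" "tgt \<C> f = src \<C> g" and t: "t \<in> val D1 (src \<C> f)"
    and z: "m \<in> kP (tgt \<C> g) \<or> t = dvx 0 (src \<C> f)"
  shows "taut (src \<C> g) (act M g m) f t = taut (tgt \<C> g) m (cmp \<C> g f) t"
proof -
  note gf = category_cmp[OF catC f(1) g f(2)[symmetric]] and o = category_Ob[OF catC g]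
  have gm: "act M g m \<in> val M (src \<C> g)" by (rule presheaf_act[OF presheaf_M g refl refl m])
  have fm: "fst (act M g m) = act X g (fst m)" by (cases m) simp
  show ?thesis
  proof (cases "m \<in> kP (tgt \<C> g)")
    case True
    then obtain x \<xi> where x: "(x, \<xi>) \<in> P (tgt \<C> g)" "unk (tgt \<C> g) m = (x, \<xi>)" by (rule kP_E[OF o(2)])
    have "act M g m \<in> kP (src \<C> g)" by (rule sub_act[OF sub_kP g refl refl True])
    then show ?thesis using True unk_act[OF g True] x(2) gf E_act[OF f t] by (simp add: taut_def)
  next
    case False
    then have t0: "t = dvx 0 (src \<C> f)" using z by simp
    have "fst m \<in> val X (tgt \<C> g)" using m by (cases m) simp
    then show ?thesis
      using taut_base[OF gm f t disjI2[OF t0] t0] taut_base[OF m gf(1,3) _ disjI2] t0 t gf fm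
        presheaf_cmp[OF X f(1) g f(2)[symmetric] refl] by simp
  qed
qed

text \<open>At a fixed \<open>(d, n)\<close> the lifting property \<open>box_prism\<close> is
  available. It completes every point of \<open>M\<close> to a local lift and so yields a simplicial
  retraction \<open>\<rho>\<close> onto \<open>kP\<close> over \<open>X\<close>. Nothing relates
  \<open>\<rho>\<close> to the identity except equality in the \<open>X\<close>-coordinate, but the
  cofree coordinate consists of arbitrary functions, so maps into it are always homotopic; the
  homotopy is constant on \<open>kP\<close>.\<close>

lemma kP_contracts:
  assumes d: "d \<in> Ob D"
  shows "scontracts 0 (sl D M d n) (\<lambda>l. kP (d, n, l))"
proof -
  let ?X = "sl D M d n" and ?A = "\<lambda>l. kP (d, n, l)" and ?T = "std_simplex n \<times>\<^sub>p \<Delta>1"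
  let ?B = "box D d ?T ?X"
  let ?S = "box_corner D d ?T (cyl (std_simplex n) (\<lambda>_. {}) \<Delta>1 (vx 0)) ?X ?A"
  have X': "presheaf simplex ?X" by (rule presheaf_sl[OF catD presheaf_M d])
  have A': "sub simplex ?X ?A" by (rule sub_sl[OF catD sub_kP d])
  have sm: "small_set U (val ?X l)" for l using small_M d unfolding small_psh_def by simp
  note rlp = box_prism[OF d X' A' sm, of n]
  have ii: "cmp D (idn D d) (idn D d) = idn D d" "cmp simplex (idn simplex n) (idn simplex n) = idn simplex n"
    using unit_D[OF idn_D(1)[OF d]] d simplex_unit[of "idn simplex n"] by simp_all
  have gd: "cmp D (idn D d) g = g" if "g \<in> Ar D" "tgt D g = d" for g using unit_D(2)[OF that(1)] that(2) by simp
  have ga: "cmp simplex (idn simplex j) \<alpha> = \<alpha>" if "\<alpha> \<in> Ar simplex" "tgt simplex \<alpha> = j" for \<alpha> j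
    using simplex_unit(2)[OF that(1)] that(2) by simp
  have gb: "cmp simplex \<alpha> (idn simplex j) = \<alpha>" if "\<alpha> \<in> Ar simplex" "src simplex \<alpha> = j" for \<alpha> j
    using simplex_unit(1)[OF that(1)] that(2) by simp
  \<comment> \<open>Points of \<open>kP\<close> bring their own local lift, which forces the
    solution to extend it; all other points prescribe only the end 0.\<close>
  define u' where "u' = (\<lambda>(d' :: 'o, k :: nat, l) (g, (\<alpha>, t), m). taut (d, n, l) m (g, \<alpha>, idn simplex l) t)"
  define v' where "v' = (\<lambda>(d', k, l) (g, (\<alpha>, t), m). v (d', k, l) (act X (g, \<alpha>, idn simplex l) (fst (m :: 'x \<times> ('m dmor \<Rightarrow> 'u))), t))"
  have u'_simp: "u' (d', k, l) (g, (\<alpha>, t), m) = taut (d, n, l) m (g, \<alpha>, idn simplex l) t" for d' k l g \<alpha> t m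
    by (simp add: u'_def)
  have v'_simp: "v' (d', k, l) (g, (\<alpha>, t), m) = v (d', k, l) (act X (g, \<alpha>, idn simplex l) (fst m), t)" for d' k l g \<alpha> t m
    by (simp add: v'_def)
  have sq: "cmp \<C> (idn D d, idn simplex n, \<beta>) (cmp D g f0, cmp simplex \<alpha> \<alpha>', idn simplex l') =
       cmp \<C> (g, \<alpha>, idn simplex l) (f0, \<alpha>', \<beta>)"
    if "g \<in> Ar D" "tgt D g = d" "f0 \<in> Ar D" "tgt D f0 = src D g" "\<alpha> \<in> smap k n" "\<alpha>' \<in> smap k' k" "\<beta> \<in> smap l' l"
    for g f0 \<alpha> \<alpha>' \<beta> k k' l l'
  proof -
    have "cmp D g f0 \<in> Ar D" "tgt D (cmp D g f0) = d" using category_cmp[OF catD that(3,1)] that by simp_all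
    moreover have "cmp simplex \<alpha> \<alpha>' \<in> smap k' n" by (rule cmp_smap(1)[OF that(6,5)])
    ultimately show ?thesis using gd ga[of "cmp simplex \<alpha> \<alpha>'" n] ga[of \<beta> l] gb[of \<beta> l'] that by simp
  qed
  have nu: "nat_on \<C> ?B ?S L u'"
  proof (rule nat_onI)
    fix c z assume c: "z \<in> ?S c"
    obtain d' k l g \<tau> m where *: "c = (d', k, l)" "z = (g, \<tau>, m)" by (metis prod_cases3)
    obtain \<alpha> t where **: "\<tau> = (\<alpha>, t)" by (cases \<tau>)
    show "u' c z \<in> val L c"
      using c taut_val[of m "(d, n, l)" "(g, \<alpha>, idn simplex l)" t] unfolding * ** u'_simp by auto
  next
    fix f z assume c: "f \<in> Ar \<C>" "z \<in> ?S (tgt \<C> f)"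
    obtain f0 \<alpha>' \<beta> g \<tau> m where *: "f = (f0, \<alpha>', \<beta>)" "z = (g, \<tau>, m)" by (metis prod_cases3)
    obtain \<alpha> t where **: "\<tau> = (\<alpha>, t)" by (cases \<tau>)
    have g: "g \<in> Ar D" "tgt D g = d" "f0 \<in> Ar D" "tgt D f0 = src D g" "\<alpha> \<in> smap (tgt simplex \<alpha>') n"
      "\<alpha>' \<in> smap (src simplex \<alpha>') (tgt simplex \<alpha>')" "\<beta> \<in> smap (src simplex \<beta>) (tgt simplex \<beta>)"
      "t \<in> smap (tgt simplex \<alpha>') 1" "m \<in> val M (d, n, tgt simplex \<beta>)"
      "m \<in> kP (d, n, tgt simplex \<beta>) \<or> t = vx 0 (tgt simplex \<alpha>')"
      using c unfolding * ** by auto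
    let ?l = "tgt simplex \<beta>" and ?l' = "src simplex \<beta>"
    have gf: "cmp D g f0 \<in> Ar D" "src D (cmp D g f0) = src D f0" "tgt D (cmp D g f0) = d"
      using category_cmp[OF catD g(3,1)] g by simp_all
    have t': "cmp simplex t \<alpha>' \<in> smap (src simplex \<alpha>') 1" by (rule cmp_smap(1)[OF g(6,8)])
    have z': "m \<in> kP (d, n, ?l) \<or> cmp simplex t \<alpha>' = vx 0 (src simplex \<alpha>')"
      using g(10) vx_act[of 0 \<alpha>'] g(6) by auto
    have "taut (d, n, ?l') (act M (idn D d, idn simplex n, \<beta>) m) (cmp D g f0, cmp simplex \<alpha> \<alpha>', idn simplex ?l') (cmp simplex t \<alpha>') =
      taut (d, n, ?l) m (cmp \<C> (idn D d, idn simplex n, \<beta>) (cmp D g f0, cmp simplex \<alpha> \<alpha>', idn simplex ?l')) (cmp simplex t \<alpha>')"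
      using taut_change[of m "(idn D d, idn simplex n, \<beta>)" "(cmp D g f0, cmp simplex \<alpha> \<alpha>', idn simplex ?l')" "cmp simplex t \<alpha>'"]
        g gf t' z' d by simp
    also have "\<dots> = taut (d, n, ?l) m (cmp \<C> (g, \<alpha>, idn simplex ?l) (f0, \<alpha>', \<beta>)) (act D1 (f0, \<alpha>', \<beta>) t)"
      unfolding sq[OF g(1-7)] by simp
    also have "\<dots> = act L (f0, \<alpha>', \<beta>) (taut (d, n, ?l) m (g, \<alpha>, idn simplex ?l) t)"
      by (rule taut_act) (use g in auto)
    finally show "u' (src \<C> f) (act ?B f z) = act L f (u' (tgt \<C> f) z)"
      unfolding * ** by (simp add: u'_simp)
  qed
  have fstM: "fst (act M h m) = act X h (fst m)" for h m by (cases m) simp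
  have nv: "nat_on \<C> ?B (val ?B) W v'"
  proof (rule nat_onI)
    fix c z assume c: "c \<in> Ob \<C>" "z \<in> val ?B c"
    obtain d' k l g \<tau> m where *: "c = (d', k, l)" "z = (g, \<tau>, m)" by (metis prod_cases3)
    obtain \<alpha> t where **: "\<tau> = (\<alpha>, t)" by (cases \<tau>)
    have m: "fst m \<in> val X (d, n, l)" using c(2) unfolding * by (cases m) simp
    have "act X (g, \<alpha>, idn simplex l) (fst m) \<in> val X (d', k, l)"
      by (rule presheaf_act[OF X _ _ _ m]) (use c(2) in \<open>simp_all add: * **\<close>)
    then show "v' c z \<in> val W c"
      using c(2) unfolding * ** v'_simp by (intro nat_on_val[OF v]) (use c(1) in \<open>simp_all add: *\<close>)
  next
    fix f z assume c: "f \<in> Ar \<C>" "z \<in> val ?B (tgt \<C> f)"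
    obtain f0 \<alpha>' \<beta> g \<tau> m where *: "f = (f0, \<alpha>', \<beta>)" "z = (g, \<tau>, m)" by (metis prod_cases3)
    obtain \<alpha> t where **: "\<tau> = (\<alpha>, t)" by (cases \<tau>)
    have g: "g \<in> Ar D" "tgt D g = d" "f0 \<in> Ar D" "tgt D f0 = src D g" "\<alpha> \<in> smap (tgt simplex \<alpha>') n"
      "\<alpha>' \<in> smap (src simplex \<alpha>') (tgt simplex \<alpha>')" "\<beta> \<in> smap (src simplex \<beta>) (tgt simplex \<beta>)"
      "t \<in> smap (tgt simplex \<alpha>') 1" "m \<in> val M (d, n, tgt simplex \<beta>)"
      using c unfolding * ** by auto
    let ?l = "tgt simplex \<beta>" and ?l' = "src simplex \<beta>"
    have gf: "cmp D g f0 \<in> Ar D" "src D (cmp D g f0) = src D f0" "tgt D (cmp D g f0) = d"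
      using category_cmp[OF catD g(3,1)] g by simp_all
    have m: "fst m \<in> val X (d, n, ?l)" using g(9) by (cases m) simp
    have "act X (cmp D g f0, cmp simplex \<alpha> \<alpha>', idn simplex ?l') (act X (idn D d, idn simplex n, \<beta>) (fst m)) =
        act X (cmp \<C> (idn D d, idn simplex n, \<beta>) (cmp D g f0, cmp simplex \<alpha> \<alpha>', idn simplex ?l')) (fst m)"
      by (rule presheaf_cmp[OF X, symmetric, of _ _ "(d, n, ?l)"]) (use g gf m d in simp_all)
    also have "\<dots> = act X (f0, \<alpha>', \<beta>) (act X (g, \<alpha>, idn simplex ?l) (fst m))"
      unfolding sq[OF g(1-7)] by (rule presheaf_cmp[OF X, of _ _ "(d, n, ?l)"]) (use g m in simp_all)
    finally have e: "act X (cmp D g f0, cmp simplex \<alpha> \<alpha>', idn simplex ?l') (act X (idn D d, idn simplex n, \<beta>) (fst m)) =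
       act X (f0, \<alpha>', \<beta>) (act X (g, \<alpha>, idn simplex ?l) (fst m))" .
    have gm: "act X (g, \<alpha>, idn simplex ?l) (fst m) \<in> val X (src D g, tgt simplex \<alpha>', ?l)"
      by (rule presheaf_act[OF X _ _ _ m]) (use g in simp_all)
    have "v (src \<C> f) (act (X \<times>\<^sub>p D1) f (act X (g, \<alpha>, idn simplex ?l) (fst m), t)) =
        act W f (v (tgt \<C> f) (act X (g, \<alpha>, idn simplex ?l) (fst m), t))"
      by (rule nat_on_act[OF v c(1) refl refl]) (use gm g in \<open>simp add: *\<close>)
    then show "v' (src \<C> f) (act ?B f z) = act W f (v' (tgt \<C> f) z)"
      unfolding * ** by (simp add: v'_simp fstM e)
  qed
  have pu: "p c (u' c z) = v' c z" if "z \<in> ?S c" for c z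
  proof -
    obtain d' k l g \<tau> m where *: "c = (d', k, l)" "z = (g, \<tau>, m)" by (metis prod_cases3)
    obtain \<alpha> t where **: "\<tau> = (\<alpha>, t)" by (cases \<tau>)
    show ?thesis
      using that taut_proj[of m "(d, n, l)" "(g, \<alpha>, idn simplex l)" t] unfolding * ** u'_simp v'_simp by auto
  qed
  obtain h where h: "nat_on \<C> ?B (val ?B) L h" "\<And>c z. c \<in> Ob \<C> \<Longrightarrow> z \<in> ?S c \<Longrightarrow> h c z = u' c z"
    "\<And>c z. c \<in> Ob \<C> \<Longrightarrow> z \<in> val ?B c \<Longrightarrow> p c (h c z) = v' c z"
    using RLPE[OF rlp nu nv pu] by blast
  \<comment> \<open>The solution at a point \<open>m\<close>, turned into a natural map on the
    representable times \<open>D[1]\<close>: the space part of an arrow acts on \<open>m\<close>,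
    the other parts are arguments of \<open>h\<close>.\<close>
  define \<xi> where "\<xi> = (\<lambda>l m. transf \<C> (Rp (d, n, l))
     (\<lambda>b ((g, \<alpha>, \<beta>), t). h b (g, (\<alpha>, t), act M (idn D d, idn simplex n, \<beta>) m)))"
  have \<xi>_simp: "\<xi> l m (d', k, l') ((g, \<alpha>, \<beta>), t) = h (d', k, l') (g, (\<alpha>, t), act M (idn D d, idn simplex n, \<beta>) m)"
    if "g \<in> Ar D" "src D g = d'" "tgt D g = d" "\<alpha> \<in> smap k n" "\<beta> \<in> smap l' l" "t \<in> smap k 1" for l m d' k l' g \<alpha> \<beta> t
    using that by (auto simp: \<xi>_def)
  have bm: "act M (idn D d, idn simplex n, \<beta>) m \<in> val M (d, n, l')" if "m \<in> val M (d, n, l)" "\<beta> \<in> smap l' l" for m \<beta> l l'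
    by (rule presheaf_act[OF presheaf_M _ _ _ that(1)]) (use that(2) d in simp_all)
  have bmc: "act M (idn D d, idn simplex n, \<gamma>) (act M (idn D d, idn simplex n, \<beta>) m) = act M (idn D d, idn simplex n, cmp simplex \<beta> \<gamma>) m"
    if "m \<in> val M (d, n, l)" "\<beta> \<in> smap l' l" "\<gamma> \<in> smap l'' l'" for m \<beta> \<gamma> l l' l''
    using presheaf_cmp[OF X', of \<gamma> \<beta> l m] that by simp
  have \<xi>_hom: "\<xi> l m \<in> hom \<C> (Rp (d, n, l)) L" if m: "m \<in> val M (d, n, l)" for l m
    unfolding \<xi>_def
  proof (rule transf_hom[OF catC presheaf_Rp], rule nat_onI)
    fix b z assume b: "b \<in> Ob \<C>" "z \<in> val (Rp (d, n, l)) b"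
    obtain d' k l' where *: "b = (d', k, l')" by (metis prod_cases3)
    obtain g \<alpha> \<beta> t where **: "z = ((g, \<alpha>, \<beta>), t)" by (metis prod.collapse)
    have "(g, (\<alpha>, t), act M (idn D d, idn simplex n, \<beta>) m) \<in> val ?B b"
      using b(2) bm[OF m, of \<beta> l'] unfolding * ** by simp
    from nat_on_val[OF h(1) b(1) this]
    show "(\<lambda>((g, \<alpha>, \<beta>), t). h b (g, (\<alpha>, t), act M (idn D d, idn simplex n, \<beta>) m)) z \<in> val L b"
      unfolding ** by simp
  next
    fix f z assume f: "f \<in> Ar \<C>" "z \<in> val (Rp (d, n, l)) (tgt \<C> f)"
    obtain f0 \<alpha>' \<beta>' where *: "f = (f0, \<alpha>', \<beta>')" by (metis prod_cases3)
    obtain g \<alpha> \<beta> t where **: "z = ((g, \<alpha>, \<beta>), t)" by (metis prod.collapse)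
    have "(g, (\<alpha>, t), act M (idn D d, idn simplex n, \<beta>) m) \<in> val ?B (tgt \<C> f)"
      using f(2) bm[OF m, of \<beta> "tgt simplex \<beta>'"] unfolding * ** by simp
    from nat_on_act[OF h(1) f(1) refl refl this]
    show "(\<lambda>((g, \<alpha>, \<beta>), t). h (src \<C> f) (g, (\<alpha>, t), act M (idn D d, idn simplex n, \<beta>) m)) (act (Rp (d, n, l)) f z) =
       act L f ((\<lambda>((g, \<alpha>, \<beta>), t). h (tgt \<C> f) (g, (\<alpha>, t), act M (idn D d, idn simplex n, \<beta>) m)) z)"
      using f bmc[OF m, of \<beta> "tgt simplex \<beta>'" \<beta>' "src simplex \<beta>'"] unfolding * ** by simp
  qed
  have facX: "act X (g, \<alpha>, idn simplex l') (fst (act M (idn D d, idn simplex n, \<beta>) m)) = act X (g, \<alpha>, \<beta>) (fst m)"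
    if "m \<in> val M (d, n, l)" "g \<in> Ar D" "tgt D g = d" "\<alpha> \<in> smap k n" "\<beta> \<in> smap l' l" for m l l' g \<alpha> \<beta> k
  proof -
    have "fst m \<in> val X (d, n, l)" using that(1) by (cases m) simp
    from presheaf_cmp[OF X, of "(g, \<alpha>, idn simplex l')" "(idn D d, idn simplex n, \<beta>)" "(d, n, l)" "fst m", symmetric] this
    show ?thesis using that d gd ga[of \<alpha> n] gb[of \<beta> l'] by (simp add: fstM)
  qed
  have \<pi>P: "(fst m, \<xi> l m) \<in> P (d, n, l)" if m: "m \<in> val M (d, n, l)" for l m
    unfolding P_iff
  proof (intro conjI ballI impI)
    show "fst m \<in> val X (d, n, l)" using m by (cases m) simp
    show "\<xi> l m \<in> hom \<C> (Rp (d, n, l)) L" by (rule \<xi>_hom[OF m])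
    fix f t assume f: "f \<in> Ar \<C>" "t \<in> val D1 (src \<C> f)" "tgt \<C> f = (d, n, l)"
    obtain g \<alpha> \<beta> where *: "f = (g, \<alpha>, \<beta>)" by (metis prod_cases3)
    let ?l = "src simplex \<beta>"
    have g: "g \<in> Ar D" "tgt D g = d" "\<alpha> \<in> smap (src simplex \<alpha>) n" "\<beta> \<in> smap ?l l" "t \<in> smap (src simplex \<alpha>) 1"
      using f unfolding * by simp_all
    have z: "(g, (\<alpha>, t), act M (idn D d, idn simplex n, \<beta>) m) \<in> val ?B (src \<C> f)"
      using g bm[OF m g(4)] unfolding * by simp
    have o: "src \<C> f \<in> Ob \<C>" by (rule category_Ob(1)[OF catC f(1)])
    have 1: "\<xi> l m (src \<C> f) (f, t) = h (src \<C> f) (g, (\<alpha>, t), act M (idn D d, idn simplex n, \<beta>) m)"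
      using \<xi>_simp[OF g(1) refl g(2,3,4,5), of m] unfolding * by simp
    show "p (src \<C> f) (\<xi> l m (src \<C> f) (f, t)) = v (src \<C> f) (act X f (fst m), t)"
      unfolding 1 h(3)[OF o z] using facX[OF m g(1-4)] unfolding * by (simp add: v'_simp)
    assume t0: "t = dvx 0 (src \<C> f)"
    have "(g, (\<alpha>, t), act M (idn D d, idn simplex n, \<beta>) m) \<in> ?S (src \<C> f)" using z t0 unfolding * by simp
    then have "\<xi> l m (src \<C> f) (f, t) = u' (src \<C> f) (g, (\<alpha>, t), act M (idn D d, idn simplex n, \<beta>) m)"
      unfolding 1 by (rule h(2)[OF o])
    also have "\<dots> = u (src D g, src simplex \<alpha>, ?l) (act X (g, \<alpha>, idn simplex ?l) (fst (act M (idn D d, idn simplex n, \<beta>) m)), t)"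
      using taut_base[OF bm[OF m g(4)], of "(g, \<alpha>, idn simplex ?l)" t] g t0 unfolding * by (simp add: u'_simp)
    finally show "\<xi> l m (src \<C> f) (f, t) = u (src \<C> f) (act X f (fst m), t)"
      unfolding facX[OF m g(1-4)] by (simp add: *)
  qed
  define \<rho> where "\<rho> = (\<lambda>l m. k (d, n, l) (fst m, \<xi> l m))"
  have o: "(d, n, l) \<in> Ob \<C>" for l using d by simp
  have \<rho>_kP: "\<rho> l m \<in> kP (d, n, l)" and \<rho>_fst: "fst (\<rho> l m) = fst m" if "m \<in> val M (d, n, l)" for l m
    unfolding \<rho>_def kP_def by (rule imageI[OF \<pi>P[OF that]]) (simp add: k_def)
  have \<rho>_id: "\<rho> l m = m" if m: "m \<in> kP (d, n, l)" for l m
  proof -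
    obtain x \<zeta> where x: "(x, \<zeta>) \<in> P (d, n, l)" "m = k (d, n, l) (x, \<zeta>)" "unk (d, n, l) m = (x, \<zeta>)" "fst m = x"
      by (rule kP_E[OF o m])
    have mM: "m \<in> val M (d, n, l)" by (rule subD[OF sub_kP o m])
    have "\<xi> l m = \<zeta>"
    proof (rule hom_ext[OF \<xi>_hom[OF mM]])
      show "\<zeta> \<in> hom \<C> (Rp (d, n, l)) L" using x(1) by (simp add: P_iff)
      fix b z assume b: "b \<in> Ob \<C>" "z \<in> val (Rp (d, n, l)) b"
      obtain d' k l' where *: "b = (d', k, l')" by (metis prod_cases3)
      obtain g \<alpha> \<beta> t where **: "z = ((g, \<alpha>, \<beta>), t)" by (metis prod.collapse)
      have g: "g \<in> Ar D" "src D g = d'" "tgt D g = d" "\<alpha> \<in> smap k n" "\<beta> \<in> smap l' l" "t \<in> smap k 1"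
        using b(2) unfolding * ** by auto
      have "act M (idn D d, idn simplex n, \<beta>) m \<in> kP (d, n, l')"
        by (rule sub_act[OF sub_kP _ _ _ m]) (use g d in simp_all)
      then have z: "(g, (\<alpha>, t), act M (idn D d, idn simplex n, \<beta>) m) \<in> ?S b"
        using g bm[OF mM g(5)] unfolding * by simp
      have "\<xi> l m b z = taut (d, n, l') (act M (idn D d, idn simplex n, \<beta>) m) (g, \<alpha>, idn simplex l') t"
        using \<xi>_simp[OF g, of m] h(2)[OF b(1) z] unfolding * ** by (simp add: u'_simp)
      also have "\<dots> = taut (d, n, l) m (cmp \<C> (idn D d, idn simplex n, \<beta>) (g, \<alpha>, idn simplex l')) t"
        using taut_change[of m "(idn D d, idn simplex n, \<beta>)" "(g, \<alpha>, idn simplex l')" t] mM m g d gb[of \<beta> l'] by simp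
      also have "\<dots> = \<zeta> b z"
        using m x(3) gd[OF g(1,3)] ga[of \<alpha> n] gb[of \<beta> l'] g unfolding * ** by (simp add: taut_def)
      finally show "\<xi> l m b z = \<zeta> b z" .
    qed
    then show ?thesis using x(2,4) by (simp add: \<rho>_def)
  qed
  have \<rho>_act: "\<rho> l' (act M (idn D d, idn simplex n, \<beta>) m) = act M (idn D d, idn simplex n, \<beta>) (\<rho> l m)"
    if m: "m \<in> val M (d, n, l)" and \<beta>: "\<beta> \<in> smap l' l" for m \<beta> l l'
  proof -
    let ?b = "(idn D d, idn simplex n, \<beta>)"
    have b: "?b \<in> Ar \<C>" "src \<C> ?b = (d, n, l')" "tgt \<C> ?b = (d, n, l)" using \<beta> d by simp_all
    have "\<xi> l' (act M ?b m) = act (exp_psh \<C> D1 L) ?b (\<xi> l m)"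
    proof (rule hom_ext[OF \<xi>_hom[OF bm[OF m \<beta>]]])
      show "act (exp_psh \<C> D1 L) ?b (\<xi> l m) \<in> hom \<C> (Rp (d, n, l')) L"
        using presheaf_act[OF presheaf_E b(1,3,2), of "\<xi> l m"] \<xi>_hom[OF m] by (simp add: exp_psh_def)
      fix e z assume e: "e \<in> Ob \<C>" "z \<in> val (Rp (d, n, l')) e"
      obtain d' k l'' where *: "e = (d', k, l'')" by (metis prod_cases3)
      obtain g \<alpha> \<gamma> t where **: "z = ((g, \<alpha>, \<gamma>), t)" by (metis prod.collapse)
      have g: "g \<in> Ar D" "src D g = d'" "tgt D g = d" "\<alpha> \<in> smap k n" "\<gamma> \<in> smap l'' l'" "t \<in> smap k 1"
        using e(2) unfolding * ** by auto
      have "act (exp_psh \<C> D1 L) ?b (\<xi> l m) e z = \<xi> l m e (cmp \<C> ?b (g, \<alpha>, \<gamma>), t)"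
        using E_act[of "(g, \<alpha>, \<gamma>)" ?b t "\<xi> l m"] g b unfolding * ** by simp
      also have "\<dots> = \<xi> l m e ((g, \<alpha>, cmp simplex \<beta> \<gamma>), t)"
        using gd[OF g(1,3)] ga[of \<alpha> n] g(4) by simp
      also have "\<dots> = h e (g, (\<alpha>, t), act M (idn D d, idn simplex n, cmp simplex \<beta> \<gamma>) m)"
        using \<xi>_simp[OF g(1-4) cmp_smap(1)[OF g(5) \<beta>] g(6), of m] unfolding * .
      finally show "\<xi> l' (act M ?b m) e z = act (exp_psh \<C> D1 L) ?b (\<xi> l m) e z"
        using \<xi>_simp[OF g, of "act M ?b m"] bmc[OF m \<beta> g(5)] unfolding * ** by simp
    qed
    then have "(fst (act M ?b m), \<xi> l' (act M ?b m)) = act XE ?b (fst m, \<xi> l m)" by (simp add: fstM)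
    then show ?thesis
      unfolding \<rho>_def using nat_on_act[OF nat_k b(1,3,2) \<pi>P[OF m]] by simp
  qed
  \<comment> \<open>The homotopy switches coordinate by coordinate: \<open>f\<close> keeps the value
    of \<open>m\<close> if \<open>r\<close>, restricted along the space part of \<open>f\<close>, is
    constant at vertex 1, and takes the value of \<open>\<rho> m\<close> otherwise. The test is
    compatible with further restriction, which is all that naturality demands.\<close>
  let ?sp = "\<lambda>r (f :: 'm dmor). cmp simplex r (snd (snd f)) = vx 1 (src simplex (snd (snd f)))"
  define K where "K = (\<lambda>l (m, r). (fst m, \<lambda>f\<in>{f \<in> Ar \<C>. tgt \<C> f = (d, n, l)}. if ?sp r f then snd m f else snd (\<rho> l m) f))"
  have K_fst: "fst (K l (m, r)) = fst m" for l m r by (simp add: K_def)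
  have K_snd: "snd (K l (m, r)) f = (if ?sp r f then snd m f else snd (\<rho> l m) f)"
    if "f \<in> Ar \<C>" "tgt \<C> f = (d, n, l)" for l m r f using that by (simp add: K_def)
  have K_val: "K l (m, r) \<in> val M (d, n, l)" if "m \<in> val M (d, n, l)" for l m r
    using that by (cases m) (simp add: K_def cofree_def restrict_PiE_iff)
  have M_ext: "m = m'" if "m \<in> val M c" "m' \<in> val M c" "fst m = fst m'"
    "\<And>f. f \<in> Ar \<C> \<Longrightarrow> tgt \<C> f = c \<Longrightarrow> snd m f = snd m' f" for m m' c
    using that cofree_ext[of "snd m" \<C> c "snd m'"] by (cases m; cases m') simp
  have \<rho>M: "\<rho> l m \<in> val M (d, n, l)" if "m \<in> val M (d, n, l)" for l m by (rule subD[OF sub_kP o \<rho>_kP[OF that]])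
  show ?thesis
  proof (rule contractsI)
    show "nat_on simplex (?X \<times>\<^sub>p \<Delta>1) (val (?X \<times>\<^sub>p \<Delta>1)) ?X K"
    proof (rule nat_onI)
      fix l z assume "z \<in> val (?X \<times>\<^sub>p \<Delta>1) l" then show "K l z \<in> val ?X l" using K_val by (cases z) simp
    next
      fix \<beta> z assume \<beta>: "\<beta> \<in> Ar simplex" and z: "z \<in> val (?X \<times>\<^sub>p \<Delta>1) (tgt simplex \<beta>)"
      obtain m r where *: "z = (m, r)" by (cases z)
      let ?b = "(idn D d, idn simplex n, \<beta>)" and ?l = "tgt simplex \<beta>" and ?l' = "src simplex \<beta>"
      have m: "m \<in> val M (d, n, ?l)" and r: "r \<in> smap ?l 1" using z unfolding * by simp_all
      note \<beta>' = smap_Ar[OF \<beta>]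
      have b: "?b \<in> Ar \<C>" "src \<C> ?b = (d, n, ?l')" "tgt \<C> ?b = (d, n, ?l)" using \<beta> d by simp_all
      have sndM: "snd (act M ?b m) f = snd m (cmp \<C> ?b f)" if "f \<in> Ar \<C>" "tgt \<C> f = (d, n, ?l')" for f m
        using that b by (cases m) simp
      have "K ?l' (act M ?b m, cmp simplex r \<beta>) = act M ?b (K ?l (m, r))"
      proof (rule M_ext[OF K_val[OF bm[OF m \<beta>']]])
        show "act M ?b (K ?l (m, r)) \<in> val M (d, n, ?l')"
          by (rule presheaf_act[OF presheaf_M b(1,3,2) K_val[OF m]])
        show "fst (K ?l' (act M ?b m, cmp simplex r \<beta>)) = fst (act M ?b (K ?l (m, r)))"
          by (simp add: K_fst fstM)
        fix f assume f: "f \<in> Ar \<C>" "tgt \<C> f = (d, n, ?l')"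
        obtain g \<alpha> \<gamma> where **: "f = (g, \<alpha>, \<gamma>)" by (metis prod_cases3)
        have \<gamma>: "\<gamma> \<in> Ar simplex" "tgt simplex \<gamma> = ?l'" using f unfolding ** by simp_all
        have bf: "cmp \<C> ?b f \<in> Ar \<C>" "tgt \<C> (cmp \<C> ?b f) = (d, n, ?l)" "snd (snd (cmp \<C> ?b f)) = cmp simplex \<beta> \<gamma>"
          using category_cmp[OF catC f(1) b(1)] b f(2) unfolding ** by simp_all
        have a: "cmp simplex (cmp simplex r \<beta>) \<gamma> = cmp simplex r (cmp simplex \<beta> \<gamma>)"
          by (rule category_assoc[OF category_simplex, symmetric]) (use \<beta> \<gamma> r in simp_all)
        have s: "src simplex (cmp simplex \<beta> \<gamma>) = src simplex \<gamma>" using \<beta> \<gamma> by simp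
        have "snd (K ?l' (act M ?b m, cmp simplex r \<beta>)) f =
            (if cmp simplex r (cmp simplex \<beta> \<gamma>) = vx 1 (src simplex \<gamma>) then snd m (cmp \<C> ?b f) else snd (\<rho> ?l m) (cmp \<C> ?b f))"
          unfolding K_snd[OF f] sndM[OF f] \<rho>_act[OF m \<beta>'] using a by (simp add: **)
        also have "\<dots> = snd (K ?l (m, r)) (cmp \<C> ?b f)"
          unfolding K_snd[OF bf(1,2)] bf(3) s ..
        also have "\<dots> = snd (act M ?b (K ?l (m, r))) f" by (rule sndM[OF f, symmetric])
        finally show "snd (K ?l' (act M ?b m, cmp simplex r \<beta>)) f = snd (act M ?b (K ?l (m, r))) f" .
      qed
      then show "K (src simplex \<beta>) (act (?X \<times>\<^sub>p \<Delta>1) \<beta> z) = act ?X \<beta> (K (tgt simplex \<beta>) z)"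
        unfolding * by simp
    qed
  next
    fix l m assume "m \<in> val ?X l"
    then have m: "m \<in> val M (d, n, l)" by simp
    have "K l (m, vx 1 l) = m"
    proof (rule M_ext[OF K_val[OF m] m])
      fix f assume f: "f \<in> Ar \<C>" "tgt \<C> f = (d, n, l)"
      obtain g \<alpha> \<gamma> where **: "f = (g, \<alpha>, \<gamma>)" by (metis prod_cases3)
      have "?sp (vx 1 l) f" using vx_act[of 1 \<gamma>] f unfolding ** by simp
      then show "snd (K l (m, vx 1 l)) f = snd m f" unfolding K_snd[OF f] by simp
    qed (simp add: K_fst)
    then show "K l (m, vx (1 - 0) l) = m" by simp
    have "K l (m, vx 0 l) = \<rho> l m"
    proof (rule M_ext[OF K_val[OF m] \<rho>M[OF m]])
      fix f assume f: "f \<in> Ar \<C>" "tgt \<C> f = (d, n, l)"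
      obtain g \<alpha> \<gamma> where **: "f = (g, \<alpha>, \<gamma>)" by (metis prod_cases3)
      have "\<not> ?sp (vx 0 l) f" using vx_act[of 0 \<gamma>] f unfolding ** by simp
      then show "snd (K l (m, vx 0 l)) f = snd (\<rho> l m) f" unfolding K_snd[OF f] by simp
    qed (simp add: K_fst \<rho>_fst[OF m])
    then show "K l (m, vx 0 l) \<in> kP (d, n, l)" using \<rho>_kP[OF m] by simp
  next
    fix l m r assume m: "m \<in> kP (d, n, l)"
    have mM: "m \<in> val M (d, n, l)" by (rule subD[OF sub_kP o m])
    have "K l (m, r) = m"
      by (rule M_ext[OF K_val[OF mM] mM K_fst]) (simp add: K_snd \<rho>_id[OF m])
    then show "K l (m, r) \<in> kP (d, n, l)" using m by simp
  qed
qed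

text \<open>The tautological lift extends over \<open>M \<times> D[1]\<close>, because its domain is
  an objectwise deformation retract and \<open>p\<close> is an injective fibration. The extension is
  restricted along a natural map from \<open>X\<close> to \<open>M\<close> that on \<open>A\<close>
  picks the local lift given by \<open>u\<close>.\<close>

lemma cylinder_lift:
  "\<exists>h. nat_on \<C> (X \<times>\<^sub>p D1) (val (X \<times>\<^sub>p D1)) L h \<and> (\<forall>c\<in>Ob \<C>. \<forall>z\<in>cyl X A D1 (dvx 0) c. h c z = u c z) \<and>
     (\<forall>c\<in>Ob \<C>. \<forall>z\<in>val (X \<times>\<^sub>p D1) c. p c (h c z) = v c z)"
proof -
  let ?Z = "M \<times>\<^sub>p D1" and ?S = "cyl M kP D1 (dvx 0)"
  have pt: "sub \<C> D1 (\<lambda>c. {dvx 0 c})" by (rule sub_point[OF point_dvx]) simp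
  have S: "sub \<C> ?Z ?S" by (rule sub_corner[OF presheaf_M presheaf_D1 sub_kP pt])
  have rlp: "RLP \<C> ?Z ?S L W p"
  proof (rule injective_fibration_RLP[OF inj presheaf_prod[OF presheaf_M presheaf_D1] small_prod[OF small_M small_dsimp] S])
    fix d n assume d: "d \<in> Ob D"
    have "scontracts 0 (sl D M d n \<times>\<^sub>p sl D D1 d n)
        (corner (sl D M d n) (\<lambda>l. kP (d, n, l)) (sl D D1 d n) (\<lambda>l. {dvx 0 (d, n, l)}))"
      by (rule contracts_corner[OF category_simplex kP_contracts[OF d] sub_sl[OF catD sub_kP d]])
    moreover have "corner (sl D M d n) (\<lambda>l. kP (d, n, l)) (sl D D1 d n) (\<lambda>l. {dvx 0 (d, n, l)}) = (\<lambda>l. ?S (d, n, l))"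
      by (auto simp: corner_def fun_eq_iff)
    ultimately show "\<exists>\<epsilon>. (\<epsilon> = 0 \<or> \<epsilon> = 1) \<and> scontracts \<epsilon> (sl D ?Z d n) (\<lambda>l. ?S (d, n, l))"
      unfolding sl_prod by auto
  qed
  have fstM: "fst (act M h m) = act X h (fst m)" for h m by (cases m) simp
  have iX: "act X (idn \<C> c) (fst m) = fst m" if "c \<in> Ob \<C>" "m \<in> val M c" for c m
    using presheaf_idn[OF X that(1), of "fst m"] that(2) by (cases m) simp
  define u' where "u' = (\<lambda>c (m, t). taut c m (idn \<C> c) t)"
  have u'_simp: "u' c (m, t) = taut c m (idn \<C> c) t" for c m t by (simp add: u'_def)
  have nu: "nat_on \<C> ?Z ?S L u'"
  proof (rule nat_onI)
    fix c z assume c: "c \<in> Ob \<C>" "z \<in> ?S c"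
    obtain m t where *: "z = (m, t)" by (cases z)
    show "u' c z \<in> val L c"
      using c taut_val[of m c "idn \<C> c" t] category_idn[OF catC c(1)] unfolding * u'_simp by auto
  next
    fix f z assume f: "f \<in> Ar \<C>" "z \<in> ?S (tgt \<C> f)"
    obtain m t where *: "z = (m, t)" by (cases z)
    note o = category_Ob[OF catC f(1)]
    note i = category_idn[OF catC o(1)] and j = category_idn[OF catC o(2)]
    have m: "m \<in> val M (tgt \<C> f)" "t \<in> val D1 (tgt \<C> f)" "m \<in> kP (tgt \<C> f) \<or> t = dvx 0 (tgt \<C> f)"
      using f(2) unfolding * by auto
    have ft: "act D1 f t \<in> val D1 (src \<C> f)" by (rule presheaf_act[OF presheaf_D1 f(1) refl refl m(2)])
    have z': "m \<in> kP (tgt \<C> f) \<or> act D1 f t = dvx 0 (src \<C> f)" using m(3) dvx_act[OF f(1), of 0] by auto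
    have "taut (src \<C> f) (act M f m) (idn \<C> (src \<C> f)) (act D1 f t) = taut (tgt \<C> f) m (cmp \<C> f (idn \<C> (src \<C> f))) (act D1 f t)"
      by (rule taut_change[OF m(1) f(1) i(1,3)]) (use i ft z' in simp_all)
    also have "cmp \<C> f (idn \<C> (src \<C> f)) = cmp \<C> (idn \<C> (tgt \<C> f)) f"
      using category_unit[OF catC f(1)] by simp
    also have "taut (tgt \<C> f) m \<dots> (act D1 f t) = act L f (taut (tgt \<C> f) m (idn \<C> (tgt \<C> f)) t)"
      by (rule taut_act[OF m(1) j(1,3)]) (use j m f(1) in simp_all)
    finally show "u' (src \<C> f) (act ?Z f z) = act L f (u' (tgt \<C> f) z)" unfolding * by (simp add: u'_simp)
  qed
  have fN: "nat_on \<C> ?Z (val ?Z) (X \<times>\<^sub>p D1) (\<lambda>c (m, t). (fst m, t))"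
    by (rule nat_onI) (auto simp: fstM)
  have nv: "nat_on \<C> ?Z (val ?Z) W (\<lambda>c z. v c (case z of (m, t) \<Rightarrow> (fst m, t)))"
    by (rule nat_on_comp[OF catC fN v nat_on_val[OF fN]])
  have pu: "p c (u' c z) = v c (case z of (m, t) \<Rightarrow> (fst m, t))" if c: "c \<in> Ob \<C>" "z \<in> ?S c" for c z
  proof -
    obtain m t where *: "z = (m, t)" by (cases z)
    show ?thesis
      using c taut_proj[of m c "idn \<C> c" t] category_idn[OF catC c(1)] iX[OF c(1), of m] unfolding * u'_simp by auto
  qed
  obtain Q where Q: "nat_on \<C> ?Z (val ?Z) L Q" "\<And>c z. c \<in> Ob \<C> \<Longrightarrow> z \<in> ?S c \<Longrightarrow> Q c z = u' c z"
    "\<And>c z. c \<in> Ob \<C> \<Longrightarrow> z \<in> val ?Z c \<Longrightarrow> p c (Q c z) = v c (case z of (m, t) \<Rightarrow> (fst m, t))"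
    using RLPE[OF rlp nu nv pu] by blast
  \<comment> \<open>Over \<open>A\<close> the map \<open>u\<close> is defined on all of
    \<open>D[1]\<close>, so it is a local lift already.\<close>
  define \<kappa> where "\<kappa> = (\<lambda>c a. (a, transf \<C> (Rp c) (\<lambda>b (f, t). u b (act X f a, t))))"
  have \<kappa>_simp: "snd (\<kappa> c a) (src \<C> f) (f, t) = u (src \<C> f) (act X f a, t)"
    if "f \<in> Ar \<C>" "tgt \<C> f = c" "t \<in> val D1 (src \<C> f)" for c a f t
    using that category_Ob[OF catC that(1)] by (simp add: \<kappa>_def)
  have \<kappa>_hom: "snd (\<kappa> c a) \<in> hom \<C> (Rp c) L" if a: "c \<in> Ob \<C>" "a \<in> A c" for c a
    unfolding \<kappa>_def snd_conv
  proof (rule transf_hom[OF catC presheaf_Rp], rule nat_onI)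
    fix b z assume b: "b \<in> Ob \<C>" "z \<in> val (Rp c) b"
    obtain f t where *: "z = (f, t)" by (cases z)
    have f: "f \<in> Ar \<C>" "tgt \<C> f = c" "src \<C> f = b" "t \<in> val D1 b" using b(2) unfolding * by simp_all
    have "act X f a \<in> A b" "act X f a \<in> val X b"
      using sub_act[OF A f(1,2,3) a(2)] subD[OF A b(1)] by blast+
    then have "(act X f a, t) \<in> cyl X A D1 (dvx 0) b" using f by simp
    from nat_on_val[OF u b(1) this] show "(case z of (f, t) \<Rightarrow> u b (act X f a, t)) \<in> val L b" unfolding * by simp
  next
    fix h z assume h: "h \<in> Ar \<C>" "z \<in> val (Rp c) (tgt \<C> h)"
    obtain f t where *: "z = (f, t)" by (cases z)
    have f: "f \<in> Ar \<C>" "tgt \<C> f = c" "src \<C> f = tgt \<C> h" "t \<in> val D1 (tgt \<C> h)" using h(2) unfolding * by simp_all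
    have "act X f a \<in> A (tgt \<C> h)" "act X f a \<in> val X (tgt \<C> h)"
      using sub_act[OF A f(1,2,3) a(2)] subD[OF A category_Ob(2)[OF catC h(1)]] by blast+
    then have "(act X f a, t) \<in> cyl X A D1 (dvx 0) (tgt \<C> h)" using f by simp
    from nat_on_act[OF u h(1) refl refl this]
    show "(case act (Rp c) h z of (f, t) \<Rightarrow> u (src \<C> h) (act X f a, t)) = act L h (case z of (f, t) \<Rightarrow> u (tgt \<C> h) (act X f a, t))"
      using presheaf_cmp[OF X h(1) f(1,3,2) subD[OF A a]] unfolding * by simp
  qed
  have \<kappa>P: "\<kappa> c a \<in> P c" if a: "c \<in> Ob \<C>" "a \<in> A c" for c a
  proof -
    have "(a, snd (\<kappa> c a)) \<in> P c" unfolding P_iff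
    proof (intro conjI ballI impI)
      show "a \<in> val X c" by (rule subD[OF A a])
      show "snd (\<kappa> c a) \<in> hom \<C> (Rp c) L" by (rule \<kappa>_hom[OF a])
      fix f t assume f: "f \<in> Ar \<C>" "t \<in> val D1 (src \<C> f)" "tgt \<C> f = c"
      note s = \<kappa>_simp[OF f(1,3,2), of a] and o = category_Ob(1)[OF catC f(1)]
      have "act X f a \<in> A (src \<C> f)" using sub_act[OF A f(1,3) refl a(2)] .
      then have "(act X f a, t) \<in> cyl X A D1 (dvx 0) (src \<C> f)" using subD[OF A o] f(2) by simp
      from uv[OF o this] show "p (src \<C> f) (snd (\<kappa> c a) (src \<C> f) (f, t)) = v (src \<C> f) (act X f a, t)" unfolding s .
      show "snd (\<kappa> c a) (src \<C> f) (f, t) = u (src \<C> f) (act X f a, t)" by (rule s)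
    qed
    then show ?thesis by (simp add: \<kappa>_def)
  qed
  have \<kappa>_act: "act XE g (\<kappa> (tgt \<C> g) a) = \<kappa> (src \<C> g) (act X g a)" if g: "g \<in> Ar \<C>" "a \<in> A (tgt \<C> g)" for g a
  proof -
    note o = category_Ob[OF catC g(1)]
    have ga: "act X g a \<in> A (src \<C> g)" by (rule sub_act[OF A g(1) refl refl g(2)])
    have "act (exp_psh \<C> D1 L) g (snd (\<kappa> (tgt \<C> g) a)) = snd (\<kappa> (src \<C> g) (act X g a))"
    proof (rule hom_ext[OF _ \<kappa>_hom[OF o(1) ga]])
      show "act (exp_psh \<C> D1 L) g (snd (\<kappa> (tgt \<C> g) a)) \<in> hom \<C> (Rp (src \<C> g)) L"
        using presheaf_act[OF presheaf_E g(1) refl refl, of "snd (\<kappa> (tgt \<C> g) a)"] \<kappa>_hom[OF o(2) g(2)]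
        by (simp add: exp_psh_def)
      fix b z assume b: "b \<in> Ob \<C>" "z \<in> val (Rp (src \<C> g)) b"
      obtain f t where *: "z = (f, t)" by (cases z)
      have f: "f \<in> Ar \<C>" "tgt \<C> f = src \<C> g" "src \<C> f = b" "t \<in> val D1 (src \<C> f)" using b(2) unfolding * by simp_all
      note gf = category_cmp[OF catC f(1) g(1) f(2)[symmetric]]
      show "act (exp_psh \<C> D1 L) g (snd (\<kappa> (tgt \<C> g) a)) b z = snd (\<kappa> (src \<C> g) (act X g a)) b z"
        using E_act[OF f(1,2,4), of "snd (\<kappa> (tgt \<C> g) a)"] \<kappa>_simp[OF f(1,2,4), of "act X g a"]
          \<kappa>_simp[OF gf(1,3), of t a] gf f presheaf_cmp[OF X f(1) g(1) f(2)[symmetric] refl subD[OF A o(2) g(2)]]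
        unfolding * by simp
    qed
    then show ?thesis by (simp add: \<kappa>_def)
  qed
  \<comment> \<open>Off \<open>A\<close> any value will do, since \<open>to_cofree\<close> asks no
    naturality of \<open>\<tau>\<close>; this is how the section over \<open>A\<close> extends to
    \<open>X\<close>.\<close>
  define \<tau> where "\<tau> = (\<lambda>c x. if x \<in> A c then code c (\<kappa> c x) else undefined)"
  define s where "s = (\<lambda>c x. (x, to_cofree \<C> X \<tau> c x))"
  have sA: "s c a = k c (\<kappa> c a)" if a: "c \<in> Ob \<C>" "a \<in> A c" for c a
  proof -
    have "to_cofree \<C> X \<tau> c a = to_cofree \<C> XE code c (\<kappa> c a)"
    proof (rule cofree_ext[OF to_cofree_val to_cofree_val])
      fix f assume f: "f \<in> Ar \<C>" "tgt \<C> f = c"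
      have "act X f a \<in> A (src \<C> f)" using sub_act[OF A f refl a(2)] .
      moreover have "act XE f (\<kappa> c a) = \<kappa> (src \<C> f) (act X f a)" using \<kappa>_act[OF f(1)] f(2) a(2) by simp
      ultimately show "to_cofree \<C> X \<tau> c a f = to_cofree \<C> XE code c (\<kappa> c a) f"
        using f by (simp add: \<tau>_def)
    qed
    then show ?thesis by (simp add: s_def k_def \<kappa>_def)
  qed
  have ns: "nat_on \<C> X (val X) M s"
    using nat_to_cofree[OF catC X sub_val[OF X], of \<tau>] to_cofree_val[of \<C> X \<tau>]
    unfolding nat_on_def s_def by simp
  have ns': "nat_on \<C> (X \<times>\<^sub>p D1) (val (X \<times>\<^sub>p D1)) ?Z (\<lambda>c z. (s c (fst z), snd z))"
    using nat_on_val[OF ns] nat_on_act[OF ns _ refl refl] by (intro nat_onI) auto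
  show ?thesis
  proof (intro exI conjI ballI)
    show "nat_on \<C> (X \<times>\<^sub>p D1) (val (X \<times>\<^sub>p D1)) L (\<lambda>c z. Q c (s c (fst z), snd z))"
      by (rule nat_on_comp[OF catC ns' Q(1) nat_on_val[OF ns']])
    fix c and z :: "'x \<times> smor" assume c: "c \<in> Ob \<C>"
    obtain x t where *: "z = (x, t)" by (cases z)
    note i = category_idn[OF catC c]
    show "Q c (s c (fst z), snd z) = u c z" if z: "z \<in> cyl X A D1 (dvx 0) c"
    proof -
      have x: "x \<in> val X c" "t \<in> val D1 c" "x \<in> A c \<or> t = dvx 0 c" using z unfolding * by auto
      have sM: "s c x \<in> val M c" by (rule nat_on_val[OF ns c x(1)])
      have ix: "act X (idn \<C> c) x = x" by (rule presheaf_idn[OF X c x(1)])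
      show ?thesis
      proof (cases "x \<in> A c")
        case True
        have "s c x \<in> kP c" unfolding sA[OF c True] kP_def using \<kappa>P[OF c True] by blast
        moreover have "unk c (s c x) = \<kappa> c x" unfolding sA[OF c True] by (rule unk_k[OF c \<kappa>P[OF c True]])
        ultimately have "taut c (s c x) (idn \<C> c) t = u c (x, t)"
          using \<kappa>_simp[OF i(1,3), of t x] i x ix by (simp add: taut_def)
        moreover have "Q c (s c x, t) = u' c (s c x, t)"
          by (rule Q(2)[OF c]) (use \<open>s c x \<in> kP c\<close> sM x in simp)
        ultimately show ?thesis unfolding * by (simp add: u'_simp)
      next
        case False
        then have t0: "t = dvx 0 c" using x(3) by simp
        have "taut c (s c x) (idn \<C> c) t = u c (x, t)"
          using taut_base[OF sM i(1,3), of t] i x t0 ix by (simp add: s_def)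
        moreover have "Q c (s c x, t) = u' c (s c x, t)"
          by (rule Q(2)[OF c]) (use t0 sM x in simp)
        ultimately show ?thesis unfolding * by (simp add: u'_simp)
      qed
    qed
    show "p c (Q c (s c (fst z), snd z)) = v c z" if z: "z \<in> val (X \<times>\<^sub>p D1) c"
      using Q(3)[OF c nat_on_val[OF ns' c z]] unfolding * by (simp add: s_def)
  qed
qed

end

context left_fibration_over_fibrant
begin

theorem cylinder_RLP:
  fixes X :: "('o, 'm, 'x) dspace"
  assumes "presheaf \<C> X" "small_psh U \<C> X" "sub \<C> X A"
  shows "RLP \<C> (X \<times>\<^sub>p dsimp 1) (cyl X A (dsimp 1) (dvx 0)) L W p"
proof (rule RLPI)
  fix u v assume "nat_on \<C> (X \<times>\<^sub>p dsimp 1) (cyl X A (dsimp 1) (dvx 0)) L u"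
    "nat_on \<C> (X \<times>\<^sub>p dsimp 1) (val (X \<times>\<^sub>p dsimp 1)) W v"
    "\<And>c x. c \<in> Ob \<C> \<Longrightarrow> x \<in> cyl X A (dsimp 1) (dvx 0) c \<Longrightarrow> p c (u c x) = v c x"
  then interpret cylinder_problem D U L W p X A u v
    using assms by unfold_locales auto
  show "\<exists>h. nat_on \<C> (X \<times>\<^sub>p dsimp 1) (val (X \<times>\<^sub>p dsimp 1)) L h \<and>
      (\<forall>c\<in>Ob \<C>. \<forall>z\<in>cyl X A (dsimp 1) (dvx 0) c. h c z = u c z) \<and>
      (\<forall>c\<in>Ob \<C>. \<forall>z\<in>val (X \<times>\<^sub>p dsimp 1) c. p c (h c z) = v c z)"
    by (rule cylinder_lift)
qed

end


section \<open>Weak equivalences in a model category\<close>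

definition ars :: "('o, 'm) cat \<Rightarrow> 'o \<Rightarrow> 'o \<Rightarrow> 'm set" where
  "ars C a b = {f \<in> Ar C. src C f = a \<and> tgt C f = b}"

lemma arsD: "f \<in> ars C a b \<Longrightarrow> f \<in> Ar C" "f \<in> ars C a b \<Longrightarrow> src C f = a" "f \<in> ars C a b \<Longrightarrow> tgt C f = b"
  by (simp_all add: ars_def)

locale model_category =
  fixes C :: "('o, 'm) cat" and cof weq fib :: "'m set"
  assumes C: "category C" and M: "model_structure C cof weq fib"
begin

lemma cmp_ars: "g \<in> ars C b c \<Longrightarrow> f \<in> ars C a b \<Longrightarrow> cmp C g f \<in> ars C a c"
  using category_cmp[OF C] by (simp add: ars_def)

lemma assoc: "h \<in> ars C c d \<Longrightarrow> g \<in> ars C b c \<Longrightarrow> f \<in> ars C a b \<Longrightarrow> cmp C h (cmp C g f) = cmp C (cmp C h g) f"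
  using category_assoc[OF C] by (simp add: ars_def)

lemma idn_ars: "a \<in> Ob C \<Longrightarrow> idn C a \<in> ars C a a"
  using category_idn[OF C] by (simp add: ars_def)

lemma unit: "f \<in> ars C a b \<Longrightarrow> cmp C f (idn C a) = f" "f \<in> ars C a b \<Longrightarrow> cmp C (idn C b) f = f"
  using category_unit[OF C] by (simp_all add: ars_def)

lemma ars_Ob: "f \<in> ars C a b \<Longrightarrow> a \<in> Ob C" "f \<in> ars C a b \<Longrightarrow> b \<in> Ob C"
  using category_Ob[OF C] by (auto simp: ars_def)

lemma classes_Ar: "f \<in> cof \<Longrightarrow> f \<in> Ar C" "f \<in> weq \<Longrightarrow> f \<in> Ar C" "f \<in> fib \<Longrightarrow> f \<in> Ar C"
  using M unfolding model_structure_def by auto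

lemma two_of_three:
  assumes "f \<in> ars C a b" "g \<in> ars C b c"
  shows "f \<in> weq \<Longrightarrow> g \<in> weq \<Longrightarrow> cmp C g f \<in> weq"
    "f \<in> weq \<Longrightarrow> cmp C g f \<in> weq \<Longrightarrow> g \<in> weq" "g \<in> weq \<Longrightarrow> cmp C g f \<in> weq \<Longrightarrow> f \<in> weq"
  using M assms unfolding model_structure_def ars_def by auto

lemma retract_weq: "f \<in> Ar C \<Longrightarrow> g \<in> Ar C \<Longrightarrow> retract_of C f g \<Longrightarrow> g \<in> weq \<Longrightarrow> f \<in> weq"
  using M unfolding model_structure_def by blast

lemma lift:
  assumes "has_lifting C i q" "i \<in> ars C a b" "q \<in> ars C x y" "f \<in> ars C a x" "g \<in> ars C b y" "cmp C q f = cmp C g i"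
  obtains h where "h \<in> ars C b x" "cmp C h i = f" "cmp C q h = g"
  using assms unfolding has_lifting_def ars_def by (auto simp del: split_paired_All split_paired_Ex)

lemma acyclic_lift: "i \<in> cof \<inter> weq \<Longrightarrow> q \<in> fib \<Longrightarrow> has_lifting C i q"
  using M unfolding model_structure_def by blast

lemma factor:
  assumes "f \<in> ars C a b"
  obtains i q x where "i \<in> ars C a x" "q \<in> ars C x b" "i \<in> cof \<inter> weq" "q \<in> fib" "cmp C q i = f"
proof -
  obtain i q where iq: "i \<in> cof \<inter> weq" "q \<in> fib" "src C q = tgt C i" "cmp C q i = f"
    using M assms unfolding model_structure_def ars_def by blast
  have "i \<in> Ar C" "q \<in> Ar C" using iq classes_Ar by auto
  then show ?thesis using that[of i "tgt C i" q] iq assms category_cmp[OF C, of i q] by (auto simp: ars_def)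
qed

text \<open>The retract argument: factor \<open>q\<close> as a cofibration followed by a trivial
  fibration; lifting against the former exhibits \<open>q\<close> as a retract of the
  latter.\<close>

lemma lifting_cof_weq:
  assumes q: "q \<in> ars C x y" and l: "\<And>i. i \<in> cof \<Longrightarrow> has_lifting C i q"
  shows "q \<in> weq"
proof -
  obtain i r where ir: "i \<in> cof" "r \<in> fib \<inter> weq" "src C r = tgt C i" "cmp C r i = q"
    using M q unfolding model_structure_def ars_def by blast
  define z where "z = tgt C i"
  have i: "i \<in> ars C x z" and r: "r \<in> ars C z y"
    using ir classes_Ar category_cmp[OF C, of i r] q by (auto simp: ars_def z_def)
  note ix = idn_ars[OF ars_Ob(1)[OF q]] and iy = idn_ars[OF ars_Ob(2)[OF q]]
  obtain h where h: "h \<in> ars C z x" "cmp C h i = idn C x" "cmp C q h = r"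
    by (rule lift[OF l[OF ir(1)] i q ix r]) (use unit(1)[OF q] ir(4) in simp)
  have "retract_of C q r"
    unfolding retract_of_def
  proof (rule bexI[OF _ arsD(1)[OF i]], rule bexI[OF _ arsD(1)[OF h(1)]],
      rule bexI[OF _ arsD(1)[OF iy]], rule bexI[OF _ arsD(1)[OF iy]], intro conjI)
    show "cmp C (idn C y) (idn C y) = idn C (tgt C q)" using unit(1)[OF iy] arsD[OF q] by simp
    show "cmp C r i = cmp C (idn C y) q" using ir(4) unit(2)[OF q] by simp
    show "cmp C q h = cmp C (idn C y) r" using h(3) unit(2)[OF r] by simp
  qed (use arsD[OF i] arsD[OF h(1)] arsD[OF iy] arsD[OF q] arsD[OF r] h(2) in simp_all)
  then show ?thesis using retract_weq[OF arsD(1)[OF q] arsD(1)[OF r]] ir(2) by blast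
qed

text \<open>\<open>model_structure\<close> does not list identities among the weak equivalences;
  they lift against everything.\<close>

lemma idn_weq:
  assumes a: "a \<in> Ob C" shows "idn C a \<in> weq"
proof (rule lifting_cof_weq[OF idn_ars[OF a]])
  fix i assume i: "i \<in> cof"
  show "has_lifting C i (idn C a)" unfolding has_lifting_def
  proof (intro ballI impI)
    fix u v assume uv: "u \<in> Ar C" "v \<in> Ar C" "src C u = src C i" "tgt C u = src C (idn C a)"
      "src C v = tgt C i" "tgt C v = tgt C (idn C a)" "cmp C (idn C a) u = cmp C v i"
    have u: "u \<in> ars C (src C i) a" and v: "v \<in> ars C (tgt C i) a"
      using uv category_idn[OF C a] by (auto simp: ars_def)
    show "\<exists>h\<in>Ar C. src C h = tgt C i \<and> tgt C h = src C (idn C a) \<and> cmp C h i = u \<and> cmp C (idn C a) h = v"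
      using unit(2)[OF u] unit(2)[OF v] uv category_idn[OF C a] by (intro bexI[of _ v]) simp_all
  qed
qed

lemma section_weq:
  assumes "q \<in> ars C x y" "q \<in> weq" "s \<in> ars C y x" "cmp C q s = idn C y" shows "s \<in> weq"
  using two_of_three(3)[OF assms(3,1,2)] assms(4) idn_weq[OF ars_Ob(1)[OF assms(3)]] by simp

lemma fibrantI:
  assumes "q \<in> ars C x w" "q \<in> fib" "terminal_object C w" shows "x \<in> fibrant_objects C fib"
  using assms category_Ob[OF C, of q] unfolding fibrant_objects_def ars_def by auto

lemma terminal_eq:
  assumes "terminal_object C w" "f \<in> ars C a w" "g \<in> ars C a w" shows "f = g"
  using assms category_Ob[OF C, of f] unfolding terminal_object_def ars_def by blast

text \<open>The lifting conditions say that \<open>i\<close> induces bijections on homotopy classes of maps into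
  fibrant objects. The argument is a two-out-of-six argument for \<open>r\<close>, \<open>s\<close> and a homotopy
  inverse of \<open>s\<close>, where \<open>s\<close> is made a fibration to get strict equalities.\<close>

theorem weq_by_fibrant_objects:
  assumes w: "terminal_object C w" and i: "i \<in> ars C a b"
    and e0: "e0 \<in> ars C b bJ" "e0 \<in> cof \<inter> weq" and e1: "e1 \<in> ars C b bJ"
    and a0: "a0 \<in> ars C a aJ" "a0 \<in> weq" and a1: "a1 \<in> ars C a aJ" "a1 \<in> weq"
    and iJ: "iJ \<in> ars C aJ bJ" "cmp C iJ a0 = cmp C e0 i" "cmp C iJ a1 = cmp C e1 i"
    and R1: "\<And>l u. l \<in> fibrant_objects C fib \<Longrightarrow> u \<in> ars C a l \<Longrightarrow> \<exists>r. r \<in> ars C b l \<and> cmp C r i = u"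
    and R2: "\<And>l u v. l \<in> fibrant_objects C fib \<Longrightarrow> u \<in> ars C b l \<Longrightarrow> v \<in> ars C b l \<Longrightarrow> cmp C u i = cmp C v i \<Longrightarrow>
       \<exists>H. H \<in> ars C bJ l \<and> cmp C H e0 = u \<and> cmp C H e1 = v"
  shows "i \<in> weq"
proof -
  have tm: "\<exists>t. t \<in> ars C y w" if "y \<in> Ob C" for y
    using w that unfolding terminal_object_def ars_def by blast
  obtain ta where ta: "ta \<in> ars C a w" using tm[OF ars_Ob(1)[OF i]] by blast
  obtain tb where tb: "tb \<in> ars C b w" using tm[OF ars_Ob(2)[OF i]] by blast
  \<comment> \<open>\<open>j\<close> and the next \<open>f\<close> are fibrant replacements of
    \<open>a\<close> and \<open>b\<close>; \<open>r\<close> will extend \<open>j\<close> along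
    \<open>i\<close>, and \<open>s0\<close> will compare the replacements.\<close>
  obtain j q a' where j: "j \<in> ars C a a'" "q \<in> ars C a' w" "j \<in> cof \<inter> weq" "q \<in> fib" by (rule factor[OF ta])
  obtain f q' b' where f: "f \<in> ars C b b'" "q' \<in> ars C b' w" "f \<in> cof \<inter> weq" "q' \<in> fib" by (rule factor[OF tb])
  obtain r where r: "r \<in> ars C b a'" "cmp C r i = j" using R1[OF fibrantI[OF j(2,4) w] j(1)] by blast
  obtain s0 where s0: "s0 \<in> ars C a' b'" "cmp C s0 j = cmp C f i"
    by (rule lift[OF acyclic_lift[OF j(3) f(4)] j(1) f(2) cmp_ars[OF f(1) i] j(2)
          terminal_eq[OF w cmp_ars[OF f(2) cmp_ars[OF f(1) i]] cmp_ars[OF j(2,1)]]])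
  \<comment> \<open>With a fibration \<open>s\<close> in place of \<open>s0\<close>, homotopies in
    \<open>b'\<close> can be lifted to \<open>a''\<close>.\<close>
  obtain c s a'' where c: "c \<in> ars C a' a''" "s \<in> ars C a'' b'" "c \<in> cof \<inter> weq" "s \<in> fib" "cmp C s c = s0"
    by (rule factor[OF s0(1)])
  define j' where "j' = cmp C c j"
  define r' where "r' = cmp C c r"
  have j': "j' \<in> ars C a a''" "j' \<in> weq"
    unfolding j'_def using cmp_ars[OF c(1) j(1)] two_of_three(1)[OF j(1) c(1)] j(3) c(3) by simp_all
  have r': "r' \<in> ars C b a''" "cmp C r' i = j'"
    unfolding r'_def j'_def using cmp_ars[OF c(1) r(1)] assoc[OF c(1) r(1) i] r(2) by simp_all
  have sj: "cmp C s j' = cmp C f i" unfolding j'_def using assoc[OF c(2,1) j(1)] c(5) s0(2) by simp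
  have sr: "cmp C s r' \<in> ars C b b'" by (rule cmp_ars[OF c(2) r'(1)])
  have "cmp C (cmp C s r') i = cmp C f i" using assoc[OF c(2) r'(1) i] r'(2) sj by simp
  then obtain H where H: "H \<in> ars C bJ b'" "cmp C H e0 = cmp C s r'" "cmp C H e1 = f"
    using R2[OF fibrantI[OF f(2,4) w] sr f(1)] by blast
  \<comment> \<open>The homotopy from \<open>s r'\<close> to \<open>f\<close> is lifted along the
    acyclic cofibration \<open>e0\<close>; its other end is a map \<open>r1\<close> with
    \<open>s r1 = f\<close> on the nose.\<close>
  obtain G where G: "G \<in> ars C bJ a''" "cmp C G e0 = r'" "cmp C s G = H"
    by (rule lift[OF acyclic_lift[OF e0(2) c(4)] e0(1) c(2) r'(1) H(1)]) (use H(2) in simp)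
  define r1 where "r1 = cmp C G e1"
  have r1: "r1 \<in> ars C b a''" "cmp C s r1 = f"
    unfolding r1_def using cmp_ars[OF G(1) e1] assoc[OF c(2) G(1) e1] G(3) H(3) by simp_all
  have GiJ: "cmp C G iJ \<in> ars C aJ a''" by (rule cmp_ars[OF G(1) iJ(1)])
  \<comment> \<open>On \<open>a\<close> the lifted homotopy joins the weak equivalence
    \<open>j'\<close> to \<open>r1 i\<close>; two-out-of-three on the cylinder of \<open>a\<close>
    passes from one end to the other.\<close>
  have "cmp C (cmp C G iJ) a0 = j'"
    using assoc[OF G(1) iJ(1) a0(1)] iJ(2) assoc[OF G(1) e0(1) i] G(2) r'(2) by simp
  then have "cmp C G iJ \<in> weq" using two_of_three(2)[OF a0(1) GiJ a0(2)] j'(2) by simp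
  then have "cmp C (cmp C G iJ) a1 \<in> weq" by (rule two_of_three(1)[OF a1(1) GiJ a1(2)])
  then have r1i: "cmp C r1 i \<in> weq"
    using assoc[OF G(1) iJ(1) a1(1)] iJ(3) assoc[OF G(1) e1 i] by (simp add: r1_def)
  note ib = idn_ars[OF ars_Ob(2)[OF f(1)]] and ia = idn_ars[OF ars_Ob(1)[OF c(2)]]
  \<comment> \<open>As \<open>f\<close> is an acyclic cofibration, \<open>s\<close> acquires a
    section \<open>h\<close> that restricts to \<open>r1\<close> along \<open>f\<close>.\<close>
  obtain h where h: "h \<in> ars C b' a''" "cmp C h f = r1" "cmp C s h = idn C b'"
    by (rule lift[OF acyclic_lift[OF f(3) c(4)] f(1) c(2) r1(1) ib]) (use r1(2) unit(2)[OF f(1)] in simp)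
  have hs: "cmp C h s \<in> ars C a'' a''" by (rule cmp_ars[OF h(1) c(2)])
  have "cmp C (cmp C h s) j' = cmp C r1 i"
    using assoc[OF h(1) c(2) j'(1)] sj assoc[OF h(1) f(1) i] h(2) by simp
  then have hsw: "cmp C h s \<in> weq" using two_of_three(2)[OF j'(1) hs j'(2)] r1i by simp
  \<comment> \<open>Since \<open>s h\<close> is the identity, \<open>s\<close> is a retract of the
    weak equivalence \<open>h s\<close>.\<close>
  have "retract_of C s (cmp C h s)"
    unfolding retract_of_def
  proof (rule bexI[OF _ arsD(1)[OF ia]], rule bexI[OF _ arsD(1)[OF ia]],
      rule bexI[OF _ arsD(1)[OF h(1)]], rule bexI[OF _ arsD(1)[OF c(2)]], intro conjI)
    show "cmp C (idn C a'') (idn C a'') = idn C (src C s)" using unit(1)[OF ia] arsD[OF c(2)] by simp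
    show "cmp C s h = idn C (tgt C s)" using h(3) arsD[OF c(2)] by simp
    show "cmp C (cmp C h s) (idn C a'') = cmp C h s" by (rule unit(1)[OF hs])
    show "cmp C s (idn C a'') = cmp C s (cmp C h s)"
      using assoc[OF c(2) h(1) c(2)] h(3) unit[OF c(2)] by simp
  qed (use arsD[OF ia] arsD[OF h(1)] arsD[OF c(2)] arsD[OF hs] in simp_all)
  then have "s \<in> weq" using retract_weq[OF arsD(1)[OF c(2)] arsD(1)[OF hs]] hsw by blast
  then have "cmp C f i \<in> weq" using two_of_three(1)[OF j'(1) c(2) j'(2)] sj by simp
  then show ?thesis using two_of_three(3)[OF i f(1)] f(3) by blast
qed

end

section \<open>Slices of presheaf categories\<close>

lemma psh_cat_simps [simp]:
  "X \<in> Ob (psh_cat C) \<longleftrightarrow> presheaf C X"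
  "(X, Y, f) \<in> Ar (psh_cat C) \<longleftrightarrow> presheaf C X \<and> presheaf C Y \<and> f \<in> hom C X Y"
  "src (psh_cat C) (X, Y, f) = X" "tgt (psh_cat C) (X, Y, f) = Y"
  "idn (psh_cat C) X = (X, X, id_transf C X)"
  "cmp (psh_cat C) (Y, Z, g) (X, Y', f) = (X, Z, comp_transf C X g f)"
  by (simp_all add: psh_cat_def)

lemma slice_cat_simps [simp]:
  "a \<in> Ob (slice_cat C w) \<longleftrightarrow> a \<in> Ar C \<and> tgt C a = w"
  "(a, b, f) \<in> Ar (slice_cat C w) \<longleftrightarrow> a \<in> Ar C \<and> tgt C a = w \<and> b \<in> Ar C \<and> tgt C b = w \<and>
     f \<in> Ar C \<and> src C f = src C a \<and> tgt C f = src C b \<and> cmp C b f = a"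
  "src (slice_cat C w) (a, b, f) = a" "tgt (slice_cat C w) (a, b, f) = b"
  "idn (slice_cat C w) a = (a, a, idn C (src C a))"
  "cmp (slice_cat C w) (b, c, g) (a, b', f) = (a, c, cmp C g f)"
  by (simp_all add: slice_cat_def)

lemma id_transf_hom: "category C \<Longrightarrow> presheaf C X \<Longrightarrow> id_transf C X \<in> hom C X X"
  using incl_hom[of C X "val X"] sub_val[of C X] by simp

lemma id_transf_apply [simp]: "c \<in> Ob C \<Longrightarrow> x \<in> val X c \<Longrightarrow> id_transf C X c x = x"
  by (simp add: id_transf_def)

lemma hom_val: "t \<in> hom C X Y \<Longrightarrow> c \<in> Ob C \<Longrightarrow> x \<in> val X c \<Longrightarrow> t c x \<in> val Y c"
  using homD nat_on_val by fastforce

lemma category_psh: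
  assumes C: "category C" shows "category (psh_cat C)"
  unfolding category_def
proof (intro conjI ballI impI)
  fix f assume f: "f \<in> Ar (psh_cat C)"
  obtain X Y t where *: "f = (X, Y, t)" by (metis prod_cases3)
  have t: "presheaf C X" "presheaf C Y" "t \<in> hom C X Y" using f unfolding * by simp_all
  show "src (psh_cat C) f \<in> Ob (psh_cat C)" "tgt (psh_cat C) f \<in> Ob (psh_cat C)" using t unfolding * by simp_all
  have "comp_transf C X t (id_transf C X) = t"
    by (rule hom_ext[OF hom_comp[OF C t(1) id_transf_hom[OF C t(1)] t(3)] t(3)]) simp
  then show "cmp (psh_cat C) f (idn (psh_cat C) (src (psh_cat C) f)) = f" unfolding * by simp
  have "comp_transf C X (id_transf C Y) t = t"
    by (rule hom_ext[OF hom_comp[OF C t(1,3) id_transf_hom[OF C t(2)]] t(3)]) (simp add: hom_val[OF t(3)])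
  then show "cmp (psh_cat C) (idn (psh_cat C) (tgt (psh_cat C) f)) f = f" unfolding * by simp
next
  fix X assume "X \<in> Ob (psh_cat C)"
  then show "idn (psh_cat C) X \<in> Ar (psh_cat C)" "src (psh_cat C) (idn (psh_cat C) X) = X"
    "tgt (psh_cat C) (idn (psh_cat C) X) = X" using id_transf_hom[OF C] by simp_all
next
  fix f g assume f: "f \<in> Ar (psh_cat C)" "g \<in> Ar (psh_cat C)" "src (psh_cat C) g = tgt (psh_cat C) f"
  obtain X Y t where *: "f = (X, Y, t)" by (metis prod_cases3)
  obtain Y' Z s where **: "g = (Y', Z, s)" by (metis prod_cases3)
  show "cmp (psh_cat C) g f \<in> Ar (psh_cat C)" "src (psh_cat C) (cmp (psh_cat C) g f) = src (psh_cat C) f"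
    "tgt (psh_cat C) (cmp (psh_cat C) g f) = tgt (psh_cat C) g"
    using f hom_comp[OF C] unfolding * ** by auto
next
  fix f g h assume f: "f \<in> Ar (psh_cat C)" "g \<in> Ar (psh_cat C)" "h \<in> Ar (psh_cat C)"
    "src (psh_cat C) g = tgt (psh_cat C) f" "src (psh_cat C) h = tgt (psh_cat C) g"
  obtain X Y t where *: "f = (X, Y, t)" by (metis prod_cases3)
  obtain Y' Z s where **: "g = (Y', Z, s)" by (metis prod_cases3)
  obtain Z' V r where ***: "h = (Z', V, r)" by (metis prod_cases3)
  have e: "Y' = Y" "Z' = Z" and t: "presheaf C X" "presheaf C Y" "presheaf C Z" "t \<in> hom C X Y" "s \<in> hom C Y Z" "r \<in> hom C Z V"
    using f unfolding * ** *** by auto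
  have "comp_transf C X r (comp_transf C X s t) = comp_transf C X (comp_transf C Y r s) t"
    by (rule hom_ext[OF hom_comp[OF C t(1) hom_comp[OF C t(1,4,5)] t(6)] hom_comp[OF C t(1,4) hom_comp[OF C t(2,5,6)]]])
      (simp add: hom_val[OF t(4)])
  then show "cmp (psh_cat C) h (cmp (psh_cat C) g f) = cmp (psh_cat C) (cmp (psh_cat C) h g) f"
    unfolding * ** *** e by simp
qed

lemma category_slice:
  assumes C: "category C" shows "category (slice_cat C w)"
  unfolding category_def
proof (intro conjI ballI impI)
  fix f assume f: "f \<in> Ar (slice_cat C w)"
  obtain a b t where *: "f = (a, b, t)" by (metis prod_cases3)
  show "src (slice_cat C w) f \<in> Ob (slice_cat C w)" "tgt (slice_cat C w) f \<in> Ob (slice_cat C w)"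
    "cmp (slice_cat C w) f (idn (slice_cat C w) (src (slice_cat C w) f)) = f"
    "cmp (slice_cat C w) (idn (slice_cat C w) (tgt (slice_cat C w) f)) f = f"
    using f category_unit[OF C] unfolding * by simp_all
next
  fix a assume "a \<in> Ob (slice_cat C w)"
  then show "idn (slice_cat C w) a \<in> Ar (slice_cat C w)" "src (slice_cat C w) (idn (slice_cat C w) a) = a"
    "tgt (slice_cat C w) (idn (slice_cat C w) a) = a"
    using category_idn[OF C] category_unit[OF C] category_Ob[OF C] by simp_all
next
  fix f g assume f: "f \<in> Ar (slice_cat C w)" "g \<in> Ar (slice_cat C w)" "src (slice_cat C w) g = tgt (slice_cat C w) f"
  obtain a b t where *: "f = (a, b, t)" by (metis prod_cases3)
  obtain b' c s where **: "g = (b', c, s)" by (metis prod_cases3)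
  have e: "b' = b" "t \<in> Ar C" "s \<in> Ar C" "c \<in> Ar C" "src C s = tgt C t" "src C c = tgt C s" "cmp C c s = b" "cmp C b t = a"
    using f unfolding * ** by auto
  have "cmp C c (cmp C s t) = a" using category_assoc[OF C e(2,3,4,5,6)] e by simp
  then show "cmp (slice_cat C w) g f \<in> Ar (slice_cat C w)" "src (slice_cat C w) (cmp (slice_cat C w) g f) = src (slice_cat C w) f"
    "tgt (slice_cat C w) (cmp (slice_cat C w) g f) = tgt (slice_cat C w) g"
    using f category_cmp[OF C e(2,3,5)] unfolding * ** by auto
next
  fix f g h assume f: "f \<in> Ar (slice_cat C w)" "g \<in> Ar (slice_cat C w)" "h \<in> Ar (slice_cat C w)"
    "src (slice_cat C w) g = tgt (slice_cat C w) f" "src (slice_cat C w) h = tgt (slice_cat C w) g"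
  obtain a b t where *: "f = (a, b, t)" by (metis prod_cases3)
  obtain b' c s where **: "g = (b', c, s)" by (metis prod_cases3)
  obtain c' d r where ***: "h = (c', d, r)" by (metis prod_cases3)
  have e: "t \<in> Ar C" "s \<in> Ar C" "r \<in> Ar C" "src C s = tgt C t" "src C r = tgt C s"
    using f unfolding * ** *** by auto
  show "cmp (slice_cat C w) h (cmp (slice_cat C w) g f) = cmp (slice_cat C w) (cmp (slice_cat C w) h g) f"
    unfolding * ** *** using category_assoc[OF C e] by simp
qed

context left_fibration_over_fibrant
begin

text \<open>The deformation need not lie over \<open>W\<close>: the map to \<open>W\<close> is
  composed with it before the cylinder problem is solved.\<close>

theorem contracting_RLP:
  fixes X :: "('o, 'm, 'x) dspace"
  assumes "presheaf \<C> X" "small_psh U \<C> X" "sub \<C> X A" "contracts \<C> (dsimp 1) (dvx 0) (dvx 1) X A"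
  shows "RLP \<C> X A L W p"
  by (rule contracts_RLP[OF catC assms(4,1) presheaf_dsimp assms(3) point_dvx point_dvx cylinder_RLP[OF assms(1-3)]]) simp_all

end

section \<open>The covariant model structure\<close>

locale covariant_model = universe D U
  for D :: "('o, 'm) cat" and U :: "'u itself" +
  fixes W :: "('o, 'm, 'u) dspace" and cof weq fib
  assumes segal: "levelwise_segal_space D W"
    and model: "D_covariant_model_structure D W cof weq fib"
begin

lemma W: "presheaf \<C> W"
  using segal unfolding levelwise_segal_space_def by blast

lemma fibrant_W: "injective_fibration D W terminal_psh (to_terminal \<C> W)"
  using segal unfolding levelwise_segal_space_def by blast

abbreviation S where "S \<equiv> dspaces_over D W"

sublocale model_category S cof weq fib
proof
  show "category S" unfolding dspaces_over_def by (intro category_slice category_psh catC)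
  show "model_structure S cof weq fib" using model unfolding D_covariant_model_structure_def by blast
qed

abbreviation ov where "ov A a \<equiv> (A, W, a)"
abbreviation av where "av A a B b f \<equiv> ((A, W, a), (B, W, b), (A, B, f))"

lemma S_Ob: "ov A a \<in> Ob S \<longleftrightarrow> presheaf \<C> A \<and> a \<in> hom \<C> A W"
  using W by (auto simp: dspaces_over_def)

lemma S_Ar:
  "av A a B b f \<in> Ar S \<longleftrightarrow> presheaf \<C> A \<and> presheaf \<C> B \<and> a \<in> hom \<C> A W \<and> b \<in> hom \<C> B W \<and>
     f \<in> hom \<C> A B \<and> comp_transf \<C> A b f = a"
  using W by (auto simp: dspaces_over_def)

lemma S_simps [simp]:
  "src S (x, y, z) = x" "tgt S (x, y, z) = y" "idn S (ov A a) = av A a A a (id_transf \<C> A)"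
  "cmp S (av B b E e g) (av A a B' b' f) = av A a E e (comp_transf \<C> A g f)"
  by (simp_all add: dspaces_over_def)

lemma av_ars:
  assumes "presheaf \<C> A" "presheaf \<C> B" "b \<in> hom \<C> B W" "f \<in> hom \<C> A B" "a = comp_transf \<C> A b f"
  shows "av A a B b f \<in> ars S (ov A a) (ov B b)"
  using assms hom_comp[OF catC assms(1,4,3)] by (simp add: ars_def S_Ar)

lemma Ar_cases:
  assumes "g \<in> Ar S"
  obtains A a B b f where "g = av A a B b f" "presheaf \<C> A" "presheaf \<C> B" "a \<in> hom \<C> A W" "b \<in> hom \<C> B W"
    "f \<in> hom \<C> A B" "comp_transf \<C> A b f = a"
proof -
  obtain A W1 a B W2 b A' B' f where *: "g = ((A, W1, a), (B, W2, b), (A', B', f))" by (metis prod.collapse)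
  have "W1 = W \<and> W2 = W \<and> A' = A \<and> B' = B" using assms unfolding * by (auto simp: dspaces_over_def)
  then show ?thesis using that[of A a B b f] assms S_Ar[of A a B b f] unfolding * by simp
qed

lemma ars_cases:
  assumes "g \<in> ars S (ov A a) (ov B b)"
  obtains f where "g = av A a B b f" "presheaf \<C> A" "presheaf \<C> B" "a \<in> hom \<C> A W" "b \<in> hom \<C> B W"
    "f \<in> hom \<C> A B" "comp_transf \<C> A b f = a"
proof -
  have g: "g \<in> Ar S" "src S g = ov A a" "tgt S g = ov B b" using assms by (simp_all add: ars_def)
  from g(1) show ?thesis by (rule Ar_cases) (use g(2,3) that in simp)
qed

lemma cof_eq: "cof = {((A, W\<^sub>1, a), (B, W\<^sub>2, b), (A', B', f)) \<in> Ar S. mono_transf \<C> A' f}"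
  using model unfolding D_covariant_model_structure_def by blast

lemma av_cof: "av A a B b f \<in> ars S x y \<Longrightarrow> mono_transf \<C> A f \<Longrightarrow> av A a B b f \<in> cof"
  unfolding cof_eq ars_def by auto

lemma cof_cases:
  assumes "g \<in> cof"
  obtains A a B b f where "g = av A a B b f" "presheaf \<C> A" "presheaf \<C> B" "a \<in> hom \<C> A W" "b \<in> hom \<C> B W"
    "f \<in> hom \<C> A B" "comp_transf \<C> A b f = a" "mono_transf \<C> A f"
proof -
  have g: "g \<in> Ar S" using assms classes_Ar(1) by blast
  from g show ?thesis by (rule Ar_cases) (use assms that in \<open>simp add: cof_eq\<close>)
qed

lemma terminal_W: "terminal_object S (ov W (id_transf \<C> W))"
  unfolding terminal_object_def
proof (intro conjI ballI)
  note i = id_transf_hom[OF catC W]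
  show "ov W (id_transf \<C> W) \<in> Ob S" using W i by (simp add: S_Ob)
  fix x assume x: "x \<in> Ob S"
  obtain A W' a where *: "x = (A, W', a)" by (metis prod_cases3)
  have w: "W' = W" using x unfolding * by (simp add: dspaces_over_def)
  have a: "presheaf \<C> A" "a \<in> hom \<C> A W" using x unfolding * w S_Ob by simp_all
  have ia: "comp_transf \<C> A (id_transf \<C> W) f = f" if "f \<in> hom \<C> A W" for f
    by (rule hom_ext[OF hom_comp[OF catC a(1) that i] that]) (simp add: hom_val[OF that])
  show "\<exists>!f. f \<in> Ar S \<and> src S f = x \<and> tgt S f = ov W (id_transf \<C> W)"
  proof (rule ex1I[of _ "av A a W (id_transf \<C> W) a"])
    show "av A a W (id_transf \<C> W) a \<in> Ar S \<and> src S (av A a W (id_transf \<C> W) a) = x \<and>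
        tgt S (av A a W (id_transf \<C> W) a) = ov W (id_transf \<C> W)"
      using a W i ia[OF a(2)] by (simp add: S_Ar * w)
    fix g assume "g \<in> Ar S \<and> src S g = x \<and> tgt S g = ov W (id_transf \<C> W)"
    then have "g \<in> ars S (ov A a) (ov W (id_transf \<C> W))" by (simp add: ars_def * w)
    then show "g = av A a W (id_transf \<C> W) a" by (rule ars_cases) (use ia in simp)
  qed
qed

lemma fibrant_cases:
  assumes "l \<in> fibrant_objects S fib"
  obtains L p where "l = ov L p" "presheaf \<C> L" "p \<in> hom \<C> L W" "left_fibration_over_fibrant D U L W p"
proof -
  have "fibrant_objects S fib = {(L, W', p) \<in> Ob S. D_left_fibration D L W' p}"
    using model unfolding D_covariant_model_structure_def by blast
  then obtain L W' p where l: "l = (L, W', p)" "(L, W', p) \<in> Ob S" "D_left_fibration D L W' p" using assms by blast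
  have w: "W' = W" using l(2) by (simp add: dspaces_over_def)
  have o: "presheaf \<C> L" "p \<in> hom \<C> L W" using l(2) unfolding w S_Ob by simp_all
  have "left_fibration_over_fibrant D U L W p"
    by unfold_locales (use o l(3) w W fibrant_W in simp_all)
  then show ?thesis using that o l(1) w by simp
qed

text \<open>Cylinder objects are products with the injective presheaf \<open>J\<close>, which has two disjoint points.\<close>

abbreviation J :: "('o, 'm, 'm dmor \<Rightarrow> bool) dspace" where "J \<equiv> cofree \<C>"

definition pt :: "bool \<Rightarrow> 'o dob \<Rightarrow> 'm dmor \<Rightarrow> bool" where
  "pt i c = (\<lambda>f\<in>{f \<in> Ar \<C>. tgt \<C> f = c}. i)"

lemma pt_val: "pt i c \<in> val J c"
  by (simp add: pt_def cofree_def restrict_PiE_iff)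

lemma pt_act: "f \<in> Ar \<C> \<Longrightarrow> act J f (pt i (tgt \<C> f)) = pt i (src \<C> f)"
  by (rule cofree_ext[OF cofree_act_val pt_val]) (use category_cmp[OF catC] in \<open>simp add: pt_def\<close>)

lemma pt_neq: assumes c: "c \<in> Ob \<C>" shows "pt False c \<noteq> pt True c"
proof
  assume "pt False c = pt True c"
  then have "pt False c (idn \<C> c) = pt True c (idn \<C> c)" by simp
  then show False using category_idn[OF catC c] by (simp add: pt_def)
qed

lemma presheaf_J: "presheaf \<C> J"
  by (rule presheaf_cofree[OF catC])

lemma small_J: "small_psh U \<C> J"
  unfolding small_psh_def
proof
  fix c :: "'o dob"
  obtain a b :: 'u where ab: "a \<noteq> b" using small_in unfolding small_in_def by blast
  let ?S = "{f \<in> Ar \<C>. tgt \<C> f = c}"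
  define \<Phi> where "\<Phi> = (\<lambda>(\<phi> :: 'm dmor \<Rightarrow> bool) s. if s \<in> ?S then (if \<phi> s then a else b) else undefined)"
  have "small_set U (\<Phi> ` val J c)"
  proof (rule small_functions[of "\<lambda>(f, \<alpha>). (f, to_nat \<alpha>)" ?S])
    fix f g assume "f \<in> \<Phi> ` val J c" "g \<in> \<Phi> ` val J c" and eq: "\<And>s. s \<in> ?S \<Longrightarrow> f s = g s"
    then obtain \<phi> \<psi> where *: "f = \<Phi> \<phi>" "g = \<Phi> \<psi>" by blast
    show "f = g"
    proof
      fix s show "f s = g s" using eq[of s] unfolding * by (cases "s \<in> ?S") (auto simp: \<Phi>_def)
    qed
  qed (auto simp: inj_on_def dsimp_cat_def prod_cat_sets)
  moreover have "inj_on \<Phi> (val J c)"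
  proof (rule inj_onI, rule cofree_ext, assumption, assumption)
    fix \<phi> \<psi> f assume "\<Phi> \<phi> = \<Phi> \<psi>" and f: "f \<in> Ar \<C>" "tgt \<C> f = c"
    then have "\<Phi> \<phi> f = \<Phi> \<psi> f" by simp
    then show "\<phi> f = \<psi> f" using f ab by (simp add: \<Phi>_def split: if_splits)
  qed
  ultimately show "small_set U (val J c)" by (rule small_inj) simp
qed

context
  fixes Y :: "('o, 'm, 'u) dspace" and y and \<iota> :: "'o dob \<Rightarrow> 'u \<times> ('m dmor \<Rightarrow> bool) \<Rightarrow> 'u"
  assumes Y: "presheaf \<C> Y" and y: "y \<in> hom \<C> Y W"
    and \<iota>: "\<And>c. c \<in> Ob \<C> \<Longrightarrow> inj_on (\<iota> c) (val (Y \<times>\<^sub>p J) c)"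
begin

abbreviation YJ where "YJ \<equiv> copy \<C> \<iota> (Y \<times>\<^sub>p J)"

lemma presheaf_YJ0: "presheaf \<C> (Y \<times>\<^sub>p J)"
  by (rule presheaf_prod[OF Y presheaf_J])

lemmas YJ_facts = copy_facts[OF catC presheaf_YJ0, of \<iota>, OF \<iota>]

lemma uncopy_YJ: "c \<in> Ob \<C> \<Longrightarrow> z \<in> val (Y \<times>\<^sub>p J) c \<Longrightarrow> uncopy \<iota> (Y \<times>\<^sub>p J) c (\<iota> c z) = z"
  using \<iota> by simp

definition proj where "proj = transf \<C> YJ (\<lambda>c z. fst (uncopy \<iota> (Y \<times>\<^sub>p J) c z))"

lemma proj_hom: "proj \<in> hom \<C> YJ Y"
proof -
  have "nat_on \<C> (Y \<times>\<^sub>p J) (val (Y \<times>\<^sub>p J)) Y (\<lambda>_. fst)" by (rule nat_onI) auto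
  from nat_on_comp[OF catC YJ_facts(3) this nat_on_val[OF YJ_facts(3)]]
  show ?thesis unfolding proj_def by (intro transf_hom[OF catC YJ_facts(1)])
qed

lemma proj_apply: "c \<in> Ob \<C> \<Longrightarrow> a \<in> val Y c \<Longrightarrow> \<phi> \<in> val J c \<Longrightarrow> proj c (\<iota> c (a, \<phi>)) = a"
  using uncopy_YJ[of c "(a, \<phi>)"] by (simp add: proj_def)

definition yJ where "yJ = comp_transf \<C> YJ y proj"

lemma yJ_hom: "yJ \<in> hom \<C> YJ W"
  unfolding yJ_def by (rule hom_comp[OF catC YJ_facts(1) proj_hom y])

lemma proj_ars: "av YJ yJ Y y proj \<in> ars S (ov YJ yJ) (ov Y y)"
  by (rule av_ars[OF YJ_facts(1) Y y proj_hom yJ_def])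

text \<open>Lifting against a monomorphism amounts to extending a map into \<open>J\<close>, and
  \<open>J\<close> is injective because it is cofree.\<close>

lemma proj_weq: "av YJ yJ Y y proj \<in> weq"
proof (rule lifting_cof_weq[OF proj_ars])
  fix i assume "i \<in> cof"
  then show "has_lifting S i (av YJ yJ Y y proj)"
  proof (rule cof_cases)
    fix K k N n f assume i: "i = av K k N n f" and K: "presheaf \<C> K" and N: "presheaf \<C> N"
      and k: "k \<in> hom \<C> K W" and n: "n \<in> hom \<C> N W" and f: "f \<in> hom \<C> K N" "comp_transf \<C> K n f = k" "mono_transf \<C> K f"
    show ?thesis unfolding has_lifting_def
    proof (intro ballI impI)
      fix u v assume uv: "u \<in> Ar S" "v \<in> Ar S" "src S u = src S i" "tgt S u = src S (av YJ yJ Y y proj)"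
        "src S v = tgt S i" "tgt S v = tgt S (av YJ yJ Y y proj)" "cmp S (av YJ yJ Y y proj) u = cmp S v i"
      have "u \<in> ars S (ov K k) (ov YJ yJ)" using uv i by (simp add: ars_def)
      then obtain u' where u: "u = av K k YJ yJ u'" "u' \<in> hom \<C> K YJ" "comp_transf \<C> K yJ u' = k" by (rule ars_cases)
      have "v \<in> ars S (ov N n) (ov Y y)" using uv i by (simp add: ars_def)
      then obtain v' where v: "v = av N n Y y v'" "v' \<in> hom \<C> N Y" "comp_transf \<C> N y v' = n" by (rule ars_cases)
      have sq: "proj c (u' c x) = v' c (f c x)" if "c \<in> Ob \<C>" "x \<in> val K c" for c x
      proof -
        have "comp_transf \<C> K proj u' = comp_transf \<C> K v' f" using uv(7) unfolding u(1) v(1) i by simp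
        from fun_cong[OF fun_cong[OF this, of c], of x] show ?thesis using that by simp
      qed
      define inv where "inv = (\<lambda>c. inv_into (val K c) (f c))"
      have inv: "inv c (f c x) = x" if "c \<in> Ob \<C>" "x \<in> val K c" for c x
        using f(3) that unfolding mono_transf_def inv_def by simp
      define w where "w = (\<lambda>c x. uncopy \<iota> (Y \<times>\<^sub>p J) c (u' c x))"
      have w: "w c x \<in> val (Y \<times>\<^sub>p J) c" "\<iota> c (w c x) = u' c x" "fst (w c x) = v' c (f c x)"
        if x: "c \<in> Ob \<C>" "x \<in> val K c" for c x
      proof -
        have "u' c x \<in> \<iota> c ` val (Y \<times>\<^sub>p J) c" using hom_val[OF u(2) x] by simp
        then obtain a \<phi> where a: "u' c x = \<iota> c (a, \<phi>)" "(a, \<phi>) \<in> val (Y \<times>\<^sub>p J) c" by auto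
        then have "w c x = (a, \<phi>)" using uncopy_YJ[OF x(1) a(2)] by (simp add: w_def)
        then show "w c x \<in> val (Y \<times>\<^sub>p J) c" "\<iota> c (w c x) = u' c x" "fst (w c x) = v' c (f c x)"
          using a sq[OF x] proj_apply[OF x(1), of a \<phi>] by auto
      qed
      have w_act: "w (src \<C> g) (act K g x) = act (Y \<times>\<^sub>p J) g (w (tgt \<C> g) x)" if "g \<in> Ar \<C>" "x \<in> val K (tgt \<C> g)" for g x
        using nat_on_act[OF nat_on_comp[OF catC homD[OF u(2)] YJ_facts(3) nat_on_val[OF homD[OF u(2)]]] that(1) refl refl that(2)]
        by (simp add: w_def)
      \<comment> \<open>The function whose adjunct is the extension: on the image of
        \<open>K\<close> it is forced by evaluation at the identity, elsewhere \<open>False\<close>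
        is an arbitrary default.\<close>
      define t where "t = (\<lambda>c z. if z \<in> f c ` val K c then snd (w c (inv c z)) (idn \<C> c) else False)"
      define h where "h = (\<lambda>c z. \<iota> c (v' c z, to_cofree \<C> N t c z))"
      have h0: "nat_on \<C> N (val N) (Y \<times>\<^sub>p J) (\<lambda>c z. (v' c z, to_cofree \<C> N t c z))"
        using hom_val[OF v(2)] nat_on_act[OF homD[OF v(2)] _ refl refl] to_cofree_val[of \<C> N t]
          nat_on_act[OF nat_to_cofree[OF catC N sub_val[OF N], of t] _ refl refl]
        by (intro nat_onI) simp_all
      have h: "nat_on \<C> N (val N) YJ h"
        unfolding h_def by (rule nat_on_comp[OF catC h0 YJ_facts(2) nat_on_val[OF h0]])
      have hK: "h c (f c x) = u' c x" if x: "c \<in> Ob \<C>" "x \<in> val K c" for c x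
      proof -
        have "to_cofree \<C> N t c (f c x) = snd (w c x)"
        proof (rule cofree_ext[OF to_cofree_val])
          show "snd (w c x) \<in> val J c" using w(1)[OF x] by (cases "w c x") simp
          fix g assume g: "g \<in> Ar \<C>" "tgt \<C> g = c"
          note o = category_Ob(1)[OF catC g(1)]
          note ii = category_idn[OF catC o]
          have gx: "act K g x \<in> val K (src \<C> g)" by (rule presheaf_act[OF K g refl x(2)])
          have "act N g (f c x) = f (src \<C> g) (act K g x)" using nat_on_act[OF homD[OF f(1)] g refl x(2)] by simp
          then have "to_cofree \<C> N t c (f c x) g = snd (w (src \<C> g) (act K g x)) (idn \<C> (src \<C> g))"
            using g gx inv[OF o gx] by (simp add: t_def)
          also have "\<dots> = snd (act (Y \<times>\<^sub>p J) g (w c x)) (idn \<C> (src \<C> g))"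
            using w_act[OF g(1), of x] g(2) x(2) by simp
          also have "\<dots> = snd (w c x) g"
            using ii category_unit(1)[OF catC g(1) refl] by (cases "w c x") simp
          finally show "to_cofree \<C> N t c (f c x) g = snd (w c x) g" .
        qed
        then have "(v' c (f c x), to_cofree \<C> N t c (f c x)) = w c x" using w(3)[OF x] by (simp add: prod_eq_iff)
        then show ?thesis using w(2)[OF x] by (simp add: h_def)
      qed
      have hp: "proj c (h c z) = v' c z" if "c \<in> Ob \<C>" "z \<in> val N c" for c z
        using proj_apply[OF that(1) hom_val[OF v(2) that] to_cofree_val] by (simp add: h_def)
      let ?h = "transf \<C> N h"
      have hh: "?h \<in> hom \<C> N YJ" by (rule transf_hom[OF catC N h])
      have e1: "comp_transf \<C> K ?h f = u'"
        by (rule hom_ext[OF hom_comp[OF catC K f(1) hh] u(2)]) (simp add: hom_val[OF f(1)] hK)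
      have e2: "comp_transf \<C> N proj ?h = v'"
        by (rule hom_ext[OF hom_comp[OF catC N hh proj_hom] v(2)]) (simp add: hp)
      have e3: "comp_transf \<C> N yJ ?h = n"
      proof (rule hom_ext[OF hom_comp[OF catC N hh yJ_hom] n])
        fix c z assume z: "c \<in> Ob \<C>" "z \<in> val N c"
        have "comp_transf \<C> N yJ ?h c z = y c (v' c z)"
          using z hom_val[OF hh z] hp[OF z] by (simp add: yJ_def)
        then show "comp_transf \<C> N yJ ?h c z = n c z" using v(3) z by (metis comp_transf_apply)
      qed
      have "av N n YJ yJ ?h \<in> ars S (ov N n) (ov YJ yJ)"
        by (rule av_ars[OF N YJ_facts(1) yJ_hom hh e3[symmetric]])
      then show "\<exists>h\<in>Ar S. src S h = tgt S i \<and> tgt S h = src S (av YJ yJ Y y proj) \<and> cmp S h i = u \<and> cmp S (av YJ yJ Y y proj) h = v"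
        using e1 e2 unfolding i u(1) v(1) ars_def by (intro bexI[of _ "av N n YJ yJ ?h"]) simp_all
    qed
  qed
qed

definition ept where "ept i = transf \<C> Y (\<lambda>c a. \<iota> c (a, pt i c))"

lemma ept_hom: "ept i \<in> hom \<C> Y YJ"
proof -
  have "nat_on \<C> Y (val Y) (Y \<times>\<^sub>p J) (\<lambda>c a. (a, pt i c))" using pt_val pt_act by (intro nat_onI) simp_all
  from nat_on_comp[OF catC this YJ_facts(2) nat_on_val[OF this]]
  show ?thesis unfolding ept_def by (rule transf_hom[OF catC Y])
qed

lemma ept_proj: "comp_transf \<C> Y proj (ept i) = id_transf \<C> Y"
  by (rule hom_ext[OF hom_comp[OF catC Y ept_hom proj_hom] id_transf_hom[OF catC Y]])
    (simp add: ept_def proj_apply pt_val)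

lemma ept_ars: "av Y y YJ yJ (ept i) \<in> ars S (ov Y y) (ov YJ yJ)"
proof -
  have "y = comp_transf \<C> Y yJ (ept i)"
  proof (rule hom_ext[OF y hom_comp[OF catC Y ept_hom yJ_hom]])
  fix c a assume a: "c \<in> Ob \<C>" "a \<in> val Y c"
  show "y c a = comp_transf \<C> Y yJ (ept i) c a"
    using a hom_val[OF ept_hom[of i] a] proj_apply[OF a pt_val[of i c]] by (simp add: yJ_def ept_def)
  qed
  from av_ars[OF Y YJ_facts(1) yJ_hom ept_hom this] show ?thesis .
qed

lemma ept_weq: "av Y y YJ yJ (ept i) \<in> weq"
  by (rule section_weq[OF proj_ars proj_weq ept_ars]) (simp add: ept_proj)

lemma ept_cof: "av Y y YJ yJ (ept i) \<in> cof"
proof (rule av_cof[OF ept_ars], unfold mono_transf_def, intro ballI inj_onI)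
  fix c a b assume a: "c \<in> Ob \<C>" "a \<in> val Y c" "b \<in> val Y c" "ept i c a = ept i c b"
  have "a = proj c (ept i c a)" using a(1,2) by (simp add: ept_def proj_apply pt_val)
  also have "\<dots> = b" unfolding a(4) using a(1,3) by (simp add: ept_def proj_apply pt_val)
  finally show "a = b" .
qed

end

text \<open>The criterion \<open>weq_by_fibrant_objects\<close> with cylinders
  \<open>A \<times> J\<close> and \<open>B \<times> J\<close>. Both of its conditions are lifting
  problems against contracting inclusions: \<open>A\<close> in \<open>B\<close>, and the corner of
  \<open>A\<close> in \<open>B\<close> with the two points of \<open>J\<close>, which inherits the
  deformation.\<close>

theorem contracting_weq:
  assumes B: "presheaf \<C> B" and A: "sub \<C> B A" and b: "b \<in> hom \<C> B W"
    and con: "contracts \<C> (dsimp 1) (dvx 0) (dvx 1) B A"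
    and i: "i = id_transf \<C> (restr B A)" and a: "a = comp_transf \<C> (restr B A) b i"
  shows "av (restr B A) a B b i \<in> weq"
proof -
  let ?A = "restr B A"
  have sB: "small_psh U \<C> B" unfolding small_psh_def using small_base by blast
  have PA: "presheaf \<C> ?A" by (rule presheaf_restr[OF catC B A])
  have ih: "i \<in> hom \<C> ?A B" unfolding i by (rule incl_hom[OF catC B A])
  have ah: "a \<in> hom \<C> ?A W" unfolding a by (rule hom_comp[OF catC PA ih b])
  have i_app: "i c x = x" if "c \<in> Ob \<C>" "x \<in> A c" for c x using that by (simp add: i)
  obtain \<iota> :: "'o dob \<Rightarrow> 'u \<times> ('m dmor \<Rightarrow> bool) \<Rightarrow> 'u" where \<iota>: "\<And>c. c \<in> Ob \<C> \<Longrightarrow> inj_on (\<iota> c) (val (B \<times>\<^sub>p J) c)"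
    using small_psh_inj[OF small_prod[OF sB small_J]] by blast
  have \<iota>A: "inj_on (\<iota> c) (val (?A \<times>\<^sub>p J) c)" if "c \<in> Ob \<C>" for c
    by (rule inj_on_subset[OF \<iota>[OF that]]) (use subD[OF A that] in auto)
  \<comment> \<open>One renaming \<open>\<iota>\<close> serves both cylinders, so that
    \<open>iJ\<close> is a literal inclusion.\<close>
  let ?BJ = "copy \<C> \<iota> (B \<times>\<^sub>p J)" and ?AJ = "copy \<C> \<iota> (?A \<times>\<^sub>p J)"
  let ?bJ = "yJ B b \<iota>" and ?aJ = "yJ ?A a \<iota>"
  note FB = copy_facts[OF catC presheaf_prod[OF B presheaf_J], of \<iota>, OF \<iota>]
  note FA = copy_facts[OF catC presheaf_prod[OF PA presheaf_J], of \<iota>, OF \<iota>A]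
  have ui: "uncopy \<iota> (B \<times>\<^sub>p J) c (\<iota> c z) = z" if "c \<in> Ob \<C>" "z \<in> val (B \<times>\<^sub>p J) c" for c z
    using \<iota>[OF that(1)] that(2) by simp
  have uiA: "uncopy \<iota> (?A \<times>\<^sub>p J) c (\<iota> c z) = z" if "c \<in> Ob \<C>" "z \<in> val (?A \<times>\<^sub>p J) c" for c z
    using \<iota>A[OF that(1)] that(2) by simp
  have incl: "nat_on \<C> (?A \<times>\<^sub>p J) (val (?A \<times>\<^sub>p J)) (B \<times>\<^sub>p J) (\<lambda>c z. z)"
    using subD[OF A] by (intro nat_onI) auto
  note n1 = nat_on_comp[OF catC FA(3) incl nat_on_val[OF FA(3)]]
  define iJ where "iJ = transf \<C> ?AJ (\<lambda>c z. \<iota> c (uncopy \<iota> (?A \<times>\<^sub>p J) c z))"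
  have iJ: "iJ \<in> hom \<C> ?AJ ?BJ"
    unfolding iJ_def by (rule transf_hom[OF catC FA(1) nat_on_comp[OF catC n1 FB(2) nat_on_val[OF n1]]])
  have iJ_app: "iJ c (\<iota> c z) = \<iota> c z" if "c \<in> Ob \<C>" "z \<in> val (?A \<times>\<^sub>p J) c" for c z
    using uiA[OF that] that by (simp add: iJ_def)
  have bJ: "?bJ \<in> hom \<C> ?BJ W"
    by (rule yJ_hom[OF B b \<iota>])
  have aJ: "?aJ \<in> hom \<C> ?AJ W"
    by (rule yJ_hom[OF PA ah \<iota>A])
  have iA: "av ?A a B b i \<in> ars S (ov ?A a) (ov B b)" by (rule av_ars[OF PA B b ih a])
  have iJA: "av ?AJ ?aJ ?BJ ?bJ iJ \<in> ars S (ov ?AJ ?aJ) (ov ?BJ ?bJ)"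
  proof -
    have "?aJ = comp_transf \<C> ?AJ ?bJ iJ"
    proof (rule hom_ext[OF aJ hom_comp[OF catC FA(1) iJ bJ]])
      fix c z assume c: "c \<in> Ob \<C>" "z \<in> val ?AJ c"
      then obtain x \<phi> where z: "z = \<iota> c (x, \<phi>)" "x \<in> A c" "\<phi> \<in> val J c" by auto
      have x: "x \<in> val B c" by (rule subD[OF A c(1) z(2)])
      have bz: "z \<in> val ?BJ c" using z x by auto
      have "?aJ c z = a c x"
        using c z proj_apply[OF PA ah \<iota>A c(1), of x \<phi>] by (simp add: yJ_def[OF PA ah \<iota>A])
      moreover have "?bJ c z = b c x"
        using c z x bz proj_apply[OF B b \<iota> c(1), of x \<phi>] by (simp add: yJ_def[OF B b \<iota>])
      moreover have "a c x = b c x" using c(1) z(2) by (simp add: a i_app)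
      moreover have "iJ c z = z" using iJ_app[OF c(1), of "(x, \<phi>)"] z by simp
      ultimately show "?aJ c z = comp_transf \<C> ?AJ ?bJ iJ c z" using c by simp
    qed
    from av_ars[OF FA(1) FB(1) bJ iJ this] show ?thesis .
  qed
  have comm: "comp_transf \<C> ?A iJ (ept ?A \<iota> k) = comp_transf \<C> ?A (ept B \<iota> k) i" for k
  proof (rule hom_ext[OF hom_comp[OF catC PA ept_hom[OF PA ah \<iota>A] iJ] hom_comp[OF catC PA ih ept_hom[OF B b \<iota>]]])
    fix c x assume c: "c \<in> Ob \<C>" "x \<in> val ?A c"
    then have x: "x \<in> A c" "x \<in> val B c" using subD[OF A] by simp_all
    show "comp_transf \<C> ?A iJ (ept ?A \<iota> k) c x = comp_transf \<C> ?A (ept B \<iota> k) i c x"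
      using c x iJ_app[OF c(1), of "(x, pt k c)"] pt_val[of k c] i_app[OF c(1) x(1)]
      by (simp add: ept_def[OF PA ah \<iota>A] ept_def[OF B b \<iota>])
  qed
  show ?thesis
  proof (rule weq_by_fibrant_objects[OF terminal_W iA ept_ars[OF B b \<iota>, of False] _ ept_ars[OF B b \<iota>, of True]
        ept_ars[OF PA ah \<iota>A, of False] ept_weq[OF PA ah \<iota>A] ept_ars[OF PA ah \<iota>A, of True] ept_weq[OF PA ah \<iota>A] iJA])
    show "av B b ?BJ ?bJ (ept B \<iota> False) \<in> cof \<inter> weq" using ept_cof[OF B b \<iota>] ept_weq[OF B b \<iota>] by blast
    show "cmp S (av ?AJ ?aJ ?BJ ?bJ iJ) (av ?A a ?AJ ?aJ (ept ?A \<iota> False)) = cmp S (av B b ?BJ ?bJ (ept B \<iota> False)) (av ?A a B b i)"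
      "cmp S (av ?AJ ?aJ ?BJ ?bJ iJ) (av ?A a ?AJ ?aJ (ept ?A \<iota> True)) = cmp S (av B b ?BJ ?bJ (ept B \<iota> True)) (av ?A a B b i)"
      by (simp_all add: comm)
  next
    fix l u assume l: "l \<in> fibrant_objects S fib" and "u \<in> ars S (ov ?A a) l"
    obtain L p where L: "l = ov L p" "presheaf \<C> L" "p \<in> hom \<C> L W" "left_fibration_over_fibrant D U L W p"
      by (rule fibrant_cases[OF l])
    have "u \<in> ars S (ov ?A a) (ov L p)" using \<open>u \<in> ars S (ov ?A a) l\<close> L(1) by simp
    then obtain u' where u: "u = av ?A a L p u'" "u' \<in> hom \<C> ?A L" "comp_transf \<C> ?A p u' = a" by (rule ars_cases)
    have u1: "nat_on \<C> B A L u'" using homD[OF u(2)] by simp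
    have pu: "p c (u' c x) = b c x" if "c \<in> Ob \<C>" "x \<in> A c" for c x
      using fun_cong[OF fun_cong[OF u(3), of c], of x] that by (simp add: a i_app)
    obtain h where h: "nat_on \<C> B (val B) L h" "\<And>c x. c \<in> Ob \<C> \<Longrightarrow> x \<in> A c \<Longrightarrow> h c x = u' c x"
      "\<And>c x. c \<in> Ob \<C> \<Longrightarrow> x \<in> val B c \<Longrightarrow> p c (h c x) = b c x"
      using RLPE[OF left_fibration_over_fibrant.contracting_RLP[OF L(4) B sB A con] u1 homD[OF b] pu] by blast
    let ?h = "transf \<C> B h"
    have hh: "?h \<in> hom \<C> B L" by (rule transf_hom[OF catC B h(1)])
    have 1: "comp_transf \<C> B p ?h = b"
      by (rule hom_ext[OF hom_comp[OF catC B hh L(3)] b]) (simp add: h(3))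
    have 2: "comp_transf \<C> ?A ?h i = u'"
      by (rule hom_ext[OF hom_comp[OF catC PA ih hh] u(2)]) (use subD[OF A] in \<open>simp add: h(2) i_app\<close>)
    show "\<exists>r. r \<in> ars S (ov B b) l \<and> cmp S r (av ?A a B b i) = u"
      using av_ars[OF B L(2,3) hh 1[symmetric]] 2 unfolding L(1) u(1) by (intro exI[of _ "av B b L p ?h"]) simp
  next
    fix l u v assume l: "l \<in> fibrant_objects S fib" and ul: "u \<in> ars S (ov B b) l" and vl: "v \<in> ars S (ov B b) l"
      and eq: "cmp S u (av ?A a B b i) = cmp S v (av ?A a B b i)"
    obtain L p where L: "l = ov L p" "presheaf \<C> L" "p \<in> hom \<C> L W" "left_fibration_over_fibrant D U L W p"
      by (rule fibrant_cases[OF l])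
    obtain u' where u: "u = av B b L p u'" "u' \<in> hom \<C> B L" "comp_transf \<C> B p u' = b"
      using ul unfolding L(1) by (rule ars_cases)
    obtain v' where v: "v = av B b L p v'" "v' \<in> hom \<C> B L" "comp_transf \<C> B p v' = b"
      using vl unfolding L(1) by (rule ars_cases)
    have pu: "p c (u' c x) = b c x" "p c (v' c x) = b c x" if "c \<in> Ob \<C>" "x \<in> val B c" for c x
      using fun_cong[OF fun_cong[OF u(3), of c], of x] fun_cong[OF fun_cong[OF v(3), of c], of x] that by simp_all
    have uv: "u' c x = v' c x" if "c \<in> Ob \<C>" "x \<in> A c" for c x
    proof -
      have "comp_transf \<C> ?A u' i = comp_transf \<C> ?A v' i" using eq unfolding u(1) v(1) by simp
      from fun_cong[OF fun_cong[OF this, of c], of x] show ?thesis using that by (simp add: i_app)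
    qed
    let ?P = "\<lambda>c. {pt False c, pt True c}"
    have sP: "sub \<C> J ?P" unfolding sub_def using pt_val pt_act by auto
    let ?c = "corner B A J ?P"
    have conJ: "contracts \<C> (dsimp 1) (dvx 0) (dvx 1) (B \<times>\<^sub>p J) ?c" by (rule contracts_corner[OF catC con A])
    note rlp = left_fibration_over_fibrant.contracting_RLP[OF L(4) presheaf_prod[OF B presheaf_J] small_prod[OF sB small_J]
        sub_corner[OF B presheaf_J A sP] conJ]
    \<comment> \<open>The two maps sit at the two points of \<open>J\<close>; over \<open>A\<close>
      they coincide and are extended constantly along \<open>J\<close>.\<close>
    define k where "k = (\<lambda>c (x, \<phi>). if \<phi> = pt True c then v' c x else u' c x)"
    have k0: "k c (x, pt False c) = u' c x" if "c \<in> Ob \<C>" for c x using pt_neq[OF that] by (simp add: k_def)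
    have k1: "k c (x, pt True c) = v' c x" for c x by (simp add: k_def)
    have kA: "k c (x, \<phi>) = u' c x" if "c \<in> Ob \<C>" "x \<in> A c" for c x \<phi> using uv[OF that] by (simp add: k_def)
    have nk: "nat_on \<C> (B \<times>\<^sub>p J) ?c L k"
    proof (rule nat_onI)
      fix c z assume c: "c \<in> Ob \<C>" "z \<in> ?c c"
      then show "k c z \<in> val L c" using hom_val[OF u(2) c(1)] hom_val[OF v(2) c(1)] by (cases z) (simp add: k_def)
    next
      fix f z assume f: "f \<in> Ar \<C>" "z \<in> ?c (tgt \<C> f)"
      obtain x \<phi> where *: "z = (x, \<phi>)" by (cases z)
      note o = category_Ob[OF catC f(1)]
      have x: "x \<in> val B (tgt \<C> f)" "x \<in> A (tgt \<C> f) \<or> \<phi> = pt False (tgt \<C> f) \<or> \<phi> = pt True (tgt \<C> f)"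
        using f(2) unfolding * by auto
      note N = nat_on_act[OF homD[OF u(2)] f(1) refl refl x(1)] nat_on_act[OF homD[OF v(2)] f(1) refl refl x(1)]
      from x(2) show "k (src \<C> f) (act (B \<times>\<^sub>p J) f z) = act L f (k (tgt \<C> f) z)"
      proof (elim disjE)
        assume xa: "x \<in> A (tgt \<C> f)"
        show ?thesis using kA[OF o(2) xa] kA[OF o(1) sub_act[OF A f(1) refl refl xa]] N(1) unfolding * by simp
      qed (use N k0[OF o(1)] k0[OF o(2)] k1 pt_act[OF f(1)] in \<open>simp_all add: *\<close>)
    qed
    have fB: "nat_on \<C> (B \<times>\<^sub>p J) (val (B \<times>\<^sub>p J)) B (\<lambda>_. fst)" by (rule nat_onI) auto
    have pk: "p c (k c z) = b c (fst z)" if c: "c \<in> Ob \<C>" "z \<in> ?c c" for c z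
      using c pu[OF c(1)] by (cases z) (simp add: k_def)
    obtain h where h: "nat_on \<C> (B \<times>\<^sub>p J) (val (B \<times>\<^sub>p J)) L h" "\<And>c z. c \<in> Ob \<C> \<Longrightarrow> z \<in> ?c c \<Longrightarrow> h c z = k c z"
      "\<And>c z. c \<in> Ob \<C> \<Longrightarrow> z \<in> val (B \<times>\<^sub>p J) c \<Longrightarrow> p c (h c z) = b c (fst z)"
      using RLPE[OF rlp nk nat_on_comp[OF catC fB homD[OF b] nat_on_val[OF fB]] pk] by blast
    let ?H = "transf \<C> ?BJ (\<lambda>c z. h c (uncopy \<iota> (B \<times>\<^sub>p J) c z))"
    have hh: "?H \<in> hom \<C> ?BJ L"
      by (rule transf_hom[OF catC FB(1) nat_on_comp[OF catC FB(3) h(1) nat_on_val[OF FB(3)]]])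
    have H_app: "?H c (\<iota> c (x, \<phi>)) = h c (x, \<phi>)" if "c \<in> Ob \<C>" "x \<in> val B c" "\<phi> \<in> val J c" for c x \<phi>
      using ui[OF that(1), of "(x, \<phi>)"] that by simp
    have 1: "comp_transf \<C> ?BJ p ?H = ?bJ"
    proof (rule hom_ext[OF hom_comp[OF catC FB(1) hh L(3)] bJ])
      fix c z assume c: "c \<in> Ob \<C>" "z \<in> val ?BJ c"
      then obtain x \<phi> where z: "z = \<iota> c (x, \<phi>)" "x \<in> val B c" "\<phi> \<in> val J c" by auto
      have "p c (?H c z) = b c x" using H_app[OF c(1) z(2,3)] h(3)[OF c(1), of "(x, \<phi>)"] z by simp
      then show "comp_transf \<C> ?BJ p ?H c z = ?bJ c z"
        using c z proj_apply[OF B b \<iota> c(1) z(2,3)] by (simp add: yJ_def[OF B b \<iota>])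
    qed
    have 2: "comp_transf \<C> B ?H (ept B \<iota> False) = u'"
    proof (rule hom_ext[OF hom_comp[OF catC B ept_hom[OF B b \<iota>] hh] u(2)])
      fix c x assume c: "c \<in> Ob \<C>" "x \<in> val B c"
      have "h c (x, pt False c) = u' c x" using h(2)[OF c(1), of "(x, pt False c)"] k0[OF c(1)] c(2) pt_val by simp
      then show "comp_transf \<C> B ?H (ept B \<iota> False) c x = u' c x"
        using c H_app[OF c pt_val] by (simp add: ept_def[OF B b \<iota>])
    qed
    have 3: "comp_transf \<C> B ?H (ept B \<iota> True) = v'"
    proof (rule hom_ext[OF hom_comp[OF catC B ept_hom[OF B b \<iota>] hh] v(2)])
      fix c x assume c: "c \<in> Ob \<C>" "x \<in> val B c"
      have "h c (x, pt True c) = v' c x" using h(2)[OF c(1), of "(x, pt True c)"] k1 c(2) pt_val by simp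
      then show "comp_transf \<C> B ?H (ept B \<iota> True) c x = v' c x"
        using c H_app[OF c pt_val] by (simp add: ept_def[OF B b \<iota>])
    qed
    show "\<exists>H. H \<in> ars S (ov ?BJ ?bJ) l \<and> cmp S H (av B b ?BJ ?bJ (ept B \<iota> False)) = u \<and>
        cmp S H (av B b ?BJ ?bJ (ept B \<iota> True)) = v"
      using av_ars[OF FB(1) L(2,3) hh 1[symmetric]] 2 3 unfolding L(1) u(1) v(1)
      by (intro exI[of _ "av ?BJ ?bJ L p ?H"]) simp
  qed
qed

end


section \<open>Under-objects contract to their base point\<close>

definition dpt :: "'o dob \<Rightarrow> smor" where
  "dpt = (\<lambda>(d, k, l). const_mor k 0 0)"

definition dmin :: "'o dob \<Rightarrow> smor \<Rightarrow> smor \<Rightarrow> smor" where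
  "dmin = (\<lambda>(d, k, l). smin k)"

lemma transf_cong:
  assumes "\<And>c x. c \<in> Ob C \<Longrightarrow> x \<in> val X c \<Longrightarrow> s c x = t c x" shows "transf C X s = transf C X t"
  unfolding transf_def by (intro restrict_ext assms)

locale under_object = covariant_model D U W cof weq fib
  for D :: "('o, 'm) cat" and U :: "'u itself" and W :: "('o, 'm, 'u) dspace" and cof weq fib +
  fixes x :: "'o dob \<Rightarrow> smor \<Rightarrow> 'u"
  assumes x: "x \<in> hom \<C> (dsimp 0) W"
begin

abbreviation D0 :: "('o, 'm, smor) dspace" where "D0 \<equiv> dsimp 0"
abbreviation D1 :: "('o, 'm, smor) dspace" where "D1 \<equiv> dsimp 1"
abbreviation Rp where "Rp c \<equiv> representable \<C> c \<times>\<^sub>p D1"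
abbreviation E where "E \<equiv> arrow_space D W"
abbreviation X where "X \<equiv> under_obj D W x"

lemma dsimp_0: "s \<in> val D0 c \<longleftrightarrow> s = dpt c"
proof -
  obtain d k l where *: "c = (d, k, l)" by (metis prod_cases3)
  have 1: "s = const_mor k 0 0" if "s \<in> smap k 0"
    by (rule smap_const[OF that]) (use smap_le[OF that] in simp_all)
  have 2: "const_mor k 0 0 \<in> smap k 0" by (rule const_mor_smap) simp
  show ?thesis unfolding * dpt_def dsimp_simps prod.case by (rule iffI[OF 1]) (assumption, simp only: 2)
qed

lemma dmin_val: "s \<in> val D1 c \<Longrightarrow> t \<in> val D1 c \<Longrightarrow> dmin c s t \<in> val D1 c"
  by (cases c rule: prod_cases3) (simp add: dmin_def smin_smap del: mem_Collect_eq)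

lemma dmin_act:
  assumes "f \<in> Ar \<C>" "s \<in> val D1 (tgt \<C> f)" "t \<in> val D1 (tgt \<C> f)"
  shows "act D1 f (dmin (tgt \<C> f) s t) = dmin (src \<C> f) (act D1 f s) (act D1 f t)"
proof -
  obtain f0 \<alpha> \<beta> where *: "f = (f0, \<alpha>, \<beta>)" by (metis prod_cases3)
  have \<alpha>: "\<alpha> \<in> Ar simplex" using assms(1) unfolding * by simp
  show ?thesis using assms(2,3) smin_act[OF _ _ smap_Ar[OF \<alpha>], of s t] unfolding *
    by (simp add: dmin_def)
qed

lemma dmin_dvx:
  assumes "t \<in> val D1 c"
  shows "dmin c t (dvx 1 c) = t" "dmin c t (dvx 0 c) = dvx 0 c" "dmin c (dvx 0 c) t = dvx 0 c"
proof -
  obtain d k l where *: "c = (d, k, l)" by (metis prod_cases3)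
  have "t \<in> smap k 1" using assms unfolding * dsimp_simps .
  from smin_vx[OF this] show "dmin c t (dvx 1 c) = t" "dmin c t (dvx 0 c) = dvx 0 c" "dmin c (dvx 0 c) t = dvx 0 c"
    unfolding * dmin_def dvx_def by simp_all
qed

lemma presheaf_Rp: "presheaf \<C> (Rp c)"
  by (intro presheaf_prod presheaf_representable catC presheaf_dsimp)

lemma presheaf_E: "presheaf \<C> E"
  by (rule presheaf_exp[OF catC presheaf_dsimp W])

lemma E_val: "val E c = hom \<C> (Rp c) W"
  by (simp add: exp_psh_def)

lemma E_act:
  assumes "f \<in> Ar \<C>" "src \<C> f = b" "tgt \<C> f = src \<C> g" "t \<in> val D1 b"
  shows "act E g \<theta> b (f, t) = \<theta> b (cmp \<C> g f, t)"
  using assms category_Ob[OF catC assms(1)] by (simp add: exp_psh_def)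

lemma dvx_val: "i \<le> 1 \<Longrightarrow> c \<in> Ob \<C> \<Longrightarrow> dvx i c \<in> val D1 c"
  using point_dvx[of i D] unfolding point_def by blast

lemma dvx_act: "i \<le> 1 \<Longrightarrow> f \<in> Ar \<C> \<Longrightarrow> src \<C> f = b \<Longrightarrow> tgt \<C> f = c \<Longrightarrow> act D1 f (dvx i c) = dvx i b"
  using point_dvx[of i D] unfolding point_def by blast

text \<open>The vertices are global points of \<open>D[1]\<close>, so naturality reduces the value
  of a path at a vertex to its value at the universal element.\<close>

lemma hom_vertex:
  assumes \<theta>: "\<theta> \<in> hom \<C> (Rp c) W" and f: "f \<in> Ar \<C>" "src \<C> f = b" "tgt \<C> f = c" and i: "i \<le> 1"
  shows "\<theta> b (f, dvx i b) = act W f (\<theta> c (idn \<C> c, dvx i c))"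
proof -
  have c: "c \<in> Ob \<C>" using category_Ob[OF catC f(1)] f(3) by simp
  have "(idn \<C> c, dvx i c) \<in> val (Rp c) c" using category_idn[OF catC c] dvx_val[OF i c] by simp
  from nat_on_act[OF homD[OF \<theta>] f(1,3,2) this] show ?thesis
    using category_unit(2)[OF catC f(1,3)] dvx_act[OF i f] by simp
qed

lemma eval_at_apply:
  assumes "c \<in> Ob \<C>" "\<theta> \<in> hom \<C> (Rp c) W" shows "eval_at D W i c \<theta> = \<theta> c (idn \<C> c, dvx i c)"
  using assms by (cases c rule: prod_cases3) (simp add: eval_at_def exp_psh_def)

lemma nat_eval_at:
  assumes i: "i \<le> 1" shows "nat_on \<C> E (val E) W (eval_at D W i)"
proof (rule nat_onI)
  fix c \<theta> assume c: "c \<in> Ob \<C>" "\<theta> \<in> val E c"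
  then have \<theta>: "\<theta> \<in> hom \<C> (Rp c) W" by (simp add: E_val)
  have "(idn \<C> c, dvx i c) \<in> val (Rp c) c" using category_idn[OF catC c(1)] dvx_val[OF i c(1)] by simp
  then show "eval_at D W i c \<theta> \<in> val W c" unfolding eval_at_apply[OF c(1) \<theta>] by (rule hom_val[OF \<theta> c(1)])
next
  fix f \<theta> assume f: "f \<in> Ar \<C>" "\<theta> \<in> val E (tgt \<C> f)"
  note o = category_Ob[OF catC f(1)]
  have \<theta>: "\<theta> \<in> hom \<C> (Rp (tgt \<C> f)) W" using f(2) by (simp add: E_val)
  have \<theta>': "act E f \<theta> \<in> hom \<C> (Rp (src \<C> f)) W" using presheaf_act[OF presheaf_E f(1) refl refl f(2)] unfolding E_val .
  show "eval_at D W i (src \<C> f) (act E f \<theta>) = act W f (eval_at D W i (tgt \<C> f) \<theta>)"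
    unfolding eval_at_apply[OF o(1) \<theta>'] eval_at_apply[OF o(2) \<theta>] hom_vertex[OF \<theta> f(1) refl refl i, symmetric]
    using E_act[of "idn \<C> (src \<C> f)" "src \<C> f" f] category_idn[OF catC o(1)] dvx_val[OF i o(1)] category_unit(1)[OF catC f(1) refl]
    by simp
qed

lemma presheaf_X: "presheaf \<C> X"
  unfolding under_obj_def by (rule presheaf_pullback[OF catC presheaf_dsimp presheaf_E homD[OF x] nat_eval_at]) simp

lemma X_iff:
  assumes "c \<in> Ob \<C>"
  shows "(s, \<theta>) \<in> val X c \<longleftrightarrow> s = dpt c \<and> \<theta> \<in> hom \<C> (Rp c) W \<and> \<theta> c (idn \<C> c, dvx 0 c) = x c (dpt c)"
  using eval_at_apply[OF assms, of \<theta> 0] by (auto simp: under_obj_def pullback_psh_def E_val dsimp_0)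

lemma X_act [simp]: "act X f (s, \<theta>) = (act D0 f s, act E f \<theta>)"
  by (simp add: under_obj_def pullback_psh_def)

lemma dpt_act: "f \<in> Ar \<C> \<Longrightarrow> src \<C> f = b \<Longrightarrow> tgt \<C> f = c \<Longrightarrow> act D0 f (dpt c) = dpt b"
  using presheaf_act[OF presheaf_dsimp, of f D c b "dpt c" 0] by (simp add: dsimp_0)

lemma x_act: "f \<in> Ar \<C> \<Longrightarrow> src \<C> f = b \<Longrightarrow> tgt \<C> f = c \<Longrightarrow> act W f (x c (dpt c)) = x b (dpt b)"
  using nat_on_act[OF homD[OF x], of f c b "dpt c"] by (simp add: dsimp_0 dpt_act)

text \<open>The constant path at \<open>x\<close>; \<open>id_point_apply\<close> identifies it as
  the second component of \<open>id_point\<close>.\<close>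

definition const where "const c = transf \<C> (Rp c) (\<lambda>b z. x b (dpt b))"

lemma const_apply [simp]: "b \<in> Ob \<C> \<Longrightarrow> z \<in> val (Rp c) b \<Longrightarrow> const c b z = x b (dpt b)"
  unfolding const_def by (rule transf_apply)

lemma const_hom: "const c \<in> hom \<C> (Rp c) W"
  unfolding const_def
proof (rule transf_hom[OF catC presheaf_Rp], rule nat_onI)
  fix b assume "b \<in> Ob \<C>"
  then show "x b (dpt b) \<in> val W b" by (rule hom_val[OF x]) (simp add: dsimp_0)
qed (simp add: x_act)

lemma const_X: "c \<in> Ob \<C> \<Longrightarrow> (dpt c, const c) \<in> val X c"
  using category_idn[OF catC] dvx_val[of 0] by (simp add: X_iff const_hom)

lemma id_point_apply:
  assumes c: "c \<in> Ob \<C>" shows "id_point D W x c (dpt c) = (dpt c, const c)"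
proof -
  have "x b (dsimp_map D (const_mor 1 0 0) b z) = x b (dpt b)" if "b \<in> Ob \<C>" "z \<in> val D1 b" for b z
  proof -
    obtain d k l where *: "b = (d, k, l)" by (metis prod_cases3)
    have z: "z \<in> smap k 1" using that(2) unfolding * dsimp_simps .
    have k: "const_mor 1 0 0 \<in> smap 1 0" by (rule const_mor_smap) simp
    then have "dsimp_map D (const_mor 1 0 0) b z = cmp simplex (const_mor 1 0 0) z"
      using that unfolding dsimp_map_def by simp
    moreover have "cmp simplex (const_mor 1 0 0) z \<in> val D0 b"
      using cmp_smap(1)[OF z k] unfolding * dsimp_simps .
    ultimately show ?thesis by (simp add: dsimp_0)
  qed
  then have "transf \<C> (Rp c) (\<lambda>b (g, z). x b (dsimp_map D (const_mor 1 0 0) b z)) = const c"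
    unfolding const_def by (intro transf_cong) auto
  then show ?thesis using c by (simp add: id_point_def dsimp_0)
qed

lemma const_act:
  assumes f: "f \<in> Ar \<C>" shows "act E f (const (tgt \<C> f)) = const (src \<C> f)"
proof (rule hom_ext[OF _ const_hom])
  show "act E f (const (tgt \<C> f)) \<in> hom \<C> (Rp (src \<C> f)) W"
    using presheaf_act[OF presheaf_E f refl refl] const_hom unfolding E_val by blast
  fix b z assume b: "b \<in> Ob \<C>" "z \<in> val (Rp (src \<C> f)) b"
  obtain g t where *: "z = (g, t)" by (cases z)
  have g: "g \<in> Ar \<C>" "src \<C> g = b" "tgt \<C> g = src \<C> f" "t \<in> val D1 b" using b(2) unfolding * by simp_all
  show "act E f (const (tgt \<C> f)) b z = const (src \<C> f) b z"
    using E_act[OF g] g b category_cmp[OF catC g(1) f g(3)[symmetric]] unfolding * by simp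
qed

abbreviation A where "A \<equiv> \<lambda>c. {(dpt c, const c)}"

lemma nat_id_point: "nat_on \<C> D0 (val D0) X (id_point D W x)"
proof (rule nat_onI)
  fix c s assume "c \<in> Ob \<C>" "s \<in> val D0 c"
  then show "id_point D W x c s \<in> val X c" using const_X id_point_apply by (simp add: dsimp_0)
next
  fix f s assume f: "f \<in> Ar \<C>" "s \<in> val D0 (tgt \<C> f)"
  then show "id_point D W x (src \<C> f) (act D0 f s) = act X f (id_point D W x (tgt \<C> f) s)"
    using category_Ob[OF catC f(1)] by (simp add: dsimp_0 dpt_act const_act id_point_apply)
qed

lemma id_point_hom: "id_point D W x \<in> hom \<C> D0 X"
proof -
  have "transf \<C> D0 (id_point D W x) = id_point D W x"
    unfolding id_point_def transf_def by (intro ext) (simp add: restrict_def)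
  then show ?thesis using transf_hom[OF catC presheaf_dsimp nat_id_point] by simp
qed

lemma under_proj_apply:
  assumes c: "c \<in> Ob \<C>" "(s, \<theta>) \<in> val X c" shows "under_proj D W x c (s, \<theta>) = eval_at D W 1 c \<theta>"
  using assms by (simp add: under_proj_def)

lemma under_proj_hom: "under_proj D W x \<in> hom \<C> X W"
proof -
  have "nat_on \<C> X (val X) E (\<lambda>_. snd)" by (intro nat_onI) (auto simp: X_iff E_val)
  from nat_on_comp[OF catC this nat_eval_at[of 1] nat_on_val[OF this]]
  have "nat_on \<C> X (val X) W (\<lambda>c (s, \<theta>). eval_at D W 1 c \<theta>)" by (simp add: case_prod_beta')
  from transf_hom[OF catC presheaf_X this] show ?thesis unfolding under_proj_def .
qed

lemma under_proj_id_point: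
  assumes c: "c \<in> Ob \<C>" shows "under_proj D W x c (dpt c, const c) = x c (dpt c)"
  unfolding under_proj_apply[OF c const_X[OF c]] eval_at_apply[OF c const_hom]
  using category_idn[OF catC c] dvx_val[OF _ c, of 1] c by simp

text \<open>The path \<open>\<theta>\<close> stopped at time \<open>t\<close>. As
  \<open>\<theta>\<close> lives on the representable times \<open>D[1]\<close>, \<open>t\<close> has
  to be restricted along the arrow argument before the minimum is taken.\<close>

definition path :: "'o dob \<Rightarrow> ('o dob \<Rightarrow> 'm dmor \<times> smor \<Rightarrow> 'u) \<Rightarrow> smor \<Rightarrow> 'o dob \<Rightarrow> 'm dmor \<times> smor \<Rightarrow> 'u" where
  "path c \<theta> t = transf \<C> (Rp c) (\<lambda>b (f, z). \<theta> b (f, dmin b z (act D1 f t)))"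

lemma path_apply:
  assumes "f \<in> Ar \<C>" "src \<C> f = b" "tgt \<C> f = c" "z \<in> val D1 b"
  shows "path c \<theta> t b (f, z) = \<theta> b (f, dmin b z (act D1 f t))"
  using assms category_Ob[OF catC assms(1)] by (simp add: path_def)

lemma path_hom:
  assumes \<theta>: "\<theta> \<in> hom \<C> (Rp c) W" and t: "t \<in> val D1 c" shows "path c \<theta> t \<in> hom \<C> (Rp c) W"
proof -
  have a: "act D1 f t \<in> val D1 b" if "f \<in> Ar \<C>" "src \<C> f = b" "tgt \<C> f = c" for f b
    by (rule presheaf_act[OF presheaf_dsimp that(1,3,2) t])
  have "nat_on \<C> (Rp c) (val (Rp c)) (Rp c) (\<lambda>b (f, z). (f, dmin b z (act D1 f t)))"
  proof (rule nat_onI)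
    fix b y assume b: "b \<in> Ob \<C>" "y \<in> val (Rp c) b"
    obtain f z where *: "y = (f, z)" by (cases y)
    have f: "f \<in> Ar \<C>" "src \<C> f = b" "tgt \<C> f = c" "z \<in> val D1 b" using b(2) unfolding * by simp_all
    show "(\<lambda>(f, z). (f, dmin b z (act D1 f t))) y \<in> val (Rp c) b"
      unfolding * using f dmin_val[OF f(4) a[OF f(1-3)]] by simp
  next
    fix g y assume g: "g \<in> Ar \<C>" "y \<in> val (Rp c) (tgt \<C> g)"
    obtain f z where *: "y = (f, z)" by (cases y)
    have f: "f \<in> Ar \<C>" "src \<C> f = tgt \<C> g" "tgt \<C> f = c" "z \<in> val D1 (tgt \<C> g)" using g(2) unfolding * by simp_all
    show "(\<lambda>(f, z). (f, dmin (src \<C> g) z (act D1 f t))) (act (Rp c) g y) =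
        act (Rp c) g ((\<lambda>(f, z). (f, dmin (tgt \<C> g) z (act D1 f t))) y)"
      using dmin_act[OF g(1) f(4) a[OF f(1-3)]] presheaf_cmp[OF presheaf_dsimp g(1) f(1,2,3) t] unfolding * by simp
  qed
  from nat_on_comp[OF catC this homD[OF \<theta>] nat_on_val[OF this]]
  have "nat_on \<C> (Rp c) (val (Rp c)) W (\<lambda>b (f, z). \<theta> b (f, dmin b z (act D1 f t)))" by (simp add: case_prod_beta')
  from transf_hom[OF catC presheaf_Rp this] show ?thesis unfolding path_def .
qed

lemma path_act:
  assumes g: "g \<in> Ar \<C>" and \<theta>: "\<theta> \<in> hom \<C> (Rp (tgt \<C> g)) W" and t: "t \<in> val D1 (tgt \<C> g)"
  shows "path (src \<C> g) (act E g \<theta>) (act D1 g t) = act E g (path (tgt \<C> g) \<theta> t)"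
proof (rule hom_ext)
  have *: "act E g \<xi> \<in> hom \<C> (Rp (src \<C> g)) W" if "\<xi> \<in> hom \<C> (Rp (tgt \<C> g)) W" for \<xi>
    using presheaf_act[OF presheaf_E g refl refl] that unfolding E_val by blast
  have t': "act D1 g t \<in> val D1 (src \<C> g)" by (rule presheaf_act[OF presheaf_dsimp g refl refl t])
  show "path (src \<C> g) (act E g \<theta>) (act D1 g t) \<in> hom \<C> (Rp (src \<C> g)) W" by (rule path_hom[OF *[OF \<theta>] t'])
  show "act E g (path (tgt \<C> g) \<theta> t) \<in> hom \<C> (Rp (src \<C> g)) W" by (rule *[OF path_hom[OF \<theta> t]])
  fix b y assume b: "b \<in> Ob \<C>" "y \<in> val (Rp (src \<C> g)) b"
  obtain f z where y: "y = (f, z)" by (cases y)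
  have f: "f \<in> Ar \<C>" "src \<C> f = b" "tgt \<C> f = src \<C> g" "z \<in> val D1 b" using b(2) unfolding y by simp_all
  note gf = category_cmp[OF catC f(1) g f(3)[symmetric]]
  have m: "dmin b z (act D1 f (act D1 g t)) \<in> val D1 b"
    by (rule dmin_val[OF f(4) presheaf_act[OF presheaf_dsimp f(1,3,2) t']])
  show "path (src \<C> g) (act E g \<theta>) (act D1 g t) b y = act E g (path (tgt \<C> g) \<theta> t) b y"
    unfolding y path_apply[OF f(1-4)] E_act[OF f] E_act[OF f(1-3) m]
    using path_apply[OF gf(1) _ gf(3), of b z \<theta> t] gf(2) f presheaf_cmp[OF presheaf_dsimp f(1) g f(3)[symmetric] refl t] by simp
qed

text \<open>At \<open>t = 1\<close> the minimum returns the whole path, at \<open>t = 0\<close> only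
  its starting point \<open>x\<close>. The starting point never moves, so the homotopy stays inside
  the under-object, and constant paths remain constant.\<close>

theorem contracts_under_object: "contracts \<C> D1 (dvx 0) (dvx 1) X A"
proof (rule contractsI[where H = "\<lambda>c ((s, \<theta>), t). (s, path c \<theta> t)"])
  have a: "act D1 f t \<in> val D1 b" if "f \<in> Ar \<C>" "src \<C> f = b" "tgt \<C> f = c" "t \<in> val D1 c" for f b c t
    by (rule presheaf_act[OF presheaf_dsimp that(1,3,2,4)])
  show "nat_on \<C> (X \<times>\<^sub>p D1) (val (X \<times>\<^sub>p D1)) X (\<lambda>c ((s, \<theta>), t). (s, path c \<theta> t))"
  proof (rule nat_onI)
    fix c y assume c: "c \<in> Ob \<C>" "y \<in> val (X \<times>\<^sub>p D1) c"
    obtain s \<theta> t where *: "y = ((s, \<theta>), t)" by (metis prod.collapse)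
    have y: "s = dpt c" "\<theta> \<in> hom \<C> (Rp c) W" "\<theta> c (idn \<C> c, dvx 0 c) = x c (dpt c)" "t \<in> val D1 c"
      using c unfolding * by (simp_all add: X_iff)
    note i = category_idn[OF catC c(1)]
    have "path c \<theta> t c (idn \<C> c, dvx 0 c) = x c (dpt c)"
      unfolding path_apply[OF i dvx_val[OF le0 c(1)]] using dmin_dvx(3)[OF a[OF i y(4)]] y(3) by simp
    then show "(\<lambda>((s, \<theta>), t). (s, path c \<theta> t)) y \<in> val X c"
      unfolding * using path_hom[OF y(2,4)] y(1) by (simp add: X_iff[OF c(1)])
  next
    fix g y assume g: "g \<in> Ar \<C>" "y \<in> val (X \<times>\<^sub>p D1) (tgt \<C> g)"
    obtain s \<theta> t where *: "y = ((s, \<theta>), t)" by (metis prod.collapse)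
    have y: "\<theta> \<in> hom \<C> (Rp (tgt \<C> g)) W" "t \<in> val D1 (tgt \<C> g)"
      using g(2) category_Ob[OF catC g(1)] unfolding * by (simp_all add: X_iff)
    show "(\<lambda>((s, \<theta>), t). (s, path (src \<C> g) \<theta> t)) (act (X \<times>\<^sub>p D1) g y) =
        act X g ((\<lambda>((s, \<theta>), t). (s, path (tgt \<C> g) \<theta> t)) y)"
      unfolding * using path_act[OF g(1) y] by simp
  qed
next
  fix c y assume c: "c \<in> Ob \<C>" "y \<in> val X c"
  obtain s \<theta> where *: "y = (s, \<theta>)" by (cases y)
  have y: "s = dpt c" "\<theta> \<in> hom \<C> (Rp c) W" "\<theta> c (idn \<C> c, dvx 0 c) = x c (dpt c)"
    using c unfolding * by (simp_all add: X_iff)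
  have 1: "path c \<theta> (dvx 1 c) = \<theta>"
  proof (rule hom_ext[OF path_hom[OF y(2) dvx_val[OF order_refl c(1)]] y(2)])
    fix b z assume b: "b \<in> Ob \<C>" "z \<in> val (Rp c) b"
    obtain f t where z: "z = (f, t)" by (cases z)
    have f: "f \<in> Ar \<C>" "src \<C> f = b" "tgt \<C> f = c" "t \<in> val D1 b" using b(2) unfolding z by simp_all
    show "path c \<theta> (dvx 1 c) b z = \<theta> b z"
      unfolding z path_apply[OF f] dvx_act[OF order_refl f(1-3)] dmin_dvx(1)[OF f(4)] by (rule refl)
  qed
  \<comment> \<open>The path stopped at time 0 takes only values of \<open>\<theta>\<close> at
    vertex 0, which \<open>hom_vertex\<close> reduces to the base point condition.\<close>
  have 0: "path c \<theta> (dvx 0 c) = const c"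
  proof (rule hom_ext[OF path_hom[OF y(2) dvx_val[OF le0 c(1)]] const_hom])
    fix b z assume b: "b \<in> Ob \<C>" "z \<in> val (Rp c) b"
    obtain f t where z: "z = (f, t)" by (cases z)
    have f: "f \<in> Ar \<C>" "src \<C> f = b" "tgt \<C> f = c" "t \<in> val D1 b" using b(2) unfolding z by simp_all
    have "path c \<theta> (dvx 0 c) b z = \<theta> b (f, dvx 0 b)"
      unfolding z path_apply[OF f] dvx_act[OF le0 f(1-3)] dmin_dvx(2)[OF f(4)] by (rule refl)
    also have "\<dots> = x b (dpt b)" unfolding hom_vertex[OF y(2) f(1-3) le0] y(3) by (rule x_act[OF f(1-3)])
    finally show "path c \<theta> (dvx 0 c) b z = const c b z" using b by simp
  qed
  show "(\<lambda>((s, \<theta>), t). (s, path c \<theta> t)) (y, dvx 1 c) = y" unfolding * by (simp add: 1)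
  show "(\<lambda>((s, \<theta>), t). (s, path c \<theta> t)) (y, dvx 0 c) \<in> A c" unfolding * by (simp add: 0 y(1))
next
  fix c y t assume c: "c \<in> Ob \<C>" "y \<in> A c" "t \<in> val D1 c"
  have "path c (const c) t = const c"
  proof (rule hom_ext[OF path_hom[OF const_hom c(3)] const_hom])
    fix b z assume b: "b \<in> Ob \<C>" "z \<in> val (Rp c) b"
    obtain f t' where z: "z = (f, t')" by (cases z)
    have f: "f \<in> Ar \<C>" "src \<C> f = b" "tgt \<C> f = c" "t' \<in> val D1 b" using b(2) unfolding z by simp_all
    have "dmin b t' (act D1 f t) \<in> val D1 b" by (rule dmin_val[OF f(4) presheaf_act[OF presheaf_dsimp f(1,3,2) c(3)]])
    then show "path c (const c) t b z = const c b z" unfolding z path_apply[OF f] using b(1) f by simp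
  qed
  then show "(\<lambda>((s, \<theta>), t). (s, path c \<theta> t)) (y, t) \<in> A c" using c(2) by simp
qed

lemma small_X: "small_psh U \<C> X"
  unfolding small_psh_def
proof
  fix c assume c: "c \<in> Ob \<C>"
  obtain d k l where *: "c = (d, k, l)" by (metis prod_cases3)
  have "val X c \<subseteq> (UNIV :: smor set) \<times> hom \<C> (Rp c) W" using X_iff[OF c] by auto
  moreover have "small_set U ((UNIV :: smor set) \<times> hom \<C> (Rp c) W)"
    by (rule small_times[OF _ small_countable small_hom]) (use c in \<open>auto simp: *\<close>)
  ultimately show "small_set U (val X c)" using small_subset by blast
qed

text \<open>Elements of the under-object are functions, so it is copied into the universe before
  \<open>contracting_weq\<close> applies. The copy contracts to the image \<open>A'\<close> of the
  base point, a one-point subpresheaf isomorphic to \<open>D[0]\<close>; the rest matches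
  isomorphisms and projections.\<close>

theorem under_object_equivalence:
  "D_covariant_equivalence D W weq D0 x X (under_proj D W x) (id_point D W x)"
proof -
  obtain \<iota> :: "'o dob \<Rightarrow> smor \<times> ('o dob \<Rightarrow> 'm dmor \<times> smor \<Rightarrow> 'u) \<Rightarrow> 'u"
    where \<iota>: "\<And>c. c \<in> Ob \<C> \<Longrightarrow> inj_on (\<iota> c) (val X c)"
    using small_psh_inj[OF small_X] by blast
  have PB: "presheaf \<C> (copy \<C> \<iota> X)" and nB: "nat_on \<C> X (val X) (copy \<C> \<iota> X) \<iota>"
    and nU: "nat_on \<C> (copy \<C> \<iota> X) (val (copy \<C> \<iota> X)) X (uncopy \<iota> X)"
    by (rule copy_facts[OF catC presheaf_X \<iota>], assumption)+
  let ?B = "copy \<C> \<iota> X"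
  have ui: "uncopy \<iota> X c (\<iota> c z) = z" if "c \<in> Ob \<C>" "z \<in> val X c" for c z
    using \<iota>[OF that(1)] that(2) by simp
  define A' where "A' = (\<lambda>c. {\<iota> c (dpt c, const c)})"
  define b where "b = transf \<C> ?B (\<lambda>c y. under_proj D W x c (uncopy \<iota> X c y))"
  define \<psi> where "\<psi> = transf \<C> X \<iota>"
  define \<phi> where "\<phi> = transf \<C> D0 (\<lambda>c s. \<iota> c (id_point D W x c s))"
  let ?A = "restr ?B A'"
  define i where "i = id_transf \<C> ?A"
  define a where "a = comp_transf \<C> ?A b i"
  have con: "contracts \<C> D1 (dvx 0) (dvx 1) ?B A'"
    by (rule contracts_iso[OF catC contracts_under_object nB nU]) (use ui const_X in \<open>auto simp: A'_def f_inv_into_f\<close>)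
  have nA: "nat_on \<C> D0 (val D0) ?B (\<lambda>c s. \<iota> c (id_point D W x c s))"
    by (rule nat_on_comp[OF catC nat_id_point nB nat_on_val[OF nat_id_point]])
  have sA: "sub \<C> ?B A'"
    unfolding sub_def A'_def
  proof (intro conjI ballI)
    fix f y assume f: "f \<in> Ar \<C>" "y \<in> {\<iota> (tgt \<C> f) (dpt (tgt \<C> f), const (tgt \<C> f))}"
    note o = category_Ob[OF catC f(1)]
    show "act ?B f y \<in> {\<iota> (src \<C> f) (dpt (src \<C> f), const (src \<C> f))}"
      using nat_on_act[OF nB f(1) refl refl const_X[OF o(2)]] f by (simp add: dpt_act const_act)
  qed (use const_X in auto)
  have bh: "b \<in> hom \<C> ?B W"
    unfolding b_def by (rule transf_hom[OF catC PB nat_on_comp[OF catC nU homD[OF under_proj_hom] nat_on_val[OF nU]]])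
  have b_apply: "b c (\<iota> c z) = under_proj D W x c z" if "c \<in> Ob \<C>" "z \<in> val X c" for c z
    using that ui[OF that] by (simp add: b_def)
  have PA: "presheaf \<C> ?A" by (rule presheaf_restr[OF catC PB sA])
  have ih: "i \<in> hom \<C> ?A ?B" unfolding i_def by (rule incl_hom[OF catC PB sA])
  have ah: "a \<in> hom \<C> ?A W" unfolding a_def by (rule hom_comp[OF catC PA ih bh])
  have \<psi>h: "\<psi> \<in> hom \<C> X ?B" unfolding \<psi>_def by (rule transf_hom[OF catC presheaf_X nB])
  have \<phi>h: "\<phi> \<in> hom \<C> D0 ?A"
    unfolding \<phi>_def
  proof (rule transf_hom[OF catC presheaf_dsimp nat_onI])
    fix c s assume "c \<in> Ob \<C>" "s \<in> val D0 c"
    then show "\<iota> c (id_point D W x c s) \<in> val ?A c" by (simp add: dsimp_0 id_point_apply A'_def)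
  qed (use nat_on_act[OF nA _ refl refl] in simp)
  have \<phi>_apply: "\<phi> c (dpt c) = \<iota> c (dpt c, const c)" if "c \<in> Ob \<C>" for c
    using that by (simp add: \<phi>_def dsimp_0 id_point_apply)
  have i_apply: "i c (\<iota> c (dpt c, const c)) = \<iota> c (dpt c, const c)" if "c \<in> Ob \<C>" for c
    using that by (simp add: i_def A'_def id_transf_def)
  have w: "((?A, W, a), (?B, W, b), (?A, ?B, i)) \<in> weq"
    by (rule contracting_weq[OF PB sA bh con i_def a_def])
  have "iso_transf \<C> D0 ?A \<phi>"
    unfolding iso_transf_def
  proof (intro conjI ballI \<phi>h)
    fix c assume c: "c \<in> Ob \<C>"
    have "val D0 c = {dpt c}" using dsimp_0[of _ c] by blast
    then show "bij_betw (\<phi> c) (val D0 c) (val ?A c)" by (simp add: bij_betw_def A'_def \<phi>_apply[OF c])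
  qed
  moreover have "iso_transf \<C> X ?B \<psi>"
    unfolding iso_transf_def
  proof (intro conjI ballI \<psi>h)
    fix c assume c: "c \<in> Ob \<C>"
    have "bij_betw (\<iota> c) (val X c) (val ?B c)" using \<iota>[OF c] by (simp add: bij_betw_def)
    then show "bij_betw (\<psi> c) (val X c) (val ?B c)"
      by (rule bij_betw_cong[THEN iffD1, rotated]) (use c in \<open>simp add: \<psi>_def\<close>)
  qed
  moreover have "comp_transf \<C> D0 a \<phi> = x"
  proof (rule hom_ext[OF hom_comp[OF catC presheaf_dsimp \<phi>h ah] x])
    fix c s assume c: "c \<in> Ob \<C>" "s \<in> val D0 c"
    have s: "s = dpt c" using c(2) by (simp add: dsimp_0)
    have "\<iota> c (dpt c, const c) \<in> val ?A c" by (simp add: A'_def)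
    then have "comp_transf \<C> D0 a \<phi> c s = b c (\<iota> c (dpt c, const c))"
      using c unfolding s by (simp add: \<phi>_apply a_def i_apply)
    then show "comp_transf \<C> D0 a \<phi> c s = x c s"
      unfolding s b_apply[OF c(1) const_X[OF c(1)]] under_proj_id_point[OF c(1)] .
  qed
  moreover have "comp_transf \<C> X b \<psi> = under_proj D W x"
    by (rule hom_ext[OF hom_comp[OF catC presheaf_X \<psi>h bh] under_proj_hom]) (simp add: \<psi>_def b_apply)
  moreover have "comp_transf \<C> D0 i \<phi> = comp_transf \<C> D0 \<psi> (id_point D W x)"
  proof (rule hom_ext[OF hom_comp[OF catC presheaf_dsimp \<phi>h ih] hom_comp[OF catC presheaf_dsimp id_point_hom \<psi>h]])
    fix c s assume c: "c \<in> Ob \<C>" "s \<in> val D0 c"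
    then show "comp_transf \<C> D0 i \<phi> c s = comp_transf \<C> D0 \<psi> (id_point D W x) c s"
      using const_X[OF c(1)] by (simp add: dsimp_0 \<phi>_apply i_apply id_point_apply \<psi>_def)
  qed
  ultimately show ?thesis unfolding D_covariant_equivalence_def using w by blast
qed

end

theorem theorem3p31:
  fixes D :: "('o, 'm) cat"
    and W :: "('o, 'm, 'u) dspace"
    and x :: "'o dob \<Rightarrow> smor \<Rightarrow> 'u"
    and cof weq fib ::
      "(('o, 'm, 'u) dspace_mor \<times> ('o, 'm, 'u) dspace_mor \<times> ('o, 'm, 'u) dspace_mor) set"
  assumes "small_in TYPE('u) D"
    and "levelwise_segal_space D W"
    and "x \<in> hom (dsimp_cat D) (dsimp 0) W"
    and "D_covariant_model_structure D W cof weq fib"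
  shows "D_covariant_equivalence D W weq (dsimp 0) x (under_obj D W x) (under_proj D W x)
           (id_point D W x)"
proof -
  interpret under_object D "TYPE('u)" W cof weq fib x
    by unfold_locales (rule assms)+
  show ?thesis by (rule under_object_equivalence)
qed

end
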